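(* Let $m,p\ge 1$ and let $x:M^m\to\mathbb{R}^{m+p}$ be a properly immersed, complete and $W$-stable $\xi$-submanifold (with $M$ connected) whose normal bundle is flat. Suppose that $$h\big(A_\xi(x^\top),v^\top\big)=0\quad\text{on }M,\qquad \forall\, v\in\mathbb{R}^{m+p}.$$ Then $x(M^m)$ is an $m$-plane.
   Context: For a smooth immersion $x:M^m\to\mathbb{R}^{m+p}$ of a smooth manifold: $\langle\cdot,\cdot\rangle$ is the Euclidean inner product, $D$ the flat connection of $\mathbb{R}^{m+p}$, $g$ the induced metric, $dV$ its volume element, $h(X,Y)=(D_XY)^\perp$ the second fundamental form, $H=\mathrm{tr}_g h$ the (unnormalized) mean curvature vector, $D^\perp$ the normal connection, and $A_\eta$ the Weingarten operator, $\langle A_\eta X,Y\rangle=\langle h(X,Y),\eta\rangle$. For any $v\in\mathbb{R}^{m+p}$ (or for the position vector $x$), $v^\top$ and $v^\perp$ are the tangential and normal components along $x$. $x$ is a $\xi$-submanifold if $H+x^\perp=\xi$ for a normal vector field $\xi$ with $D^\perp\xi=0$. For such $x$ put $f=\tfrac12|x-\xi|^2$, and for an immersion $y:M\to\mathbb{R}^{m+p}$ put $V_\xi(y)=\int_M e^{-\frac12|y-\xi|^2}dV_y$, with $\xi:M\to\mathbb{R}^{m+p}$ kept fixed and $dV_y$ the volume element induced by $y$. A variation of $x$ is a smooth map $F:M\times(-\varepsilon,\varepsilon)\to\mathbb{R}^{m+p}$ such that each $x_t=F(\cdot,t)$ is an immersion and $x_0=x$; its variation vector field is $\eta=\partial F/\partial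 t|_{t=0}$. It is compact if there is a relatively compact open $B\subset M$ containing the support of $\partial F/\partial t(\cdot,t)$ for every $t$; normal if $\eta$ is a normal field along $x$; $SN$ if it is normal and $\partial^2F/\partial t^2|_{t=0}=0$. An $SN$-variation is $VP$ if $\int_M\langle\eta,N\rangle e^{-f}dV=0$ for every normal field $N$ on $M$ with $D^\perp N\equiv 0$. A $\xi$-submanifold $x$ is $W$-stable if $V_\xi(x)<+\infty$ and $V_\xi''(0):=\frac{d^2}{dt^2}\big|_{t=0}V_\xi(x_t)\ge 0$ for every compact $VP$-variation. An $m$-plane is a (not necessarily linear) affine $m$-dimensional subspace of $\mathbb{R}^{m+p}$. *)

theory Defs
  imports "HOL-Analysis.Analysis"
begin

text \<open>For an open set and a finite-dimensional domain this is class C-k; the directional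
  derivatives are taken along all constant vectors.\<close>

primrec Ck_on :: "nat \<Rightarrow> 'a::real_normed_vector set \<Rightarrow> ('a \<Rightarrow> 'b::real_normed_vector) \<Rightarrow> bool" where
  "Ck_on 0 S f \<longleftrightarrow> continuous_on S f"
| "Ck_on (Suc k) S f \<longleftrightarrow> (\<forall>u\<in>S. f differentiable (at u)) \<and>
     (\<forall>v. Ck_on k S (\<lambda>u. frechet_derivative f (at u) v))"

definition smooth_on :: "'a::real_normed_vector set \<Rightarrow> ('a \<Rightarrow> 'b::real_normed_vector) \<Rightarrow> bool" where
  "smooth_on S f \<longleftrightarrow> (\<forall>k. Ck_on k S f)"

text \<open>A chart is a pair of a domain and a coordinate map, the latter being irrelevant outside
  the domain. The manifold is the whole type \<open>'a\<close>.\<close>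

type_synonym ('a, 'm) chart = "'a set \<times> ('a \<Rightarrow> real ^ 'm)"

definition param :: "('a, 'm) chart \<Rightarrow> real ^ 'm \<Rightarrow> 'a" where
  "param c = inv_into (fst c) (snd c)"

definition chart_image :: "('a, 'm) chart \<Rightarrow> (real ^ 'm) set" where
  "chart_image c = snd c ` fst c"

definition smooth_atlas :: "('a::topological_space, 'm::finite) chart set \<Rightarrow> bool" where
  "smooth_atlas \<A> \<longleftrightarrow>
     (\<forall>c\<in>\<A>. open (fst c) \<and> open (chart_image c) \<and>
        homeomorphism (fst c) (chart_image c) (snd c) (param c)) \<and>
     (\<Union>c\<in>\<A>. fst c) = UNIV \<and>
     (\<forall>c\<in>\<A>. \<forall>d\<in>\<A>. smooth_on (snd c ` (fst c \<inter> fst d)) (snd d \<circ> param c))"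

definition smooth_map ::
  "('a, 'm::finite) chart set \<Rightarrow> ('a \<Rightarrow> 'e::real_normed_vector) \<Rightarrow> bool" where
  "smooth_map \<A> y \<longleftrightarrow> (\<forall>c\<in>\<A>. smooth_on (chart_image c) (y \<circ> param c))"

text \<open>The tangent space of the manifold at \<open>q\<close> is identified with \<open>real ^ 'm\<close> through one
  chart around \<open>q\<close>, chosen once and for all; \<open>differential \<A> y q\<close> is the differential of \<open>y\<close>
  at \<open>q\<close> under this identification.\<close>

definition chart_at :: "('a, 'm) chart set \<Rightarrow> 'a \<Rightarrow> ('a, 'm) chart" where
  "chart_at \<A> q = (SOME c. c \<in> \<A> \<and> q \<in> fst c)"

definition differential ::
  "('a, 'm::finite) chart set \<Rightarrow> ('a \<Rightarrow> 'e::real_normed_vector) \<Rightarrow> 'a \<Rightarrow> real ^ 'm \<Rightarrow> 'e" where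
  "differential \<A> y q =
     frechet_derivative (y \<circ> param (chart_at \<A> q)) (at (snd (chart_at \<A> q) q))"

definition immersion ::
  "('a, 'm::finite) chart set \<Rightarrow> ('a \<Rightarrow> 'e::real_normed_vector) \<Rightarrow> bool" where
  "immersion \<A> y \<longleftrightarrow> smooth_map \<A> y \<and> (\<forall>q. inj (differential \<A> y q))"

text \<open>Tangent vectors at \<open>q\<close> are represented by their images under the (injective) differential
  of the immersion, hence as elements of the ambient space; the induced metric is then the
  restriction of the inner product.\<close>

definition tangent_space ::
  "('a, 'm::finite) chart set \<Rightarrow> ('a \<Rightarrow> 'e::euclidean_space) \<Rightarrow> 'a \<Rightarrow> 'e set" where
  "tangent_space \<A> x q = range (differential \<A> x q)"

definition tan_part ::
  "('a, 'm::finite) chart set \<Rightarrow> ('a \<Rightarrow> 'e::euclidean_space) \<Rightarrow> 'a \<Rightarrow> 'e \<Rightarrow> 'e" where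
  "tan_part \<A> x q v =
     (THE w. w \<in> tangent_space \<A> x q \<and> (\<forall>u\<in>tangent_space \<A> x q. (v - w) \<bullet> u = 0))"

definition nor_part ::
  "('a, 'm::finite) chart set \<Rightarrow> ('a \<Rightarrow> 'e::euclidean_space) \<Rightarrow> 'a \<Rightarrow> 'e \<Rightarrow> 'e" where
  "nor_part \<A> x q v = v - tan_part \<A> x q v"

definition tangent_field ::
  "('a, 'm::finite) chart set \<Rightarrow> ('a \<Rightarrow> 'e::euclidean_space) \<Rightarrow> ('a \<Rightarrow> 'e) \<Rightarrow> bool" where
  "tangent_field \<A> x X \<longleftrightarrow> smooth_map \<A> X \<and> (\<forall>q. X q \<in> tangent_space \<A> x q)"

definition normal_field ::
  "('a, 'm::finite) chart set \<Rightarrow> ('a \<Rightarrow> 'e::euclidean_space) \<Rightarrow> ('a \<Rightarrow> 'e) \<Rightarrow> bool" where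
  "normal_field \<A> x N \<longleftrightarrow>
     smooth_map \<A> N \<and> (\<forall>q. \<forall>X\<in>tangent_space \<A> x q. N q \<bullet> X = 0)"

text \<open>The flat connection: the derivative at \<open>q\<close> of the field \<open>Y\<close> along the immersion, in the
  direction of the tangent vector \<open>X\<close> of \<open>tangent_space \<A> x q\<close>.\<close>

definition flat_D ::
  "('a, 'm::finite) chart set \<Rightarrow> ('a \<Rightarrow> 'e::euclidean_space) \<Rightarrow> 'a \<Rightarrow> 'e \<Rightarrow> ('a \<Rightarrow> 'e) \<Rightarrow> 'e" where
  "flat_D \<A> x q X Y = differential \<A> Y q (THE a. differential \<A> x q a = X)"

text \<open>The normal part of \<open>D_X Y\<close>, where the tangent vector \<open>Y\<close> at \<open>q\<close> is extended to the tangent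
  field of the tangential parts of the constant vector \<open>Y\<close>. By tensoriality any other extension
  gives the same value.\<close>

definition second_form ::
  "('a, 'm::finite) chart set \<Rightarrow> ('a \<Rightarrow> 'e::euclidean_space) \<Rightarrow> 'a \<Rightarrow> 'e \<Rightarrow> 'e \<Rightarrow> 'e" where
  "second_form \<A> x q X Y = nor_part \<A> x q (flat_D \<A> x q X (\<lambda>r. tan_part \<A> x r Y))"

definition metric_matrix ::
  "('a, 'm::finite) chart set \<Rightarrow> ('a \<Rightarrow> 'e::euclidean_space) \<Rightarrow> 'a \<Rightarrow> real ^ 'm ^ 'm" where
  "metric_matrix \<A> x q =
     (\<chi> i j. differential \<A> x q (axis i 1) \<bullet> differential \<A> x q (axis j 1))"

definition mean_curvature ::
  "('a, 'm::finite) chart set \<Rightarrow> ('a \<Rightarrow> 'e::euclidean_space) \<Rightarrow> 'a \<Rightarrow> 'e" where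
  "mean_curvature \<A> x q =
     (\<Sum>i\<in>UNIV. \<Sum>j\<in>UNIV. matrix_inv (metric_matrix \<A> x q) $ i $ j *\<^sub>R
        second_form \<A> x q (differential \<A> x q (axis i 1)) (differential \<A> x q (axis j 1)))"

definition weingarten ::
  "('a, 'm::finite) chart set \<Rightarrow> ('a \<Rightarrow> 'e::euclidean_space) \<Rightarrow> 'a \<Rightarrow> 'e \<Rightarrow> 'e \<Rightarrow> 'e" where
  "weingarten \<A> x q \<eta> X =
     (THE Z. Z \<in> tangent_space \<A> x q \<and>
        (\<forall>Y\<in>tangent_space \<A> x q. Z \<bullet> Y = second_form \<A> x q X Y \<bullet> \<eta>))"

definition normal_D ::
  "('a, 'm::finite) chart set \<Rightarrow> ('a \<Rightarrow> 'e::euclidean_space) \<Rightarrow> 'a \<Rightarrow> 'e \<Rightarrow> ('a \<Rightarrow> 'e) \<Rightarrow> 'e" where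
  "normal_D \<A> x q X N = nor_part \<A> x q (flat_D \<A> x q X N)"

definition parallel_normal_field ::
  "('a, 'm::finite) chart set \<Rightarrow> ('a \<Rightarrow> 'e::euclidean_space) \<Rightarrow> ('a \<Rightarrow> 'e) \<Rightarrow> bool" where
  "parallel_normal_field \<A> x N \<longleftrightarrow>
     normal_field \<A> x N \<and> (\<forall>q. \<forall>X\<in>tangent_space \<A> x q. normal_D \<A> x q X N = 0)"

text \<open>The flat connection is torsion-free, so the differential of the immersion maps the Lie
  bracket of \<open>X\<close> and \<open>Y\<close> to \<open>D_X Y - D_Y X\<close>.\<close>

definition normal_curvature ::
  "('a, 'm::finite) chart set \<Rightarrow> ('a \<Rightarrow> 'e::euclidean_space) \<Rightarrow>
     ('a \<Rightarrow> 'e) \<Rightarrow> ('a \<Rightarrow> 'e) \<Rightarrow> ('a \<Rightarrow> 'e) \<Rightarrow> 'a \<Rightarrow> 'e" where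
  "normal_curvature \<A> x X Y N q =
     normal_D \<A> x q (X q) (\<lambda>r. normal_D \<A> x r (Y r) N)
     - normal_D \<A> x q (Y q) (\<lambda>r. normal_D \<A> x r (X r) N)
     - normal_D \<A> x q (flat_D \<A> x q (X q) Y - flat_D \<A> x q (Y q) X) N"

definition flat_normal_bundle ::
  "('a, 'm::finite) chart set \<Rightarrow> ('a \<Rightarrow> 'e::euclidean_space) \<Rightarrow> bool" where
  "flat_normal_bundle \<A> x \<longleftrightarrow>
     (\<forall>X Y N q. tangent_field \<A> x X \<and> tangent_field \<A> x Y \<and> normal_field \<A> x N \<longrightarrow>
        normal_curvature \<A> x X Y N q = 0)"

definition smooth_curve :: "('a::topological_space, 'm::finite) chart set \<Rightarrow> (real \<Rightarrow> 'a) \<Rightarrow> bool" where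
  "smooth_curve \<A> \<gamma> \<longleftrightarrow>
     continuous_on UNIV \<gamma> \<and> (\<forall>c\<in>\<A>. smooth_on (\<gamma> -` fst c) (snd c \<circ> \<gamma>))"

text \<open>Corners may be smoothed by reparametrization (the curves need not be regular), so the
  infimum over piecewise smooth curves is the same.\<close>

definition induced_dist ::
  "('a::topological_space, 'm::finite) chart set \<Rightarrow> ('a \<Rightarrow> 'e::euclidean_space) \<Rightarrow> 'a \<Rightarrow> 'a \<Rightarrow> ennreal" where
  "induced_dist \<A> x q r =
     (INF \<gamma>\<in>{\<gamma>. smooth_curve \<A> \<gamma> \<and> \<gamma> 0 = q \<and> \<gamma> 1 = r}.
        ennreal (integral {0..1} (\<lambda>t. norm (vector_derivative (x \<circ> \<gamma>) (at t)))))"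

definition complete_immersion ::
  "('a::topological_space, 'm::finite) chart set \<Rightarrow> ('a \<Rightarrow> 'e::euclidean_space) \<Rightarrow> bool" where
  "complete_immersion \<A> x \<longleftrightarrow>
     (\<forall>s :: nat \<Rightarrow> 'a.
        (\<forall>\<epsilon>>0. \<exists>K. \<forall>i\<ge>K. \<forall>j\<ge>K. induced_dist \<A> x (s i) (s j) < ennreal \<epsilon>) \<longrightarrow>
        (\<exists>q. (\<lambda>i. induced_dist \<A> x (s i) q) \<longlonglongrightarrow> 0))"

definition proper_immersion :: "('a::topological_space \<Rightarrow> 'e::euclidean_space) \<Rightarrow> bool" where
  "proper_immersion x \<longleftrightarrow> (\<forall>K. compact K \<longrightarrow> compact (x -` K))"

definition vol_density ::
  "('a, 'm::finite) chart \<Rightarrow> ('a \<Rightarrow> 'e::euclidean_space) \<Rightarrow> real ^ 'm \<Rightarrow> real" where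
  "vol_density c y u =
     sqrt (det (\<chi> i j. frechet_derivative (y \<circ> param c) (at u) (axis i 1) \<bullet>
                       frechet_derivative (y \<circ> param c) (at u) (axis j 1)))"

text \<open>The Borel measure given in every chart by \<open>vol_density\<close>. On a second countable
  manifold it exists, by the change of variables formula, and it is unique.\<close>

definition volume_measure ::
  "('a::topological_space, 'm::finite) chart set \<Rightarrow> ('a \<Rightarrow> 'e::euclidean_space) \<Rightarrow> 'a measure" where
  "volume_measure \<A> y =
     (THE \<mu>. sets \<mu> = sets borel \<and>
        (\<forall>c\<in>\<A>. \<forall>B\<in>sets borel. B \<subseteq> fst c \<longrightarrow>
           emeasure \<mu> B = (\<integral>\<^sup>+ u\<in>snd c ` B. ennreal (vol_density c y u) \<partial>lborel)))"

definition xi_submanifold ::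
  "('a, 'm::finite) chart set \<Rightarrow> ('a \<Rightarrow> 'e::euclidean_space) \<Rightarrow> ('a \<Rightarrow> 'e) \<Rightarrow> bool" where
  "xi_submanifold \<A> x \<xi> \<longleftrightarrow>
     immersion \<A> x \<and> parallel_normal_field \<A> x \<xi> \<and>
     (\<forall>q. mean_curvature \<A> x q + nor_part \<A> x q (x q) = \<xi> q)"

definition V_xi ::
  "('a::topological_space, 'm::finite) chart set \<Rightarrow> ('a \<Rightarrow> 'e::euclidean_space) \<Rightarrow> ('a \<Rightarrow> 'e) \<Rightarrow> ennreal" where
  "V_xi \<A> \<xi> y =
     (\<integral>\<^sup>+ q. ennreal (exp (- (1/2) * (norm (y q - \<xi> q))\<^sup>2)) \<partial>volume_measure \<A> y)"

definition variation ::
  "('a, 'm::finite) chart set \<Rightarrow> ('a \<Rightarrow> 'e::euclidean_space) \<Rightarrow> real \<Rightarrow> ('a \<Rightarrow> real \<Rightarrow> 'e) \<Rightarrow> bool" where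
  "variation \<A> x \<epsilon> F \<longleftrightarrow>
     \<epsilon> > 0 \<and>
     (\<forall>c\<in>\<A>. smooth_on (chart_image c \<times> {-\<epsilon><..<\<epsilon>}) (\<lambda>(u, t). F (param c u) t)) \<and>
     (\<forall>t\<in>{-\<epsilon><..<\<epsilon>}. immersion \<A> (\<lambda>q. F q t)) \<and>
     (\<forall>q. F q 0 = x q)"

definition velocity :: "('a \<Rightarrow> real \<Rightarrow> 'e::euclidean_space) \<Rightarrow> real \<Rightarrow> 'a \<Rightarrow> 'e" where
  "velocity F t q = vector_derivative (F q) (at t)"

definition compact_variation ::
  "real \<Rightarrow> ('a::topological_space \<Rightarrow> real \<Rightarrow> 'e::euclidean_space) \<Rightarrow> bool" where
  "compact_variation \<epsilon> F \<longleftrightarrow>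
     (\<exists>B. open B \<and> compact (closure B) \<and>
        (\<forall>t\<in>{-\<epsilon><..<\<epsilon>}. closure {q. velocity F t q \<noteq> 0} \<subseteq> B))"

definition normal_variation ::
  "('a, 'm::finite) chart set \<Rightarrow> ('a \<Rightarrow> 'e::euclidean_space) \<Rightarrow> ('a \<Rightarrow> real \<Rightarrow> 'e) \<Rightarrow> bool" where
  "normal_variation \<A> x F \<longleftrightarrow> normal_field \<A> x (velocity F 0)"

definition SN_variation ::
  "('a, 'm::finite) chart set \<Rightarrow> ('a \<Rightarrow> 'e::euclidean_space) \<Rightarrow> ('a \<Rightarrow> real \<Rightarrow> 'e) \<Rightarrow> bool" where
  "SN_variation \<A> x F \<longleftrightarrow>
     normal_variation \<A> x F \<and>
     (\<forall>q. vector_derivative (\<lambda>t. velocity F t q) (at 0) = 0)"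

definition VP_variation ::
  "('a::topological_space, 'm::finite) chart set \<Rightarrow> ('a \<Rightarrow> 'e::euclidean_space) \<Rightarrow> ('a \<Rightarrow> 'e) \<Rightarrow>
     ('a \<Rightarrow> real \<Rightarrow> 'e) \<Rightarrow> bool" where
  "VP_variation \<A> x \<xi> F \<longleftrightarrow>
     SN_variation \<A> x F \<and>
     (\<forall>N. parallel_normal_field \<A> x N \<longrightarrow>
        (LINT q|volume_measure \<A> x.
           (velocity F 0 q \<bullet> N q) * exp (- (1/2) * (norm (x q - \<xi> q))\<^sup>2)) = 0)"

text \<open>For a compact variation, \<open>V_xi\<close> is finite and smooth along the variation as soon as it is
  finite at \<open>x\<close>, so that the conversion to real numbers and \<open>deriv\<close> are meaningful here.\<close>

definition W_stable ::
  "('a::topological_space, 'm::finite) chart set \<Rightarrow> ('a \<Rightarrow> 'e::euclidean_space) \<Rightarrow> ('a \<Rightarrow> 'e) \<Rightarrow> bool" where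
  "W_stable \<A> x \<xi> \<longleftrightarrow>
     V_xi \<A> \<xi> x < \<infinity> \<and>
     (\<forall>\<epsilon> F. variation \<A> x \<epsilon> F \<and> compact_variation \<epsilon> F \<and> VP_variation \<A> x \<xi> F \<longrightarrow>
        deriv (deriv (\<lambda>t. enn2real (V_xi \<A> \<xi> (\<lambda>q. F q t)))) 0 \<ge> 0)"

end

theory Submission
  imports Defs
begin

text \<open>For a constant vector \<open>v\<close> and a parallel normal field \<open>N\<close>, the test field
  \<open>\<phi> (v\<^sup>\<bottom> - N)\<close> with a cutoff \<open>\<phi>\<close> in \<open>\<bar>x\<bar>\<^sup>2\<close> is orthogonal to all parallel normal fields for
  the right choice of \<open>N\<close>, so that the second variation along it is nonnegative.
  By the Codazzi equation and the hypothesis on \<open>A\<^sub>\<xi>\<close>, the normal part \<open>v\<^sup>\<bottom>\<close> is an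
  eigenfield of the Jacobi operator with a negative second variation, and an integration by parts
  bounds the second variation of the test field by
  \<open>\<integral> (\<bar>\<nabla>\<phi>\<bar>\<^sup>2 (\<bar>v\<^sup>\<bottom> - N\<bar>\<^sup>2 + \<bar>v\<bar>\<^sup>2) - \<phi>\<^sup>2 \<bar>v\<^sup>\<bottom> - N\<bar>\<^sup>2) e\<^sup>-\<^sup>f dV\<close>. The weighted volume is finite, so in
  the limit \<open>v\<^sup>\<bottom>\<close> equals a parallel field. This holds for every \<open>v\<close>, hence the second
  fundamental form vanishes and the tangent space is constant. The image is closed by properness and
  open in an \<open>m\<close>-plane, hence is that plane.\<close>

subsection \<open>Calculus of smooth maps\<close>

text \<open>Orthonormal tangent frames exist only locally. They are avoided: maps are differentiated
  along the tangential projections of constant vectors of the ambient space, and metric traces are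
  sums over \<open>Basis\<close> of that space. The second fundamental form and the Weingarten
  operator are then restrictions of one object, the derivative \<open>S\<close> of the projection
  \<open>P\<close>, and the structure equations come from differentiating
  \<open>P q (P q w) = P q w\<close>, from the self-adjointness of \<open>P\<close> and from the
  equality of mixed derivatives. The integration by parts rests on the function
  \<open>w = (v \<bullet> vn) / 2 - 2 * (v \<bullet> N)\<close>. Its drift Laplacian exceeds the
  curvature terms of the second variation by the squares of \<open>norm (S q c (N q))\<close>, and
  exactly these squares absorb, after completing a square, the cross term with the gradient of the
  cutoff. This is where the square of \<open>norm v\<close> in the bound comes from. The field
  \<open>N\<close> depends on the cutoff, so the limit is taken in both at once, with bounds that
  are uniform in the cutoff.\<close>

lemma Ck_on_SucD:
  assumes "Ck_on (Suc k) S f" "u \<in> S"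
  shows "(f has_derivative frechet_derivative f (at u)) (at u)"
  using assms by (simp add: frechet_derivative_works)

lemma Ck_on_cong:
  assumes "open S" "\<And>u. u \<in> S \<Longrightarrow> f u = g u" "Ck_on k S f"
  shows "Ck_on k S g"
  using assms(2,3)
proof (induction k arbitrary: f g)
  case 0
  then show ?case using continuous_on_cong[of S S f g] by auto
next
  case (Suc k)
  have *: "(g has_derivative frechet_derivative f (at u)) (at u)" if "u \<in> S" for u
    by (rule has_derivative_transform_within_open[OF Ck_on_SucD[OF Suc.prems(2) that] assms(1) that])
      (rule Suc.prems(1))
  have eq: "frechet_derivative f (at u) = frechet_derivative g (at u)" if "u \<in> S" for u
    using frechet_derivative_at[OF *[OF that]] .
  have "Ck_on k S (\<lambda>u. frechet_derivative g (at u) v)" for v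
    by (rule Suc.IH[of "\<lambda>u. frechet_derivative f (at u) v"]) (use eq Suc.prems(2) in auto)
  then show ?case
    using * by (auto simp: differentiable_def)
qed

lemma Ck_on_Suc_imp: "Ck_on (Suc k) S f \<Longrightarrow> Ck_on k S f"
proof (induction k arbitrary: f)
  case 0
  then show ?case
    by (auto intro!: continuous_at_imp_continuous_on differentiable_imp_continuous_within)
next
  case (Suc k)
  have "Ck_on k S (\<lambda>u. frechet_derivative f (at u) v)" for v
    by (rule Suc.IH) (use Suc.prems Ck_on.simps(2)[of "Suc k" S f] in blast)
  moreover have "\<forall>u\<in>S. f differentiable at u"
    using Suc.prems Ck_on.simps(2)[of "Suc k" S f] by blast
  ultimately show ?case using Ck_on.simps(2)[of k S f] by blast
qed

lemma Ck_on_subset: "Ck_on k S f \<Longrightarrow> T \<subseteq> S \<Longrightarrow> Ck_on k T f"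
  by (induction k arbitrary: f) (auto intro: continuous_on_subset)

lemma Ck_on_Union:
  assumes "\<And>V. V \<in> \<V> \<Longrightarrow> open V \<and> Ck_on k V f"
  shows "Ck_on k (\<Union>\<V>) f"
  using assms
proof (induction k arbitrary: f)
  case 0
  then show ?case by (auto intro: continuous_on_open_Union)
qed auto

text \<open>By uniqueness of derivatives an explicit formula \<open>f'\<close> may stand in for
  \<open>frechet_derivative\<close>; the closure properties below only have to exhibit such a
  formula.\<close>

lemma Ck_on_SucI:
  assumes "open S" "\<And>u. u \<in> S \<Longrightarrow> (f has_derivative f' u) (at u)"
    "\<And>v. Ck_on k S (\<lambda>u. f' u v)"
  shows "Ck_on (Suc k) S f"
proof -
  have "f' u = frechet_derivative f (at u)" if "u \<in> S" for u
    by (rule frechet_derivative_at[OF assms(2)[OF that]])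
  then have "Ck_on k S (\<lambda>u. frechet_derivative f (at u) v)" for v
    by (intro Ck_on_cong[OF assms(1) _ assms(3)]) simp
  then show ?thesis
    using assms(2) by (auto simp: differentiable_def)
qed

lemma Ck_on_const: "open S \<Longrightarrow> Ck_on k S (\<lambda>u. c)"
proof (induction k arbitrary: c)
  case (Suc k)
  then show ?case
    by (intro Ck_on_SucI[where f' = "\<lambda>u v. 0"]) auto
qed simp

lemma Ck_on_bounded_linear:
  assumes "open S" "bounded_linear L" "Ck_on k S f"
  shows "Ck_on k S (\<lambda>u. L (f u))"
  using assms(3)
proof (induction k arbitrary: f)
  case 0
  then show ?case using assms(2) by (auto intro: bounded_linear.continuous_on)
next
  case (Suc k)
  show ?case
  proof (rule Ck_on_SucI[OF assms(1)])
    show "((\<lambda>u. L (f u)) has_derivative (\<lambda>v. L (frechet_derivative f (at u) v))) (at u)"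
      if "u \<in> S" for u
      by (rule bounded_linear.has_derivative[OF assms(2) Ck_on_SucD[OF Suc.prems that]])
    show "Ck_on k S (\<lambda>u. L (frechet_derivative f (at u) v))" for v
      using Suc by simp
  qed
qed

lemma Ck_on_linear: "open S \<Longrightarrow> bounded_linear L \<Longrightarrow> Ck_on k S L"
proof (induction k)
  case 0
  then show ?case by (simp add: linear_continuous_on)
next
  case (Suc k)
  then show ?case
    by (intro Ck_on_SucI[where f' = "\<lambda>u. L"]) (auto intro: Ck_on_const bounded_linear_imp_has_derivative)
qed

lemma Ck_on_add:
  assumes "open S" "Ck_on k S f" "Ck_on k S g"
  shows "Ck_on k S (\<lambda>u. f u + g u)"
  using assms(2,3)
proof (induction k arbitrary: f g)
  case 0
  then show ?case by (auto intro: continuous_on_add)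
next
  case (Suc k)
  show ?case
  proof (rule Ck_on_SucI[OF assms(1)])
    show "((\<lambda>u. f u + g u) has_derivative
      (\<lambda>v. frechet_derivative f (at u) v + frechet_derivative g (at u) v)) (at u)" if "u \<in> S" for u
      using Suc.prems that by (intro has_derivative_add Ck_on_SucD)
  qed (use Suc in simp)
qed

text \<open>One Leibniz rule serves scalar multiples, inner products and real products. The
  induction generalizes both factors, because the derivative pairs each factor with the derivative
  of the other.\<close>

lemma Ck_on_bilinear:
  assumes "open S" "bounded_bilinear B" "Ck_on k S f" "Ck_on k S g"
  shows "Ck_on k S (\<lambda>u. B (f u) (g u))"
  using assms(3,4)
proof (induction k arbitrary: f g)
  case 0
  then show ?case using assms(2) by (auto intro: bounded_bilinear.continuous_on)
next
  case (Suc k)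
  show ?case
  proof (rule Ck_on_SucI[OF assms(1)])
    show "((\<lambda>u. B (f u) (g u)) has_derivative
      (\<lambda>v. B (f u) (frechet_derivative g (at u) v) + B (frechet_derivative f (at u) v) (g u))) (at u)"
      if "u \<in> S" for u
      using Suc.prems that by (intro bounded_bilinear.FDERIV[OF assms(2)] Ck_on_SucD)
    show "Ck_on k S (\<lambda>u. B (f u) (frechet_derivative g (at u) v) + B (frechet_derivative f (at u) v) (g u))" for v
      using Suc.prems
      by (intro Ck_on_add assms Suc.IH Ck_on_Suc_imp[OF Suc.prems(1)] Ck_on_Suc_imp[OF Suc.prems(2)]) simp_all
  qed
qed

lemma Ck_on_sum:
  assumes "open S" "\<And>i. i \<in> I \<Longrightarrow> Ck_on k S (f i)"
  shows "Ck_on k S (\<lambda>u. \<Sum>i\<in>I. f i u)"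
  using assms(2)
  by (induction I rule: infinite_finite_induct)
    (simp_all add: assms(1) Ck_on_const Ck_on_add)

lemma Ck_on_compose:
  fixes f :: "'a::real_normed_vector \<Rightarrow> 'b::euclidean_space"
  assumes "open S" "open T" "f ` S \<subseteq> T" "Ck_on k S f" "Ck_on k T g"
  shows "Ck_on k S (\<lambda>u. g (f u))"
  using assms(4,5)
proof (induction k arbitrary: g)
  case 0
  then show ?case using assms(3) by (auto intro: continuous_on_compose2)
next
  case (Suc k)
  \<comment> \<open>The induction hypothesis concerns derivatives along fixed vectors, whereas the
    chain rule evaluates the derivative of \<open>g\<close> at the moving vector
    \<open>frechet_derivative f (at u) v\<close>. Expanding that vector in \<open>Basis\<close>
    separates the two dependences on \<open>u\<close>.\<close>
  let ?h = "\<lambda>u v. \<Sum>b\<in>Basis. (frechet_derivative f (at u) v \<bullet> b) *\<^sub>R frechet_derivative g (at (f u)) b"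
  show ?case
  proof (rule Ck_on_SucI[OF assms(1)])
    fix u assume "u \<in> S"
    then have f: "(f has_derivative frechet_derivative f (at u)) (at u)"
      and g: "(g has_derivative frechet_derivative g (at (f u))) (at (f u))"
      using Suc.prems assms(3) by (auto intro!: Ck_on_SucD)
    interpret g: linear "frechet_derivative g (at (f u))"
      using g has_derivative_linear by blast
    have rep: "frechet_derivative g (at (f u)) w = (\<Sum>b\<in>Basis. (w \<bullet> b) *\<^sub>R frechet_derivative g (at (f u)) b)" for w
      by (subst euclidean_representation[of w, symmetric]) (simp only: g.sum g.scaleR)
    have "(\<lambda>v. frechet_derivative g (at (f u)) (frechet_derivative f (at u) v)) = ?h u"
      by (rule ext) (rule rep)
    then show "((\<lambda>u. g (f u)) has_derivative ?h u) (at u)"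
      using has_derivative_compose[OF f g] by (simp only:)
  next
    fix v
    show "Ck_on k S (\<lambda>u. ?h u v)"
    proof (intro Ck_on_sum assms(1) Ck_on_bilinear[OF assms(1) bounded_bilinear_scaleR])
      fix b :: 'b
      show "Ck_on k S (\<lambda>u. frechet_derivative f (at u) v \<bullet> b)"
        using Suc.prems by (intro Ck_on_bounded_linear[OF assms(1) bounded_linear_inner_left]) simp
      show "Ck_on k S (\<lambda>u. frechet_derivative g (at (f u)) b)"
        by (rule Suc.IH[OF Ck_on_Suc_imp[OF Suc.prems(1)]]) (use Suc.prems(2) in simp)
    qed
  qed
qed

lemma smooth_onD: "smooth_on S f \<Longrightarrow> Ck_on k S f"
  by (simp add: smooth_on_def)

lemma smooth_on_cong: "smooth_on S f \<Longrightarrow> open S \<Longrightarrow> (\<And>u. u \<in> S \<Longrightarrow> f u = g u) \<Longrightarrow> smooth_on S g"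
  unfolding smooth_on_def using Ck_on_cong by metis

lemma smooth_on_subset: "smooth_on S f \<Longrightarrow> T \<subseteq> S \<Longrightarrow> smooth_on T f"
  unfolding smooth_on_def using Ck_on_subset by blast

lemma smooth_on_Un:
  assumes "open S" "open T" "smooth_on S f" "smooth_on T f"
  shows "smooth_on (S \<union> T) f"
  using Ck_on_Union[of "{S, T}" _ f] assms by (auto simp: smooth_on_def)

lemma smooth_on_local:
  assumes "\<And>u. u \<in> S \<Longrightarrow> \<exists>V. open V \<and> u \<in> V \<and> smooth_on V f"
  shows "smooth_on S f"
proof -
  have "Ck_on k (\<Union>{V. open V \<and> smooth_on V f}) f" for k
    by (rule Ck_on_Union) (auto simp: smooth_on_def)
  moreover have "S \<subseteq> \<Union>{V. open V \<and> smooth_on V f}"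
    using assms by blast
  ultimately show ?thesis
    unfolding smooth_on_def using Ck_on_subset by blast
qed

lemma smooth_on_continuous: "smooth_on S f \<Longrightarrow> continuous_on S f"
  using smooth_onD[of S f 0] by simp

lemma smooth_on_has_derivative:
  "smooth_on S f \<Longrightarrow> u \<in> S \<Longrightarrow> (f has_derivative frechet_derivative f (at u)) (at u)"
  by (rule Ck_on_SucD[OF smooth_onD])

lemma smooth_on_frechet: "smooth_on S f \<Longrightarrow> smooth_on S (\<lambda>u. frechet_derivative f (at u) v)"
  unfolding smooth_on_def by (metis Ck_on.simps(2))

lemma smooth_on_const: "open S \<Longrightarrow> smooth_on S (\<lambda>u. c)"
  by (simp add: smooth_on_def Ck_on_const)

lemma smooth_on_linear: "open S \<Longrightarrow> bounded_linear L \<Longrightarrow> smooth_on S L"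
  by (simp add: smooth_on_def Ck_on_linear)

lemma smooth_on_add: "open S \<Longrightarrow> smooth_on S f \<Longrightarrow> smooth_on S g \<Longrightarrow> smooth_on S (\<lambda>u. f u + g u)"
  by (simp add: smooth_on_def Ck_on_add)

lemma smooth_on_bilinear:
  "open S \<Longrightarrow> bounded_bilinear B \<Longrightarrow> smooth_on S f \<Longrightarrow> smooth_on S g \<Longrightarrow> smooth_on S (\<lambda>u. B (f u) (g u))"
  by (simp add: smooth_on_def Ck_on_bilinear)

lemma smooth_on_sum:
  "open S \<Longrightarrow> (\<And>i. i \<in> I \<Longrightarrow> smooth_on S (f i)) \<Longrightarrow> smooth_on S (\<lambda>u. \<Sum>i\<in>I. f i u)"
  by (simp add: smooth_on_def Ck_on_sum)

lemma smooth_on_compose: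
  fixes f :: "'a::real_normed_vector \<Rightarrow> 'b::euclidean_space"
  shows "open S \<Longrightarrow> open T \<Longrightarrow> f ` S \<subseteq> T \<Longrightarrow> smooth_on S f \<Longrightarrow> smooth_on T g \<Longrightarrow> smooth_on S (\<lambda>u. g (f u))"
  by (simp add: smooth_on_def Ck_on_compose)

lemma smooth_on_bounded_linear:
  "open S \<Longrightarrow> bounded_linear L \<Longrightarrow> smooth_on S f \<Longrightarrow> smooth_on S (\<lambda>u. L (f u))"
  by (simp add: smooth_on_def Ck_on_bounded_linear)

lemmas smooth_on_scaleR = smooth_on_bilinear[OF _ bounded_bilinear_scaleR]
lemmas smooth_on_inner = smooth_on_bilinear[OF _ bounded_bilinear_inner]

lemma smooth_on_mult:
  fixes f g :: "'a::real_normed_vector \<Rightarrow> real"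
  shows "open S \<Longrightarrow> smooth_on S f \<Longrightarrow> smooth_on S g \<Longrightarrow> smooth_on S (\<lambda>u. f u * g u)"
  by (rule smooth_on_bilinear[OF _ bounded_bilinear_mult])

lemma smooth_on_minus: "open S \<Longrightarrow> smooth_on S f \<Longrightarrow> smooth_on S (\<lambda>u. - f u)"
  by (rule smooth_on_bounded_linear) (auto intro: bounded_linear_minus bounded_linear_ident)

lemma smooth_on_diff: "open S \<Longrightarrow> smooth_on S f \<Longrightarrow> smooth_on S g \<Longrightarrow> smooth_on S (\<lambda>u. f u - g u)"
  using smooth_on_add[of S f "\<lambda>u. - g u"] smooth_on_minus[of S g] by simp

lemma smooth_on_prod:
  fixes f :: "'i \<Rightarrow> 'a::real_normed_vector \<Rightarrow> real"
  assumes "open S" "\<And>i. i \<in> I \<Longrightarrow> smooth_on S (f i)"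
  shows "smooth_on S (\<lambda>u. \<Prod>i\<in>I. f i u)"
  using assms(2)
  by (induction I rule: infinite_finite_induct) (simp_all add: assms(1) smooth_on_const smooth_on_mult)

lemma smooth_on_vec:
  fixes f :: "'a::real_normed_vector \<Rightarrow> real ^ 'm::finite"
  assumes "open S" "\<And>i. smooth_on S (\<lambda>u. f u $ i)"
  shows "smooth_on S f"
proof -
  have "smooth_on S (\<lambda>u. \<Sum>i\<in>UNIV. (f u $ i) *\<^sub>R axis i (1::real))"
    by (intro smooth_on_sum smooth_on_scaleR smooth_on_const assms)
  moreover have "(\<Sum>i\<in>UNIV. (f u $ i) *\<^sub>R axis i (1::real)) = f u" for u
    by (simp add: vec_eq_iff axis_def if_distrib cong: if_cong)
  ultimately show ?thesis by simp
qed

lemma smooth_on_nth: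
  "open S \<Longrightarrow> smooth_on S f \<Longrightarrow> smooth_on S (\<lambda>u. f u $ i)"
  by (rule smooth_on_bounded_linear[OF _ bounded_linear_vec_nth])

lemma smooth_on_det:
  fixes M :: "'a::real_normed_vector \<Rightarrow> real ^ 'm::finite ^ 'm"
  assumes "open S" "\<And>i j. smooth_on S (\<lambda>u. M u $ i $ j)"
  shows "smooth_on S (\<lambda>u. det (M u))"
  unfolding det_def
  by (intro smooth_on_sum smooth_on_mult smooth_on_prod smooth_on_const assms)

section \<open>Elementary real functions and the bump function\<close>

lemma smooth_on_real_SucI:
  fixes f :: "real \<Rightarrow> real"
  assumes "open S" "\<And>u. u \<in> S \<Longrightarrow> (f has_real_derivative f' u) (at u)" "Ck_on k S f'"
  shows "Ck_on (Suc k) S f"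
proof (rule Ck_on_SucI[OF assms(1)])
  show "(f has_derivative (\<lambda>v. f' u * v)) (at u)" if "u \<in> S" for u
    using assms(2)[OF that] by (simp add: has_field_derivative_def)
  show "Ck_on k S (\<lambda>u. f' u * v)" for v
    by (intro Ck_on_bilinear[OF assms(1) bounded_bilinear_mult] assms Ck_on_const)
qed

lemma smooth_on_inverse_real: "smooth_on {s::real. s \<noteq> 0} inverse"
proof -
  have o: "open {s::real. s \<noteq> 0}" by (simp add: open_Collect_neq)
  have "Ck_on k {s::real. s \<noteq> 0} inverse" for k
  proof (induction k)
    case (Suc k)
    show ?case
      by (rule smooth_on_real_SucI[OF o, of _ "\<lambda>s. - (inverse s * inverse s)"])
        (auto intro!: derivative_eq_intros Ck_on_bounded_linear[OF o bounded_linear_minus[OF bounded_linear_ident]]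
          Ck_on_bilinear[OF o bounded_bilinear_mult] Suc simp: power2_eq_square)
  qed (auto intro!: continuous_intros)
  then show ?thesis by (simp add: smooth_on_def)
qed

lemma smooth_on_exp_real: "smooth_on UNIV (exp :: real \<Rightarrow> real)"
proof -
  have "Ck_on k UNIV (exp :: real \<Rightarrow> real)" for k
  proof (induction k)
    case (Suc k)
    show ?case
      by (rule smooth_on_real_SucI[of _ _ exp]) (auto intro!: derivative_eq_intros Suc)
  qed (auto intro!: continuous_intros)
  then show ?thesis by (simp add: smooth_on_def)
qed

lemma smooth_on_ln_real: "smooth_on {0::real<..} ln"
proof -
  have "Ck_on k {0::real<..} ln" for k
  proof (cases k)
    case (Suc j)
    show ?thesis
      unfolding Suc
      by (rule smooth_on_real_SucI[of _ _ inverse])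
        (auto intro!: derivative_eq_intros smooth_onD smooth_on_subset[OF smooth_on_inverse_real]
          simp: field_simps)
  qed (auto intro!: continuous_intros)
  then show ?thesis by (simp add: smooth_on_def)
qed

lemma smooth_on_inverse:
  fixes f :: "'a::real_normed_vector \<Rightarrow> real"
  assumes "open S" "smooth_on S f" "\<And>u. u \<in> S \<Longrightarrow> f u \<noteq> 0"
  shows "smooth_on S (\<lambda>u. inverse (f u))"
  by (rule smooth_on_compose[OF assms(1) _ _ assms(2) smooth_on_inverse_real])
    (use assms(3) in \<open>auto simp: open_Collect_neq\<close>)

lemma smooth_on_divide:
  fixes f g :: "'a::real_normed_vector \<Rightarrow> real"
  assumes "open S" "smooth_on S f" "smooth_on S g" "\<And>u. u \<in> S \<Longrightarrow> g u \<noteq> 0"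
  shows "smooth_on S (\<lambda>u. f u / g u)"
  unfolding divide_inverse by (intro smooth_on_mult smooth_on_inverse assms)

lemma smooth_on_exp:
  fixes f :: "'a::real_normed_vector \<Rightarrow> real"
  shows "open S \<Longrightarrow> smooth_on S f \<Longrightarrow> smooth_on S (\<lambda>u. exp (f u))"
  by (rule smooth_on_compose[OF _ open_UNIV _ _ smooth_on_exp_real]) auto

lemma smooth_on_sqrt:
  fixes f :: "'a::real_normed_vector \<Rightarrow> real"
  assumes "open S" "smooth_on S f" "\<And>u. u \<in> S \<Longrightarrow> f u > 0"
  shows "smooth_on S (\<lambda>u. sqrt (f u))"
proof (rule smooth_on_cong[OF _ assms(1)])
  show "smooth_on S (\<lambda>u. exp (ln (f u) * (1/2)))"
    by (intro smooth_on_exp smooth_on_mult smooth_on_const assms(1)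
        smooth_on_compose[OF assms(1) _ _ assms(2) smooth_on_ln_real]) (use assms(3) in auto)
  show "exp (ln (f u) * (1/2)) = sqrt (f u)" if "u \<in> S" for u
    using assms(3)[OF that] by (simp add: powr_half_sqrt[symmetric] powr_def mult.commute)
qed

text \<open>The derivatives of the flat function have the form of a polynomial in
  \<open>inverse s\<close> times \<open>exp (- inverse s)\<close>, which is the class the induction runs over.\<close>

definition flat_fun :: "real poly \<Rightarrow> real \<Rightarrow> real" where
  "flat_fun p s = (if s > 0 then poly p (inverse s) * exp (- inverse s) else 0)"

text \<open>In the variable \<open>inverse s\<close> this is the decay of a polynomial divided by
  the exponential at infinity.\<close>

lemma flat_fun_tendsto_0: "(flat_fun p \<longlongrightarrow> 0) (at_right 0)"
proof -
  have "((\<lambda>s::real. \<Sum>i\<le>degree p. coeff p i * (s ^ i / exp s)) \<longlongrightarrow> 0) at_top"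
    by (intro tendsto_null_sum tendsto_mult_right_zero tendsto_power_div_exp_0)
  moreover have "poly p s * exp (- s) = (\<Sum>i\<le>degree p. coeff p i * (s ^ i / exp s))" for s
    by (simp add: poly_altdef exp_minus sum_distrib_right divide_inverse mult.assoc)
  ultimately have "((\<lambda>s. poly p s * exp (- s)) \<longlongrightarrow> 0) at_top"
    by simp
  then have "((\<lambda>s. poly p (inverse s) * exp (- inverse s)) \<longlongrightarrow> 0) (at_right 0)"
    by (rule filterlim_compose) (rule filterlim_inverse_at_top_right)
  then show ?thesis
    by (rule Lim_transform_eventually) (auto simp: flat_fun_def eventually_at_filter)
qed

text \<open>The derivative of \<open>inverse s\<close> brings out the square of
  \<open>inverse s\<close>, that is, multiplication by the polynomial \<open>[:0, 0, 1:]\<close>. At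
  0 the right difference quotient is itself a flat function, with polynomial
  \<open>[:0, 1:] * p\<close>, and so tends to 0.\<close>

lemma flat_fun_has_derivative:
  "(flat_fun p has_real_derivative flat_fun ([:0, 0, 1:] * (p - pderiv p)) s) (at s)"
proof (cases s "0::real" rule: linorder_cases)
  case less
  show ?thesis
    by (rule has_field_derivative_transform_within_open[of "\<lambda>s. 0" _ _ "{..<0}"])
      (use less in \<open>auto simp: flat_fun_def\<close>)
next
  case greater
  have "((\<lambda>s. poly p (inverse s) * exp (- inverse s)) has_real_derivative
      flat_fun ([:0, 0, 1:] * (p - pderiv p)) s) (at s)"
  proof (rule DERIV_cong[OF DERIV_mult])
    have inv: "(inverse has_real_derivative - (inverse s ^ Suc (Suc 0))) (at s)"
      using greater by (intro DERIV_inverse) simp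
    show "((\<lambda>s. poly p (inverse s)) has_real_derivative
        poly (pderiv p) (inverse s) * (- (inverse s ^ Suc (Suc 0)))) (at s)"
      by (rule DERIV_chain2[OF poly_DERIV inv])
    show "((\<lambda>s. exp (- inverse s)) has_real_derivative
        exp (- inverse s) * (- (- (inverse s ^ Suc (Suc 0))))) (at s)"
      by (rule DERIV_fun_exp[OF DERIV_minus[OF inv]])
    show "poly (pderiv p) (inverse s) * (- (inverse s ^ Suc (Suc 0))) * exp (- inverse s)
        + exp (- inverse s) * (- (- (inverse s ^ Suc (Suc 0)))) * poly p (inverse s)
      = flat_fun ([:0, 0, 1:] * (p - pderiv p)) s"
      using greater by (simp add: flat_fun_def algebra_simps)
  qed
  then show ?thesis
    by (rule has_field_derivative_transform_within_open[of _ _ _ "{0<..}"])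
      (use greater in \<open>auto simp: flat_fun_def\<close>)
next
  case equal
  have "(flat_fun p has_real_derivative 0) (at 0)"
    unfolding has_field_derivative_iff
  proof (rule filterlim_split_at)
    have "\<forall>\<^sub>F s in at_left 0. (flat_fun p s - flat_fun p 0) / (s - 0) = 0"
      by (auto simp: flat_fun_def eventually_at_filter)
    then show "((\<lambda>s. (flat_fun p s - flat_fun p 0) / (s - 0)) \<longlongrightarrow> 0) (at_left 0)"
      by (rule tendsto_eventually)
    have "\<forall>\<^sub>F s in at_right 0. flat_fun ([:0, 1:] * p) s = (flat_fun p s - flat_fun p 0) / (s - 0)"
      using eventually_at_right_less[of "0::real"]
      by eventually_elim (simp add: flat_fun_def divide_inverse)
    then show "((\<lambda>s. (flat_fun p s - flat_fun p 0) / (s - 0)) \<longlongrightarrow> 0) (at_right 0)"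
      by (rule Lim_transform_eventually[OF flat_fun_tendsto_0])
  qed
  then show ?thesis using equal by (simp add: flat_fun_def)
qed

lemma smooth_on_flat_fun: "smooth_on UNIV (flat_fun p)"
proof -
  have "Ck_on k UNIV (flat_fun p)" for k
  proof (induction k arbitrary: p)
    case 0
    show ?case
      using flat_fun_has_derivative[THEN DERIV_isCont] by (simp add: continuous_at_imp_continuous_on)
  next
    case (Suc k)
    show ?case
      by (rule smooth_on_real_SucI[OF _ flat_fun_has_derivative Suc]) simp
  qed
  then show ?thesis by (simp add: smooth_on_def)
qed

text \<open>The function \<open>exp (- inverse s)\<close> continued by 0. It is not normalized, so
  that \<open>bump 1\<close> appears as the limit of the cutoffs.\<close>

definition bump :: "real \<Rightarrow> real" where
  "bump = flat_fun 1"

lemma bump_nonneg: "0 \<le> bump s"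
  and bump_le_1: "bump s \<le> 1"
  and bump_pos_iff: "0 < bump s \<longleftrightarrow> 0 < s"
  and bump_eq_0: "s \<le> 0 \<Longrightarrow> bump s = 0"
  by (auto simp: bump_def flat_fun_def)

lemma smooth_on_bump: "smooth_on UNIV bump"
  unfolding bump_def by (rule smooth_on_flat_fun)

text \<open>The mean value theorem is applied twice: along \<open>w\<close> to the increment in
  direction \<open>v\<close>, then along \<open>v\<close> to the derivative so obtained. The second
  difference is symmetric in \<open>v\<close> and \<open>w\<close>, while the derivative on the
  right is taken in one fixed order.\<close>

lemma second_difference:
  fixes f :: "'a::real_normed_vector \<Rightarrow> real"
  assumes "smooth_on (ball u \<delta>) f" "h > 0" "h * norm v + h * norm w < \<delta>"
  shows "\<exists>p\<in>ball u \<delta>. f (u + h *\<^sub>R w + h *\<^sub>R v) - f (u + h *\<^sub>R w) - f (u + h *\<^sub>R v) + f u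
     = h\<^sup>2 * frechet_derivative (\<lambda>u. frechet_derivative f (at u) w) (at p) v"
proof -
  have in_ball: "u + s *\<^sub>R w + t *\<^sub>R v \<in> ball u \<delta>" if "0 \<le> s" "s \<le> h" "0 \<le> t" "t \<le> h" for s t
  proof -
    have "norm (s *\<^sub>R w + t *\<^sub>R v) \<le> s * norm w + t * norm v"
      using that norm_triangle_ineq[of "s *\<^sub>R w" "t *\<^sub>R v"] by simp
    also have "\<dots> \<le> h * norm w + h * norm v"
      using that by (intro add_mono mult_right_mono) auto
    finally have "norm (- (s *\<^sub>R w + t *\<^sub>R v)) < \<delta>"
      using assms(3) by (simp only: norm_minus_cancel)
    moreover have "u - (u + s *\<^sub>R w + t *\<^sub>R v) = - (s *\<^sub>R w + t *\<^sub>R v)" by simp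
    ultimately show ?thesis by (simp only: mem_ball dist_norm)
  qed
  have line: "((\<lambda>s. g (a + s *\<^sub>R b)) has_real_derivative frechet_derivative g (at (a + s *\<^sub>R b)) b) (at s)"
    if "smooth_on (ball u \<delta>) g" "a + s *\<^sub>R b \<in> ball u \<delta>" for g :: "'a \<Rightarrow> real" and a b s
  proof -
    have "((\<lambda>s. a + s *\<^sub>R b) has_derivative (\<lambda>r. r *\<^sub>R b)) (at s)"
      by (auto intro!: derivative_eq_intros)
    from has_derivative_compose[OF this smooth_on_has_derivative[OF that]]
    have "((\<lambda>s. g (a + s *\<^sub>R b)) has_derivative (\<lambda>r. frechet_derivative g (at (a + s *\<^sub>R b)) (r *\<^sub>R b))) (at s)" .
    moreover have "linear (frechet_derivative g (at (a + s *\<^sub>R b)))"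
      using smooth_on_has_derivative[OF that] has_derivative_linear by blast
    ultimately show ?thesis
      unfolding has_field_derivative_def by (simp add: linear_scale mult.commute[of _ "frechet_derivative g _ b"])
  qed
  define F where "F = (\<lambda>u. frechet_derivative f (at u) w)"
  have smF: "smooth_on (ball u \<delta>) F"
    unfolding F_def by (rule smooth_on_frechet[OF assms(1)])
  define \<psi> where "\<psi> s = f ((u + h *\<^sub>R v) + s *\<^sub>R w) - f (u + s *\<^sub>R w)" for s
  have "\<exists>\<sigma>. 0 < \<sigma> \<and> \<sigma> < h \<and> \<psi> h - \<psi> 0 = (h - 0) * (F ((u + h *\<^sub>R v) + \<sigma> *\<^sub>R w) - F (u + \<sigma> *\<^sub>R w))"
  proof (rule MVT2[OF assms(2)])
    fix s assume "0 \<le> s" "s \<le> h"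
    then show "(\<psi> has_real_derivative F ((u + h *\<^sub>R v) + s *\<^sub>R w) - F (u + s *\<^sub>R w)) (at s)"
      unfolding \<psi>_def F_def
      using in_ball[of s h] in_ball[of s 0] assms(2)
      by (intro DERIV_diff line assms(1)) (auto simp: algebra_simps)
  qed
  then obtain \<sigma> where \<sigma>: "0 < \<sigma>" "\<sigma> < h"
    "\<psi> h - \<psi> 0 = h * (F ((u + h *\<^sub>R v) + \<sigma> *\<^sub>R w) - F (u + \<sigma> *\<^sub>R w))" by auto
  have "\<exists>\<tau>. 0 < \<tau> \<and> \<tau> < h \<and> F ((u + \<sigma> *\<^sub>R w) + h *\<^sub>R v) - F ((u + \<sigma> *\<^sub>R w) + 0 *\<^sub>R v)
      = (h - 0) * frechet_derivative F (at ((u + \<sigma> *\<^sub>R w) + \<tau> *\<^sub>R v)) v"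
    by (rule MVT2[OF assms(2)]) (use in_ball \<sigma> in \<open>auto intro!: line smF\<close>)
  then obtain \<tau> where \<tau>: "0 < \<tau>" "\<tau> < h" "F ((u + \<sigma> *\<^sub>R w) + h *\<^sub>R v) - F (u + \<sigma> *\<^sub>R w)
      = h * frechet_derivative F (at ((u + \<sigma> *\<^sub>R w) + \<tau> *\<^sub>R v)) v" by auto
  have "\<psi> h - \<psi> 0 = h * (h * frechet_derivative F (at ((u + \<sigma> *\<^sub>R w) + \<tau> *\<^sub>R v)) v)"
    unfolding \<sigma>(3) using \<tau>(3) by (simp add: add.commute add.left_commute)
  then show ?thesis
    using in_ball[of \<sigma> \<tau>] \<sigma> \<tau>
    by (intro bexI[of _ "u + \<sigma> *\<^sub>R w + \<tau> *\<^sub>R v"])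
      (auto simp: \<psi>_def F_def power2_eq_square algebra_simps)
qed

text \<open>If the mixed derivatives differed at \<open>u\<close>, continuity would keep their
  values apart on a small ball; but evaluating one second difference in both orders yields points of
  that ball where they agree.\<close>

lemma second_derivative_symmetric_real:
  fixes f :: "'a::real_normed_vector \<Rightarrow> real"
  assumes "open S" "smooth_on S f" "u \<in> S"
  shows "frechet_derivative (\<lambda>u. frechet_derivative f (at u) w) (at u) v =
     frechet_derivative (\<lambda>u. frechet_derivative f (at u) v) (at u) w"
proof (rule ccontr)
  define A where "A = (\<lambda>u. frechet_derivative (\<lambda>u. frechet_derivative f (at u) w) (at u) v)"
  define B where "B = (\<lambda>u. frechet_derivative (\<lambda>u. frechet_derivative f (at u) v) (at u) w)"
  assume "\<not> ?thesis"
  then have e: "\<bar>A u - B u\<bar> / 2 > 0" (is "?e > 0") by (simp add: A_def B_def)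
  have "continuous_on S A" "continuous_on S B"
    unfolding A_def B_def by (intro smooth_on_continuous smooth_on_frechet assms)+
  then have "isCont A u" "isCont B u"
    using assms continuous_on_eq_continuous_at by blast+
  then obtain d1 d2 where d: "d1 > 0" "\<And>y. dist y u < d1 \<Longrightarrow> dist (A y) (A u) < ?e"
    "d2 > 0" "\<And>y. dist y u < d2 \<Longrightarrow> dist (B y) (B u) < ?e"
    using e unfolding continuous_at_eps_delta by metis
  obtain d3 where d3: "d3 > 0" "ball u d3 \<subseteq> S"
    using assms openE by blast
  define \<delta> where "\<delta> = min d1 (min d2 d3)"
  have \<delta>: "\<delta> > 0" "ball u \<delta> \<subseteq> S" using d d3 by (auto simp: \<delta>_def)
  \<comment> \<open>Small enough for the parallelogram spanned by \<open>h *\<^sub>R v\<close> and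
    \<open>h *\<^sub>R w\<close> to stay in the ball; the summand 1 covers the case that both
    vectors are zero.\<close>
  define h where "h = \<delta> / (2 * (norm v + norm w + 1))"
  have n: "norm v + norm w + 1 > 0" by (simp add: add_nonneg_pos)
  have h: "h > 0" using \<delta> n by (simp add: h_def)
  have "h * norm v + h * norm w \<le> h * (norm v + norm w + 1)"
    using h by (simp add: algebra_simps)
  also have "\<dots> = \<delta> / 2" using n by (simp add: h_def field_simps)
  finally have hs: "h * norm v + h * norm w < \<delta>" using \<delta> by simp
  have sm: "smooth_on (ball u \<delta>) f" using smooth_on_subset[OF assms(2) \<delta>(2)] .
  obtain p where p: "p \<in> ball u \<delta>" "f (u + h *\<^sub>R w + h *\<^sub>R v) - f (u + h *\<^sub>R w) - f (u + h *\<^sub>R v) + f u = h\<^sup>2 * A p"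
    using second_difference[OF sm h hs] unfolding A_def by blast
  obtain q where q: "q \<in> ball u \<delta>" "f (u + h *\<^sub>R v + h *\<^sub>R w) - f (u + h *\<^sub>R v) - f (u + h *\<^sub>R w) + f u = h\<^sup>2 * B q"
    using second_difference[OF sm h, of w v] hs unfolding B_def by (auto simp: add.commute)
  have "h\<^sup>2 * A p = h\<^sup>2 * B q"
    using p(2) q(2) by (simp add: algebra_simps)
  then have "A p = B q" using h by simp
  moreover have "dist (A p) (A u) < ?e" "dist (B q) (B u) < ?e"
    using d p(1) q(1) by (auto simp: \<delta>_def dist_commute)
  ultimately show False by (simp add: dist_real_def abs_if split: if_splits)
qed

lemma second_derivative_symmetric:
  fixes f :: "'a::real_normed_vector \<Rightarrow> 'e::euclidean_space"
  assumes "open S" "smooth_on S f" "u \<in> S"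
  shows "frechet_derivative (\<lambda>u. frechet_derivative f (at u) w) (at u) v =
     frechet_derivative (\<lambda>u. frechet_derivative f (at u) v) (at u) w"
proof (rule euclidean_eqI)
  fix b :: 'e
  have inner: "frechet_derivative (\<lambda>u. g u \<bullet> b) (at y) a = frechet_derivative g (at y) a \<bullet> b"
    if "smooth_on S g" "y \<in> S" for g :: "'a \<Rightarrow> 'e" and a y
  proof -
    have "((\<lambda>u. g u \<bullet> b) has_derivative (\<lambda>a. frechet_derivative g (at y) a \<bullet> b)) (at y)"
      by (rule bounded_linear.has_derivative[OF bounded_linear_inner_left smooth_on_has_derivative[OF that]])
    from frechet_derivative_at[OF this] show ?thesis by (metis (no_types))
  qed
  have sm: "smooth_on S (\<lambda>u. f u \<bullet> b)"
    by (rule smooth_on_inner[OF assms(1,2) smooth_on_const[OF assms(1)]])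
  have 1: "frechet_derivative (\<lambda>u. frechet_derivative f (at u) w) (at u) v \<bullet> b =
      frechet_derivative (\<lambda>u. frechet_derivative (\<lambda>u. f u \<bullet> b) (at u) w) (at u) v" for v w
  proof -
    have "((\<lambda>u. frechet_derivative f (at u) w \<bullet> b) has_derivative
        frechet_derivative (\<lambda>u. frechet_derivative (\<lambda>u. f u \<bullet> b) (at u) w) (at u)) (at u)"
      by (rule has_derivative_transform_within_open[OF smooth_on_has_derivative[OF smooth_on_frechet[OF sm] assms(3)] assms(1,3)])
        (simp add: inner[OF assms(2)])
    from frechet_derivative_at[OF this] show ?thesis
      using inner[OF smooth_on_frechet[OF assms(2)] assms(3)] by (metis (no_types))
  qed
  show "frechet_derivative (\<lambda>u. frechet_derivative f (at u) w) (at u) v \<bullet> b =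
     frechet_derivative (\<lambda>u. frechet_derivative f (at u) v) (at u) w \<bullet> b"
    unfolding 1 by (rule second_derivative_symmetric_real[OF assms(1) sm assms(3)])
qed

subsection \<open>Gram matrices\<close>

lemma matrix_inv_mult:
  fixes A :: "real ^ 'm::finite ^ 'm"
  assumes "det A \<noteq> 0"
  shows "A ** matrix_inv A = mat 1" "matrix_inv A ** A = mat 1"
proof -
  have "\<exists>A'. A ** A' = mat 1 \<and> A' ** A = mat 1"
    using assms invertible_det_nz[of A] unfolding invertible_def by blast
  then have "A ** matrix_inv A = mat 1 \<and> matrix_inv A ** A = mat 1"
    unfolding matrix_inv_def by (rule someI_ex)
  then show "A ** matrix_inv A = mat 1" "matrix_inv A ** A = mat 1" by auto
qed

lemma matrix_inv_unique:
  fixes A B :: "real ^ 'm::finite ^ 'm"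
  assumes "A ** B = mat 1"
  shows "matrix_inv A = B"
proof -
  have "det A \<noteq> 0"
    using assms by (metis det_I det_mul mult_zero_left zero_neq_one)
  then have "matrix_inv A ** (A ** B) = B"
    by (simp add: matrix_mul_assoc matrix_inv_mult)
  then show ?thesis using assms by simp
qed

lemma matrix_inv_symmetric:
  fixes A :: "real ^ 'm::finite ^ 'm"
  assumes "det A \<noteq> 0" "transpose A = A"
  shows "transpose (matrix_inv A) = matrix_inv A"
proof -
  have "A ** transpose (matrix_inv A) = transpose (matrix_inv A ** A)"
    by (simp add: matrix_transpose_mul assms(2))
  also have "\<dots> = mat 1" by (simp add: matrix_inv_mult[OF assms(1)] transpose_mat)
  finally show ?thesis using matrix_inv_unique by metis
qed

text \<open>Cramer's rule. Quotients of determinants make the smooth dependence of the inverse on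
  the matrix visible.\<close>

lemma matrix_inv_nth:
  fixes A :: "real ^ 'm::finite ^ 'm"
  assumes "det A \<noteq> 0"
  shows "matrix_inv A $ i $ j = det (\<chi> k l. if l = i then axis j 1 $ k else A $ k $ l) / det A"
proof -
  have "A *v (matrix_inv A *v axis j 1) = axis j 1"
    by (simp add: matrix_vector_mul_assoc matrix_inv_mult[OF assms])
  then have "matrix_inv A *v axis j 1 =
      (\<chi> i. det (\<chi> k l. if l = i then axis j 1 $ k else A $ k $ l) / det A)"
    by (simp only: cramer[OF assms])
  moreover have "(matrix_inv A *v axis j 1) $ i = matrix_inv A $ i $ j"
    by (simp add: matrix_vector_mul_component inner_axis)
  ultimately show ?thesis by simp
qed

lemma smooth_on_matrix_inv:
  fixes M :: "'a::real_normed_vector \<Rightarrow> real ^ 'm::finite ^ 'm"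
  assumes "open S" "\<And>i j. smooth_on S (\<lambda>u. M u $ i $ j)" "\<And>u. u \<in> S \<Longrightarrow> det (M u) \<noteq> 0"
  shows "smooth_on S (\<lambda>u. matrix_inv (M u) $ i $ j)"
proof (rule smooth_on_cong[OF _ assms(1)])
  show "smooth_on S (\<lambda>u. det (\<chi> k l. if l = i then axis j 1 $ k else M u $ k $ l) / det (M u))"
  proof (intro smooth_on_divide smooth_on_det assms)
    fix k l
    show "smooth_on S (\<lambda>u. (\<chi> k l. if l = i then axis j 1 $ k else M u $ k $ l) $ k $ l)"
      by (cases "l = i") (simp_all add: smooth_on_const assms)
  qed
qed (use assms(3) in \<open>simp add: matrix_inv_nth\<close>)

text \<open>Jacobi's formula. The determinant is linear in each row, and
  \<open>M' = (M' ** matrix_inv (M t)) ** M t\<close> expresses the differentiated row through the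
  rows of \<open>M t\<close>; of these only the row with the same index contributes, which leaves
  the diagonal entry.\<close>

lemma det_has_derivative:
  fixes M :: "real \<Rightarrow> real ^ 'm::finite ^ 'm"
  assumes "\<And>i j. ((\<lambda>s. M s $ i $ j) has_real_derivative M' $ i $ j) (at t)" "det (M t) \<noteq> 0"
  shows "((\<lambda>s. det (M s)) has_real_derivative
    det (M t) * (\<Sum>i\<in>UNIV. \<Sum>j\<in>UNIV. matrix_inv (M t) $ i $ j * M' $ j $ i)) (at t)"
proof -
  let ?N = "matrix_inv (M t)"
  let ?R = "\<lambda>i. (\<chi> k l. if k = i then M' $ k $ l else M t $ k $ l) :: real ^ 'm ^ 'm"
  let ?P = "{p. p permutes (UNIV :: 'm set)}"
  have "((\<lambda>s. det (M s)) has_real_derivative (\<Sum>p\<in>?P. of_int (sign p) *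
      (\<Sum>i\<in>UNIV. M' $ i $ p i * (\<Prod>k\<in>UNIV - {i}. M t $ k $ p k)))) (at t)"
    unfolding det_def
    by (intro DERIV_sum DERIV_cmult has_field_derivative_prod assms(1))
  also have "(\<Sum>p\<in>?P. of_int (sign p) * (\<Sum>i\<in>UNIV. M' $ i $ p i * (\<Prod>k\<in>UNIV - {i}. M t $ k $ p k)))
      = (\<Sum>i\<in>UNIV. \<Sum>p\<in>?P. of_int (sign p) * (M' $ i $ p i * (\<Prod>k\<in>UNIV - {i}. M t $ k $ p k)))"
    by (simp add: sum_distrib_left sum.swap[of _ _ ?P])
  also have "\<dots> = (\<Sum>i\<in>UNIV. det (?R i))"
  proof (rule sum.cong[OF refl])
    fix i :: 'm
    have "M' $ i $ p i * (\<Prod>k\<in>UNIV - {i}. M t $ k $ p k) = (\<Prod>k\<in>UNIV. ?R i $ k $ p k)" for p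
    proof -
      have "(\<Prod>k\<in>UNIV - {i}. ?R i $ k $ p k) = (\<Prod>k\<in>UNIV - {i}. M t $ k $ p k)"
        by (rule prod.cong) auto
      then show ?thesis
        by (subst prod.remove[of UNIV i]) simp_all
    qed
    then show "(\<Sum>p\<in>?P. of_int (sign p) * (M' $ i $ p i * (\<Prod>k\<in>UNIV - {i}. M t $ k $ p k))) = det (?R i)"
      unfolding det_def by simp
  qed
  also have "\<dots> = (\<Sum>i\<in>UNIV. (M' ** ?N) $ i $ i * det (M t))"
  proof (rule sum.cong[OF refl])
    fix i :: 'm
    define x where "x = (M' ** ?N) $ i"
    have "M' $ i $ l = (\<Sum>k\<in>UNIV. x $ k * M t $ k $ l)" for l
    proof -
      have "M' $ i $ l = ((M' ** ?N) ** M t) $ i $ l"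
        by (simp add: matrix_mul_assoc[symmetric] matrix_inv_mult[OF assms(2)])
      then show ?thesis by (simp add: x_def matrix_matrix_mult_def[of "M' ** ?N"])
    qed
    then have "?R i = (\<chi> k. if k = i then \<Sum>k\<in>UNIV. x $ k *s row k (M t) else row k (M t))"
      by (simp add: vec_eq_iff row_def)
    then show "det (?R i) = (M' ** ?N) $ i $ i * det (M t)"
      by (simp add: cramer_lemma_transpose x_def)
  qed
  also have "\<dots> = det (M t) * (\<Sum>i\<in>UNIV. (M' ** ?N) $ i $ i)"
    by (simp add: sum_distrib_left mult.commute)
  also have "(\<Sum>i\<in>UNIV. (M' ** ?N) $ i $ i) = (\<Sum>i\<in>UNIV. \<Sum>j\<in>UNIV. ?N $ i $ j * M' $ j $ i)"
    unfolding matrix_matrix_mult_def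
    by (simp add: mult.commute) (rule sum.swap)
  finally show ?thesis .
qed

text \<open>Cramer's rule provides some derivative; its value is forced by differentiating
  \<open>M s ** matrix_inv (M s) = mat 1\<close>.\<close>

lemma matrix_inv_has_derivative:
  fixes M :: "real \<Rightarrow> real ^ 'm::finite ^ 'm"
  assumes "open S" "t \<in> S" "\<And>i j. smooth_on S (\<lambda>s. M s $ i $ j)" "\<And>s. s \<in> S \<Longrightarrow> det (M s) \<noteq> 0"
    "\<And>i j. ((\<lambda>s. M s $ i $ j) has_real_derivative M' $ i $ j) (at t)"
  shows "((\<lambda>s. matrix_inv (M s) $ i $ j) has_real_derivative
    - (matrix_inv (M t) ** M' ** matrix_inv (M t)) $ i $ j) (at t)"
proof -
  have "\<exists>D. ((\<lambda>s. matrix_inv (M s) $ i $ j) has_real_derivative D) (at t)" for i j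
    using smooth_on_has_derivative[OF smooth_on_matrix_inv[OF assms(1,3,4)] assms(2)]
      has_real_derivative by blast
  then obtain D where D: "\<And>i j. ((\<lambda>s. matrix_inv (M s) $ i $ j) has_real_derivative D i j) (at t)"
    by metis
  define N' :: "real ^ 'm ^ 'm" where "N' = (\<chi> i j. D i j)"
  have "(M' ** matrix_inv (M t) + M t ** N') $ i $ j = 0" for i j
  proof -
    have "((\<lambda>s. (M s ** matrix_inv (M s)) $ i $ j) has_real_derivative
        (\<Sum>k\<in>UNIV. M' $ i $ k * matrix_inv (M t) $ k $ j + D k j * M t $ i $ k)) (at t)"
      unfolding matrix_matrix_mult_def by (simp, intro DERIV_sum DERIV_mult assms(5) D)
    moreover have "((\<lambda>s. (M s ** matrix_inv (M s)) $ i $ j) has_real_derivative 0) (at t)"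
      by (rule has_field_derivative_transform_within_open[OF _ assms(1,2), of "\<lambda>s. mat 1 $ i $ j"])
        (simp_all add: matrix_inv_mult assms(4))
    ultimately have "(\<Sum>k\<in>UNIV. M' $ i $ k * matrix_inv (M t) $ k $ j + D k j * M t $ i $ k) = 0"
      by (rule DERIV_unique)
    then show ?thesis
      by (simp add: matrix_matrix_mult_def N'_def sum.distrib mult.commute)
  qed
  then have "M' ** matrix_inv (M t) + M t ** N' = 0" by (simp add: vec_eq_iff)
  then have "M t ** N' = - (M' ** matrix_inv (M t))" by (simp add: add_eq_0_iff)
  then have "matrix_inv (M t) ** (M t ** N') = - (matrix_inv (M t) ** (M' ** matrix_inv (M t)))"
    by (simp add: matrix_matrix_mult_def vec_eq_iff sum_negf)
  then have "N' = - (matrix_inv (M t) ** M' ** matrix_inv (M t))"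
    by (simp add: matrix_mul_assoc matrix_inv_mult[OF assms(4)[OF assms(2)]])
  then have "D i j = - (matrix_inv (M t) ** M' ** matrix_inv (M t)) $ i $ j"
    by (metis N'_def vec_lambda_beta vector_uminus_component)
  then show ?thesis using D by metis
qed

section \<open>Frames, orthogonal projections and metric traces\<close>

definition gram :: "(real ^ 'm::finite \<Rightarrow> 'e::euclidean_space) \<Rightarrow> real ^ 'm ^ 'm" where
  "gram E = (\<chi> i j. E (axis i 1) \<bullet> E (axis j 1))"

text \<open>The coordinates, with respect to the basis \<open>E (axis i 1)\<close>, of the orthogonal projection
  of \<open>w\<close> to the range of \<open>E\<close>.\<close>

definition coord :: "(real ^ 'm::finite \<Rightarrow> 'e::euclidean_space) \<Rightarrow> 'e \<Rightarrow> real ^ 'm" where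
  "coord E w = matrix_inv (gram E) *v (\<chi> i. E (axis i 1) \<bullet> w)"

lemma linear_axis_expand:
  fixes E :: "real ^ 'm::finite \<Rightarrow> 'e::real_vector"
  assumes "linear E"
  shows "E a = (\<Sum>i\<in>UNIV. a $ i *\<^sub>R E (axis i 1))"
proof -
  have "a = (\<Sum>i\<in>UNIV. a $ i *\<^sub>R axis i 1)"
    by (simp add: vec_eq_iff axis_def if_distrib cong: if_cong)
  then have "E a = E (\<Sum>i\<in>UNIV. a $ i *\<^sub>R axis i 1)" by simp
  also have "\<dots> = (\<Sum>i\<in>UNIV. a $ i *\<^sub>R E (axis i 1))"
    using assms by (simp add: linear_sum linear_scale)
  finally show ?thesis .
qed

lemma gram_symmetric: "transpose (gram E) = gram E"
  by (simp add: gram_def transpose_def vec_eq_iff inner_commute)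

lemma gram_mult:
  assumes "linear E"
  shows "gram E *v a = (\<chi> i. E (axis i 1) \<bullet> E a)"
  by (subst (2) linear_axis_expand[OF assms])
    (simp add: gram_def matrix_vector_mult_def vec_eq_iff inner_sum_right mult.commute)

lemma inner_gram_mult:
  assumes "linear E"
  shows "b \<bullet> (gram E *v a) = E b \<bullet> E a"
  by (subst linear_axis_expand[OF assms, of b])
    (simp add: gram_mult[OF assms] inner_vec_def inner_sum_left)

text \<open>For injective \<open>E\<close> the segment from the identity to the Gram matrix consists
  of positive definite matrices. The determinant therefore has no zero on it and keeps the sign that
  it has at the identity.\<close>

lemma det_gram_pos_iff:
  assumes "linear E"
  shows "det (gram E) > 0 \<longleftrightarrow> inj E" "det (gram E) \<noteq> 0 \<longleftrightarrow> inj E"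
proof -
  have "det (gram E) > 0" if "inj E"
  proof (rule ccontr)
    assume neg: "\<not> det (gram E) > 0"
    define M where "M s = (1 - s) *\<^sub>R mat 1 + s *\<^sub>R gram E" for s :: real
    have "continuous_on {0..1} (\<lambda>s. det (M s))"
      unfolding M_def det_def by (intro continuous_intros)
    moreover have "det (M 0) = 1" "det (M 1) = det (gram E)"
      by (simp_all add: M_def)
    ultimately obtain s where s: "0 \<le> s" "s \<le> 1" "det (M s) = 0"
      using IVT2'[of "\<lambda>s. det (M s)" 1 0 0] neg by auto
    then obtain a where a: "a \<noteq> 0" "M s *v a = 0"
      using invertible_det_nz[of "M s"] matrix_left_invertible_ker[of "M s"] invertible_left_inverse[of "M s"] by auto
    have "a \<bullet> (M s *v a) = (1 - s) * (a \<bullet> a) + s * (E a \<bullet> E a)"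
      by (simp add: M_def matrix_vector_mult_add_rdistrib inner_add_right
          scaleR_matrix_vector_assoc[symmetric] inner_gram_mult[OF assms])
    then have eq: "(1 - s) * (a \<bullet> a) + s * (E a \<bullet> E a) = 0" using a by simp
    have "E a \<noteq> 0" using that a(1) assms by (metis linear_injective_0)
    then have pos: "a \<bullet> a > 0" "E a \<bullet> E a > 0" using a(1) by simp_all
    show False
    proof (cases "s = 0")
      case False
      then have "s * (E a \<bullet> E a) > 0" using s(1) pos by simp
      moreover have "(1 - s) * (a \<bullet> a) \<ge> 0" using s(2) pos by simp
      ultimately show False using eq by linarith
    qed (use eq pos in simp)
  qed
  moreover have "inj E" if "det (gram E) \<noteq> 0"
  proof -
    have "a = 0" if "E a = 0" for a
    proof -
      have "gram E *v a = 0" using that by (simp add: gram_mult[OF assms] vec_eq_iff)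
      then have "matrix_inv (gram E) *v (gram E *v a) = 0" by simp
      then show ?thesis
        by (simp add: matrix_vector_mul_assoc matrix_inv_mult[OF \<open>det (gram E) \<noteq> 0\<close>])
    qed
    then show ?thesis using assms by (metis linear_injective_0)
  qed
  ultimately show "det (gram E) > 0 \<longleftrightarrow> inj E" "det (gram E) \<noteq> 0 \<longleftrightarrow> inj E" by auto
qed

locale frame =
  fixes E :: "real ^ 'm::finite \<Rightarrow> 'e::euclidean_space"
  assumes lin: "linear E" and inj: "inj E"
begin

lemma det_gram: "det (gram E) > 0" "det (gram E) \<noteq> 0"
  using det_gram_pos_iff[OF lin] inj by auto

lemma linear_coord: "linear (coord E)"
proof (rule linearI)
  have "(\<chi> i. E (axis i 1) \<bullet> (v + w)) = (\<chi> i. E (axis i 1) \<bullet> v) + (\<chi> i. E (axis i 1) \<bullet> w)" for v w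
    by (simp add: vec_eq_iff inner_add_right)
  then show "coord E (v + w) = coord E v + coord E w" for v w
    by (simp add: coord_def matrix_vector_right_distrib)
  have "(\<chi> i. E (axis i 1) \<bullet> (r *\<^sub>R w)) = r *\<^sub>R (\<chi> i. E (axis i 1) \<bullet> w)" for r w
    by (simp add: vec_eq_iff)
  then show "coord E (r *\<^sub>R w) = r *\<^sub>R coord E w" for r w
    by (simp add: coord_def matrix_vector_mult_scaleR)
qed

lemma coord_E: "coord E (E a) = a"
  by (simp add: coord_def gram_mult[OF lin, symmetric] matrix_vector_mul_assoc matrix_inv_mult det_gram)

lemma E_coord_inner: "E (coord E w) \<bullet> E a = w \<bullet> E a"
proof -
  have "gram E *v coord E w = (\<chi> i. E (axis i 1) \<bullet> w)"
    by (simp add: coord_def matrix_vector_mul_assoc matrix_inv_mult det_gram)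
  then have "a \<bullet> (gram E *v coord E w) = (\<Sum>i\<in>UNIV. a $ i * (E (axis i 1) \<bullet> w))"
    by (simp add: inner_vec_def)
  also have "\<dots> = E a \<bullet> w"
    by (subst linear_axis_expand[OF lin, of a]) (simp add: inner_sum_left)
  finally show ?thesis by (simp add: inner_gram_mult[OF lin] inner_commute)
qed

lemma coord_nth: "coord E w $ i = w \<bullet> (\<Sum>k\<in>UNIV. matrix_inv (gram E) $ i $ k *\<^sub>R E (axis k 1))"
  by (simp add: coord_def matrix_vector_mult_def inner_sum_right inner_commute)

lemma sum_coord_scaleR:
  "(\<Sum>c\<in>Basis. coord E c $ i *\<^sub>R c) = (\<Sum>k\<in>UNIV. matrix_inv (gram E) $ i $ k *\<^sub>R E (axis k 1))"
  by (simp only: coord_nth inner_commute[of _ "sum _ _"] euclidean_representation)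

text \<open>The vectors \<open>\<Sum>c\<in>Basis. coord E c $ i *\<^sub>R c\<close> form the basis
  dual to the vectors \<open>E (axis i 1)\<close>, and the Gram matrix of a dual basis is the
  inverse one.\<close>

lemma sum_coord_mult:
  "(\<Sum>c\<in>Basis. coord E c $ i * coord E c $ j) = matrix_inv (gram E) $ i $ j"
proof -
  interpret c: linear "coord E" by (rule linear_coord)
  have "(\<Sum>c\<in>Basis. coord E c $ i * coord E c $ j) = coord E (\<Sum>c\<in>Basis. coord E c $ i *\<^sub>R c) $ j"
    by (simp add: c.sum c.scaleR)
  also have "\<dots> = matrix_inv (gram E) $ i $ j"
    by (simp add: sum_coord_scaleR c.sum c.scaleR coord_E axis_def if_distrib cong: if_cong)
  finally show ?thesis .
qed

lemma matrix_inv_gram_symmetric: "matrix_inv (gram E) $ i $ j = matrix_inv (gram E) $ j $ i"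
  using arg_cong[OF matrix_inv_symmetric[OF det_gram(2) gram_symmetric], of "\<lambda>A. A $ j $ i"]
  by (simp add: transpose_def)

text \<open>This is how indices are removed: a metric trace becomes a sum over an orthonormal basis
  of the ambient space, in which no inverse matrix is left.\<close>

lemma trace_bilinear:
  assumes "bilinear B"
  shows "(\<Sum>i\<in>UNIV. \<Sum>j\<in>UNIV. matrix_inv (gram E) $ i $ j *\<^sub>R B (axis i 1) (axis j 1))
    = (\<Sum>c\<in>Basis. B (coord E c) (coord E c))"
proof -
  have l: "linear (B x)" "linear (\<lambda>y. B y x)" for x
    using assms by (auto simp: bilinear_def)
  have exp: "B a b = (\<Sum>i\<in>UNIV. \<Sum>j\<in>UNIV. (a $ i * b $ j) *\<^sub>R B (axis i 1) (axis j 1))" for a b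
    unfolding linear_axis_expand[OF l(2)[of b], of a]
    by (simp only: linear_axis_expand[OF l(1), of _ b] scaleR_sum_right scaleR_scaleR)
  have "(\<Sum>c\<in>Basis. B (coord E c) (coord E c)) =
      (\<Sum>c\<in>Basis. \<Sum>i\<in>UNIV. \<Sum>j\<in>UNIV. (coord E c $ i * coord E c $ j) *\<^sub>R B (axis i 1) (axis j 1))"
    by (intro sum.cong refl exp)
  also have "\<dots> = (\<Sum>i\<in>UNIV. \<Sum>c\<in>Basis. \<Sum>j\<in>UNIV. (coord E c $ i * coord E c $ j) *\<^sub>R B (axis i 1) (axis j 1))"
    by (rule sum.swap)
  also have "\<dots> = (\<Sum>i\<in>UNIV. \<Sum>j\<in>UNIV. \<Sum>c\<in>Basis. (coord E c $ i * coord E c $ j) *\<^sub>R B (axis i 1) (axis j 1))"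
    by (intro sum.cong refl sum.swap)
  also have "\<dots> = (\<Sum>i\<in>UNIV. \<Sum>j\<in>UNIV. matrix_inv (gram E) $ i $ j *\<^sub>R B (axis i 1) (axis j 1))"
    by (simp add: scaleR_left.sum[symmetric] sum_coord_mult)
  finally show ?thesis ..
qed

lemma trace_inner:
  assumes "linear F"
  shows "(\<Sum>i\<in>UNIV. \<Sum>j\<in>UNIV. matrix_inv (gram E) $ i $ j * (F (axis i 1) \<bullet> E (axis j 1)))
    = (\<Sum>c\<in>Basis. F (coord E c) \<bullet> c)"
proof -
  have "(\<Sum>c\<in>Basis. F (coord E c) \<bullet> c) = (\<Sum>c\<in>Basis. \<Sum>i\<in>UNIV. F (axis i 1) \<bullet> (coord E c $ i *\<^sub>R c))"
    by (subst linear_axis_expand[OF assms]) (simp add: inner_sum_left)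
  also have "\<dots> = (\<Sum>i\<in>UNIV. F (axis i 1) \<bullet> (\<Sum>c\<in>Basis. coord E c $ i *\<^sub>R c))"
    by (subst sum.swap) (simp add: inner_sum_right)
  also have "\<dots> = (\<Sum>i\<in>UNIV. \<Sum>j\<in>UNIV. matrix_inv (gram E) $ i $ j * (F (axis i 1) \<bullet> E (axis j 1)))"
    by (simp add: sum_coord_scaleR inner_sum_right)
  finally show ?thesis ..
qed

end

lemma trace_matrix_mult:
  fixes X Y :: "real ^ 'm::finite ^ 'm"
  shows "trace (X ** Y) = (\<Sum>i\<in>UNIV. \<Sum>j\<in>UNIV. X $ i $ j * Y $ j $ i)"
  by (simp add: trace_def matrix_matrix_mult_def)

context frame
begin

lemma norm_E_coord: 
  "(norm (E (coord E v)))\<^sup>2 = (\<Sum>k\<in>UNIV. \<Sum>l\<in>UNIV. matrix_inv (gram E) $ k $ l * (v \<bullet> E (axis l 1)) * (v \<bullet> E (axis k 1)))"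
proof -
  have "(norm (E (coord E v)))\<^sup>2 = v \<bullet> E (coord E v)"
    by (simp only: power2_norm_eq_inner E_coord_inner)
  also have "\<dots> = (\<Sum>k\<in>UNIV. coord E v $ k * (v \<bullet> E (axis k 1)))"
    by (subst linear_axis_expand[OF lin]) (simp add: inner_sum_right)
  also have "\<dots> = (\<Sum>k\<in>UNIV. \<Sum>l\<in>UNIV. matrix_inv (gram E) $ k $ l * (v \<bullet> E (axis l 1)) * (v \<bullet> E (axis k 1)))"
    by (simp add: coord_nth inner_sum_right sum_distrib_right)
  finally show ?thesis .
qed

text \<open>The product \<open>matrix_inv (gram E) ** b\<close> represents the tangential part of
  \<open>F\<close>. By \<open>sym\<close> this operator is self-adjoint, so the trace of its square
  is its squared norm.\<close>

lemma trace_symmetric_square: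
  assumes F: "linear F" and sym: "\<And>a b. F a \<bullet> E b = F b \<bullet> E a"
  defines "b \<equiv> (\<chi> i j. F (axis i 1) \<bullet> E (axis j 1)) :: real ^ 'm ^ 'm"
  shows "trace (matrix_inv (gram E) ** b ** matrix_inv (gram E) ** b)
    = (\<Sum>c\<in>Basis. (norm (E (coord E (F (coord E c)))))\<^sup>2)"
proof -
  let ?N = "matrix_inv (gram E)"
  define B where "B x y = (\<Sum>k\<in>UNIV. \<Sum>l\<in>UNIV. ?N $ k $ l * (F x \<bullet> E (axis l 1)) * (F y \<bullet> E (axis k 1)))" for x y
  have bil: "bilinear B"
    unfolding bilinear_def B_def
    by (auto intro!: linearI simp: linear_add[OF F] linear_scale[OF F] inner_add_left algebra_simps
        sum.distrib sum_distrib_left)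
  have "(\<Sum>c\<in>Basis. (norm (E (coord E (F (coord E c)))))\<^sup>2) = (\<Sum>c\<in>Basis. B (coord E c) (coord E c))"
    by (simp add: norm_E_coord B_def)
  also have "\<dots> = (\<Sum>i\<in>UNIV. \<Sum>j\<in>UNIV. ?N $ i $ j * B (axis i 1) (axis j 1))"
    using trace_bilinear[OF bil] by simp
  also have "\<dots> = (\<Sum>i\<in>UNIV. \<Sum>j\<in>UNIV. ?N $ i $ j * (b ** (?N ** b)) $ j $ i)"
  proof (intro sum.cong refl arg_cong2[of _ _ _ _ "(*)"])
    fix i j
    have "(b ** (?N ** b)) $ j $ i = (\<Sum>k\<in>UNIV. \<Sum>l\<in>UNIV. b $ j $ k * (?N $ k $ l * b $ l $ i))"
      by (simp add: matrix_matrix_mult_def sum_distrib_left)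
    also have "\<dots> = B (axis i 1) (axis j 1)"
      by (simp add: B_def b_def sym[of "axis _ 1" "axis i 1"] mult_ac)
    finally show "B (axis i 1) (axis j 1) = (b ** (?N ** b)) $ j $ i" ..
  qed
  also have "\<dots> = trace (?N ** (b ** (?N ** b)))"
    by (simp only: trace_matrix_mult)
  finally show ?thesis by (simp only: matrix_mul_assoc)
qed

text \<open>The pointwise second variation of the weighted volume element. By Jacobi's formula the
  logarithmic derivative \<open>a\<close> is half a trace minus an inner product. The assumption
  \<open>crit\<close>, later the equation of a \<xi>-submanifold paired with \<open>\<eta>\<close>,
  makes \<open>a\<close> vanish at 0, so that its square drops out and only its derivative
  contributes.\<close>

lemma volume_second_variation:
  fixes F :: "real ^ 'm \<Rightarrow> 'e" and w \<eta> :: 'e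
  assumes F: "linear F" and sym: "\<And>a b. F a \<bullet> E b = F b \<bullet> E a"
    and crit: "(\<Sum>c\<in>Basis. F (coord E c) \<bullet> c) = w \<bullet> \<eta>"
  defines "M \<equiv> \<lambda>t. gram (\<lambda>a. E a + t *\<^sub>R F a)"
  defines "\<Theta> \<equiv> \<lambda>t. exp (- (1/2) * (norm (w + t *\<^sub>R \<eta>))\<^sup>2) * sqrt (det (M t) / det (M 0))"
  shows "\<exists>\<Theta>1. (\<forall>\<^sub>F t in nhds 0. (\<Theta> has_real_derivative \<Theta>1 t) (at t)) \<and>
    (\<Theta>1 has_real_derivative exp (- (1/2) * (norm w)\<^sup>2) *
      ((\<Sum>c\<in>Basis. (norm (F (coord E c)))\<^sup>2) - 2 * (\<Sum>c\<in>Basis. (norm (E (coord E (F (coord E c)))))\<^sup>2)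
        - (norm \<eta>)\<^sup>2)) (at 0)"
proof -
  define M' where "M' t = (\<chi> i j. F (axis i 1) \<bullet> E (axis j 1) + E (axis i 1) \<bullet> F (axis j 1)
    + 2 * t * (F (axis i 1) \<bullet> F (axis j 1)))" for t
  define C where "C = (\<chi> i j. 2 * (F (axis i 1) \<bullet> F (axis j 1)))"
  define b where "b = (\<chi> i j. F (axis i 1) \<bullet> E (axis j 1))"
  let ?N = "\<lambda>t. matrix_inv (M t)"
  have M_nth: "M t $ i $ j = E (axis i 1) \<bullet> E (axis j 1) + t * (F (axis i 1) \<bullet> E (axis j 1))
     + t * (E (axis i 1) \<bullet> F (axis j 1)) + t * t * (F (axis i 1) \<bullet> F (axis j 1))" for t i j
    by (simp add: M_def gram_def inner_add_left inner_add_right algebra_simps)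
  have dM: "((\<lambda>t. M t $ i $ j) has_real_derivative M' t $ i $ j) (at t)" for i j t
    unfolding M_nth M'_def by (auto intro!: derivative_eq_intros simp: algebra_simps)
  have dM': "((\<lambda>t. M' t $ i $ j) has_real_derivative C $ i $ j) (at t)" for i j t
    unfolding M'_def C_def by (auto intro!: derivative_eq_intros)
  have smM: "smooth_on UNIV (\<lambda>t. M t $ i $ j)" for i j
    unfolding M_nth
    by (intro smooth_on_add smooth_on_mult smooth_on_const smooth_on_linear bounded_linear_ident) auto
  have M0: "M 0 = gram E" by (simp add: M_def)
  define S where "S = {t. det (M t) > 0}"
  have "continuous_on UNIV (\<lambda>t. det (M t))"
    by (intro smooth_on_continuous smooth_on_det smM) simp
  then have oS: "open S"
    unfolding S_def using open_Collect_less[of "\<lambda>t. 0" "\<lambda>t. det (M t)"] by simp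
  have S0: "0 \<in> S" using det_gram by (simp add: S_def M0)
  define T where "T t = (\<Sum>i\<in>UNIV. \<Sum>j\<in>UNIV. ?N t $ i $ j * M' t $ j $ i)" for t
  define a where "a t = T t / 2 - (w + t *\<^sub>R \<eta>) \<bullet> \<eta>" for t
  have dT: "(\<Theta> has_real_derivative \<Theta> t * a t) (at t)" if "t \<in> S" for t
  proof -
    have pos: "det (M t) > 0" "det (M 0) > 0" using that S0 by (auto simp: S_def)
    have d: "((\<lambda>t. det (M t)) has_real_derivative det (M t) * T t) (at t)"
      unfolding T_def by (rule det_has_derivative[OF dM]) (use pos in simp)
    have q: "((\<lambda>t. det (M t) / det (M 0)) has_real_derivative det (M t) * T t / det (M 0)) (at t)"
      by (rule DERIV_cdivide[OF d])
    have dS: "((\<lambda>t. sqrt (det (M t) / det (M 0))) has_real_derivative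
        sqrt (det (M t) / det (M 0)) * (T t / 2)) (at t)"
    proof (rule DERIV_cong[OF DERIV_chain2[OF DERIV_real_sqrt q]])
      let ?r = "det (M t) / det (M 0)"
      have r: "?r > 0" using pos by simp
      then show "0 < ?r" .
      have "inverse (sqrt r) * r = sqrt r" if "r > 0" for r :: real
        using that real_div_sqrt[of r] by (simp add: divide_inverse mult.commute)
      from this[OF r]
      show "inverse (sqrt ?r) / 2 * (det (M t) * T t / det (M 0)) = sqrt ?r * (T t / 2)"
        by (metis (no_types, lifting) divide_inverse mult.assoc mult.commute)
    qed
    have dE: "((\<lambda>t. exp (- (1/2) * (norm (w + t *\<^sub>R \<eta>))\<^sup>2)) has_real_derivative
        exp (- (1/2) * (norm (w + t *\<^sub>R \<eta>))\<^sup>2) * - ((w + t *\<^sub>R \<eta>) \<bullet> \<eta>)) (at t)"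
    proof (rule DERIV_fun_exp)
      have "((\<lambda>t. (w + t *\<^sub>R \<eta>) \<bullet> (w + t *\<^sub>R \<eta>)) has_derivative (\<lambda>s. 2 * s * ((w + t *\<^sub>R \<eta>) \<bullet> \<eta>))) (at t)"
        by (auto intro!: derivative_eq_intros simp: inner_commute algebra_simps)
      then show "((\<lambda>t. - (1/2) * (norm (w + t *\<^sub>R \<eta>))\<^sup>2) has_real_derivative - ((w + t *\<^sub>R \<eta>) \<bullet> \<eta>)) (at t)"
        unfolding power2_norm_eq_inner has_field_derivative_def
        by (auto intro!: derivative_eq_intros simp: inner_commute[of \<eta>] fun_eq_iff field_simps)
    qed
    have "X * - i * S + S * (r / 2) * X = X * S * (r / 2 - i)" for X S r i :: real
      by (simp add: algebra_simps)
    then show ?thesis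
      unfolding \<Theta>_def a_def by (rule DERIV_cong[OF DERIV_mult[OF dE dS]])
  qed
  have N0: "?N 0 = matrix_inv (gram E)" by (simp add: M0)
  \<comment> \<open>This factor 2 becomes 4 in the trace of the square; the square root halves it,
    which leaves the coefficient 2 of the tangential part.\<close>
  have M'0: "M' 0 = 2 *\<^sub>R b"
    by (simp add: M'_def b_def vec_eq_iff inner_commute[of "E _"] sym[of "axis _ 1" "axis _ 1"])
  have "T 0 = 2 * (\<Sum>i\<in>UNIV. \<Sum>j\<in>UNIV. matrix_inv (gram E) $ i $ j * (F (axis i 1) \<bullet> E (axis j 1)))"
    unfolding T_def M'0 N0
    by (simp add: b_def sum_distrib_left sym[of "axis _ 1" "axis _ 1"] mult_ac)
  also have "\<dots> = 2 * (w \<bullet> \<eta>)" by (simp only: trace_inner[OF F] crit)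
  finally have a0: "a 0 = 0" by (simp add: a_def)
  have dN: "((\<lambda>t. ?N t $ i $ j) has_real_derivative - (?N 0 ** M' 0 ** ?N 0) $ i $ j) (at 0)" for i j
    by (rule matrix_inv_has_derivative[OF oS S0 _ _ dM])
      (auto intro: smooth_on_subset[OF smM] simp: S_def)
  have "(T has_real_derivative
     (\<Sum>i\<in>UNIV. \<Sum>j\<in>UNIV. - (?N 0 ** M' 0 ** ?N 0) $ i $ j * M' 0 $ j $ i + C $ j $ i * ?N 0 $ i $ j)) (at 0)"
    unfolding T_def by (intro DERIV_sum DERIV_mult dN dM')
  also have "(\<Sum>i\<in>UNIV. \<Sum>j\<in>UNIV. - (?N 0 ** M' 0 ** ?N 0) $ i $ j * M' 0 $ j $ i + C $ j $ i * ?N 0 $ i $ j)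
    = - trace (?N 0 ** M' 0 ** ?N 0 ** M' 0) + (\<Sum>i\<in>UNIV. \<Sum>j\<in>UNIV. ?N 0 $ i $ j * C $ j $ i)"
    by (simp add: trace_matrix_mult sum.distrib sum_negf sum_subtractf mult.commute)
  also have "trace (?N 0 ** M' 0 ** ?N 0 ** M' 0) = 4 * trace (?N 0 ** b ** ?N 0 ** b)"
  proof -
    have "X ** (r *\<^sub>R Y) = r *\<^sub>R (X ** Y)" "(r *\<^sub>R X) ** Y = r *\<^sub>R (X ** Y)" for X Y :: "real ^ 'm ^ 'm" and r
      by (simp_all add: matrix_matrix_mult_def vec_eq_iff sum_distrib_left mult_ac)
    then show ?thesis by (simp add: M'0 trace_def sum_distrib_left)
  qed
  also have "trace (?N 0 ** b ** ?N 0 ** b) = (\<Sum>c\<in>Basis. (norm (E (coord E (F (coord E c)))))\<^sup>2)"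
    unfolding N0 b_def by (rule trace_symmetric_square[OF F sym])
  also have "(\<Sum>i\<in>UNIV. \<Sum>j\<in>UNIV. ?N 0 $ i $ j * C $ j $ i) =
     2 * (\<Sum>i\<in>UNIV. \<Sum>j\<in>UNIV. matrix_inv (gram E) $ i $ j *\<^sub>R (F (axis i 1) \<bullet> F (axis j 1)))"
    by (simp add: C_def N0 sum_distrib_left inner_commute mult_ac)
  also have "(\<Sum>i\<in>UNIV. \<Sum>j\<in>UNIV. matrix_inv (gram E) $ i $ j *\<^sub>R (F (axis i 1) \<bullet> F (axis j 1)))
    = (\<Sum>c\<in>Basis. (norm (F (coord E c)))\<^sup>2)"
    unfolding power2_norm_eq_inner
    by (rule trace_bilinear)
      (auto simp: bilinear_def linear_add[OF F] linear_scale[OF F] inner_add_left inner_add_right intro!: linearI)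
  finally have dT0: "(T has_real_derivative
      - (4 * (\<Sum>c\<in>Basis. (norm (E (coord E (F (coord E c)))))\<^sup>2)) + 2 * (\<Sum>c\<in>Basis. (norm (F (coord E c)))\<^sup>2)) (at 0)" .
  have "((\<lambda>t. \<Theta> t * a t) has_real_derivative exp (- (1/2) * (norm w)\<^sup>2) *
      ((\<Sum>c\<in>Basis. (norm (F (coord E c)))\<^sup>2) - 2 * (\<Sum>c\<in>Basis. (norm (E (coord E (F (coord E c)))))\<^sup>2)
        - (norm \<eta>)\<^sup>2)) (at 0)"
  proof (rule DERIV_cong[OF DERIV_mult[OF dT[OF S0]]])
    have "((\<lambda>t. (w + t *\<^sub>R \<eta>) \<bullet> \<eta>) has_real_derivative (norm \<eta>)\<^sup>2) (at 0)"
      unfolding has_field_derivative_def power2_norm_eq_inner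
      by (auto intro!: derivative_eq_intros simp: mult.commute)
    then show "(a has_real_derivative (- (4 * (\<Sum>c\<in>Basis. (norm (E (coord E (F (coord E c)))))\<^sup>2))
       + 2 * (\<Sum>c\<in>Basis. (norm (F (coord E c)))\<^sup>2)) / 2 - (norm \<eta>)\<^sup>2) (at 0)"
      unfolding a_def by (intro DERIV_diff DERIV_cdivide dT0)
    have "\<Theta> 0 = exp (- (1/2) * (norm w)\<^sup>2)"
      using S0 by (simp add: \<Theta>_def S_def)
    then show "\<Theta> 0 * a 0 * a 0 + ((- (4 * (\<Sum>c\<in>Basis. (norm (E (coord E (F (coord E c)))))\<^sup>2))
       + 2 * (\<Sum>c\<in>Basis. (norm (F (coord E c)))\<^sup>2)) / 2 - (norm \<eta>)\<^sup>2) * \<Theta> 0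
      = exp (- (1/2) * (norm w)\<^sup>2) *
      ((\<Sum>c\<in>Basis. (norm (F (coord E c)))\<^sup>2) - 2 * (\<Sum>c\<in>Basis. (norm (E (coord E (F (coord E c)))))\<^sup>2)
        - (norm \<eta>)\<^sup>2)"
      by (simp add: a0 field_simps)
  qed
  moreover have "\<forall>\<^sub>F t in nhds 0. (\<Theta> has_real_derivative \<Theta> t * a t) (at t)"
    using dT oS S0 unfolding eventually_nhds by blast
  ultimately show ?thesis
    by (intro exI[of _ "\<lambda>t. \<Theta> t * a t"] conjI)
qed

end

subsection \<open>Smooth maps on a manifold\<close>

text \<open>The derivative in an arbitrary chart, in contrast to \<open>differential\<close>, which
  is tied to the chart selected at the point.\<close>

definition cder :: "('a, 'm::finite) chart \<Rightarrow> ('a \<Rightarrow> 'e::real_normed_vector) \<Rightarrow> 'a \<Rightarrow> real ^ 'm \<Rightarrow> 'e" where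
  "cder c y q = frechet_derivative (y \<circ> param c) (at (snd c q))"

locale atlas =
  fixes \<A> :: "('a::{t2_space, second_countable_topology}, 'm::finite) chart set"
  assumes smooth_atlas: "smooth_atlas \<A>"
begin

lemma chart:
  assumes "c \<in> \<A>"
  shows "open (fst c)" "open (chart_image c)"
    "homeomorphism (fst c) (chart_image c) (snd c) (param c)"
  using smooth_atlas assms by (auto simp: smooth_atlas_def)

lemma chart_cont:
  assumes "c \<in> \<A>"
  shows "continuous_on (fst c) (snd c)" "continuous_on (chart_image c) (param c)"
  using chart(3)[OF assms] by (auto simp: homeomorphism_def)

lemma param_chart [simp]: "c \<in> \<A> \<Longrightarrow> q \<in> fst c \<Longrightarrow> param c (snd c q) = q"
  using chart(3) by (auto simp: homeomorphism_def)

lemma chart_param [simp]: "c \<in> \<A> \<Longrightarrow> u \<in> chart_image c \<Longrightarrow> snd c (param c u) = u"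
  using chart(3) by (auto simp: homeomorphism_def)

lemma param_in [simp]: "c \<in> \<A> \<Longrightarrow> u \<in> chart_image c \<Longrightarrow> param c u \<in> fst c"
  using chart(3) unfolding homeomorphism_def by blast

lemma chart_in [simp]: "q \<in> fst c \<Longrightarrow> snd c q \<in> chart_image c"
  by (auto simp: chart_image_def)

lemma chart_at: "chart_at \<A> q \<in> \<A>" "q \<in> fst (chart_at \<A> q)"
proof -
  have "\<exists>c. c \<in> \<A> \<and> q \<in> fst c" using smooth_atlas unfolding smooth_atlas_def by blast
  then have "chart_at \<A> q \<in> \<A> \<and> q \<in> fst (chart_at \<A> q)"
    unfolding chart_at_def by (rule someI_ex)
  then show "chart_at \<A> q \<in> \<A>" "q \<in> fst (chart_at \<A> q)" by auto
qed

lemma open_chart_preimage: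
  assumes "c \<in> \<A>" "open W"
  shows "open (chart_image c \<inter> param c -` W)"
  using chart_cont(2)[OF assms(1)] chart(2)[OF assms(1)] assms(2)
  by (rule continuous_open_preimage)

lemma open_param_image:
  assumes "c \<in> \<A>" "open W" "W \<subseteq> chart_image c"
  shows "open (param c ` W)"
proof -
  have "param c ` W = fst c \<inter> snd c -` W"
    using assms by (force simp: image_def)
  then show ?thesis
    using continuous_open_preimage[OF chart_cont(1)[OF assms(1)] chart(1)[OF assms(1)] assms(2)] by simp
qed

lemma overlap: "c \<in> \<A> \<Longrightarrow> snd c ` (fst c \<inter> fst d) = chart_image c \<inter> param c -` fst d"
  by (force simp: chart_image_def)

lemma open_overlap: "c \<in> \<A> \<Longrightarrow> d \<in> \<A> \<Longrightarrow> open (snd c ` (fst c \<inter> fst d))"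
  using overlap open_chart_preimage chart(1) by metis

lemma smooth_transition:
  "c \<in> \<A> \<Longrightarrow> d \<in> \<A> \<Longrightarrow> smooth_on (snd c ` (fst c \<inter> fst d)) (snd d \<circ> param c)"
  using smooth_atlas by (auto simp: smooth_atlas_def)

lemma smooth_mapD: "smooth_map \<A> y \<Longrightarrow> c \<in> \<A> \<Longrightarrow> smooth_on (chart_image c) (\<lambda>u. y (param c u))"
  by (auto simp: smooth_map_def o_def)

lemma smooth_mapI: "(\<And>c. c \<in> \<A> \<Longrightarrow> smooth_on (chart_image c) (\<lambda>u. y (param c u))) \<Longrightarrow> smooth_map \<A> y"
  by (auto simp: smooth_map_def o_def)

lemma smooth_map_const: "smooth_map \<A> (\<lambda>q. k)"
  by (rule smooth_mapI, rule smooth_on_const) (rule chart)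

lemma smooth_map_add: "smooth_map \<A> y \<Longrightarrow> smooth_map \<A> z \<Longrightarrow> smooth_map \<A> (\<lambda>q. y q + z q)"
  by (rule smooth_mapI, rule smooth_on_add) (simp_all add: chart smooth_mapD)

lemma smooth_map_diff: "smooth_map \<A> y \<Longrightarrow> smooth_map \<A> z \<Longrightarrow> smooth_map \<A> (\<lambda>q. y q - z q)"
  by (rule smooth_mapI, rule smooth_on_diff) (simp_all add: chart smooth_mapD)

lemma smooth_map_scaleR: "smooth_map \<A> y \<Longrightarrow> smooth_map \<A> z \<Longrightarrow> smooth_map \<A> (\<lambda>q. y q *\<^sub>R z q)"
  by (rule smooth_mapI, rule smooth_on_scaleR) (simp_all add: chart smooth_mapD)

lemma smooth_map_inner: "smooth_map \<A> y \<Longrightarrow> smooth_map \<A> z \<Longrightarrow> smooth_map \<A> (\<lambda>q. y q \<bullet> z q)"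
  by (rule smooth_mapI, rule smooth_on_inner) (simp_all add: chart smooth_mapD)

lemma smooth_map_mult:
  "smooth_map \<A> y \<Longrightarrow> smooth_map \<A> z \<Longrightarrow> smooth_map \<A> (\<lambda>q. y q * z q :: real)"
  by (rule smooth_mapI, rule smooth_on_mult) (simp_all add: chart smooth_mapD)

lemma smooth_map_sum: "(\<And>i. i \<in> I \<Longrightarrow> smooth_map \<A> (y i)) \<Longrightarrow> smooth_map \<A> (\<lambda>q. \<Sum>i\<in>I. y i q)"
  by (rule smooth_mapI, rule smooth_on_sum) (simp_all add: chart smooth_mapD)

lemma smooth_map_compose:
  fixes y :: "'a \<Rightarrow> 'e::euclidean_space"
  assumes "smooth_map \<A> y" "smooth_on UNIV g"
  shows "smooth_map \<A> (\<lambda>q. g (y q))"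
  by (rule smooth_mapI, rule smooth_on_compose[OF _ open_UNIV _ _ assms(2)]) (simp_all add: chart smooth_mapD assms(1))

lemmas smooth_map_intros = smooth_map_const smooth_map_add smooth_map_diff smooth_map_scaleR
  smooth_map_inner smooth_map_mult smooth_map_sum

lemma smooth_map_continuous:
  assumes "smooth_map \<A> y"
  shows "continuous_on UNIV y"
proof -
  have "continuous (at q) y" for q
  proof -
    let ?c = "chart_at \<A> q"
    have c: "?c \<in> \<A>" "q \<in> fst ?c" by (rule chart_at)+
    have "continuous_on (fst ?c) (\<lambda>q. y (param ?c (snd ?c q)))"
      by (rule continuous_on_compose2[OF smooth_on_continuous[OF smooth_mapD[OF assms c(1)]] chart_cont(1)[OF c(1)]])
        auto
    then have "continuous_on (fst ?c) y"
      by (rule continuous_on_eq) (use c in simp)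
    then show ?thesis
      using chart(1)[OF c(1)] c(2) continuous_on_eq_continuous_at by blast
  qed
  then show ?thesis by (simp add: continuous_on_eq_continuous_at)
qed

lemma smooth_map_local:
  assumes "\<And>q. \<exists>W. open W \<and> q \<in> W \<and> (\<forall>c\<in>\<A>. smooth_on (chart_image c \<inter> param c -` W) (\<lambda>u. y (param c u)))"
  shows "smooth_map \<A> y"
proof (rule smooth_mapI, rule smooth_on_local)
  fix c u assume c: "c \<in> \<A>" and u: "u \<in> chart_image c"
  obtain W where "open W" "param c u \<in> W" "\<forall>c\<in>\<A>. smooth_on (chart_image c \<inter> param c -` W) (\<lambda>u. y (param c u))"
    using assms by blast
  then show "\<exists>V. open V \<and> u \<in> V \<and> smooth_on V (\<lambda>u. y (param c u))"
    using c u open_chart_preimage[OF c] by (intro exI[of _ "chart_image c \<inter> param c -` W"]) auto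
qed

lemma has_derivative_cder:
  assumes "smooth_map \<A> y" "c \<in> \<A>" "q \<in> fst c"
  shows "((\<lambda>u. y (param c u)) has_derivative cder c y q) (at (snd c q))"
  using smooth_on_has_derivative[OF smooth_mapD[OF assms(1,2)] chart_in[OF assms(3)]]
  by (simp add: cder_def o_def)

lemma cder_eqI:
  assumes "((\<lambda>u. y (param c u)) has_derivative G) (at (snd c q))"
  shows "cder c y q = G"
  using frechet_derivative_at[OF assms] by (simp add: cder_def o_def)

lemma linear_cder: "smooth_map \<A> y \<Longrightarrow> c \<in> \<A> \<Longrightarrow> q \<in> fst c \<Longrightarrow> linear (cder c y q)"
  by (rule has_derivative_linear[OF has_derivative_cder])

lemma differential_eq_cder: "differential \<A> y q = cder (chart_at \<A> q) y q"
  by (simp add: differential_def cder_def)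

definition trans where
  "trans c d q = frechet_derivative (snd d \<circ> param c) (at (snd c q))"

lemma has_derivative_trans:
  assumes "c \<in> \<A>" "d \<in> \<A>" "q \<in> fst c" "q \<in> fst d"
  shows "((\<lambda>u. snd d (param c u)) has_derivative trans c d q) (at (snd c q))"
  using smooth_on_has_derivative[OF smooth_transition[OF assms(1,2)], of "snd c q"] assms
  by (auto simp: trans_def o_def)

lemma cder_trans:
  assumes "smooth_map \<A> y" "c \<in> \<A>" "d \<in> \<A>" "q \<in> fst c" "q \<in> fst d"
  shows "cder c y q = (\<lambda>a. cder d y q (trans c d q a))"
proof (rule cder_eqI)
  have "((\<lambda>u. y (param d u)) has_derivative cder d y q) (at (snd d (param c (snd c q))))"
    using has_derivative_cder[OF assms(1,3,5)] assms by simp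
  from has_derivative_compose[OF has_derivative_trans[OF assms(2,3,4,5)] this]
  have "((\<lambda>u. y (param d (snd d (param c u)))) has_derivative (\<lambda>a. cder d y q (trans c d q a))) (at (snd c q))" .
  then show "((\<lambda>u. y (param c u)) has_derivative (\<lambda>a. cder d y q (trans c d q a))) (at (snd c q))"
  proof (rule has_derivative_transform_within_open)
    show "open (snd c ` (fst c \<inter> fst d))" by (rule open_overlap[OF assms(2,3)])
  qed (use assms in auto)
qed

lemma trans_inverse:
  assumes "c \<in> \<A>" "d \<in> \<A>" "q \<in> fst c" "q \<in> fst d"
  shows "trans d c q (trans c d q a) = a"
proof -
  have "((\<lambda>u. snd c (param d u)) has_derivative trans d c q) (at (snd d (param c (snd c q))))"
    using has_derivative_trans[of d c q] assms by simp
  from has_derivative_compose[OF has_derivative_trans[OF assms] this]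
  have "((\<lambda>u. snd c (param d (snd d (param c u)))) has_derivative (\<lambda>a. trans d c q (trans c d q a))) (at (snd c q))" .
  then have "((\<lambda>u. u) has_derivative (\<lambda>a. trans d c q (trans c d q a))) (at (snd c q))"
  proof (rule has_derivative_transform_within_open)
    show "open (snd c ` (fst c \<inter> fst d))" by (rule open_overlap[OF assms(1,2)])
  qed (use assms in \<open>auto simp: chart_image_def\<close>)
  from fun_cong[OF has_derivative_unique[OF this has_derivative_ident]] show ?thesis .
qed

lemma linear_trans:
  assumes "c \<in> \<A>" "d \<in> \<A>" "q \<in> fst c" "q \<in> fst d"
  shows "linear (trans c d q)"
  using has_derivative_linear[OF has_derivative_trans[OF assms]] .

end

subsection \<open>Differentiation along an immersion\<close>

locale immersed = atlas \<A> for \<A> :: "('a::{t2_space, second_countable_topology}, 'm::finite) chart set" +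
  fixes x :: "'a \<Rightarrow> 'e::euclidean_space"
  assumes immersion: "immersion \<A> x"
begin

abbreviation P where "P \<equiv> tan_part \<A> x"

lemma smooth_x: "smooth_map \<A> x"
  using immersion by (simp add: immersion_def)

lemma frame_cder:
  assumes "c \<in> \<A>" "q \<in> fst c"
  shows "frame (cder c x q)"
proof (rule frame.intro)
  show "linear (cder c x q)" by (rule linear_cder[OF smooth_x assms])
  have "cder c x q a = differential \<A> x q (trans c (chart_at \<A> q) q a)" for a
    using cder_trans[OF smooth_x assms(1) chart_at(1) assms(2) chart_at(2)]
    by (simp add: differential_eq_cder)
  moreover have "inj (differential \<A> x q)" using immersion by (simp add: immersion_def)
  ultimately have "cder c x q a = cder c x q b \<Longrightarrow> trans c (chart_at \<A> q) q a = trans c (chart_at \<A> q) q b" for a b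
    by (auto dest: injD)
  then show "inj (cder c x q)"
    using trans_inverse[OF assms(1) chart_at(1) assms(2) chart_at(2)]
    by (intro injI) (metis)
qed

lemma tangent_space_cder:
  assumes "c \<in> \<A>" "q \<in> fst c"
  shows "tangent_space \<A> x q = range (cder c x q)"
proof -
  let ?d = "chart_at \<A> q"
  have "cder c x q a \<in> range (cder ?d x q)" for a
    unfolding cder_trans[OF smooth_x assms(1) chart_at(1) assms(2) chart_at(2)] by (rule rangeI)
  moreover have "cder ?d x q a \<in> range (cder c x q)" for a
    unfolding cder_trans[OF smooth_x chart_at(1) assms(1) chart_at(2) assms(2)] by (rule rangeI)
  ultimately show ?thesis
    unfolding tangent_space_def differential_eq_cder by blast
qed

lemma tan_part_eqI:
  assumes "w \<in> tangent_space \<A> x q" "\<And>u. u \<in> tangent_space \<A> x q \<Longrightarrow> (v - w) \<bullet> u = 0"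
  shows "P q v = w"
  unfolding tan_part_def
proof (rule the_equality)
  fix w' assume w': "w' \<in> tangent_space \<A> x q \<and> (\<forall>u\<in>tangent_space \<A> x q. (v - w') \<bullet> u = 0)"
  interpret frame "differential \<A> x q"
    using frame_cder[OF chart_at] by (simp add: differential_eq_cder)
  obtain a b where "w = differential \<A> x q a" "w' = differential \<A> x q b"
    using w' assms(1) by (auto simp: tangent_space_def)
  then have "w - w' = differential \<A> x q (a - b)"
    by (simp add: linear_diff[OF lin])
  then have "w - w' \<in> tangent_space \<A> x q"
    by (simp add: tangent_space_def)
  then have "(v - w) \<bullet> (w - w') = 0" "(v - w') \<bullet> (w - w') = 0"
    using assms(2) w' by auto
  then have "(w - w') \<bullet> (w - w') = 0" by (simp add: inner_diff_left inner_diff_right)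
  then show "w' = w" by simp
qed (use assms in auto)

lemma P_cder:
  assumes "c \<in> \<A>" "q \<in> fst c"
  shows "P q w = cder c x q (coord (cder c x q) w)"
proof (rule tan_part_eqI)
  interpret frame "cder c x q" by (rule frame_cder[OF assms])
  show "cder c x q (coord (cder c x q) w) \<in> tangent_space \<A> x q"
    by (simp add: tangent_space_cder[OF assms])
  show "(w - cder c x q (coord (cder c x q) w)) \<bullet> u = 0" if "u \<in> tangent_space \<A> x q" for u
    using that by (auto simp: tangent_space_cder[OF assms] inner_diff_left E_coord_inner)
qed

text \<open>The derivative along the tangential part of \<open>w\<close>. Admitting every ambient
  vector makes constant vectors available as directions, so iterated derivatives call for no
  extension of a tangent vector to a field.\<close>

definition D :: "('a \<Rightarrow> 'f::real_normed_vector) \<Rightarrow> 'a \<Rightarrow> 'e \<Rightarrow> 'f" where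
  "D y q w = differential \<A> y q (THE a. differential \<A> x q a = P q w)"

lemma flat_D_P: "flat_D \<A> x q (P q w) y = D y q w"
  by (simp add: D_def flat_D_def)

text \<open>The transition map carries the coordinates of \<open>P q w\<close> in the chart
  \<open>c\<close> to those in the selected chart, and injectivity of the differential identifies
  the vector chosen by \<open>THE\<close>.\<close>

lemma D_cder:
  assumes "smooth_map \<A> y" "c \<in> \<A>" "q \<in> fst c"
  shows "D y q w = cder c y q (coord (cder c x q) w)"
proof -
  let ?d = "chart_at \<A> q"
  let ?a = "trans c ?d q (coord (cder c x q) w)"
  interpret d: frame "cder ?d x q" by (rule frame_cder[OF chart_at])
  have *: "cder ?d x q ?a = P q w"
    by (simp add: P_cder[OF assms(2,3)] cder_trans[OF smooth_x assms(2) chart_at(1) assms(3) chart_at(2)])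
  have "(THE a. cder ?d x q a = P q w) = ?a"
    by (rule the_equality, rule *) (rule injD[OF d.inj], simp add: *)
  then show ?thesis
    by (simp add: D_def differential_eq_cder cder_trans[OF assms(1,2) chart_at(1) assms(3) chart_at(2)])
qed

lemma linear_D: "smooth_map \<A> y \<Longrightarrow> linear (D y q)"
proof -
  assume y: "smooth_map \<A> y"
  have "D y q = cder (chart_at \<A> q) y q \<circ> coord (cder (chart_at \<A> q) x q)"
    using D_cder[OF y chart_at] by (auto simp: fun_eq_iff)
  then show ?thesis
    using linear_compose[OF frame.linear_coord[OF frame_cder[OF chart_at]] linear_cder[OF y chart_at]] by simp
qed

lemma D_eqI:
  assumes "smooth_map \<A> y"
    "((\<lambda>u. y (param (chart_at \<A> q) u)) has_derivative G) (at (snd (chart_at \<A> q) q))"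
  shows "D y q w = G (coord (cder (chart_at \<A> q) x q) w)"
  using D_cder[OF assms(1) chart_at] cder_eqI[OF assms(2)] by simp

lemma D_x: "D x q w = P q w"
  by (simp add: D_cder[OF smooth_x chart_at] P_cder[OF chart_at])

lemma D_const: "D (\<lambda>q. k) q w = 0"
  by (subst D_eqI[OF smooth_map_const has_derivative_const]) simp

lemma D_add:
  assumes "smooth_map \<A> y" "smooth_map \<A> z"
  shows "D (\<lambda>q. y q + z q) q w = D y q w + D z q w"
  unfolding D_eqI[OF smooth_map_add[OF assms]
      has_derivative_add[OF has_derivative_cder[OF assms(1) chart_at] has_derivative_cder[OF assms(2) chart_at]]]
  by (simp add: D_cder[OF assms(1) chart_at] D_cder[OF assms(2) chart_at])

lemma D_diff:
  assumes "smooth_map \<A> y" "smooth_map \<A> z"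
  shows "D (\<lambda>q. y q - z q) q w = D y q w - D z q w"
  unfolding D_eqI[OF smooth_map_diff[OF assms]
      has_derivative_diff[OF has_derivative_cder[OF assms(1) chart_at] has_derivative_cder[OF assms(2) chart_at]]]
  by (simp add: D_cder[OF assms(1) chart_at] D_cder[OF assms(2) chart_at])

lemma D_scaleR:
  assumes "smooth_map \<A> y" "smooth_map \<A> z"
  shows "D (\<lambda>q. y q *\<^sub>R z q) q w = y q *\<^sub>R D z q w + D y q w *\<^sub>R z q"
  unfolding D_eqI[OF smooth_map_scaleR[OF assms]
      has_derivative_scaleR[OF has_derivative_cder[OF assms(1) chart_at] has_derivative_cder[OF assms(2) chart_at]]]
  by (simp add: D_cder[OF assms(1) chart_at] D_cder[OF assms(2) chart_at] chart_at)

lemma D_mult: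
  fixes y z :: "'a \<Rightarrow> real"
  assumes "smooth_map \<A> y" "smooth_map \<A> z"
  shows "D (\<lambda>q. y q * z q) q w = y q * D z q w + D y q w * z q"
  using D_scaleR[OF assms] by simp

lemma D_inner:
  assumes "smooth_map \<A> y" "smooth_map \<A> z"
  shows "D (\<lambda>q. y q \<bullet> z q) q w = y q \<bullet> D z q w + D y q w \<bullet> z q"
  unfolding D_eqI[OF smooth_map_inner[OF assms]
      has_derivative_inner[OF has_derivative_cder[OF assms(1) chart_at] has_derivative_cder[OF assms(2) chart_at]]]
  by (simp add: D_cder[OF assms(1) chart_at] D_cder[OF assms(2) chart_at] chart_at)

lemma D_sum:
  "(\<And>i. i \<in> I \<Longrightarrow> smooth_map \<A> (y i)) \<Longrightarrow> D (\<lambda>q. \<Sum>i\<in>I. y i q) q w = (\<Sum>i\<in>I. D (y i) q w)"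
  by (induction I rule: infinite_finite_induct)
    (simp_all add: D_const D_add smooth_map_sum)

lemma D_compose_real:
  fixes y :: "'a \<Rightarrow> real" and g :: "real \<Rightarrow> real"
  assumes "smooth_map \<A> y" "smooth_on UNIV g" "(g has_real_derivative d) (at (y q))"
  shows "D (\<lambda>q. g (y q)) q w = d * D y q w"
proof -
  have "(g has_derivative (*) d) (at (y (param (chart_at \<A> q) (snd (chart_at \<A> q) q))))"
    using assms(3) by (simp add: has_field_derivative_def chart_at)
  from D_eqI[OF smooth_map_compose[OF assms(1,2)]
      has_derivative_compose[OF has_derivative_cder[OF assms(1) chart_at] this]]
  show ?thesis by (simp add: D_cder[OF assms(1) chart_at])
qed

lemma D_cong_open:
  assumes "smooth_map \<A> y" "smooth_map \<A> z" "open W" "q \<in> W" "\<And>r. r \<in> W \<Longrightarrow> y r = z r"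
  shows "D y q w = D z q w"
proof -
  let ?c = "chart_at \<A> q"
  have "((\<lambda>u. y (param ?c u)) has_derivative cder ?c z q) (at (snd ?c q))"
    by (rule has_derivative_transform_within_open[OF has_derivative_cder[OF assms(2) chart_at]
          open_chart_preimage[OF chart_at(1)[of q] assms(3)]])
      (use assms(4,5) chart_at[of q] in auto)
  from D_eqI[OF assms(1) this] show ?thesis
    by (simp add: D_cder[OF assms(2) chart_at])
qed

lemma P_linear: "linear (P q)"
proof -
  have "P q = D x q" by (rule ext) (simp add: D_x)
  then show ?thesis using linear_D[OF smooth_x] by simp
qed

lemma P_idem [simp]: "P q (P q w) = P q w"
  using frame.coord_E[OF frame_cder[OF chart_at]] by (simp add: P_cder[OF chart_at])

lemma P_inner: "P q v \<bullet> w = v \<bullet> P q w"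
proof -
  interpret frame "cder (chart_at \<A> q) x q" by (rule frame_cder[OF chart_at])
  have *: "P q v \<bullet> P q w = v \<bullet> P q w" for v w
    by (simp add: P_cder[OF chart_at] E_coord_inner)
  show ?thesis
    using *[of v w] *[of w v] by (simp add: inner_commute)
qed

lemma P_in_tangent: "P q w \<in> tangent_space \<A> x q"
  by (simp add: P_cder[OF chart_at] tangent_space_cder[OF chart_at])

lemma tangent_iff: "w \<in> tangent_space \<A> x q \<longleftrightarrow> P q w = w"
proof
  assume "w \<in> tangent_space \<A> x q"
  then show "P q w = w" by (rule tan_part_eqI) simp
next
  assume "P q w = w"
  then show "w \<in> tangent_space \<A> x q" using P_in_tangent[of q w] by simp
qed

lemma D_P: "smooth_map \<A> y \<Longrightarrow> D y q (P q w) = D y q w"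
  using frame.coord_E[OF frame_cder[OF chart_at]]
  by (simp add: P_cder[OF chart_at] D_cder[OF _ chart_at])

lemma normal_iff: "(\<forall>X\<in>tangent_space \<A> x q. v \<bullet> X = 0) \<longleftrightarrow> P q v = 0"
proof
  assume "\<forall>X\<in>tangent_space \<A> x q. v \<bullet> X = 0"
  moreover have "0 \<in> tangent_space \<A> x q" by (simp add: tangent_iff linear_0[OF P_linear])
  ultimately show "P q v = 0" by (intro tan_part_eqI) simp_all
next
  assume "P q v = 0"
  then have "v \<bullet> X = 0" if "P q X = X" for X
    using P_inner[of q v X] that by simp
  then show "\<forall>X\<in>tangent_space \<A> x q. v \<bullet> X = 0"
    by (simp add: tangent_iff)
qed

lemma smooth_on_coord:
  assumes c: "c \<in> \<A>"
  shows "smooth_on (chart_image c) (\<lambda>u. coord (cder c x (param c u)) w)"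
proof -
  let ?U = "chart_image c"
  let ?E = "\<lambda>u. frechet_derivative (\<lambda>u. x (param c u)) (at u)"
  have U: "open ?U" by (rule chart[OF c])
  have E: "cder c x (param c u) = ?E u" if "u \<in> ?U" for u
    using that c by (simp add: cder_def o_def)
  have sE: "smooth_on ?U (\<lambda>u. ?E u a)" for a
    by (rule smooth_on_frechet[OF smooth_mapD[OF smooth_x c]])
  have sN: "smooth_on ?U (\<lambda>u. matrix_inv (gram (?E u)) $ i $ k)" for i k
  proof (rule smooth_on_matrix_inv[OF U])
    show "smooth_on ?U (\<lambda>u. gram (?E u) $ i $ j)" for i j
      by (simp add: gram_def smooth_on_inner U sE)
    show "det (gram (?E u)) \<noteq> 0" if "u \<in> ?U" for u
      using frame.det_gram(2)[OF frame_cder[OF c param_in[OF c that]]] E[OF that] by simp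
  qed
  show ?thesis
  proof (rule smooth_on_vec[OF U], rule smooth_on_cong[OF _ U])
    show "smooth_on ?U (\<lambda>u. w \<bullet> (\<Sum>k\<in>UNIV. matrix_inv (gram (?E u)) $ i $ k *\<^sub>R ?E u (axis k 1)))" for i
      by (intro smooth_on_sum smooth_on_scaleR smooth_on_inner smooth_on_const sE sN U)
    show "w \<bullet> (\<Sum>k\<in>UNIV. matrix_inv (gram (?E u)) $ i $ k *\<^sub>R ?E u (axis k 1))
       = coord (cder c x (param c u)) w $ i" if "u \<in> ?U" for i u
      using frame.coord_nth[OF frame_cder[OF c param_in[OF c that]], of w i] by (simp only: E[OF that])
  qed
qed

lemma D_in_chart:
  assumes "smooth_map \<A> y" "c \<in> \<A>" "u \<in> chart_image c"
  shows "D y (param c u) w = (\<Sum>i\<in>UNIV. coord (cder c x (param c u)) w $ i *\<^sub>R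
    frechet_derivative (\<lambda>u. y (param c u)) (at u) (axis i 1))"
proof -
  note q = param_in[OF assms(2,3)]
  have "D y (param c u) w = cder c y (param c u) (coord (cder c x (param c u)) w)"
    by (rule D_cder[OF assms(1,2) q])
  also have "\<dots> = (\<Sum>i\<in>UNIV. coord (cder c x (param c u)) w $ i *\<^sub>R cder c y (param c u) (axis i 1))"
    by (rule linear_axis_expand[OF linear_cder[OF assms(1,2) q]])
  finally show ?thesis using assms(2,3) by (simp add: cder_def o_def)
qed

lemma smooth_map_D:
  assumes "smooth_map \<A> y"
  shows "smooth_map \<A> (\<lambda>q. D y q w)"
proof (rule smooth_mapI, rule smooth_on_cong)
  fix c assume c: "c \<in> \<A>"
  show U: "open (chart_image c)" by (rule chart[OF c])
  show "smooth_on (chart_image c) (\<lambda>u. \<Sum>i\<in>UNIV. coord (cder c x (param c u)) w $ i *\<^sub>R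
    frechet_derivative (\<lambda>u. y (param c u)) (at u) (axis i 1))"
    by (intro smooth_on_sum smooth_on_scaleR smooth_on_nth smooth_on_coord U c
        smooth_on_frechet[OF smooth_mapD[OF assms c]])
qed (simp add: D_in_chart[OF assms])

lemma smooth_map_P: "smooth_map \<A> (\<lambda>q. P q w)"
  using smooth_map_D[OF smooth_x] by (simp add: D_x)

lemma smooth_map_D_field:
  assumes "smooth_map \<A> y" "smooth_map \<A> W"
  shows "smooth_map \<A> (\<lambda>q. D y q (W q))"
proof -
  have "D y q (W q) = (\<Sum>b\<in>Basis. (W q \<bullet> b) *\<^sub>R D y q b)" for q
    by (subst (1) euclidean_representation[of "W q", symmetric])
      (simp only: linear_sum[OF linear_D[OF assms(1)]] linear_scale[OF linear_D[OF assms(1)]])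
  then show ?thesis
    by (simp only:) (intro smooth_map_intros smooth_map_D assms)
qed

section \<open>Commutators of derivatives along projected constant vectors\<close>

definition coord_der where
  "coord_der w q = frechet_derivative (\<lambda>u. coord (cder (chart_at \<A> q) x (param (chart_at \<A> q) u)) w)
     (at (snd (chart_at \<A> q) q))"

text \<open>The Lie bracket of the tangent fields \<open>P r a\<close> and \<open>P r b\<close>, in
  the coordinates of the chart selected at \<open>q\<close>.\<close>

definition bracket where
  "bracket a b q = coord_der b q (coord (cder (chart_at \<A> q) x q) a) - coord_der a q (coord (cder (chart_at \<A> q) x q) b)"

text \<open>The second derivatives of \<open>z\<close> enter symmetrically in the two directions and
  cancel. What remains is a first derivative of \<open>z\<close> along a vector that does not
  involve \<open>z\<close>.\<close>

lemma D_D_diff: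
  fixes z :: "'a \<Rightarrow> 'g::euclidean_space"
  assumes z: "smooth_map \<A> z"
  shows "D (\<lambda>r. D z r b) q a - D (\<lambda>r. D z r a) q b = cder (chart_at \<A> q) z q (bracket a b q)"
proof -
  let ?c = "chart_at \<A> q"
  let ?U = "chart_image ?c"
  let ?u = "snd ?c q"
  note c = chart_at[of q]
  have U: "open ?U" "?u \<in> ?U" using chart(2)[OF c(1)] c by auto
  define \<Lambda> where "\<Lambda> w = (\<lambda>u. coord (cder ?c x (param ?c u)) w)" for w
  define \<Lambda>' where "\<Lambda>' w = frechet_derivative (\<Lambda> w) (at ?u)" for w
  have dL: "(\<Lambda> w has_derivative \<Lambda>' w) (at ?u)" for w
    unfolding \<Lambda>_def \<Lambda>'_def by (rule smooth_on_has_derivative[OF smooth_on_coord[OF c(1)] U(2)])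
  have L: "\<Lambda> w ?u = coord (cder ?c x q) w" for w
    using c by (simp add: \<Lambda>_def)
  have \<kappa>_def: "bracket a b q = \<Lambda>' b (\<Lambda> a ?u) - \<Lambda>' a (\<Lambda> b ?u)"
    unfolding bracket_def L by (simp only: coord_der_def \<Lambda>'_def \<Lambda>_def)
  define Z where "Z = (\<lambda>u. frechet_derivative (\<lambda>u. z (param ?c u)) (at u))"
  define Z2 where "Z2 h v = frechet_derivative (\<lambda>u. Z u v) (at ?u) h" for h v
  have smz: "smooth_on ?U (\<lambda>u. z (param ?c u))" by (rule smooth_mapD[OF z c(1)])
  have dZ: "((\<lambda>u. Z u v) has_derivative (\<lambda>h. Z2 h v)) (at ?u)" for v
    unfolding Z_def Z2_def by (rule smooth_on_has_derivative[OF smooth_on_frechet[OF smz] U(2)])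
  have linZ2: "linear (\<lambda>h. Z2 h v)" for v using has_derivative_linear[OF dZ] .
  have Zq: "Z ?u = cder ?c z q" by (simp add: Z_def cder_def o_def)
  have sym: "Z2 (axis i 1) (axis j 1) = Z2 (axis j 1) (axis i 1)" for i j
    unfolding Z2_def Z_def by (rule second_derivative_symmetric[OF U(1) smz U(2)])
  have DD: "D (\<lambda>r. D z r w) q v = cder ?c z q (\<Lambda>' w (\<Lambda> v ?u))
     + (\<Sum>i\<in>UNIV. \<Sum>j\<in>UNIV. (\<Lambda> w ?u $ i * \<Lambda> v ?u $ j) *\<^sub>R Z2 (axis j 1) (axis i 1))" for v w
  proof -
    have "((\<lambda>u. \<Sum>i\<in>UNIV. \<Lambda> w u $ i *\<^sub>R Z u (axis i 1)) has_derivative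
      (\<lambda>h. \<Sum>i\<in>UNIV. \<Lambda> w ?u $ i *\<^sub>R Z2 h (axis i 1) + \<Lambda>' w h $ i *\<^sub>R Z ?u (axis i 1))) (at ?u)"
      by (intro has_derivative_sum has_derivative_scaleR dZ
          bounded_linear.has_derivative[OF bounded_linear_vec_nth dL])
    then have "((\<lambda>u. D z (param ?c u) w) has_derivative
      (\<lambda>h. \<Sum>i\<in>UNIV. \<Lambda> w ?u $ i *\<^sub>R Z2 h (axis i 1) + \<Lambda>' w h $ i *\<^sub>R Z ?u (axis i 1))) (at ?u)"
      by (rule has_derivative_transform_within_open[OF _ U])
        (simp add: D_in_chart[OF z c(1)] \<Lambda>_def Z_def)
    from D_eqI[OF smooth_map_D[OF z] this]
    have "D (\<lambda>r. D z r w) q v = (\<Sum>i\<in>UNIV. \<Lambda> w ?u $ i *\<^sub>R Z2 (\<Lambda> v ?u) (axis i 1))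
       + (\<Sum>i\<in>UNIV. \<Lambda>' w (\<Lambda> v ?u) $ i *\<^sub>R Z ?u (axis i 1))"
      by (simp add: L sum.distrib)
    also have "(\<Sum>i\<in>UNIV. \<Lambda>' w (\<Lambda> v ?u) $ i *\<^sub>R Z ?u (axis i 1)) = cder ?c z q (\<Lambda>' w (\<Lambda> v ?u))"
      unfolding Zq by (rule linear_axis_expand[OF linear_cder[OF z c], symmetric])
    also have "(\<Sum>i\<in>UNIV. \<Lambda> w ?u $ i *\<^sub>R Z2 (\<Lambda> v ?u) (axis i 1)) =
      (\<Sum>i\<in>UNIV. \<Sum>j\<in>UNIV. (\<Lambda> w ?u $ i * \<Lambda> v ?u $ j) *\<^sub>R Z2 (axis j 1) (axis i 1))"
      by (simp only: linear_axis_expand[OF linZ2, of "\<Lambda> v ?u"] scaleR_sum_right scaleR_scaleR)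
    finally show ?thesis by (simp only: add.commute)
  qed
  have "(\<Sum>i\<in>UNIV. \<Sum>j\<in>UNIV. (\<Lambda> b ?u $ i * \<Lambda> a ?u $ j) *\<^sub>R Z2 (axis j 1) (axis i 1))
     = (\<Sum>j\<in>UNIV. \<Sum>i\<in>UNIV. (\<Lambda> b ?u $ i * \<Lambda> a ?u $ j) *\<^sub>R Z2 (axis j 1) (axis i 1))"
    by (rule sum.swap)
  also have "\<dots> = (\<Sum>i\<in>UNIV. \<Sum>j\<in>UNIV. (\<Lambda> a ?u $ i * \<Lambda> b ?u $ j) *\<^sub>R Z2 (axis j 1) (axis i 1))"
    by (intro sum.cong refl arg_cong2[of _ _ _ _ "(*\<^sub>R)"] sym) (rule mult.commute)
  finally show ?thesis
    unfolding DD \<kappa>_def by (simp add: linear_diff[OF linear_cder[OF z c]])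
qed

text \<open>The vector left over in \<open>D_D_diff\<close> is the same for all maps, and the choice
  \<open>z = x\<close>, for which \<open>D x\<close> is \<open>P\<close>, identifies it. This is the
  vanishing of torsion.\<close>

lemma D_commutator:
  fixes y :: "'a \<Rightarrow> 'g::euclidean_space"
  assumes y: "smooth_map \<A> y"
  shows "D (\<lambda>r. D y r b) q a - D (\<lambda>r. D y r a) q b = D y q (D (\<lambda>r. P r b) q a - D (\<lambda>r. P r a) q b)"
proof -
  let ?c = "chart_at \<A> q"
  have "D y q (cder ?c x q (bracket a b q)) = cder ?c y q (bracket a b q)"
    by (simp add: D_cder[OF y chart_at] frame.coord_E[OF frame_cder[OF chart_at]])
  moreover have "D (\<lambda>r. P r b) q a - D (\<lambda>r. P r a) q b = cder ?c x q (bracket a b q)"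
    using D_D_diff[OF smooth_x] by (simp add: D_x)
  ultimately show ?thesis using D_D_diff[OF y] by simp
qed

subsection \<open>The derivative of the tangential projection\<close>

text \<open>On tangent vectors \<open>w\<close> this is the second fundamental form, on normal
  vectors \<open>w\<close> the Weingarten operator; see \<open>second_form_S\<close> and
  \<open>weingarten_S\<close>.\<close>

definition S :: "'a \<Rightarrow> 'e \<Rightarrow> 'e \<Rightarrow> 'e" where
  "S q a w = D (\<lambda>r. P r w) q a"

lemma smooth_map_P_field:
  assumes "smooth_map \<A> Y"
  shows "smooth_map \<A> (\<lambda>r. P r (Y r))"
  using smooth_map_D_field[OF smooth_x assms] by (simp add: D_x)

lemma P_expand: "P r w = (\<Sum>d\<in>Basis. (w \<bullet> d) *\<^sub>R P r d)"
  by (subst (1) euclidean_representation[of w, symmetric])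
    (simp only: linear_sum[OF P_linear] linear_scale[OF P_linear])

lemma linear_S_left: "linear (\<lambda>a. S q a w)"
  unfolding S_def by (rule linear_D[OF smooth_map_P])

lemma linear_S: "linear (S q a)"
proof (rule linearI)
  show "S q a (v + w) = S q a v + S q a w" for v w
    unfolding S_def by (simp add: linear_add[OF P_linear] D_add smooth_map_P)
  show "S q a (r *\<^sub>R w) = r *\<^sub>R S q a w" for r w
    unfolding S_def by (simp add: linear_scale[OF P_linear] D_scaleR smooth_map_P smooth_map_const D_const)
qed

lemmas S_linear_simps = linear_add[OF linear_S] linear_diff[OF linear_S] linear_neg[OF linear_S]
  linear_0[OF linear_S] linear_scale[OF linear_S]
lemmas S_left_simps = linear_add[OF linear_S_left] linear_diff[OF linear_S_left] linear_0[OF linear_S_left]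
lemmas P_simps = linear_add[OF P_linear] linear_diff[OF P_linear] linear_neg[OF P_linear]
  linear_0[OF P_linear] linear_scale[OF P_linear]

lemma S_P [simp]: "S q (P q a) w = S q a w"
  unfolding S_def by (rule D_P[OF smooth_map_P])

lemma S_normal_left: "P q n = 0 \<Longrightarrow> S q n w = 0"
  using S_P[of q n w] by (simp add: linear_0[OF linear_S_left])

lemma D_P_field:
  assumes Y: "smooth_map \<A> Y"
  shows "D (\<lambda>r. P r (Y r)) q a = S q a (Y q) + P q (D Y q a)"
proof -
  have sd: "smooth_map \<A> (\<lambda>r. Y r \<bullet> d)" for d
    by (intro smooth_map_inner Y smooth_map_const)
  have Dd: "D (\<lambda>r. Y r \<bullet> d) q a = D Y q a \<bullet> d" for d
    by (simp add: D_inner Y smooth_map_const D_const)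
  have "D (\<lambda>r. P r (Y r)) q a = D (\<lambda>r. \<Sum>d\<in>Basis. (Y r \<bullet> d) *\<^sub>R P r d) q a"
    by (simp only: P_expand[of _ "Y _"])
  also have "\<dots> = (\<Sum>d\<in>Basis. (Y q \<bullet> d) *\<^sub>R S q a d + (D Y q a \<bullet> d) *\<^sub>R P q d)"
    by (simp add: D_sum smooth_map_scaleR sd smooth_map_P D_scaleR Dd S_def)
  also have "\<dots> = S q a (\<Sum>d\<in>Basis. (Y q \<bullet> d) *\<^sub>R d) + P q (D Y q a)"
    by (simp only: sum.distrib P_expand[of q "D Y q a"] linear_sum[OF linear_S] linear_scale[OF linear_S])
  finally show ?thesis by (simp only: euclidean_representation)
qed

lemma S_symmetric: "S q a v \<bullet> w = v \<bullet> S q a w"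
proof -
  have "D (\<lambda>r. P r v \<bullet> w) q a = D (\<lambda>r. v \<bullet> P r w) q a" by (simp only: P_inner)
  then show ?thesis
    by (simp add: D_inner smooth_map_P smooth_map_const D_const S_def)
qed

text \<open>The derivative of \<open>P r (P r w) = P r w\<close>. It makes \<open>S q a\<close>
  exchange tangent and normal vectors, the source of most orthogonality relations below.\<close>

lemma S_split: "S q a w = S q a (P q w) + P q (S q a w)"
proof -
  have "S q a w = D (\<lambda>r. P r (P r w)) q a" by (simp add: S_def)
  also have "\<dots> = S q a (P q w) + P q (S q a w)"
    by (simp only: D_P_field[OF smooth_map_P] S_def)
  finally show ?thesis .
qed

lemma S_tangent: "P q X = X \<Longrightarrow> P q (S q a X) = 0"
  using S_split[of q a X] by simp

lemma S_normal: "P q n = 0 \<Longrightarrow> P q (S q a n) = S q a n"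
  using S_split[of q a n] by (simp add: linear_0[OF linear_S])

lemma tangent_normal_orthogonal: "P q X = X \<Longrightarrow> P q n = 0 \<Longrightarrow> X \<bullet> n = 0"
  using P_inner[of q X n] by simp

text \<open>The commutator identity for \<open>x\<close> says that \<open>S q a b - S q b a\<close>
  is tangent, and the normal part of \<open>S q a b\<close> is \<open>S q a (P q b)\<close>.\<close>

lemma S_commute: "S q a (P q b) = S q b (P q a)"
proof -
  have n: "S q a (P q b) = S q a b - P q (S q a b)" for a b
    using S_split[of q a b] by (simp add: algebra_simps)
  have "S q a b - S q b a = P q (S q a b - S q b a)"
    using D_commutator[OF smooth_x, of b q a] by (simp add: D_x S_def)
  then show ?thesis
    by (simp add: n P_simps algebra_simps)
qed

lemma second_form_S:
  assumes "P q X = X"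
  shows "second_form \<A> x q X Y = S q X (P q Y)"
proof -
  have "flat_D \<A> x q X (\<lambda>r. P r Y) = S q X Y"
    using flat_D_P[of q X "\<lambda>r. P r Y"] assms by (simp add: S_def)
  then show ?thesis
    using S_split[of q X Y] by (simp add: second_form_def nor_part_def algebra_simps)
qed

lemma weingarten_S:
  assumes "P q X = X" "P q \<eta> = 0"
  shows "weingarten \<A> x q \<eta> X = S q X \<eta>"
  unfolding weingarten_def
proof (rule the_equality)
  have *: "second_form \<A> x q X Y \<bullet> \<eta> = S q X \<eta> \<bullet> Y" if "P q Y = Y" for Y
    using that S_symmetric[of q X Y \<eta>] inner_commute[of Y] by (simp add: second_form_S[OF assms(1)])
  then show "S q X \<eta> \<in> tangent_space \<A> x q \<and>
      (\<forall>Y\<in>tangent_space \<A> x q. S q X \<eta> \<bullet> Y = second_form \<A> x q X Y \<bullet> \<eta>)"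
    by (simp add: tangent_iff S_normal[OF assms(2)])
  fix Z assume Z: "Z \<in> tangent_space \<A> x q \<and>
      (\<forall>Y\<in>tangent_space \<A> x q. Z \<bullet> Y = second_form \<A> x q X Y \<bullet> \<eta>)"
  let ?d = "Z - S q X \<eta>"
  have d: "P q ?d = ?d"
    using Z by (simp add: tangent_iff P_simps S_normal[OF assms(2)])
  have "Z \<bullet> ?d = S q X \<eta> \<bullet> ?d"
    using Z d *[OF d] by (simp add: tangent_iff)
  then have "?d \<bullet> ?d = 0" by (simp add: inner_diff_left)
  then show "Z = S q X \<eta>" by simp
qed

text \<open>The projections \<open>P\<close> and \<open>1 - P\<close> are orthogonal to each other.
  Mixed tangent-normal terms thus drop out whenever a sum over \<open>Basis\<close> is
  split.\<close>

lemma trace_cross: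
  fixes B :: "'e \<Rightarrow> 'e \<Rightarrow> 'f::real_vector"
  assumes "bilinear B"
  shows "(\<Sum>c\<in>Basis. B (P q c) (c - P q c)) = 0"
proof -
  have l: "linear (B a)" "linear (\<lambda>a. B a b)" for a b
    using assms by (auto simp: bilinear_def)
  have "B (P q c) (c - P q c) = (\<Sum>d\<in>Basis. B d ((c \<bullet> P q d) *\<^sub>R (c - P q c)))" for c
  proof -
    have "B (P q c) e = (\<Sum>d\<in>Basis. B d ((c \<bullet> P q d) *\<^sub>R e))" for e
    proof -
      have "B (P q c) e = B (\<Sum>d\<in>Basis. (P q c \<bullet> d) *\<^sub>R d) e"
        by (simp only: euclidean_representation)
      also have "\<dots> = (\<Sum>d\<in>Basis. (P q c \<bullet> d) *\<^sub>R B d e)"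
        by (simp only: linear_sum[OF l(2)] linear_scale[OF l(2)])
      finally show ?thesis
        using linear_scale[OF l(1)] by (simp add: P_inner)
    qed
    then show ?thesis .
  qed
  then have "(\<Sum>c\<in>Basis. B (P q c) (c - P q c)) =
      (\<Sum>d\<in>Basis. \<Sum>c\<in>Basis. B d ((c \<bullet> P q d) *\<^sub>R (c - P q c)))"
    by (simp only:) (rule sum.swap)
  also have "\<dots> = (\<Sum>d\<in>Basis. B d (\<Sum>c\<in>Basis. (P q d \<bullet> c) *\<^sub>R (c - P q c)))"
    by (simp add: linear_sum[OF l(1)] inner_commute)
  also have "\<dots> = 0"
  proof (rule sum.neutral, rule ballI)
    fix d
    have "(\<Sum>c\<in>Basis. (P q d \<bullet> c) *\<^sub>R (c - P q c)) = P q d - P q (P q d)"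
      by (simp only: scaleR_diff_right sum_subtractf euclidean_representation P_expand[of q "P q d", symmetric])
    then show "B d (\<Sum>c\<in>Basis. (P q d \<bullet> c) *\<^sub>R (c - P q c)) = 0"
      using linear_0[OF l(1)] by simp
  qed
  finally show ?thesis .
qed

definition H :: "'a \<Rightarrow> 'e" where
  "H q = (\<Sum>c\<in>Basis. S q c (P q c))"

lemma H_eq_trace: "(\<Sum>c\<in>Basis. S q c c) = H q"
proof -
  have "(\<Sum>c\<in>Basis. S q (P q c) (c - P q c)) = 0"
    by (rule trace_cross) (simp add: bilinear_def linear_S linear_S_left)
  then show ?thesis
    by (simp add: H_def S_linear_simps sum_subtractf)
qed

lemma H_normal: "P q (H q) = 0"
  by (simp add: H_def linear_sum[OF P_linear] S_tangent)

lemma mean_curvature_eq: "mean_curvature \<A> x q = H q"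
proof -
  interpret frame "differential \<A> x q"
    using frame_cder[OF chart_at] by (simp add: differential_eq_cder)
  let ?E = "differential \<A> x q"
  have E: "P q (?E a) = ?E a" for a
    using tangent_iff by (auto simp: tangent_space_def)
  have P: "?E (coord ?E c) = P q c" for c
    by (simp add: P_cder[OF chart_at] differential_eq_cder)
  have "bilinear (\<lambda>a b. S q (?E a) (?E b))"
    unfolding bilinear_def
    using linear_compose[OF lin linear_S_left] linear_compose[OF lin linear_S] by (simp add: o_def)
  from trace_bilinear[OF this]
  have "mean_curvature \<A> x q = (\<Sum>c\<in>Basis. S q (?E (coord ?E c)) (?E (coord ?E c)))"
    by (simp add: mean_curvature_def metric_matrix_def gram_def second_form_S E)
  then show ?thesis by (simp add: P H_def)
qed

subsection \<open>The Codazzi equation\<close>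

lemma S_expand: "S r b w = (\<Sum>d\<in>Basis. (w \<bullet> d) *\<^sub>R S r b d)"
  by (subst (1) euclidean_representation[of w, symmetric])
    (simp only: linear_sum[OF linear_S] linear_scale[OF linear_S])

lemma smooth_map_S: "smooth_map \<A> (\<lambda>r. S r b w)"
  unfolding S_def by (rule smooth_map_D[OF smooth_map_P])

lemma smooth_map_S_field:
  assumes "smooth_map \<A> Y"
  shows "smooth_map \<A> (\<lambda>r. S r b (Y r))"
  unfolding S_expand[of _ b "Y _"]
  by (intro smooth_map_sum smooth_map_scaleR smooth_map_inner assms smooth_map_const smooth_map_S)

text \<open>A plain iterated derivative of the projection. The fields \<open>P r b\<close> and
  \<open>P r c\<close> do not commute, so it is not symmetric in \<open>b\<close> and
  \<open>c\<close>; \<open>S2_commutator\<close> gives the defect.\<close>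

definition S2 :: "'a \<Rightarrow> 'e \<Rightarrow> 'e \<Rightarrow> 'e \<Rightarrow> 'e" where
  "S2 q c b w = D (\<lambda>r. S r b w) q c"

lemma linear_S2: "linear (S2 q c b)"
proof (rule linearI)
  show "S2 q c b (v + w) = S2 q c b v + S2 q c b w" for v w
    unfolding S2_def by (simp add: S_linear_simps D_add smooth_map_S)
  show "S2 q c b (r *\<^sub>R w) = r *\<^sub>R S2 q c b w" for r w
    unfolding S2_def by (simp add: S_linear_simps D_scaleR smooth_map_S smooth_map_const D_const)
qed

lemma D_S_field:
  assumes Y: "smooth_map \<A> Y"
  shows "D (\<lambda>r. S r b (Y r)) q a = S2 q a b (Y q) + S q b (D Y q a)"
proof -
  have sd: "smooth_map \<A> (\<lambda>r. Y r \<bullet> d)" for d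
    by (intro smooth_map_inner Y smooth_map_const)
  have Dd: "D (\<lambda>r. Y r \<bullet> d) q a = D Y q a \<bullet> d" for d
    by (simp add: D_inner Y smooth_map_const D_const)
  have "D (\<lambda>r. S r b (Y r)) q a = D (\<lambda>r. \<Sum>d\<in>Basis. (Y r \<bullet> d) *\<^sub>R S r b d) q a"
    by (simp only: S_expand[of _ _ "Y _"])
  also have "\<dots> = (\<Sum>d\<in>Basis. (Y q \<bullet> d) *\<^sub>R S2 q a b d + (D Y q a \<bullet> d) *\<^sub>R S q b d)"
    by (simp add: D_sum smooth_map_scaleR sd smooth_map_S D_scaleR Dd S2_def)
  also have "\<dots> = S2 q a b (\<Sum>d\<in>Basis. (Y q \<bullet> d) *\<^sub>R d) + S q b (D Y q a)"
    by (simp only: sum.distrib S_expand[of q b "D Y q a"] linear_sum[OF linear_S2] linear_scale[OF linear_S2])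
  finally show ?thesis by (simp only: euclidean_representation)
qed

lemma S2_symmetric: "S2 q c b v \<bullet> w = v \<bullet> S2 q c b w"
proof -
  have "D (\<lambda>r. S r b v \<bullet> w) q c = D (\<lambda>r. v \<bullet> S r b w) q c" by (simp only: S_symmetric)
  then show ?thesis
    by (simp add: D_inner smooth_map_S smooth_map_const D_const S2_def)
qed

lemma S2_commutator: "S2 q c b w - S2 q b c w = S q (S q c b - S q b c) w"
  using D_commutator[OF smooth_map_P, of w b q c] by (simp add: S2_def S_def)

text \<open>The Laplacian of the components of \<open>P r w\<close>: for a function, second
  derivatives along projected constant vectors, summed over \<open>Basis\<close>, give the
  Laplace-Beltrami operator.\<close>

definition LP :: "'a \<Rightarrow> 'e \<Rightarrow> 'e" where
  "LP q w = (\<Sum>c\<in>Basis. S2 q c c w)"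

lemma linear_LP: "linear (LP q)"
  unfolding LP_def by (intro linear_compose_sum ballI linear_S2)

lemma LP_symmetric: "LP q v \<bullet> w = v \<bullet> LP q w"
  by (simp add: LP_def inner_sum_left inner_sum_right S2_symmetric)

text \<open>Differentiating \<open>S_commute\<close> replaces \<open>S2 q c c b\<close> by
  \<open>S2 q c b (P q c)\<close>, the commutator exchanges the directions \<open>c\<close> and
  \<open>b\<close>, and the sum over \<open>c\<close> is then the derivative of \<open>H\<close>.
  The other terms are quadratic in \<open>S\<close>: they are tangent, hence orthogonal to
  \<open>n\<close>, or vanish because \<open>S\<close> is applied along a normal direction, or
  because of \<open>trace_cross\<close>.\<close>

lemma codazzi:
  assumes n: "P q n = 0" and b: "P q b = b"
  shows "n \<bullet> LP q b = n \<bullet> D H q b"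
proof -
  have tan0: "n \<bullet> S q c k = 0" if "P q k = 0" for c k
    using tangent_normal_orthogonal[OF S_normal[OF that] n] by (simp add: inner_commute)
  have Db: "D (\<lambda>r. P r b) q c = S q c b" for c by (simp add: S_def)
  have Dc: "D (\<lambda>r. P r c) q a = S q a c" for a c by (simp add: S_def)
  have 1: "S2 q c c b + S q c (S q c b) = S2 q c b (P q c) + S q b (S q c c)" for c
  proof -
    have "D (\<lambda>r. S r c (P r b)) q c = D (\<lambda>r. S r b (P r c)) q c"
      by (simp only: S_commute)
    then show ?thesis
      by (simp only: D_S_field[OF smooth_map_P] Dc b)
  qed
  have 2: "D H q b = (\<Sum>c\<in>Basis. S2 q b c (P q c) + S q c (S q b c))"
    unfolding H_def by (simp add: D_sum smooth_map_S_field smooth_map_P D_S_field Dc)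
  have 3: "S2 q c b (P q c) = S2 q b c (P q c) + S q (S q c b) (P q c) - S q (S q b c) (P q c)" for c
    using S2_commutator[of q c b "P q c"] by (simp add: S_left_simps algebra_simps)
  have Scb: "P q (S q c b) = 0" for c by (rule S_tangent[OF b])
  have "S2 q c c b = (S2 q b c (P q c) + S q c (S q b c)) + S q b (S q c c) - S q c (S q c b)
      - S q (S q b c) (P q c) - S q c (S q b c)" for c
    using 1[of c] 3[of c] S_normal_left[OF Scb] by (simp add: algebra_simps)
  then have "LP q b = D H q b + S q b (H q) - (\<Sum>c\<in>Basis. S q c (S q c b))
      - (\<Sum>c\<in>Basis. S q (S q b c) (P q c)) - (\<Sum>c\<in>Basis. S q c (S q b c))"
    by (simp add: LP_def 2 sum.distrib sum_subtractf H_eq_trace[symmetric] linear_sum[OF linear_S])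
  moreover have "n \<bullet> S q b (H q) = 0" by (rule tan0[OF H_normal])
  moreover have "n \<bullet> (\<Sum>c\<in>Basis. S q c (S q c b)) = 0"
    by (simp add: inner_sum_right tan0 Scb)
  moreover have "(\<Sum>c\<in>Basis. S q (S q b c) (P q c)) = 0"
  proof -
    have "bilinear (\<lambda>a d. S q (S q b d) a)"
      unfolding bilinear_def using linear_compose[OF linear_S linear_S_left] linear_S by (simp add: o_def)
    from trace_cross[OF this, of q]
    have "(\<Sum>c\<in>Basis. S q (S q b (c - P q c)) (P q c)) = 0" .
    moreover have "S q (S q b (c - P q c)) (P q c) = S q (S q b c) (P q c)" for c
      using S_normal_left[OF S_tangent[of q "P q c" b]] by (simp add: S_linear_simps S_left_simps)
    ultimately show ?thesis by simp
  qed
  moreover have "n \<bullet> (\<Sum>c\<in>Basis. S q c (S q b c)) = 0"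
  proof -
    have "bilinear (\<lambda>a d. S q a (S q b d))"
      unfolding bilinear_def using linear_compose[OF linear_S linear_S] linear_S_left by (simp add: o_def)
    from trace_cross[OF this, of q]
    have "(\<Sum>c\<in>Basis. S q c (S q b (c - P q c))) = 0" by simp
    then have "n \<bullet> (\<Sum>c\<in>Basis. S q c (S q b c)) = n \<bullet> (\<Sum>c\<in>Basis. S q c (S q b (P q c)))"
      by (simp add: S_linear_simps sum_subtractf)
    also have "\<dots> = 0"
      by (simp add: inner_sum_right tan0 S_tangent)
    finally show ?thesis .
  qed
  ultimately show ?thesis by (simp add: inner_add_right inner_diff_right)
qed

text \<open>The identity \<open>P r (P r w) = P r w\<close> differentiated twice and traced. The
  factor 2 is the one of the mixed term in the Leibniz rule.\<close>

lemma LP_split: "LP q w = LP q (P q w) + P q (LP q w) + 2 *\<^sub>R (\<Sum>c\<in>Basis. S q c (S q c w))"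
proof -
  have Dw: "D (\<lambda>r. P r w) q a = S q a w" for a by (simp add: S_def)
  have "S2 q c c w = S2 q c c (P q w) + P q (S2 q c c w) + 2 *\<^sub>R S q c (S q c w)" for c
  proof -
    have "S2 q c c w = D (\<lambda>r. S r c (P r w) + P r (S r c w)) q c"
      unfolding S2_def using S_split by simp
    also have "\<dots> = (S2 q c c (P q w) + S q c (S q c w)) + (S q c (S q c w) + P q (S2 q c c w))"
      by (simp add: D_add smooth_map_S_field smooth_map_P smooth_map_P_field smooth_map_S
          D_S_field D_P_field Dw S2_def[symmetric])
    finally show ?thesis unfolding scaleR_2 by (simp only: ac_simps)
  qed
  then have "LP q w = (\<Sum>c\<in>Basis. S2 q c c (P q w) + P q (S2 q c c w) + 2 *\<^sub>R S q c (S q c w))"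
    unfolding LP_def by (intro sum.cong refl)
  also have "\<dots> = LP q (P q w) + P q (LP q w) + 2 *\<^sub>R (\<Sum>c\<in>Basis. S q c (S q c w))"
    by (simp only: LP_def sum.distrib linear_sum[OF P_linear] scaleR_sum_right)
  finally show ?thesis .
qed

lemma LP_tangent:
  assumes "P q X = X" "P q Y = Y"
  shows "X \<bullet> LP q Y = - 2 * (\<Sum>c\<in>Basis. S q c X \<bullet> S q c Y)"
proof -
  have "X \<bullet> LP q Y = X \<bullet> (LP q (P q Y) + P q (LP q Y) + 2 *\<^sub>R (\<Sum>c\<in>Basis. S q c (S q c Y)))"
    using LP_split[of q Y] by simp
  also have "\<dots> = X \<bullet> LP q Y + X \<bullet> LP q Y + 2 * (\<Sum>c\<in>Basis. S q c X \<bullet> S q c Y)"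
    using assms P_inner[of q X "LP q Y"] by (simp add: inner_add_right inner_sum_right S_symmetric)
  finally show ?thesis by simp
qed

lemma LP_normal:
  assumes "P q n = 0" "P q k = 0"
  shows "n \<bullet> LP q k = 2 * (\<Sum>c\<in>Basis. S q c n \<bullet> S q c k)"
proof -
  have "n \<bullet> LP q k = n \<bullet> (LP q (P q k) + P q (LP q k) + 2 *\<^sub>R (\<Sum>c\<in>Basis. S q c (S q c k)))"
    using LP_split[of q k] by simp
  also have "\<dots> = 2 * (\<Sum>c\<in>Basis. S q c n \<bullet> S q c k)"
    using assms P_inner[of q n "LP q k"]
    by (simp add: inner_add_right inner_sum_right S_symmetric linear_0[OF linear_LP])
  finally show ?thesis .
qed

section \<open>Normal fields and parallel normal fields\<close>

lemma D_normal:
  assumes "smooth_map \<A> N" "\<And>r. P r (N r) = 0"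
  shows "P q (D N q a) = - S q a (N q)"
proof -
  have "D (\<lambda>r. P r (N r)) q a = 0" by (simp add: assms(2) D_const)
  then show ?thesis using D_P_field[OF assms(1), of q a] by (simp add: eq_neg_iff_add_eq_0 add.commute)
qed

text \<open>By \<open>D_normal\<close> the tangential part of \<open>D N\<close> is always
  \<open>- S q a (N q)\<close>, so being parallel means that this is the whole derivative.\<close>

lemma parallel_normal_field_iff:
  "parallel_normal_field \<A> x N \<longleftrightarrow>
    smooth_map \<A> N \<and> (\<forall>q. P q (N q) = 0) \<and> (\<forall>q a. D N q a = - S q a (N q))"
proof -
  have *: "(\<forall>X\<in>tangent_space \<A> x q. normal_D \<A> x q X N = 0) \<longleftrightarrow> (\<forall>a. D N q a = - S q a (N q))"
    if N: "smooth_map \<A> N" "\<And>q. P q (N q) = 0" for q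
  proof -
    have nD: "normal_D \<A> x q (P q a) N = D N q a + S q a (N q)" for a
      by (simp add: normal_D_def nor_part_def flat_D_P D_normal[OF N])
    show ?thesis
    proof
      assume "\<forall>X\<in>tangent_space \<A> x q. normal_D \<A> x q X N = 0"
      then show "\<forall>a. D N q a = - S q a (N q)"
        using nD P_in_tangent by (metis eq_neg_iff_add_eq_0)
    next
      assume a: "\<forall>a. D N q a = - S q a (N q)"
      show "\<forall>X\<in>tangent_space \<A> x q. normal_D \<A> x q X N = 0"
      proof
        fix X assume "X \<in> tangent_space \<A> x q"
        then have "P q X = X" by (simp add: tangent_iff)
        then show "normal_D \<A> x q X N = 0" using nD[of X] a by simp
      qed
    qed
  qed
  show ?thesis
    unfolding parallel_normal_field_def normal_field_def normal_iff using * by blast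
qed

end

subsection \<open>The pointwise stability inequality\<close>

locale xi_immersed = immersed \<A> x
  for \<A> :: "('a::{t2_space, second_countable_topology}, 'm::finite) chart set"
    and x :: "'a \<Rightarrow> 'e::euclidean_space" +
  fixes \<xi> :: "'a \<Rightarrow> 'e"
  assumes xi: "xi_submanifold \<A> x \<xi>"
    and hyp: "second_form \<A> x q (weingarten \<A> x q (\<xi> q) (tan_part \<A> x q (x q))) (tan_part \<A> x q v) = 0"
begin

lemma parallel_xi: "parallel_normal_field \<A> x \<xi>"
  using xi by (simp add: xi_submanifold_def)

lemma smooth_xi: "smooth_map \<A> \<xi>"
  and P_xi: "P q (\<xi> q) = 0"
  and D_xi: "D \<xi> q a = - S q a (\<xi> q)"
  using parallel_xi by (auto simp: parallel_normal_field_iff)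

lemma H_xi: "H q = \<xi> q - x q + P q (x q)"
proof -
  have "H q + nor_part \<A> x q (x q) = \<xi> q"
    using xi by (simp add: xi_submanifold_def mean_curvature_eq)
  then show ?thesis by (simp add: nor_part_def algebra_simps)
qed

text \<open>The gradient of \<open>f\<close>, as \<open>D_\<omega>\<close> confirms. The second
  summand arises because \<open>\<xi>\<close> also varies along the immersion, with derivative
  \<open>- S q a (\<xi> q)\<close>.\<close>

definition G :: "'a \<Rightarrow> 'e" where
  "G q = P q (x q) + S q (P q (x q)) (\<xi> q)"

lemma S_xi_zero: "S q (S q (P q (x q)) (\<xi> q)) (P q v) = 0"
proof -
  have "P q (S q (P q (x q)) (\<xi> q)) = S q (P q (x q)) (\<xi> q)"
    by (rule S_normal[OF P_xi])
  then show ?thesis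
    using hyp[of q v] by (simp add: weingarten_S P_xi second_form_S del: S_P)
qed

text \<open>Here the hypothesis on \<open>A_\<xi>\<close> takes effect: the drift along the gradient
  of \<open>f\<close> acts like the drift along \<open>x\<^sup>\<top>\<close>, and the latter is
  what the Codazzi equation produces through \<open>normal_D_H\<close>.\<close>

lemma S_G: "S q (G q) (P q v) = S q (P q (x q)) (P q v)"
  by (simp add: G_def S_left_simps S_xi_zero del: S_P)

text \<open>In \<open>H q = \<xi> q - x q + P q (x q)\<close> the derivatives of
  \<open>\<xi>\<close> and \<open>x\<close> are tangent, so a normal part can only come from the
  derivative of the projection.\<close>

lemma normal_D_H:
  assumes "P q n = 0" "P q X = X"
  shows "n \<bullet> D H q X = n \<bullet> S q (P q (x q)) X"
proof -
  have "D H q X = D (\<lambda>r. \<xi> r - x r + P r (x r)) q X"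
    using H_xi by presburger
  also have "\<dots> = - S q X (\<xi> q) + S q X (x q)"
    by (simp add: D_add D_diff smooth_map_diff smooth_xi smooth_x smooth_map_P_field D_P_field D_xi D_x)
  finally have "n \<bullet> D H q X = - (n \<bullet> S q X (\<xi> q)) + n \<bullet> S q X (x q)"
    by (simp add: inner_add_right inner_diff_right)
  also have "n \<bullet> S q X (\<xi> q) = 0"
    using tangent_normal_orthogonal[OF S_normal[OF P_xi] assms(1)] by (simp add: inner_commute)
  also have "n \<bullet> S q X (x q) = n \<bullet> S q X (P q (x q)) + n \<bullet> P q (S q X (x q))"
    by (metis S_split inner_add_right)
  also have "n \<bullet> P q (S q X (x q)) = 0"
    using P_inner[of q n] assms(1) by (metis inner_zero_left)
  also have "S q X (P q (x q)) = S q (P q (x q)) X"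
    using S_commute[of q X "x q"] assms(2) by simp
  finally show ?thesis by simp
qed

definition \<omega> :: "'a \<Rightarrow> real" where
  "\<omega> q = exp (- (1/2) * (norm (x q - \<xi> q))\<^sup>2)"

lemma \<omega>_pos: "\<omega> q > 0" by (simp add: \<omega>_def)

lemma smooth_\<omega>: "smooth_map \<A> \<omega>"
  and D_\<omega>: "D \<omega> q c = - \<omega> q * (G q \<bullet> c)"
proof -
  let ?y = "\<lambda>q. (x q - \<xi> q) \<bullet> (x q - \<xi> q)"
  have sy: "smooth_map \<A> ?y"
    by (intro smooth_map_inner smooth_map_diff smooth_x smooth_xi)
  let ?g = "\<lambda>s. exp (- (1/2) * s) :: real"
  have sg: "smooth_on UNIV ?g"
    by (intro smooth_on_exp smooth_on_mult smooth_on_const smooth_on_linear bounded_linear_ident) auto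
  have w: "\<omega> = (\<lambda>q. ?g (?y q))" by (simp add: \<omega>_def power2_norm_eq_inner fun_eq_iff)
  show "smooth_map \<A> \<omega>" unfolding w by (rule smooth_map_compose[OF sy sg])
  have dg: "(?g has_real_derivative - (1/2) * ?g (?y q)) (at (?y q))"
    by (auto intro!: derivative_eq_intros)
  have Sc: "S q c (\<xi> q) = P q (S q c (\<xi> q))" by (rule S_normal[OF P_xi, symmetric])
  have "D ?y q c = 2 * ((x q - \<xi> q) \<bullet> (P q c + S q c (\<xi> q)))"
  proof -
    have "D ?y q c = (x q - \<xi> q) \<bullet> (P q c - - S q c (\<xi> q)) + (P q c - - S q c (\<xi> q)) \<bullet> (x q - \<xi> q)"
      by (simp only: D_inner D_diff smooth_map_diff smooth_x smooth_xi D_x D_xi)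
    then show ?thesis by (simp add: inner_commute)
  qed
  also have "(x q - \<xi> q) \<bullet> (P q c + S q c (\<xi> q)) = P q (x q) \<bullet> c + x q \<bullet> S q c (\<xi> q)"
  proof -
    have "\<xi> q \<bullet> P q c = 0" using P_inner[of q "\<xi> q" c] by (simp add: P_xi)
    moreover have "\<xi> q \<bullet> S q c (\<xi> q) = 0"
      using tangent_normal_orthogonal[OF Sc[symmetric] P_xi] by (simp add: inner_commute)
    ultimately show ?thesis by (simp add: inner_diff_left inner_add_right P_inner)
  qed
  also have "x q \<bullet> S q c (\<xi> q) = P q (x q) \<bullet> S q c (\<xi> q)"
    using P_inner[of q "x q" "S q c (\<xi> q)"] Sc by simp
  also have "\<dots> = S q c (P q (x q)) \<bullet> \<xi> q" by (simp only: S_symmetric)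
  also have "\<dots> = S q (P q (x q)) (P q c) \<bullet> \<xi> q" using S_commute[of q c "x q"] by simp
  also have "\<dots> = P q c \<bullet> S q (P q (x q)) (\<xi> q)" by (simp only: S_symmetric)
  also have "\<dots> = c \<bullet> S q (P q (x q)) (\<xi> q)"
    by (simp only: P_inner S_normal[OF P_xi])
  finally have Dy: "D ?y q c = 2 * (G q \<bullet> c)"
    by (simp add: G_def inner_add_left inner_add_right inner_commute)
  show "D \<omega> q c = - \<omega> q * (G q \<bullet> c)"
  proof -
    have "D (\<lambda>q. ?g (?y q)) q c = - (1/2) * ?g (?y q) * (2 * (G q \<bullet> c))"
      by (simp only: D_compose_real[OF sy sg dg] Dy)
    then show ?thesis unfolding w by simp
  qed
qed

end

section \<open>The test field and the function that drives the integration by parts\<close>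

locale stable_test = xi_immersed \<A> x \<xi>
  for \<A> :: "('a::{t2_space, second_countable_topology}, 'm::finite) chart set"
    and x \<xi> :: "'a \<Rightarrow> 'e::euclidean_space" +
  fixes v :: 'e and N :: "'a \<Rightarrow> 'e"
  assumes parallel_N: "parallel_normal_field \<A> x N"
begin

lemma smooth_N: "smooth_map \<A> N"
  and P_N: "P q (N q) = 0"
  and D_N: "D N q a = - S q a (N q)"
  using parallel_N by (auto simp: parallel_normal_field_iff)

definition vn :: "'a \<Rightarrow> 'e" where "vn q = v - P q v"
definition u :: "'a \<Rightarrow> 'e" where "u q = vn q - N q"
text \<open>The drift Laplacian of \<open>(v \<bullet> vn q) / 2\<close> is the sum over
  \<open>c\<close> of the squares of \<open>norm (S q c (P q v))\<close> minus those of
  \<open>norm (S q c (vn q))\<close>, and that of \<open>v \<bullet> N q\<close> is minus the sum of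
  \<open>S q c (vn q) \<bullet> S q c (N q)\<close>. The factor -2 therefore supplies the mixed term
  in the expansion of the square of \<open>norm (S q c (u q))\<close>.\<close>

definition w :: "'a \<Rightarrow> real" where "w q = (v \<bullet> vn q) / 2 - 2 * (v \<bullet> N q)"

lemma P_vn: "P q (vn q) = 0" by (simp add: vn_def P_simps)
lemma P_u: "P q (u q) = 0" by (simp add: u_def P_simps P_vn P_N)

lemma smooth_vn: "smooth_map \<A> vn"
  unfolding vn_def[abs_def] by (intro smooth_map_diff smooth_map_const smooth_map_P)

lemma smooth_u: "smooth_map \<A> u"
  unfolding u_def[abs_def] by (intro smooth_map_diff smooth_vn smooth_N)

lemma smooth_w: "smooth_map \<A> w"
proof -
  have "w = (\<lambda>q. (1/2) * (v \<bullet> vn q) - 2 * (v \<bullet> N q))" by (auto simp: w_def)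
  then show ?thesis
    by (simp only:) (intro smooth_map_diff smooth_map_mult smooth_map_inner smooth_map_const smooth_vn smooth_N)
qed

lemma D_w_v: "D w q c = - (1/2) * (v \<bullet> S q c v) + 2 * (v \<bullet> S q c (N q))"
proof -
  have w: "w = (\<lambda>q. (1/2) * (v \<bullet> vn q) - 2 * (v \<bullet> N q))" by (auto simp: w_def)
  have Dvn: "D vn q c = - S q c v"
    by (simp add: vn_def[abs_def] D_diff smooth_map_const smooth_map_P D_const S_def)
  have "D w q c = ((1/2) * (v \<bullet> - S q c v + 0 \<bullet> vn q) + 0 * (v \<bullet> vn q))
      - (2 * (v \<bullet> - S q c (N q) + 0 \<bullet> N q) + 0 * (v \<bullet> N q))"
    unfolding w
    by (simp only: D_diff D_mult D_inner smooth_map_diff smooth_map_mult smooth_map_inner smooth_map_const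
        smooth_vn smooth_N D_const D_N Dvn)
  then show ?thesis by simp
qed

lemma v_split: "v = P q v + vn q" by (simp add: vn_def)

lemma orthogonal_simps:
  "P q n = 0 \<Longrightarrow> S q c (P q v) \<bullet> P q y = 0"
  "P q n = 0 \<Longrightarrow> P q k = 0 \<Longrightarrow> S q c n \<bullet> k = 0"
proof -
  show "S q c (P q v) \<bullet> P q y = 0"
    using P_inner[of q "S q c (P q v)" y] by (simp add: S_tangent)
  show "P q n = 0 \<Longrightarrow> P q k = 0 \<Longrightarrow> S q c n \<bullet> k = 0"
    using tangent_normal_orthogonal[OF S_normal] .
qed

lemma v_S_normal: "P q k = 0 \<Longrightarrow> v \<bullet> S q c k = S q c (P q v) \<bullet> k"
proof -
  assume k: "P q k = 0"
  have "v \<bullet> S q c k = P q v \<bullet> S q c k + vn q \<bullet> S q c k"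
    using v_split[of q] by (metis inner_add_left)
  also have "vn q \<bullet> S q c k = 0"
    using orthogonal_simps(2)[OF k P_vn] by (simp add: inner_commute)
  finally show ?thesis by (simp add: S_symmetric)
qed

lemma v_S_v: "v \<bullet> S q c v = 2 * (S q c (P q v) \<bullet> vn q)"
proof -
  have "S q c v = S q c (P q v) + S q c (vn q)"
    using v_split[of q] by (metis linear_add[OF linear_S])
  then have "v \<bullet> S q c v = v \<bullet> S q c (P q v) + v \<bullet> S q c (vn q)" by (simp add: inner_add_right)
  also have "v \<bullet> S q c (P q v) = P q v \<bullet> S q c (P q v) + vn q \<bullet> S q c (P q v)"
    using v_split[of q] by (metis inner_add_left)
  also have "P q v \<bullet> S q c (P q v) = 0"
    using orthogonal_simps(1)[of q 0 c v] by (simp add: inner_commute P_simps)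
  finally show ?thesis by (simp add: v_S_normal[OF P_vn] inner_commute)
qed

lemma D_w: "D w q c = - (S q c (P q v) \<bullet> (vn q - 2 *\<^sub>R N q))"
  by (simp add: D_w_v v_S_v v_S_normal[OF P_N] inner_diff_right)

lemma D_D_w: "D (\<lambda>r. D w r c) q c = - (1/2) * (v \<bullet> S2 q c c v) + 2 * (v \<bullet> S2 q c c (N q)) - 2 * (S q c v \<bullet> S q c (N q))"
proof -
  have "D (\<lambda>r. D w r c) q c =
    (- (1/2) * (v \<bullet> S2 q c c v + 0 \<bullet> S q c v) + 0 * (v \<bullet> S q c v))
      + (2 * (v \<bullet> (S2 q c c (N q) + S q c (- S q c (N q))) + 0 \<bullet> S q c (N q)) + 0 * (v \<bullet> S q c (N q)))"
    by (simp only: D_w_v D_add D_mult D_inner smooth_map_mult smooth_map_inner smooth_map_const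
      smooth_map_S smooth_map_S_field smooth_N D_const D_S_field D_N S2_def[symmetric])
  then show ?thesis
    by (simp add: S_linear_simps inner_diff_right S_symmetric[of q c v "S q c (N q)"])
qed

text \<open>The Codazzi equation contributes \<open>h(x\<^sup>\<top>, v\<^sup>\<top>)\<close> paired
  with \<open>vn q - 2 *\<^sub>R N q\<close>, and by \<open>S_G\<close> the drift term contributes
  the same expression. They cancel, and only terms quadratic in \<open>S\<close> remain.\<close>

lemma Laplace_w:
  "(\<Sum>c\<in>Basis. D (\<lambda>r. D w r c) q c) - D w q (G q) =
    (\<Sum>c\<in>Basis. (norm (S q c (P q v)))\<^sup>2) - (\<Sum>c\<in>Basis. (norm (S q c (vn q)))\<^sup>2)
     + 2 * (\<Sum>c\<in>Basis. S q c (vn q) \<bullet> S q c (N q))"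
proof -
  let ?X = "P q v" and ?a = "vn q" and ?N = "N q"
  let ?y = "S q (P q (x q)) ?X"
  have cod: "n \<bullet> LP q ?X = n \<bullet> ?y" if "P q n = 0" for n
    using codazzi[OF that, of ?X] normal_D_H[OF that, of ?X] by simp
  have LPadd: "LP q v = LP q ?X + LP q ?a"
    using v_split[of q] by (metis linear_add[OF linear_LP])
  have vadd: "v \<bullet> z = ?X \<bullet> z + ?a \<bullet> z" for z
    using v_split[of q] by (metis inner_add_left)
  have Sv: "S q c v = S q c ?X + S q c ?a" for c
    using v_split[of q] by (metis linear_add[OF linear_S])
  have 1: "v \<bullet> LP q v = - 2 * (\<Sum>c\<in>Basis. (norm (S q c ?X))\<^sup>2) + 2 * (?a \<bullet> ?y)
      + 2 * (\<Sum>c\<in>Basis. (norm (S q c ?a))\<^sup>2)"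
  proof -
    have "v \<bullet> LP q v = ?X \<bullet> LP q ?X + ?X \<bullet> LP q ?a + ?a \<bullet> LP q ?X + ?a \<bullet> LP q ?a"
      by (simp add: LPadd inner_add_right vadd)
    also have "?X \<bullet> LP q ?a = ?a \<bullet> LP q ?X"
      by (metis LP_symmetric inner_commute)
    finally show ?thesis
      by (simp add: LP_tangent LP_normal P_vn cod power2_norm_eq_inner)
  qed
  have 2: "v \<bullet> LP q ?N = ?N \<bullet> ?y + 2 * (\<Sum>c\<in>Basis. S q c ?a \<bullet> S q c ?N)"
  proof -
    have "v \<bullet> LP q ?N = ?X \<bullet> LP q ?N + ?a \<bullet> LP q ?N" by (rule vadd)
    also have "?X \<bullet> LP q ?N = ?N \<bullet> LP q ?X" by (metis LP_symmetric inner_commute)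
    finally show ?thesis by (simp add: LP_normal P_vn P_N cod)
  qed
  have 3: "S q c v \<bullet> S q c ?N = S q c ?a \<bullet> S q c ?N" for c
  proof -
    have "S q c ?X \<bullet> S q c ?N = 0"
      using orthogonal_simps(1)[of q 0 c "S q c ?N"] by (simp add: P_simps S_normal[OF P_N])
    then show ?thesis by (simp add: Sv inner_add_left)
  qed
  have "(\<Sum>c\<in>Basis. D (\<lambda>r. D w r c) q c) =
      - (1/2) * (v \<bullet> LP q v) + 2 * (v \<bullet> LP q ?N) - 2 * (\<Sum>c\<in>Basis. S q c ?a \<bullet> S q c ?N)"
    by (simp add: D_D_w 3 sum.distrib sum_subtractf sum_negf LP_def inner_sum_right sum_distrib_left sum_divide_distrib)
  moreover have "D w q (G q) = - (?y \<bullet> (?a - 2 *\<^sub>R ?N))"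
    by (simp only: D_w S_G)
  ultimately show ?thesis
    by (simp add: 1 2 inner_diff_right inner_commute field_simps)
qed

text \<open>The vector field of the integration by parts: the gradient of \<open>w\<close>,
  multiplied by the square of the cutoff and by the weight. The weight inside turns the Laplacian in
  its divergence into the drift Laplacian.\<close>

definition Z :: "('a \<Rightarrow> real) \<Rightarrow> 'a \<Rightarrow> 'e" where
  "Z \<phi> q = (\<phi> q * \<phi> q * \<omega> q) *\<^sub>R (\<Sum>c\<in>Basis. D w q c *\<^sub>R c)"

lemma smooth_Z: "smooth_map \<A> \<phi> \<Longrightarrow> smooth_map \<A> (Z \<phi>)"
  unfolding Z_def[abs_def]
  by (intro smooth_map_scaleR smooth_map_mult smooth_\<omega> smooth_map_sum smooth_map_D smooth_w smooth_map_const)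

lemma D_eq_gradient: "smooth_map \<A> y \<Longrightarrow> (\<Sum>c\<in>Basis. (D y q c :: real) * (b \<bullet> c)) = D y q b"
  by (subst (2) euclidean_representation[of b, symmetric])
    (simp add: linear_sum[OF linear_D] linear_scale[OF linear_D] mult.commute)

lemma tangent_Z: "P q (Z \<phi> q) = Z \<phi> q"
proof -
  have "P q (\<Sum>c\<in>Basis. D w q c *\<^sub>R c) = (\<Sum>c\<in>Basis. D w q c *\<^sub>R c)"
  proof (rule euclidean_eqI)
    fix b :: 'e assume b: "b \<in> Basis"
    have "P q (\<Sum>c\<in>Basis. D w q c *\<^sub>R c) \<bullet> b = P q b \<bullet> (\<Sum>c\<in>Basis. D w q c *\<^sub>R c)"
      by (simp only: P_inner inner_commute)
    also have "\<dots> = (\<Sum>c\<in>Basis. D w q c * (P q b \<bullet> c))"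
      by (simp add: inner_sum_right)
    also have "\<dots> = D w q b" by (simp only: D_eq_gradient[OF smooth_w] D_P[OF smooth_w])
    finally show "P q (\<Sum>c\<in>Basis. D w q c *\<^sub>R c) \<bullet> b = (\<Sum>c\<in>Basis. D w q c *\<^sub>R c) \<bullet> b"
      using b by (simp add: inner_sum_left inner_Basis if_distrib cong: if_cong)
  qed
  then show ?thesis by (simp add: Z_def P_simps)
qed

lemma divergence_Z:
  assumes \<phi>: "smooth_map \<A> \<phi>"
  shows "(\<Sum>c\<in>Basis. D (Z \<phi>) q c \<bullet> c) =
    \<omega> q * (2 * \<phi> q * (\<Sum>c\<in>Basis. D \<phi> q c * D w q c)
      + (\<phi> q)\<^sup>2 * ((\<Sum>c\<in>Basis. D (\<lambda>r. D w r c) q c) - D w q (G q)))"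
proof -
  have "D (Z \<phi>) q c \<bullet> c = \<omega> q * (2 * \<phi> q * (D \<phi> q c * D w q c)
      + (\<phi> q)\<^sup>2 * (D (\<lambda>r. D w r c) q c - D w q c * (G q \<bullet> c)))" if c: "c \<in> Basis" for c
  proof -
    have "D (Z \<phi>) q c \<bullet> c = D (\<lambda>r. Z \<phi> r \<bullet> c) q c"
      by (simp add: D_inner smooth_Z \<phi> smooth_map_const D_const)
    also have "(\<lambda>r. Z \<phi> r \<bullet> c) = (\<lambda>r. \<phi> r * \<phi> r * \<omega> r * D w r c)"
      using c by (simp add: Z_def inner_sum_left inner_Basis if_distrib cong: if_cong)
    also have "D \<dots> q c = \<phi> q * \<phi> q * \<omega> q * D (\<lambda>r. D w r c) q c
        + (\<phi> q * \<phi> q * D \<omega> q c + (\<phi> q * D \<phi> q c + D \<phi> q c * \<phi> q) * \<omega> q) * D w q c"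
      by (simp only: D_mult smooth_map_mult \<phi> smooth_\<omega> smooth_map_D smooth_w)
    finally show ?thesis
      by (simp add: D_\<omega> power2_eq_square algebra_simps)
  qed
  then have "(\<Sum>c\<in>Basis. D (Z \<phi>) q c \<bullet> c) = (\<Sum>c\<in>Basis. \<omega> q * (2 * \<phi> q * (D \<phi> q c * D w q c)
      + (\<phi> q)\<^sup>2 * (D (\<lambda>r. D w r c) q c - D w q c * (G q \<bullet> c))))"
    by (intro sum.cong refl)
  also have "\<dots> = \<omega> q * (2 * \<phi> q * (\<Sum>c\<in>Basis. D \<phi> q c * D w q c)
      + (\<phi> q)\<^sup>2 * ((\<Sum>c\<in>Basis. D (\<lambda>r. D w r c) q c) - (\<Sum>c\<in>Basis. D w q c * (G q \<bullet> c))))"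
    by (simp only: sum_distrib_left[symmetric] sum.distrib sum_subtractf)
  finally show ?thesis by (simp only: D_eq_gradient[OF smooth_w])
qed

lemma D_test:
  assumes \<phi>: "smooth_map \<A> \<phi>"
  shows "D (\<lambda>r. \<phi> r *\<^sub>R u r) q c = (D \<phi> q c *\<^sub>R u q - \<phi> q *\<^sub>R S q c (P q v)) - \<phi> q *\<^sub>R S q c (u q)"
    "P q (D (\<lambda>r. \<phi> r *\<^sub>R u r) q c) = - \<phi> q *\<^sub>R S q c (u q)"
proof -
  have "D u q c = - S q c v + S q c (N q)"
    by (simp add: u_def[abs_def] vn_def[abs_def] D_diff smooth_map_diff smooth_map_const smooth_map_P smooth_N
        D_const D_N S_def)
  also have "v = P q v + u q + N q" by (simp add: u_def vn_def)
  then have "S q c v = S q c (P q v) + S q c (u q) + S q c (N q)"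
    by (metis linear_add[OF linear_S])
  finally have Du: "D u q c = - S q c (P q v) - S q c (u q)" by simp
  show 1: "D (\<lambda>r. \<phi> r *\<^sub>R u r) q c = (D \<phi> q c *\<^sub>R u q - \<phi> q *\<^sub>R S q c (P q v)) - \<phi> q *\<^sub>R S q c (u q)"
    by (simp add: D_scaleR \<phi> smooth_u Du algebra_simps)
  show "P q (D (\<lambda>r. \<phi> r *\<^sub>R u r) q c) = - \<phi> q *\<^sub>R S q c (u q)"
    unfolding 1 by (simp add: P_simps P_u S_tangent S_normal)
qed

text \<open>Apart from the weight and the term of order zero, the difference of the integrand and
  the divergence is, for each \<open>c\<close>, equal to \<open>(D \<phi> q c)\<^sup>2 * ((norm (u
  q))\<^sup>2 + (norm (P q v))\<^sup>2)\<close> minus the squared norm of \<open>\<phi> q *\<^sub>R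
  S q c (N q) + D \<phi> q c *\<^sub>R P q v\<close>. That square is dropped.\<close>

lemma integrand_le:
  assumes \<phi>: "smooth_map \<A> \<phi>"
  defines "\<eta> \<equiv> \<lambda>r. \<phi> r *\<^sub>R u r"
  shows "\<omega> q * ((\<Sum>c\<in>Basis. (norm (D \<eta> q c))\<^sup>2) - 2 * (\<Sum>c\<in>Basis. (norm (P q (D \<eta> q c)))\<^sup>2) - (norm (\<eta> q))\<^sup>2)
    \<le> (\<Sum>c\<in>Basis. D (Z \<phi>) q c \<bullet> c)
      + \<omega> q * ((\<Sum>c\<in>Basis. (D \<phi> q c)\<^sup>2) * ((norm (u q))\<^sup>2 + (norm v)\<^sup>2) - (\<phi> q)\<^sup>2 * (norm (u q))\<^sup>2)"
proof -
  let ?X = "P q v" and ?a = "vn q" and ?N = "N q" and ?u = "u q"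
  let ?t = "\<phi> q"
  have lhs: "(norm (D \<eta> q c))\<^sup>2 - 2 * (norm (P q (D \<eta> q c)))\<^sup>2 =
      (D \<phi> q c)\<^sup>2 * (norm ?u)\<^sup>2 - 2 * ?t * D \<phi> q c * (S q c ?X \<bullet> ?u) + ?t\<^sup>2 * (norm (S q c ?X))\<^sup>2
      - ?t\<^sup>2 * (norm (S q c ?u))\<^sup>2" for c
  proof -
    have 1: "S q c ?X \<bullet> S q c ?u = 0"
      using orthogonal_simps(1)[of q 0 c "S q c ?u"] by (simp add: P_simps S_normal P_u)
    have 2: "S q c ?u \<bullet> ?u = 0" by (rule orthogonal_simps(2)[OF P_u P_u])
    show ?thesis
      unfolding \<eta>_def D_test(2)[OF \<phi>] unfolding D_test(1)[OF \<phi>] power2_norm_eq_inner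
      using 1 2 by (simp add: inner_diff_left inner_diff_right inner_commute power2_eq_square algebra_simps)
  qed
  have Su: "S q c ?u = S q c ?a - S q c ?N" for c by (simp add: u_def S_linear_simps)
  have diff: "(norm (D \<eta> q c))\<^sup>2 - 2 * (norm (P q (D \<eta> q c)))\<^sup>2
     - (2 * ?t * (D \<phi> q c * D w q c) + ?t\<^sup>2 * ((norm (S q c ?X))\<^sup>2 - (norm (S q c ?a))\<^sup>2 + 2 * (S q c ?a \<bullet> S q c ?N)))
     \<le> (D \<phi> q c)\<^sup>2 * ((norm ?u)\<^sup>2 + (norm v)\<^sup>2)" for c
  proof -
    have Xv: "(norm ?X)\<^sup>2 \<le> (norm v)\<^sup>2"
    proof -
      have "(norm v)\<^sup>2 = (norm ?X)\<^sup>2 + (norm ?a)\<^sup>2"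
        unfolding power2_norm_eq_inner
        using tangent_normal_orthogonal[of q ?X ?a, OF P_idem P_vn]
        by (subst (1 2) v_split[of q]) (simp add: inner_add_left inner_add_right inner_commute)
      then show ?thesis by simp
    qed
    have "0 \<le> (norm (?t *\<^sub>R S q c ?N + D \<phi> q c *\<^sub>R ?X))\<^sup>2" by simp
    also have "\<dots> = ?t\<^sup>2 * (norm (S q c ?N))\<^sup>2 + 2 * ?t * D \<phi> q c * (S q c ?X \<bullet> ?N) + (D \<phi> q c)\<^sup>2 * (norm ?X)\<^sup>2"
      unfolding power2_norm_eq_inner S_symmetric[of q c ?X ?N]
      by (simp add: inner_add_left inner_add_right inner_commute power2_eq_square algebra_simps)
    also have "\<dots> \<le> ?t\<^sup>2 * (norm (S q c ?N))\<^sup>2 + 2 * ?t * D \<phi> q c * (S q c ?X \<bullet> ?N) + (D \<phi> q c)\<^sup>2 * (norm v)\<^sup>2"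
      by (intro add_left_mono mult_left_mono Xv) simp
    finally have key: "- (2 * ?t * D \<phi> q c * (S q c ?X \<bullet> ?N)) - ?t\<^sup>2 * (norm (S q c ?N))\<^sup>2 \<le> (D \<phi> q c)\<^sup>2 * (norm v)\<^sup>2"
      by simp
    have nSu: "(norm (S q c ?u))\<^sup>2 = (norm (S q c ?a))\<^sup>2 - 2 * (S q c ?a \<bullet> S q c ?N) + (norm (S q c ?N))\<^sup>2"
      unfolding Su power2_norm_eq_inner by (simp add: inner_diff_left inner_diff_right inner_commute)
    have uN: "S q c ?X \<bullet> ?u = S q c ?X \<bullet> ?a - S q c ?X \<bullet> ?N" by (simp add: u_def inner_diff_right)
    have wN: "D w q c = - (S q c ?X \<bullet> ?a) + 2 * (S q c ?X \<bullet> ?N)" by (simp add: D_w inner_diff_right)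
    show ?thesis
      unfolding lhs nSu uN wN using key by (simp add: algebra_simps)
  qed
  have "(\<Sum>c\<in>Basis. (norm (D \<eta> q c))\<^sup>2 - 2 * (norm (P q (D \<eta> q c)))\<^sup>2
     - (2 * ?t * (D \<phi> q c * D w q c) + ?t\<^sup>2 * ((norm (S q c ?X))\<^sup>2 - (norm (S q c ?a))\<^sup>2 + 2 * (S q c ?a \<bullet> S q c ?N))))
     \<le> (\<Sum>c\<in>Basis. (D \<phi> q c)\<^sup>2 * ((norm ?u)\<^sup>2 + (norm v)\<^sup>2))"
    by (intro sum_mono diff)
  also have "(\<Sum>c\<in>Basis. (norm (D \<eta> q c))\<^sup>2 - 2 * (norm (P q (D \<eta> q c)))\<^sup>2
     - (2 * ?t * (D \<phi> q c * D w q c) + ?t\<^sup>2 * ((norm (S q c ?X))\<^sup>2 - (norm (S q c ?a))\<^sup>2 + 2 * (S q c ?a \<bullet> S q c ?N))))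
    = (\<Sum>c\<in>Basis. (norm (D \<eta> q c))\<^sup>2) - 2 * (\<Sum>c\<in>Basis. (norm (P q (D \<eta> q c)))\<^sup>2)
      - (2 * ?t * (\<Sum>c\<in>Basis. D \<phi> q c * D w q c)
         + ?t\<^sup>2 * ((\<Sum>c\<in>Basis. D (\<lambda>r. D w r c) q c) - D w q (G q)))"
    by (simp only: Laplace_w sum.distrib sum_subtractf sum_distrib_left[symmetric])
  finally have "(\<Sum>c\<in>Basis. (norm (D \<eta> q c))\<^sup>2) - 2 * (\<Sum>c\<in>Basis. (norm (P q (D \<eta> q c)))\<^sup>2) - (norm (\<eta> q))\<^sup>2
    \<le> (2 * ?t * (\<Sum>c\<in>Basis. D \<phi> q c * D w q c)
         + ?t\<^sup>2 * ((\<Sum>c\<in>Basis. D (\<lambda>r. D w r c) q c) - D w q (G q)))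
      + ((\<Sum>c\<in>Basis. (D \<phi> q c)\<^sup>2) * ((norm ?u)\<^sup>2 + (norm v)\<^sup>2) - ?t\<^sup>2 * (norm ?u)\<^sup>2)"
    by (simp add: \<eta>_def sum_distrib_right power_mult_distrib)
  then have "\<omega> q * ((\<Sum>c\<in>Basis. (norm (D \<eta> q c))\<^sup>2) - 2 * (\<Sum>c\<in>Basis. (norm (P q (D \<eta> q c)))\<^sup>2) - (norm (\<eta> q))\<^sup>2)
    \<le> \<omega> q * ((2 * ?t * (\<Sum>c\<in>Basis. D \<phi> q c * D w q c)
         + ?t\<^sup>2 * ((\<Sum>c\<in>Basis. D (\<lambda>r. D w r c) q c) - D w q (G q)))
      + ((\<Sum>c\<in>Basis. (D \<phi> q c)\<^sup>2) * ((norm ?u)\<^sup>2 + (norm v)\<^sup>2) - ?t\<^sup>2 * (norm ?u)\<^sup>2))"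
    using \<omega>_pos[of q] by (intro mult_left_mono) auto
  then show ?thesis
    by (simp only: divergence_Z[OF \<phi>] distrib_left)
qed

end

subsection \<open>Change of variables\<close>

text \<open>The change of variables theorem of the library requires a well-ordered index type. A finite
  type without an order is replaced by a copy of it, ordered through an enumeration.\<close>

typedef 'm ordered = "UNIV :: 'm set" by simp

definition enumeration :: "'m::finite ordered \<Rightarrow> nat" where
  "enumeration = (SOME f. inj f)"

instance ordered :: (finite) finite
proof
  have "(UNIV :: 'a ordered set) = range Abs_ordered"
    by (metis Rep_ordered_inverse surjI surj_def)
  then show "finite (UNIV :: 'a ordered set)"
    using finite_imageI[of "UNIV :: 'a set" Abs_ordered] by simp
qed

lemma inj_enumeration: "inj (enumeration :: 'm::finite ordered \<Rightarrow> nat)"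
proof -
  have "\<exists>f :: 'm ordered \<Rightarrow> nat. inj f"
    using finite_imp_inj_to_nat_seg[of "UNIV :: 'm ordered set"] by auto
  then show ?thesis unfolding enumeration_def by (rule someI_ex)
qed

instantiation ordered :: (finite) wellorder
begin

definition less_eq_ordered :: "'a ordered \<Rightarrow> 'a ordered \<Rightarrow> bool" where
  "x \<le> y \<longleftrightarrow> enumeration x \<le> enumeration y"

definition less_ordered :: "'a ordered \<Rightarrow> 'a ordered \<Rightarrow> bool" where
  "x < y \<longleftrightarrow> enumeration x < enumeration y"

instance
proof
  fix x y z :: "'a ordered" and Q :: "'a ordered \<Rightarrow> bool"
  show "x < y \<longleftrightarrow> x \<le> y \<and> \<not> y \<le> x" by (auto simp: less_eq_ordered_def less_ordered_def)
  show "x \<le> x" by (simp add: less_eq_ordered_def)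
  show "x \<le> y \<Longrightarrow> y \<le> z \<Longrightarrow> x \<le> z" by (simp add: less_eq_ordered_def)
  show "x \<le> y \<Longrightarrow> y \<le> x \<Longrightarrow> x = y"
    using inj_enumeration[where 'm = 'a] by (simp add: less_eq_ordered_def inj_eq)
  show "x \<le> y \<or> y \<le> x" by (auto simp: less_eq_ordered_def)
  show "(\<And>x. (\<And>y. y < x \<Longrightarrow> Q y) \<Longrightarrow> Q x) \<Longrightarrow> Q x"
    unfolding less_ordered_def by (rule measure_induct_rule[of enumeration Q]) blast
qed

end

definition to_ord :: "real ^ 'm::finite \<Rightarrow> real ^ 'm ordered" where
  "to_ord u = (\<chi> i. u $ Rep_ordered i)"

definition of_ord :: "real ^ 'm::finite ordered \<Rightarrow> real ^ 'm" where
  "of_ord w = (\<chi> j. w $ Abs_ordered j)"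

lemma of_ord_nth: "of_ord w $ j = w $ Abs_ordered j"
  by (simp add: of_ord_def)

lemma of_ord_to_ord [simp]: "of_ord (to_ord u) = u"
  by (simp add: of_ord_def to_ord_def Abs_ordered_inverse)

lemma to_ord_of_ord [simp]: "to_ord (of_ord w) = w"
  by (simp add: of_ord_def to_ord_def Rep_ordered_inverse)

lemma bounded_linear_to_ord: "bounded_linear to_ord"
  by (intro linear_conv_bounded_linear[THEN iffD1] linearI) (simp_all add: to_ord_def vec_eq_iff)

lemma bounded_linear_of_ord: "bounded_linear of_ord"
  by (intro linear_conv_bounded_linear[THEN iffD1] linearI) (simp_all add: of_ord_def vec_eq_iff)

lemma to_ord_axis: "to_ord (axis j r) = axis (Abs_ordered j) r"
  by (auto simp: to_ord_def axis_def vec_eq_iff Abs_ordered_inverse Rep_ordered_inverse)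

lemma of_ord_axis: "of_ord (axis i r) = axis (Rep_ordered i) r"
  using to_ord_axis[of "Rep_ordered i" r] by (metis Rep_ordered_inverse of_ord_to_ord)

lemma bij_Rep_ordered: "bij (Rep_ordered :: 'm ordered \<Rightarrow> 'm)"
  by (rule bijI') (auto simp: Rep_ordered_inject intro: exI[of _ "Abs_ordered _"] Abs_ordered_inverse[symmetric])

lemma measurable_to_ord [measurable]: "to_ord \<in> borel_measurable borel"
  and measurable_of_ord [measurable]: "of_ord \<in> borel_measurable borel"
  by (auto intro!: borel_measurable_continuous_onI linear_continuous_on bounded_linear_to_ord bounded_linear_of_ord)

lemma distr_lborel_to_ord: "distr lborel borel (to_ord :: real ^ 'm::finite \<Rightarrow> _) = lborel"
proof (rule lborel_eqI[symmetric])
  fix l u :: "real ^ 'm ordered"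
  assume le: "\<And>b. b \<in> Basis \<Longrightarrow> l \<bullet> b \<le> u \<bullet> b"
  have le': "l $ i \<le> u $ i" for i
    using le[of "axis i 1"] by (simp add: axis_in_Basis_iff inner_axis)
  have "to_ord -` box l u = box (of_ord l) (of_ord u)"
    by (auto simp: mem_box_cart to_ord_def of_ord_def) (metis Abs_ordered_inverse UNIV_I Rep_ordered_inverse)+
  then have "emeasure (distr lborel borel to_ord) (box l u) = emeasure lborel (box (of_ord l) (of_ord u))"
    by (simp add: emeasure_distr)
  also have "\<dots> = (\<Prod>b\<in>Basis. (of_ord u - of_ord l) \<bullet> b)"
    by (rule emeasure_lborel_box) (auto simp: Basis_vec_def inner_axis of_ord_def le')
  also have "(\<Prod>b\<in>Basis. (of_ord u - of_ord l) \<bullet> b) = (\<Prod>b\<in>Basis. (u - l) \<bullet> b)"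
    by (rule prod.reindex_bij_witness[of _ of_ord to_ord])
      (auto simp: Basis_vec_def to_ord_axis of_ord_axis inner_axis of_ord_nth Abs_ordered_inverse Rep_ordered_inverse)
  finally show "emeasure (distr lborel borel to_ord) (box l u) = ennreal (\<Prod>b\<in>Basis. (u - l) \<bullet> b)" .
qed simp

section \<open>Determinants and Lebesgue measure under a change of the index type\<close>

lemma swapidseq_conjugate:
  assumes "swapidseq n p" "bij f"
  shows "swapidseq n (f \<circ> p \<circ> inv f)"
  using assms(1)
proof induction
  case id
  have "f \<circ> inv f = id" by (rule iffD1[OF surj_iff bij_is_surj[OF assms(2)]])
  then show ?case by (simp only: comp_id swapidseq.id)
next
  case (comp_Suc n p a b)
  have "f \<circ> (Transposition.transpose a b \<circ> p) \<circ> inv f = Transposition.transpose (f a) (f b) \<circ> (f \<circ> p \<circ> inv f)"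
    using bij_is_inj[OF assms(2)] by (auto simp: fun_eq_iff Transposition.transpose_def inj_eq)
  moreover have "f a \<noteq> f b" using comp_Suc.hyps assms(2) by (auto simp: bij_is_inj inj_eq)
  ultimately show ?case using swapidseq.comp_Suc[OF comp_Suc.IH] by (simp only: )
qed

lemma sign_conjugate:
  assumes "permutation p" "bij f"
  shows "sign (f \<circ> p \<circ> inv f) = sign p"
proof -
  obtain n where n: "swapidseq n p" using assms(1) by (auto simp: permutation_def)
  show ?thesis
    using evenperm_unique[OF n refl] evenperm_unique[OF swapidseq_conjugate[OF n assms(2)] refl]
    by (simp add: sign_def)
qed

text \<open>Conjugation by \<open>f\<close> is a bijection between the permutations of the two index
  types, and it preserves signs because it maps transpositions to transpositions.\<close>

lemma det_reindex:
  fixes A :: "real ^ 'm::finite ^ 'm" and f :: "'k::finite \<Rightarrow> 'm"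
  assumes "bij f"
  shows "det (\<chi> i j. A $ f i $ f j) = det A"
proof -
  have b: "bij (inv f)" by (rule bij_imp_bij_inv[OF assms])
  have inv: "inv f (f i) = i" "f (inv f j) = j" for i j
    using assms by (auto simp: bij_is_inj bij_is_surj surj_f_inv_f)
  have perm: "f \<circ> p \<circ> inv f permutes UNIV" if "p permutes UNIV" for p
    by (rule bij_imp_permutes) (auto intro!: bij_comp b assms permutes_bij[OF that])
  have perm': "inv f \<circ> p \<circ> f permutes UNIV" if "p permutes UNIV" for p
    by (rule bij_imp_permutes) (auto intro!: bij_comp b assms permutes_bij[OF that])
  show ?thesis
    unfolding det_def
  proof (rule sum.reindex_bij_witness[of _ "\<lambda>p. inv f \<circ> p \<circ> f" "\<lambda>p. f \<circ> p \<circ> inv f"])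
    fix p :: "'k \<Rightarrow> 'k" assume p: "p \<in> {p. p permutes UNIV}"
    show "inv f \<circ> (f \<circ> p \<circ> inv f) \<circ> f = p" by (simp add: fun_eq_iff inv)
    show "f \<circ> p \<circ> inv f \<in> {p. p permutes UNIV}" using perm p by simp
    have "sign (f \<circ> p \<circ> inv f) = sign p"
      using p by (intro sign_conjugate assms) (auto simp: permutation_permutes)
    moreover have "(\<Prod>i\<in>UNIV. A $ i $ (f \<circ> p \<circ> inv f) i) = (\<Prod>i\<in>UNIV. A $ f i $ f (p i))"
      by (rule prod.reindex_bij_witness[of _ f "inv f"]) (auto simp: inv)
    ultimately show "of_int (sign (f \<circ> p \<circ> inv f)) * (\<Prod>i\<in>UNIV. A $ i $ (f \<circ> p \<circ> inv f) i)
      = of_int (sign p) * (\<Prod>i\<in>UNIV. (\<chi> i j. A $ f i $ f j) $ i $ p i)" by simp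
  next
    fix p :: "'m \<Rightarrow> 'm" assume p: "p \<in> {p. p permutes UNIV}"
    show "f \<circ> (inv f \<circ> p \<circ> f) \<circ> inv f = p" by (simp add: fun_eq_iff inv)
    show "inv f \<circ> p \<circ> f \<in> {p. p permutes UNIV}" using perm' p by simp
  qed
qed

text \<open>The underlying theorem is an equivalence about finite values. It settles the infinite
  case too: a finite integral of the Jacobian would force the image to have finite measure.\<close>

lemma emeasure_image_wellorder:
  fixes f :: "real ^ 'n::{finite,wellorder} \<Rightarrow> real ^ 'n::_"
  assumes S: "S \<in> sets borel" and fS: "f ` S \<in> sets borel" and inj: "inj_on f S"
    and der: "\<And>u. u \<in> S \<Longrightarrow> (f has_derivative f' u) (at u)"
    and meas: "(\<lambda>u. indicator S u * \<bar>det (matrix (f' u))\<bar>) \<in> borel_measurable borel"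
  shows "emeasure lborel (f ` S) = (\<integral>\<^sup>+u. ennreal (indicator S u * \<bar>det (matrix (f' u))\<bar>) \<partial>lborel)"
proof -
  let ?h = "\<lambda>u. \<bar>det (matrix (f' u))\<bar>"
  have eqv: "f ` S \<in> lmeasurable \<and> measure lebesgue (f ` S) = m \<longleftrightarrow> (?h has_integral m) S" for m
    using S der inj by (intro has_measure_differentiable_image) (auto intro: has_derivative_at_withinI)
  have em: "emeasure lebesgue (f ` S) = emeasure lborel (f ` S)"
    using fS by simp
  show ?thesis
  proof (cases "f ` S \<in> lmeasurable")
    case True
    then have "(?h has_integral measure lebesgue (f ` S)) S" using eqv by blast
    then have "(\<integral>\<^sup>+u. ennreal (indicator S u * ?h u) \<partial>lborel) = ennreal (measure lebesgue (f ` S))"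
      using nn_integral_has_integral_lebesgue[of S ?h] by simp
    also have "\<dots> = emeasure lebesgue (f ` S)"
      using True by (simp add: emeasure_eq_measure2 fmeasurableD2)
    finally show ?thesis using em by simp
  next
    case False
    have "emeasure lebesgue (f ` S) = \<infinity>"
      using False fS by (auto simp: fmeasurable_def less_top[symmetric])
    moreover have "(\<integral>\<^sup>+u. ennreal (indicator S u * ?h u) \<partial>lborel) = \<infinity>"
    proof (rule ccontr)
      assume "\<not> ?thesis"
      then obtain r where r: "0 \<le> r" "(\<integral>\<^sup>+u. ennreal (indicator S u * ?h u) \<partial>lborel) = ennreal r"
        by (cases "\<integral>\<^sup>+u. ennreal (indicator S u * ?h u) \<partial>lborel" rule: ennreal_cases) auto
      have "((\<lambda>u. indicator S u * ?h u) has_integral r) UNIV"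
        by (rule nn_integral_has_integral[OF meas _ r(2,1)]) auto
      then have "((\<lambda>u. if u \<in> S then ?h u else 0) has_integral r) UNIV"
        by (rule has_integral_eq[rotated]) (auto simp: indicator_def)
      then have "(?h has_integral r) S" by (simp add: has_integral_restrict_UNIV)
      then show False using eqv False by blast
    qed
    ultimately show ?thesis using em by simp
  qed
qed

lemma emeasure_diffeo_image:
  fixes f :: "real ^ 'm::finite \<Rightarrow> real ^ 'm"
  assumes S: "S \<in> sets borel" and fS: "f ` S \<in> sets borel" and inj: "inj_on f S"
    and der: "\<And>u. u \<in> S \<Longrightarrow> (f has_derivative f' u) (at u)"
    and meas: "(\<lambda>u. indicator S u * \<bar>det (matrix (f' u))\<bar>) \<in> borel_measurable borel"
  shows "emeasure lborel (f ` S) = (\<integral>\<^sup>+u. ennreal (indicator S u * \<bar>det (matrix (f' u))\<bar>) \<partial>lborel)"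
proof -
  let ?F = "\<lambda>w. to_ord (f (of_ord w))"
  let ?F' = "\<lambda>w h. to_ord (f' (of_ord w) (of_ord h))"
  let ?S = "of_ord -` S"
  have det: "det (matrix (?F' w)) = det (matrix (f' (of_ord w)))" for w
  proof -
    have "matrix (?F' w) = (\<chi> i j. matrix (f' (of_ord w)) $ Rep_ordered i $ Rep_ordered j)"
      by (simp add: matrix_def vec_eq_iff to_ord_def of_ord_axis)
    then show ?thesis by (simp add: det_reindex[OF bij_Rep_ordered])
  qed
  have S': "?S \<in> sets borel" using measurable_sets_borel[OF measurable_of_ord S] .
  have FS: "?F ` ?S = of_ord -` (f ` S)"
  proof (intro equalityI subsetI)
    fix w assume "w \<in> of_ord -` (f ` S)"
    then obtain s where s: "s \<in> S" "of_ord w = f s" by auto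
    then have "w = ?F (to_ord s)" by (metis of_ord_to_ord to_ord_of_ord)
    moreover have "to_ord s \<in> ?S" using s by simp
    ultimately show "w \<in> ?F ` ?S" by blast
  qed auto
  have "emeasure lborel (f ` S) = emeasure (distr lborel borel to_ord) (of_ord -` (f ` S))"
    using measurable_sets_borel[OF measurable_of_ord fS] by (simp add: emeasure_distr vimage_def)
  also have "\<dots> = emeasure lborel (?F ` ?S)" by (simp only: FS distr_lborel_to_ord)
  also have "\<dots> = (\<integral>\<^sup>+w. ennreal (indicator ?S w * \<bar>det (matrix (?F' w))\<bar>) \<partial>lborel)"
  proof (rule emeasure_image_wellorder[OF S'])
    show "?F ` ?S \<in> sets borel" unfolding FS by (rule measurable_sets_borel[OF measurable_of_ord fS])
    show "inj_on ?F ?S"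
      using inj by (auto simp: inj_on_def) (metis of_ord_to_ord to_ord_of_ord)
    show "(?F has_derivative ?F' w) (at w)" if "w \<in> ?S" for w
      by (intro bounded_linear.has_derivative[OF bounded_linear_to_ord]
          has_derivative_compose[OF bounded_linear_imp_has_derivative[OF bounded_linear_of_ord]] der)
        (use that in simp)
    have "(\<lambda>w. indicator S (of_ord w) * \<bar>det (matrix (f' (of_ord w)))\<bar>) \<in> borel_measurable borel"
      using measurable_compose[OF measurable_of_ord meas] .
    then show "(\<lambda>w. indicator ?S w * \<bar>det (matrix (?F' w))\<bar>) \<in> borel_measurable borel"
      by (simp add: det indicator_def)
  qed
  also have "\<dots> = (\<integral>\<^sup>+w. ennreal (indicator S (of_ord w) * \<bar>det (matrix (f' (of_ord w)))\<bar>) \<partial>distr lborel borel to_ord)"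
    by (simp add: det distr_lborel_to_ord indicator_def)
  also have "\<dots> = (\<integral>\<^sup>+u. ennreal (indicator S u * \<bar>det (matrix (f' u))\<bar>) \<partial>lborel)"
    by (subst nn_integral_distr)
      (auto intro!: measurable_compose[OF _ measurable_ennreal] measurable_compose[OF measurable_of_ord meas])
  finally show ?thesis .
qed

lemma borel_measurable_extend:
  fixes f :: "'a::topological_space \<Rightarrow> 'b::topological_space"
  assumes "open U" "continuous_on U f"
  shows "(\<lambda>u. if u \<in> U then f u else k) \<in> borel_measurable borel"
proof (rule borel_measurableI)
  fix V :: "'b set" assume "open V"
  then have "open (U \<inter> f -` V)" using assms by (intro continuous_open_preimage)
  moreover have "(\<lambda>u. if u \<in> U then f u else k) -` V = (U \<inter> f -` V) \<union> (if k \<in> V then - U else {})"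
    by (auto split: if_splits)
  ultimately show "(\<lambda>u. if u \<in> U then f u else k) -` V \<inter> space borel \<in> sets borel"
    using assms(1) by auto
qed

lemma borel_measurable_indicator_mult:
  fixes f :: "'a::topological_space \<Rightarrow> real"
  assumes "open U" "continuous_on U f"
  shows "(\<lambda>u. indicator U u * f u) \<in> borel_measurable borel"
proof -
  have "(\<lambda>u. indicator U u * f u) = (\<lambda>u. if u \<in> U then f u else 0)" by auto
  then show ?thesis using borel_measurable_extend[OF assms] by simp
qed

text \<open>The formula for the measure of images says that pushing forward the Jacobian density
  gives Lebesgue measure on the image of \<open>W\<close>. Integrating \<open>g\<close> against both
  measures is the claim.\<close>

lemma nn_integral_diffeo:
  fixes f :: "real ^ 'm::finite \<Rightarrow> real ^ 'm" and g :: "real ^ 'm \<Rightarrow> ennreal"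
  assumes W: "open W" and fW: "open (f ` W)"
    and cont: "continuous_on W f" and conth: "continuous_on (f ` W) h" and h: "\<And>u. u \<in> W \<Longrightarrow> h (f u) = u"
    and der: "\<And>u. u \<in> W \<Longrightarrow> (f has_derivative f' u) (at u)"
    and contd: "continuous_on W (\<lambda>u. det (matrix (f' u)))"
    and g: "g \<in> borel_measurable borel"
  shows "(\<integral>\<^sup>+w. indicator (f ` W) w * g w \<partial>lborel) =
    (\<integral>\<^sup>+u. ennreal (indicator W u * \<bar>det (matrix (f' u))\<bar>) * g (f u) \<partial>lborel)"
proof -
  let ?F = "\<lambda>u. if u \<in> W then f u else 0"
  let ?d = "\<lambda>u. indicator W u * \<bar>det (matrix (f' u))\<bar>"
  have F: "?F \<in> borel_measurable borel" by (rule borel_measurable_extend[OF W cont])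
  have md: "?d \<in> borel_measurable borel"
    by (intro borel_measurable_indicator_mult W continuous_on_rabs contd)
  have inj: "inj_on f W" by (rule inj_on_inverseI[of _ h]) (rule h)
  have imW: "f ` W \<in> sets borel" using fW by simp
  \<comment> \<open>The continuous inverse \<open>h\<close> exhibits the image of a Borel set as a
    preimage, hence as a Borel set.\<close>
  have im: "f ` S \<in> sets borel" if S: "S \<in> sets borel" "S \<subseteq> W" for S
  proof -
    have "f ` S = f ` W \<inter> (\<lambda>w. if w \<in> f ` W then h w else 0) -` S"
      (is "_ = ?R")
    proof (intro equalityI subsetI)
      fix w assume "w \<in> f ` S"
      then obtain u where "u \<in> S" "w = f u" by blast
      then show "w \<in> ?R" using S(2) h[of u] by auto
    next
      fix w assume "w \<in> ?R"
      then obtain u where "u \<in> W" "w = f u" "h w \<in> S" by (auto split: if_splits)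
      then show "w \<in> f ` S" using h by auto
    qed
    then show ?thesis
      using measurable_sets_borel[OF borel_measurable_extend[OF fW conth] S(1)] imW by (simp add: sets.Int)
  qed
  have "distr (density lborel (\<lambda>u. ennreal (?d u))) borel ?F = density lborel (indicator (f ` W))"
    (is "?M1 = ?M2")
  proof (rule measure_eqI)
    fix B assume "B \<in> sets ?M1"
    then have B: "B \<in> sets borel" by simp
    let ?S = "W \<inter> ?F -` B"
    have S: "?S \<in> sets borel" using measurable_sets_borel[OF F B] W by (simp add: sets.Int)
    have fS: "f ` ?S = f ` W \<inter> B" by auto
    have "emeasure ?M1 B = (\<integral>\<^sup>+u. ennreal (?d u) * indicator (?F -` B) u \<partial>lborel)"
      using F md B by (simp add: emeasure_distr emeasure_density measurable_sets_borel)
    also have "\<dots> = (\<integral>\<^sup>+u. ennreal (indicator ?S u * \<bar>det (matrix (f' u))\<bar>) \<partial>lborel)"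
      by (rule nn_integral_cong) (auto simp: indicator_def)
    also have "\<dots> = emeasure lborel (f ` ?S)"
    proof (rule emeasure_diffeo_image[symmetric, OF S im[OF S]])
      show "inj_on f ?S" by (rule inj_on_subset[OF inj]) auto
      show "(\<lambda>u. indicator ?S u * \<bar>det (matrix (f' u))\<bar>) \<in> borel_measurable borel"
      proof -
        have "(\<lambda>u. indicator ?S u * \<bar>det (matrix (f' u))\<bar>) = (\<lambda>u. indicator ?S u * ?d u)"
          by (auto simp: indicator_def)
        then show ?thesis using md S by simp
      qed
    qed (use der in auto)
    also have "\<dots> = emeasure ?M2 B"
    proof -
      have "emeasure ?M2 B = (\<integral>\<^sup>+u. indicator (f ` W) u * indicator B u \<partial>lborel)"
        using imW B by (simp add: emeasure_density)
      also have "\<dots> = (\<integral>\<^sup>+u. indicator (f ` W \<inter> B) u \<partial>lborel)"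
        by (simp add: indicator_inter_arith)
      finally show ?thesis using imW B by (simp add: fS sets.Int)
    qed
    finally show "emeasure ?M1 B = emeasure ?M2 B" .
  qed simp
  then have "(\<integral>\<^sup>+w. g w \<partial>?M2) = (\<integral>\<^sup>+w. g w \<partial>?M1)" by simp
  moreover have "(\<integral>\<^sup>+w. g w \<partial>?M2) = (\<integral>\<^sup>+w. indicator (f ` W) w * g w \<partial>lborel)"
    using imW g by (subst nn_integral_density) auto
  moreover have "(\<integral>\<^sup>+w. g w \<partial>?M1) = (\<integral>\<^sup>+u. ennreal (?d u) * g (?F u) \<partial>lborel)"
    using F g md by (subst nn_integral_distr, simp, simp, subst nn_integral_density) (auto intro: measurable_compose[OF F g])
  moreover have "(\<integral>\<^sup>+u. ennreal (?d u) * g (?F u) \<partial>lborel) = (\<integral>\<^sup>+u. ennreal (?d u) * g (f u) \<partial>lborel)"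
    by (rule nn_integral_cong) (auto simp: indicator_def)
  ultimately show ?thesis by simp
qed

lemma gram_compose:
  assumes E: "linear E" and T: "linear T"
  shows "gram (\<lambda>a. E (T a)) = Finite_Cartesian_Product.transpose (matrix T) ** gram E ** matrix T"
proof -
  have ET: "E (T (axis i 1)) = (\<Sum>k\<in>UNIV. matrix T $ k $ i *\<^sub>R E (axis k 1))" for i
    using linear_axis_expand[OF E, of "T (axis i 1)"] by (simp add: matrix_def)
  show ?thesis
    by (simp add: vec_eq_iff gram_def ET inner_sum_left inner_sum_right matrix_matrix_mult_def
        Finite_Cartesian_Product.transpose_def sum_distrib_left sum_distrib_right mult_ac)
qed

subsection \<open>The volume measure of an immersion\<close>

context immersed
begin

lemma vol_density_eq:
  assumes "c \<in> \<A>" "u \<in> chart_image c"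
  shows "vol_density c x u = sqrt (det (gram (cder c x (param c u))))"
  using assms by (simp add: vol_density_def gram_def cder_def)

lemma smooth_on_det_gram:
  assumes c: "c \<in> \<A>"
  shows "smooth_on (chart_image c) (\<lambda>u. det (gram (cder c x (param c u))))"
proof (rule smooth_on_cong[OF _ chart(2)[OF c]])
  let ?E = "\<lambda>u. frechet_derivative (\<lambda>u. x (param c u)) (at u)"
  show "smooth_on (chart_image c) (\<lambda>u. det (gram (?E u)))"
    by (intro smooth_on_det chart c)
      (simp add: gram_def smooth_on_inner chart(2)[OF c] smooth_on_frechet[OF smooth_mapD[OF smooth_x c]])
  show "det (gram (?E u)) = det (gram (cder c x (param c u)))" if "u \<in> chart_image c" for u
    using that c by (simp add: cder_def o_def)
qed

lemma det_gram_cder_pos: "c \<in> \<A> \<Longrightarrow> u \<in> chart_image c \<Longrightarrow> det (gram (cder c x (param c u))) > 0"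
  using frame.det_gram(1)[OF frame_cder] by simp

lemma smooth_on_vol_density:
  assumes c: "c \<in> \<A>"
  shows "smooth_on (chart_image c) (vol_density c x)"
  by (rule smooth_on_cong[OF smooth_on_sqrt[OF chart(2)[OF c] smooth_on_det_gram[OF c]]])
    (auto simp: det_gram_cder_pos c vol_density_eq chart)

lemma vol_density_pos: "c \<in> \<A> \<Longrightarrow> u \<in> chart_image c \<Longrightarrow> vol_density c x u > 0"
  by (simp add: vol_density_eq det_gram_cder_pos)

text \<open>The behaviour of \<open>param c\<close> off the chart image is unspecified; one constant
  value there makes the map Borel measurable on the whole space.\<close>

definition pm :: "('a, 'm) chart \<Rightarrow> real ^ 'm \<Rightarrow> 'a" where
  "pm c u = (if u \<in> chart_image c then param c u else undefined)"

definition chart_measure :: "('a, 'm) chart \<Rightarrow> 'a measure" where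
  "chart_measure c = distr (density lborel (\<lambda>u. ennreal (indicator (chart_image c) u * vol_density c x u))) borel (pm c)"

lemma measurable_pm: "c \<in> \<A> \<Longrightarrow> pm c \<in> borel_measurable borel"
  unfolding pm_def[abs_def] by (intro borel_measurable_extend chart chart_cont)

lemma measurable_vol:
  "c \<in> \<A> \<Longrightarrow> (\<lambda>u. indicator (chart_image c) u * vol_density c x u) \<in> borel_measurable borel"
  by (intro borel_measurable_indicator_mult chart smooth_on_continuous smooth_on_vol_density)

lemma sets_chart_measure [simp]: "sets (chart_measure c) = sets borel"
  by (simp add: chart_measure_def)

lemma nn_integral_chart_measure:
  assumes c: "c \<in> \<A>" and g: "g \<in> borel_measurable borel"
  shows "(\<integral>\<^sup>+q. g q \<partial>chart_measure c) =
    (\<integral>\<^sup>+u. ennreal (indicator (chart_image c) u * vol_density c x u) * g (pm c u) \<partial>lborel)"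
  unfolding chart_measure_def
  using measurable_pm[OF c] measurable_vol[OF c] g
  by (subst nn_integral_distr, simp, simp, subst nn_integral_density)
    (auto intro: measurable_compose[OF measurable_pm[OF c] g])

lemma emeasure_chart_measure:
  assumes c: "c \<in> \<A>" and B: "B \<in> sets borel"
  shows "emeasure (chart_measure c) B =
    (\<integral>\<^sup>+u. ennreal (indicator (chart_image c) u * vol_density c x u) * indicator B (pm c u) \<partial>lborel)"
  using nn_integral_chart_measure[OF c, of "indicator B"] B by simp

lemma emeasure_chart_measure_subset:
  assumes c: "c \<in> \<A>" and B: "B \<in> sets borel" "B \<subseteq> fst c"
  shows "emeasure (chart_measure c) B = (\<integral>\<^sup>+u\<in>snd c ` B. ennreal (vol_density c x u) \<partial>lborel)"
  unfolding emeasure_chart_measure[OF c B(1)]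
proof (rule nn_integral_cong)
  fix u
  have "u \<in> snd c ` B \<longleftrightarrow> u \<in> chart_image c \<and> param c u \<in> B"
    using c B(2) by (force simp: chart_image_def)
  then show "ennreal (indicator (chart_image c) u * vol_density c x u) * indicator B (pm c u)
    = ennreal (vol_density c x u) * indicator (snd c ` B) u"
    by (auto simp: indicator_def pm_def)
qed

lemma emeasure_chart_measure_Int:
  assumes c: "c \<in> \<A>" and B: "B \<in> sets borel"
  shows "emeasure (chart_measure c) (B \<inter> fst c) = emeasure (chart_measure c) B"
proof -
  have "fst c \<in> sets borel" using chart(1)[OF c] by simp
  then show ?thesis
    using c B by (simp add: emeasure_chart_measure sets.Int)
      (auto intro!: nn_integral_cong simp: indicator_def pm_def)
qed

text \<open>Under a change of charts the Gram determinant is multiplied by the square of the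
  Jacobian determinant, hence the density by its absolute value, which is the factor in the change
  of variables.\<close>

lemma chart_measure_compatible:
  assumes c: "c \<in> \<A>" and d: "d \<in> \<A>" and B: "B \<in> sets borel" "B \<subseteq> fst c \<inter> fst d"
  shows "emeasure (chart_measure c) B = emeasure (chart_measure d) B"
proof -
  let ?W = "snd c ` (fst c \<inter> fst d)"
  let ?f = "\<lambda>u. snd d (param c u)"
  let ?h = "\<lambda>u. snd c (param d u)"
  let ?T = "\<lambda>u. trans c d (param c u)"
  have W: "open ?W" by (rule open_overlap[OF c d])
  have W_iff: "u \<in> ?W \<longleftrightarrow> u \<in> chart_image c \<and> param c u \<in> fst d" for u
    by (simp only: overlap[OF c] Int_iff vimage_eq)
  have fW: "?f ` ?W = snd d ` (fst d \<inter> fst c)"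
    using c by (force simp: image_image)
  have oW: "open (?f ` ?W)" unfolding fW by (rule open_overlap[OF d c])
  have der: "(?f has_derivative ?T u) (at u)" if "u \<in> ?W" for u
    using has_derivative_trans[OF c d, of "param c u"] that c by (auto simp: W_iff)
  have "continuous_on ?W (\<lambda>u. det (matrix (?T u)))"
  proof (intro smooth_on_continuous smooth_on_det W)
    fix i j
    have "smooth_on ?W (\<lambda>u. frechet_derivative ?f (at u) (axis j 1) $ i)"
      using smooth_on_frechet[OF smooth_transition[OF c d]]
      by (intro smooth_on_nth W) (simp add: o_def)
    then show "smooth_on ?W (\<lambda>u. matrix (?T u) $ i $ j)"
      by (rule smooth_on_cong[OF _ W]) (use c in \<open>auto simp: matrix_def trans_def o_def W_iff\<close>)
  qed
  moreover have "continuous_on ?W ?f"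
    using smooth_on_continuous[OF smooth_transition[OF c d]] by (simp add: o_def)
  moreover have "continuous_on (?f ` ?W) ?h"
    unfolding fW using smooth_on_continuous[OF smooth_transition[OF d c]] by (simp add: o_def)
  moreover have "?h (?f u) = u" if "u \<in> ?W" for u
    using that c d by (auto simp: W_iff)
  moreover let ?g = "\<lambda>w. ennreal (indicator (chart_image d) w * vol_density d x w) * indicator B (pm d w)"
  have "?g \<in> borel_measurable borel"
    using measurable_vol[OF d] measurable_compose[OF measurable_pm[OF d] borel_measurable_indicator[OF B(1)]]
    by (intro borel_measurable_times_ennreal) auto
  ultimately have "(\<integral>\<^sup>+w. indicator (?f ` ?W) w * ?g w \<partial>lborel) =
    (\<integral>\<^sup>+u. ennreal (indicator ?W u * \<bar>det (matrix (?T u))\<bar>) * ?g (?f u) \<partial>lborel)"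
    by (intro nn_integral_diffeo[OF W oW _ _ _ der])
  also have "\<dots> = (\<integral>\<^sup>+u. ennreal (indicator (chart_image c) u * vol_density c x u) * indicator B (pm c u) \<partial>lborel)"
  proof (rule nn_integral_cong)
    fix u
    show "ennreal (indicator ?W u * \<bar>det (matrix (?T u))\<bar>) * ?g (?f u)
      = ennreal (indicator (chart_image c) u * vol_density c x u) * indicator B (pm c u)"
    proof (cases "u \<in> ?W")
      case True
      then have u: "u \<in> chart_image c" and q: "param c u \<in> fst c" "param c u \<in> fst d"
        using c by (auto simp: W_iff)
      let ?q = "param c u"
      have fu: "?f u \<in> chart_image d" "param d (?f u) = ?q" using q d by auto
      have lin: "linear (cder d x ?q)" "linear (trans c d ?q)"
        using linear_cder[OF smooth_x d q(2)] linear_trans[OF c d q] by auto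
      have "gram (cder c x ?q) = Finite_Cartesian_Product.transpose (matrix (?T u)) ** gram (cder d x ?q) ** matrix (?T u)"
        unfolding cder_trans[OF smooth_x c d q] by (rule gram_compose[OF lin])
      then have "det (gram (cder c x ?q)) = (det (matrix (?T u)))\<^sup>2 * det (gram (cder d x ?q))"
        by (simp add: det_mul det_transpose power2_eq_square)
      then have "vol_density c x u = \<bar>det (matrix (?T u))\<bar> * vol_density d x (?f u)"
        using vol_density_eq[OF c u] vol_density_eq[OF d fu(1)] fu by (simp add: real_sqrt_mult)
      then show ?thesis
        using True u fu q by (simp add: pm_def ennreal_mult' mult.assoc)
    next
      case False
      then have "indicator B (pm c u) * indicator (chart_image c) u = (0::ennreal)"
        using B(2) by (auto simp: W_iff pm_def indicator_def)
      then show ?thesis using False by (auto simp: indicator_def split: if_splits)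
    qed
  qed
  also have "(\<integral>\<^sup>+w. indicator (?f ` ?W) w * ?g w \<partial>lborel) = (\<integral>\<^sup>+w. ?g w \<partial>lborel)"
  proof (rule nn_integral_cong)
    fix w
    have "w \<in> chart_image d \<Longrightarrow> pm d w \<in> B \<Longrightarrow> w \<in> ?f ` ?W"
      unfolding fW overlap[OF d] using B(2) by (auto simp: pm_def)
    then show "indicator (?f ` ?W) w * ?g w = ?g w"
      by (auto simp: indicator_def)
  qed
  finally show ?thesis
    by (simp only: emeasure_chart_measure[OF c B(1)] emeasure_chart_measure[OF d B(1)])
qed

abbreviation \<mu> where "\<mu> \<equiv> volume_measure \<A> x"

section \<open>Gluing the chart measures to the volume measure\<close>

definition is_volume :: "'a measure \<Rightarrow> bool" where
  "is_volume M \<longleftrightarrow> sets M = sets borel \<and>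
    (\<forall>c\<in>\<A>. \<forall>B\<in>sets borel. B \<subseteq> fst c \<longrightarrow> emeasure M B = emeasure (chart_measure c) B)"

lemma countable_chart_cover:
  "\<exists>C :: nat \<Rightarrow> ('a, 'm) chart. (\<forall>n. C n \<in> \<A>) \<and> (\<Union>n. fst (C n)) = UNIV"
proof -
  have "\<And>T. T \<in> fst ` \<A> \<Longrightarrow> openin (top_of_set UNIV) T"
    using chart(1) by auto
  then obtain \<F> where F: "\<F> \<subseteq> fst ` \<A>" "countable \<F>" "\<Union>\<F> = \<Union>(fst ` \<A>)"
    using Lindelof_openin[of "fst ` \<A>" UNIV] by metis
  have cov: "\<Union>\<F> = UNIV" using F(3) smooth_atlas unfolding smooth_atlas_def by blast
  then have ne: "\<F> \<noteq> {}" by auto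
  have "\<exists>c. c \<in> \<A> \<and> fst c = from_nat_into \<F> n" for n
    using from_nat_into[OF ne, of n] F(1) by (metis imageE subsetD)
  then obtain C where C: "\<And>n. C n \<in> \<A>" "\<And>n. fst (C n) = from_nat_into \<F> n" by metis
  have "(\<Union>n. fst (C n)) = \<Union>\<F>"
    unfolding C(2) by (simp only: range_from_nat_into[OF ne F(2)])
  then show ?thesis using C(1) cov by (intro exI[of _ C]) simp
qed

text \<open>A countable chart cover is cut into disjoint Borel pieces, each inside one chart. The
  chart measures of the pieces add up to a volume, and any other volume agrees with it piece by
  piece.\<close>

lemma is_volume_ex1: "\<exists>!M. is_volume M"
proof -
  obtain C :: "nat \<Rightarrow> ('a, 'm) chart" where C: "\<And>n. C n \<in> \<A>" "(\<Union>n. fst (C n)) = UNIV"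
    using countable_chart_cover by auto
  define A where "A n = disjointed (\<lambda>n. fst (C n)) n" for n
  have A_sub: "A n \<subseteq> fst (C n)" for n unfolding A_def by (rule disjointed_subset)
  have A_sets: "A n \<in> sets borel" for n
    unfolding A_def disjointed_def using chart(1)[OF C(1)] by auto
  have A_disj: "disjoint_family A"
    using disjoint_family_disjointed[of "\<lambda>n. fst (C n)"] by (simp add: A_def[abs_def])
  have A_cov: "(\<Union>n. A n) = UNIV"
    using UN_disjointed_eq[of "\<lambda>n. fst (C n)"] C(2) by (simp add: A_def)
  have split: "emeasure M B = (\<Sum>n. emeasure M (B \<inter> A n))"
    if "sets M = sets borel" "B \<in> sets borel" for M B
  proof -
    have "(\<Sum>n. emeasure M (B \<inter> A n)) = emeasure M (\<Union>n. B \<inter> A n)"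
    proof (rule suminf_emeasure)
      show "disjoint_family (\<lambda>n. B \<inter> A n)"
        using A_disj unfolding disjoint_family_on_def by blast
    qed (use that A_sets in auto)
    also have "(\<Union>n. B \<inter> A n) = B" using A_cov by auto
    finally show ?thesis ..
  qed
  \<comment> \<open>Writing the series over the pieces as an integral for the counting measure turns
    countable additivity into the exchange of an integral with a series.\<close>
  define m where "m B = (\<integral>\<^sup>+n. emeasure (chart_measure (C n)) (B \<inter> A n) \<partial>count_space UNIV)" for B
  define M where "M = measure_of UNIV (sets borel) m"
  have M_sets: "sets M = sets borel" using sets.sigma_sets_eq[of borel] by (simp add: M_def)
  have em: "emeasure M B = m B" if B: "B \<in> sets borel" for B
    unfolding M_def
  proof (rule emeasure_measure_of_sigma[OF _ _ _ B])
    show "sigma_algebra UNIV (sets (borel :: 'a measure))"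
      using sets.sigma_algebra_axioms[of "borel :: 'a measure"] by simp
    show "positive (sets borel) m" by (simp add: positive_def m_def)
    show "countably_additive (sets borel) m"
      unfolding countably_additive_def
    proof safe
      fix F :: "nat \<Rightarrow> 'a set" assume F: "range F \<subseteq> sets borel" "disjoint_family F"
      have "(\<Sum>i. m (F i)) = (\<integral>\<^sup>+n. (\<Sum>i. emeasure (chart_measure (C n)) (F i \<inter> A n)) \<partial>count_space UNIV)"
        unfolding m_def by (rule nn_integral_suminf[symmetric]) simp
      also have "\<dots> = (\<integral>\<^sup>+n. emeasure (chart_measure (C n)) (\<Union> (range F) \<inter> A n) \<partial>count_space UNIV)"
      proof (rule nn_integral_cong)
        fix n
        have "(\<Sum>i. emeasure (chart_measure (C n)) (F i \<inter> A n)) = emeasure (chart_measure (C n)) (\<Union>i. F i \<inter> A n)"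
          using F A_sets by (intro suminf_emeasure) (auto simp: disjoint_family_on_def)
        then show "(\<Sum>i. emeasure (chart_measure (C n)) (F i \<inter> A n)) = emeasure (chart_measure (C n)) (\<Union> (range F) \<inter> A n)"
          by (simp only: UN_extend_simps)
      qed
      finally show "(\<Sum>i. m (F i)) = m (\<Union> (range F))" by (simp add: m_def)
    qed
  qed
  have comp: "emeasure (chart_measure (C n)) (B \<inter> A n) = emeasure (chart_measure c) (B \<inter> A n)"
    if "c \<in> \<A>" "B \<in> sets borel" "B \<subseteq> fst c" for c B n
    using that A_sub[of n] A_sets[of n] C(1) by (intro chart_measure_compatible) auto
  show ?thesis
  proof (rule ex1I)
    show "is_volume M"
      unfolding is_volume_def
    proof (intro conjI ballI impI M_sets)
      fix c B assume c: "c \<in> \<A>" "B \<in> sets borel" "B \<subseteq> fst c"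
      have "emeasure M B = (\<Sum>n. emeasure (chart_measure (C n)) (B \<inter> A n))"
        using em[OF c(2)] by (simp add: m_def nn_integral_count_space_nat)
      then show "emeasure M B = emeasure (chart_measure c) B"
        using split[of "chart_measure c" B] c by (simp add: comp)
    qed
    fix M' assume M': "is_volume M'"
    show "M' = M"
    proof (rule measure_eqI)
      fix B assume "B \<in> sets M'"
      then have B: "B \<in> sets borel" using M' by (simp add: is_volume_def)
      have "B \<inter> A n \<in> sets borel" "B \<inter> A n \<subseteq> fst (C n)" for n
        using B A_sets[of n] A_sub[of n] by auto
      then have "emeasure M' (B \<inter> A n) = emeasure (chart_measure (C n)) (B \<inter> A n)" for n
        using M' C(1)[of n] unfolding is_volume_def by blast
      then show "emeasure M' B = emeasure M B"
        using split[of M' B] M' B by (simp add: is_volume_def em m_def nn_integral_count_space_nat)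
    qed (use M' M_sets in \<open>simp add: is_volume_def\<close>)
  qed
qed

lemma volume_measure_The: "\<mu> = (THE M. is_volume M)"
proof -
  have "(sets M = sets borel \<and> (\<forall>c\<in>\<A>. \<forall>B\<in>sets borel. B \<subseteq> fst c \<longrightarrow>
      emeasure M B = (\<integral>\<^sup>+ u\<in>snd c ` B. ennreal (vol_density c x u) \<partial>lborel))) = is_volume M" for M
    unfolding is_volume_def by (simp add: emeasure_chart_measure_subset)
  then show ?thesis by (simp add: volume_measure_def)
qed

lemma is_volume_\<mu>: "is_volume \<mu>"
  unfolding volume_measure_The by (rule theI'[OF is_volume_ex1])

lemma \<mu>_unique: "is_volume M \<Longrightarrow> \<mu> = M"
  using is_volume_\<mu> is_volume_ex1 by blast

lemma sets_\<mu> [measurable_cong, simp]: "sets \<mu> = sets borel"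
  using is_volume_\<mu> by (simp add: is_volume_def)

lemma space_\<mu> [simp]: "space \<mu> = UNIV"
  using sets_eq_imp_space_eq[OF sets_\<mu>] by simp

lemma density_chart:
  assumes c: "c \<in> \<A>"
  shows "density \<mu> (indicator (fst c)) = chart_measure c"
proof (rule measure_eqI)
  fix B assume "B \<in> sets (density \<mu> (indicator (fst c)))"
  then have B: "B \<in> sets borel" by simp
  have fc: "fst c \<in> sets borel" using chart(1)[OF c] by simp
  have "emeasure (density \<mu> (indicator (fst c))) B = (\<integral>\<^sup>+q. indicator (fst c) q * indicator B q \<partial>\<mu>)"
    using B fc by (simp add: emeasure_density)
  also have "\<dots> = (\<integral>\<^sup>+q. indicator (B \<inter> fst c) q \<partial>\<mu>)"
    by (simp add: indicator_inter_arith mult.commute)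
  also have "\<dots> = emeasure \<mu> (B \<inter> fst c)" using B fc by (simp add: sets.Int)
  also have "\<dots> = emeasure (chart_measure c) (B \<inter> fst c)"
    using is_volume_\<mu> c B fc by (auto simp: is_volume_def)
  finally show "emeasure (density \<mu> (indicator (fst c))) B = emeasure (chart_measure c) B"
    by (simp add: emeasure_chart_measure_Int[OF c B])
qed simp

lemma integral_in_chart:
  fixes g :: "'a \<Rightarrow> real"
  assumes c: "c \<in> \<A>" and g: "g \<in> borel_measurable borel" and 0: "\<And>q. q \<notin> fst c \<Longrightarrow> g q = 0"
  shows "(LINT q|\<mu>. g q) = (LINT u|lborel. indicator (chart_image c) u * vol_density c x u * g (param c u))"
    and "integrable \<mu> g \<longleftrightarrow> integrable lborel (\<lambda>u. indicator (chart_image c) u * vol_density c x u * g (param c u))"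
proof -
  have fc: "fst c \<in> sets borel" using chart(1)[OF c] by simp
  have gi: "g = (\<lambda>q. indicator (fst c) q *\<^sub>R g q)"
  proof
    show "g q = indicator (fst c) q *\<^sub>R g q" for q using 0[of q] by (cases "q \<in> fst c") simp_all
  qed
  have d: "density \<mu> (\<lambda>q. ennreal (indicator (fst c) q)) = chart_measure c"
  proof -
    have "(\<lambda>q. ennreal (indicator (fst c) q)) = indicator (fst c)"
      by (simp add: ennreal_indicator fun_eq_iff)
    then show ?thesis using density_chart[OF c] by simp
  qed
  have pm: "pm c \<in> measurable (density lborel (\<lambda>u. ennreal (indicator (chart_image c) u * vol_density c x u))) borel"
    using measurable_pm[OF c] by simp
  have nn: "AE u in lborel. 0 \<le> indicator (chart_image c) u * vol_density c x u"
    using vol_density_pos[OF c] by (auto simp: indicator_def less_imp_le)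
  have gp: "(\<lambda>u. g (pm c u)) \<in> borel_measurable lborel"
    using measurable_compose[OF measurable_pm[OF c] g] by simp
  have eq: "indicator (chart_image c) u * vol_density c x u * g (pm c u) =
      indicator (chart_image c) u * vol_density c x u * g (param c u)" for u
    by (auto simp: pm_def indicator_def)
  have "(LINT q|\<mu>. g q) = (LINT q|chart_measure c. g q)"
    using fc g by (subst gi, subst integral_density[symmetric]) (auto simp: d)
  also have "\<dots> = (LINT u|lborel. (indicator (chart_image c) u * vol_density c x u) *\<^sub>R g (pm c u))"
    unfolding chart_measure_def
    by (subst integral_distr[OF pm g], subst integral_density[OF gp _ nn]) (use measurable_vol[OF c] in auto)
  finally show "(LINT q|\<mu>. g q) = (LINT u|lborel. indicator (chart_image c) u * vol_density c x u * g (param c u))"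
    by (simp add: eq)
  have "integrable \<mu> g \<longleftrightarrow> integrable (chart_measure c) g"
    using fc g by (subst gi, subst integrable_density[symmetric]) (auto simp: d)
  also have "\<dots> \<longleftrightarrow> integrable lborel (\<lambda>u. (indicator (chart_image c) u * vol_density c x u) *\<^sub>R g (pm c u))"
    unfolding chart_measure_def
    by (subst integrable_distr_eq[OF pm g], subst integrable_density[OF gp _ nn]) (use measurable_vol[OF c] in auto)
  finally show "integrable \<mu> g \<longleftrightarrow> integrable lborel (\<lambda>u. indicator (chart_image c) u * vol_density c x u * g (param c u))"
    by (simp add: eq)
qed

end

subsection \<open>The divergence theorem\<close>

lemma smooth_on_line_derivative:
  assumes "open U" "smooth_on U h" "a + s *\<^sub>R e \<in> U"
  shows "((\<lambda>s. h (a + s *\<^sub>R e)) has_vector_derivative frechet_derivative h (at (a + s *\<^sub>R e)) e) (at s)"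
proof -
  have "((\<lambda>s. a + s *\<^sub>R e) has_derivative (\<lambda>r. r *\<^sub>R e)) (at s)"
    by (auto intro!: derivative_eq_intros)
  from has_derivative_compose[OF this smooth_on_has_derivative[OF assms(2,3)]]
  have "((\<lambda>s. h (a + s *\<^sub>R e)) has_derivative (\<lambda>r. frechet_derivative h (at (a + s *\<^sub>R e)) (r *\<^sub>R e))) (at s)" .
  then show ?thesis
    unfolding has_vector_derivative_def
    by (simp add: linear_scale[OF has_derivative_linear[OF smooth_on_has_derivative[OF assms(2,3)]]])
qed

lemma integral_translate:
  fixes h :: "'a::euclidean_space \<Rightarrow> real"
  assumes "h \<in> borel_measurable borel"
  shows "(LINT u|lborel. h (a + u)) = (LINT u|lborel. h u)"
    and "integrable lborel (\<lambda>u. h (a + u)) \<longleftrightarrow> integrable lborel h"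
proof -
  have m: "(+) a \<in> measurable lborel borel" by simp
  show "(LINT u|lborel. h (a + u)) = (LINT u|lborel. h u)"
    using integral_distr[OF m assms] by (simp add: lborel_distr_plus)
  show "integrable lborel (\<lambda>u. h (a + u)) \<longleftrightarrow> integrable lborel h"
    using integrable_distr_eq[OF m assms] by (simp add: lborel_distr_plus)
qed

lemma integrable_continuous_compact_support:
  fixes h :: "'a::euclidean_space \<Rightarrow> real"
  assumes h: "continuous_on UNIV h" and K: "compact K" and 0: "\<And>u. u \<notin> K \<Longrightarrow> h u = 0"
  shows "integrable lborel h"
proof -
  have "integrable lborel (\<lambda>u. indicator K u *\<^sub>R h u)"
    using borel_integrable_compact[OF K continuous_on_subset[OF h]] by simp
  moreover have "indicator K u *\<^sub>R h u = h u" for u using 0[of u] by (cases "u \<in> K") auto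
  ultimately show ?thesis by (simp only:)
qed

text \<open>The difference quotients of \<open>h\<close> along \<open>e\<close> have integral 0 by
  translation invariance, and dominated convergence passes this on to the derivative.\<close>

lemma integral_directional_derivative_0:
  fixes h :: "'a::euclidean_space \<Rightarrow> real"
  assumes h: "smooth_on UNIV h" and K: "compact K" and 0: "\<And>u. u \<notin> K \<Longrightarrow> h u = 0"
  shows "integrable lborel (\<lambda>u. frechet_derivative h (at u) e)"
    and "(LINT u|lborel. frechet_derivative h (at u) e) = 0"
proof -
  let ?d = "\<lambda>u. frechet_derivative h (at u) e"
  have ch: "continuous_on UNIV h" by (rule smooth_on_continuous[OF h])
  have cd: "continuous_on UNIV ?d" by (rule smooth_on_continuous[OF smooth_on_frechet[OF h]])
  have mh: "h \<in> borel_measurable borel" by (rule borel_measurable_continuous_onI[OF ch])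
  have d0: "?d u = 0" if "u \<notin> K" for u
  proof -
    have "(h has_derivative (\<lambda>v. 0)) (at u)"
      by (rule has_derivative_transform_within_open[of "\<lambda>u. 0" _ _ _ "- K"])
        (use that 0 compact_imp_closed[OF K] in auto)
    from frechet_derivative_at[OF this] show ?thesis by (metis (no_types))
  qed
  show "integrable lborel ?d" by (rule integrable_continuous_compact_support[OF cd K d0])
  have "bounded (?d ` K)"
    by (intro compact_imp_bounded compact_continuous_image K continuous_on_subset[OF cd]) auto
  then obtain C where C0: "\<forall>y\<in>?d ` K. norm y \<le> C" unfolding bounded_iff by blast
  have C: "\<bar>?d u\<bar> \<le> max C 0" for u
  proof (cases "u \<in> K")
    case True
    then have "\<bar>?d u\<bar> \<le> C" using C0 by simp
    then show ?thesis by linarith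
  qed (simp add: d0)
  obtain R where R: "K \<subseteq> cball 0 R"
    using compact_imp_bounded[OF K] unfolding bounded_iff by (auto simp: subset_iff)
  \<comment> \<open>Contains the support of \<open>h\<close> and its translates by
    \<open>- t n *\<^sub>R e\<close>, as \<open>t n\<close> is at most 1, so all difference
    quotients vanish outside.\<close>
  let ?K = "cball 0 (R + norm e)"
  define t where "t n = 1 / (1 + real n)" for n
  have t: "0 < t n" "t n \<le> 1" for n by (auto simp: t_def field_simps)
  define G where "G n u = (h (t n *\<^sub>R e + u) - h u) / t n" for n u
  have "(\<lambda>n. LINT u|lborel. G n u) \<longlonglongrightarrow> (LINT u|lborel. ?d u)"
  proof (rule integral_dominated_convergence)
    show "?d \<in> borel_measurable lborel" using borel_measurable_continuous_onI[OF cd] by simp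
    show "G n \<in> borel_measurable lborel" for n
      unfolding G_def using mh by measurable
    show "integrable lborel (\<lambda>u. indicator ?K u *\<^sub>R max C 0)"
      by (rule borel_integrable_compact) auto
    show "AE u in lborel. (\<lambda>n. G n u) \<longlonglongrightarrow> ?d u"
    proof (rule AE_I2)
      fix u
      have "((\<lambda>s. h (u + s *\<^sub>R e)) has_real_derivative ?d u) (at 0)"
        using smooth_on_line_derivative[OF open_UNIV h, of u 0 e]
        by (simp add: has_real_derivative_iff_has_vector_derivative)
      then have "((\<lambda>s. (h (u + s *\<^sub>R e) - h u) / s) \<longlongrightarrow> ?d u) (at 0)"
        by (simp add: has_field_derivative_iff)
      moreover have "filterlim t (at 0) sequentially"
      proof (rule filterlim_atI)
        show "t \<longlonglongrightarrow> 0" unfolding t_def using LIMSEQ_inverse_real_of_nat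
          by (simp add: inverse_eq_divide add.commute)
        show "\<forall>\<^sub>F n in sequentially. t n \<noteq> 0" using t(1) by (auto intro!: always_eventually simp: less_imp_neq[symmetric])
      qed
      ultimately have "(\<lambda>n. (h (u + t n *\<^sub>R e) - h u) / t n) \<longlonglongrightarrow> ?d u"
        by (rule filterlim_compose)
      then show "(\<lambda>n. G n u) \<longlonglongrightarrow> ?d u" by (simp add: G_def add.commute)
    qed
    show "AE u in lborel. norm (G n u) \<le> indicator ?K u *\<^sub>R max C 0" for n
    proof (rule AE_I2)
      fix u
      show "norm (G n u) \<le> indicator ?K u *\<^sub>R max C 0"
      proof (cases "u \<in> ?K")
        case True
        have "\<exists>z>0. z < t n \<and> h (u + t n *\<^sub>R e) - h (u + 0 *\<^sub>R e) = (t n - 0) * ?d (u + z *\<^sub>R e)"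
          by (rule MVT2[OF t(1)])
            (use smooth_on_line_derivative[OF open_UNIV h, of u _ e] in
              \<open>simp add: has_real_derivative_iff_has_vector_derivative\<close>)
        then obtain z where "h (u + t n *\<^sub>R e) - h u = t n * ?d (u + z *\<^sub>R e)" by auto
        then have "G n u = ?d (u + z *\<^sub>R e)" using t(1)[of n] by (simp add: G_def add.commute)
        then show ?thesis using C True by simp
      next
        case False
        have "u \<notin> K"
        proof
          assume "u \<in> K"
          then have "norm u \<le> R" using R by auto
          then show False using False norm_ge_zero[of e] by simp
        qed
        moreover have "t n *\<^sub>R e + u \<notin> K"
        proof
          assume "t n *\<^sub>R e + u \<in> K"
          then have "norm (t n *\<^sub>R e + u) \<le> R" using R by auto
          moreover have "norm u \<le> norm (t n *\<^sub>R e + u) + norm (t n *\<^sub>R e)"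
            using norm_triangle_ineq4[of "t n *\<^sub>R e + u" "t n *\<^sub>R e"] by simp
          moreover have "norm (t n *\<^sub>R e) \<le> norm e"
            using t[of n] by (simp add: mult_left_le_one_le)
          ultimately show False using False by simp
        qed
        ultimately show ?thesis using False 0 by (simp add: G_def)
      qed
    qed
  qed
  moreover have "(LINT u|lborel. G n u) = 0" for n
  proof -
    have ih: "integrable lborel h" by (rule integrable_continuous_compact_support[OF ch K 0])
    then have "integrable lborel (\<lambda>u. h (t n *\<^sub>R e + u))" using integral_translate(2)[OF mh] by blast
    then have "(LINT u|lborel. G n u) = ((LINT u|lborel. h (t n *\<^sub>R e + u)) - (LINT u|lborel. h u)) / t n"
      unfolding G_def using ih by (simp add: Bochner_Integration.integral_diff)
    then show ?thesis using integral_translate(1)[OF mh] by simp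
  qed
  ultimately have "(\<lambda>n. 0) \<longlonglongrightarrow> (LINT u|lborel. ?d u)" by simp
  then show "(LINT u|lborel. ?d u) = 0" by (simp add: LIMSEQ_const_iff)
qed

context immersed
begin

text \<open>Jacobi's formula for the Gram determinant. The two summands in the derivative of an
  inner product have the same trace, and the resulting 2 cancels against the 1/2 from the square
  root.\<close>

lemma vol_density_derivative:
  assumes c: "c \<in> \<A>" and u: "u \<in> chart_image c"
  defines "E \<equiv> cder c x (param c u)"
  defines "X2 \<equiv> \<lambda>i l. frechet_derivative (\<lambda>u. frechet_derivative (\<lambda>u. x (param c u)) (at u) (axis i 1)) (at u) (axis l 1)"
  shows "frechet_derivative (vol_density c x) (at u) (axis l 1) =
    vol_density c x u * (\<Sum>i\<in>UNIV. \<Sum>j\<in>UNIV. matrix_inv (gram E) $ i $ j * (X2 i l \<bullet> E (axis j 1)))"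
proof -
  let ?U = "chart_image c"
  let ?e = "axis l 1 :: real ^ 'm"
  have U: "open ?U" by (rule chart[OF c])
  interpret frame E unfolding E_def using u by (intro frame_cder[OF c]) (simp add: c)
  define Xd where "Xd i = (\<lambda>u. frechet_derivative (\<lambda>u. x (param c u)) (at u) (axis i 1))" for i
  have smXd: "smooth_on ?U (Xd i)" for i
    unfolding Xd_def by (rule smooth_on_frechet[OF smooth_mapD[OF smooth_x c]])
  have gE: "gram (cder c x (param c u)) = (\<chi> i j. Xd i u \<bullet> Xd j u)" if "u \<in> ?U" for u
    using that c by (simp add: gram_def cder_def o_def Xd_def)
  have Ei: "E (axis i 1) = Xd i u" for i
    using u c by (simp add: E_def cder_def o_def Xd_def)
  define M where "M s = (\<chi> i j. Xd i (u + s *\<^sub>R ?e) \<bullet> Xd j (u + s *\<^sub>R ?e))" for s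
  have M0: "M 0 = gram E" using gE[OF u] by (simp add: M_def E_def)
  define M' where "M' = (\<chi> i j. Xd i u \<bullet> X2 j l + X2 i l \<bullet> Xd j u)"
  have dX: "((\<lambda>s. Xd i (u + s *\<^sub>R ?e)) has_vector_derivative X2 i l) (at 0)" for i
    using smooth_on_line_derivative[OF U smXd, of u 0 ?e i] u by (simp add: X2_def Xd_def)
  have dM: "((\<lambda>s. M s $ i $ j) has_real_derivative M' $ i $ j) (at 0)" for i j
    using bounded_bilinear.has_vector_derivative[OF bounded_bilinear_inner dX[of i] dX[of j]]
    by (simp add: M_def M'_def has_real_derivative_iff_has_vector_derivative)
  let ?T = "\<Sum>i\<in>UNIV. \<Sum>j\<in>UNIV. matrix_inv (gram E) $ i $ j * (X2 i l \<bullet> E (axis j 1))"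
  have "(\<Sum>i\<in>UNIV. \<Sum>j\<in>UNIV. matrix_inv (gram E) $ i $ j * M' $ j $ i)
     = (\<Sum>i\<in>UNIV. \<Sum>j\<in>UNIV. matrix_inv (gram E) $ i $ j * (X2 i l \<bullet> E (axis j 1)))
       + (\<Sum>i\<in>UNIV. \<Sum>j\<in>UNIV. matrix_inv (gram E) $ i $ j * (X2 j l \<bullet> E (axis i 1)))"
    by (simp add: M'_def Ei sum.distrib[symmetric] inner_commute distrib_left)
  also have "(\<Sum>i\<in>UNIV. \<Sum>j\<in>UNIV. matrix_inv (gram E) $ i $ j * (X2 j l \<bullet> E (axis i 1))) = ?T"
    by (subst sum.swap) (simp add: matrix_inv_gram_symmetric)
  finally have tr: "(\<Sum>i\<in>UNIV. \<Sum>j\<in>UNIV. matrix_inv (gram E) $ i $ j * M' $ j $ i) = 2 * ?T" by simp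
  have d1: "((\<lambda>s. det (M s)) has_real_derivative det (gram E) * (2 * ?T)) (at 0)"
    using det_has_derivative[of M M' 0, OF dM] det_gram(2) by (simp only: M0 tr not_False_eq_True)
  have d2: "(sqrt has_real_derivative inverse (sqrt (det (gram E))) / 2) (at (det (M 0)))"
    unfolding M0 by (rule DERIV_real_sqrt[OF det_gram(1)])
  have "inverse (sqrt r) / 2 * (r * (2 * T)) = sqrt r * T" if "r > 0" for r T :: real
  proof -
    have "inverse (sqrt r) * r = sqrt r"
      using that real_div_sqrt[of r] by (simp add: divide_inverse mult.commute)
    moreover have "inverse (sqrt r) / 2 * (r * (2 * T)) = (inverse (sqrt r) * r) * T"
      by (simp only: divide_inverse mult_ac) simp
    ultimately show ?thesis by (simp only:)
  qed
  from this[OF det_gram(1)]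
  have "((\<lambda>s. sqrt (det (M s))) has_real_derivative sqrt (det (gram E)) * ?T) (at 0)"
    by (rule DERIV_cong[OF DERIV_chain2[OF d2 d1]])
  then have 1: "((\<lambda>s. sqrt (det (M s))) has_real_derivative vol_density c x u * ?T) (at 0)"
    by (simp only: vol_density_eq[OF c u] E_def)
  have "open ((\<lambda>s. u + s *\<^sub>R ?e) -` ?U)"
    by (rule open_vimage[OF U]) (intro continuous_intros)
  then have "((\<lambda>s. vol_density c x (u + s *\<^sub>R ?e)) has_real_derivative vol_density c x u * ?T) (at 0)"
    by (rule has_field_derivative_transform_within_open[OF 1])
      (use u in \<open>auto simp: vol_density_eq[OF c] gE M_def\<close>)
  moreover have "((\<lambda>s. vol_density c x (u + s *\<^sub>R ?e)) has_real_derivative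
      frechet_derivative (vol_density c x) (at u) ?e) (at 0)"
    using smooth_on_line_derivative[OF U smooth_on_vol_density[OF c], of u 0 ?e] u
    by (simp add: has_real_derivative_iff_has_vector_derivative)
  ultimately show ?thesis by (rule DERIV_unique[symmetric])
qed

text \<open>In the derivative of \<open>Z\<close> the moving basis vectors contribute second
  derivatives of \<open>x\<close>. By the symmetry of these, the contribution is the logarithmic
  derivative of the volume density along the coordinate field.\<close>

lemma divergence_in_chart:
  assumes c: "c \<in> \<A>" and u: "u \<in> chart_image c"
    and Z: "smooth_map \<A> Z" and tan: "\<And>q. P q (Z q) = Z q"
  shows "(\<Sum>l\<in>UNIV. frechet_derivative (\<lambda>u. vol_density c x u * coord (cder c x (param c u)) (Z (param c u)) $ l) (at u) (axis l 1))
    = vol_density c x u * (\<Sum>b\<in>Basis. D Z (param c u) b \<bullet> b)"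
proof -
  let ?U = "chart_image c"
  let ?q = "param c u"
  let ?vol = "vol_density c x"
  have U: "open ?U" by (rule chart[OF c])
  have q: "?q \<in> fst c" using u c by simp
  interpret frame "cder c x ?q" by (rule frame_cder[OF c q])
  let ?E = "cder c x ?q"
  let ?N = "matrix_inv (gram ?E)"
  define Xd where "Xd i = (\<lambda>u. frechet_derivative (\<lambda>u. x (param c u)) (at u) (axis i 1))" for i
  define X2 where "X2 i l = frechet_derivative (Xd i) (at u) (axis l 1)" for i l
  define \<zeta> where "\<zeta> = (\<lambda>u. coord (cder c x (param c u)) (Z (param c u)))"
  have smXd: "smooth_on ?U (Xd i)" for i
    unfolding Xd_def by (rule smooth_on_frechet[OF smooth_mapD[OF smooth_x c]])
  have Ei: "cder c x (param c u) (axis i 1) = Xd i u" if "u \<in> ?U" for i u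
    using that c by (simp add: cder_def o_def Xd_def)
  have sm\<zeta>: "smooth_on ?U \<zeta>"
  proof (rule smooth_on_cong[OF _ U])
    show "smooth_on ?U (\<lambda>u. \<Sum>d\<in>Basis. (Z (param c u) \<bullet> d) *\<^sub>R coord (cder c x (param c u)) d)"
      by (intro smooth_on_sum smooth_on_scaleR smooth_on_inner smooth_on_const smooth_on_coord U c smooth_mapD[OF Z])
    fix u assume "u \<in> ?U"
    then have "linear (coord (cder c x (param c u)))"
      using frame.linear_coord[OF frame_cder[OF c]] c by simp
    then show "(\<Sum>d\<in>Basis. (Z (param c u) \<bullet> d) *\<^sub>R coord (cder c x (param c u)) d) = \<zeta> u"
      unfolding \<zeta>_def
      by (subst (3) euclidean_representation[symmetric]) (simp only: linear_sum linear_scale)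
  qed
  have sm\<zeta>l: "smooth_on ?U (\<lambda>u. \<zeta> u $ l)" for l by (rule smooth_on_nth[OF U sm\<zeta>])
  define d\<zeta> where "d\<zeta> l k = frechet_derivative (\<lambda>u. \<zeta> u $ l) (at u) (axis k 1)" for l k
  have ZX: "Z (param c u) = (\<Sum>l\<in>UNIV. \<zeta> u $ l *\<^sub>R Xd l u)" if "u \<in> ?U" for u
  proof -
    have q: "param c u \<in> fst c" using that c by simp
    have "Z (param c u) = cder c x (param c u) (\<zeta> u)"
      using tan[of "param c u"] by (simp add: P_cder[OF c q] \<zeta>_def)
    also have "\<dots> = (\<Sum>l\<in>UNIV. \<zeta> u $ l *\<^sub>R Xd l u)"
      unfolding Ei[OF that, symmetric] by (rule linear_axis_expand[OF linear_cder[OF smooth_x c q]])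
    finally show ?thesis .
  qed
  have dZ: "cder c Z ?q (axis k 1) = (\<Sum>l\<in>UNIV. \<zeta> u $ l *\<^sub>R X2 l k + d\<zeta> l k *\<^sub>R Xd l u)" for k
  proof -
    have "((\<lambda>u. \<Sum>l\<in>UNIV. \<zeta> u $ l *\<^sub>R Xd l u) has_derivative
      (\<lambda>h. \<Sum>l\<in>UNIV. \<zeta> u $ l *\<^sub>R frechet_derivative (Xd l) (at u) h
        + frechet_derivative (\<lambda>u. \<zeta> u $ l) (at u) h *\<^sub>R Xd l u)) (at u)"
      by (intro has_derivative_sum has_derivative_scaleR smooth_on_has_derivative[OF sm\<zeta>l u]
          smooth_on_has_derivative[OF smXd u])
    then have "((\<lambda>u. Z (param c u)) has_derivative
      (\<lambda>h. \<Sum>l\<in>UNIV. \<zeta> u $ l *\<^sub>R frechet_derivative (Xd l) (at u) h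
        + frechet_derivative (\<lambda>u. \<zeta> u $ l) (at u) h *\<^sub>R Xd l u)) (at u)"
      by (rule has_derivative_transform_within_open[OF _ U u]) (simp add: ZX)
    then have "cder c Z ?q = (\<lambda>h. \<Sum>l\<in>UNIV. \<zeta> u $ l *\<^sub>R frechet_derivative (Xd l) (at u) h
        + frechet_derivative (\<lambda>u. \<zeta> u $ l) (at u) h *\<^sub>R Xd l u)"
      using u c by (intro cder_eqI) simp
    then show ?thesis by (simp add: X2_def d\<zeta>_def)
  qed
  have N1: "(\<Sum>j\<in>UNIV. ?N $ i $ j * (Xd l u \<bullet> Xd j u)) = (if i = l then 1 else 0)" for i l
  proof -
    have "(?N ** gram ?E) $ i $ l = (\<Sum>j\<in>UNIV. ?N $ i $ j * (Xd l u \<bullet> Xd j u))"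
      by (simp add: matrix_matrix_mult_def gram_def Ei[OF u] inner_commute)
    then show ?thesis by (simp add: matrix_inv_mult det_gram mat_def)
  qed
  let ?T = "\<lambda>l. \<Sum>i\<in>UNIV. \<Sum>j\<in>UNIV. ?N $ i $ j * (X2 i l \<bullet> Xd j u)"
  have sym: "X2 l k = X2 k l" for l k
    unfolding X2_def Xd_def by (rule second_derivative_symmetric[OF U smooth_mapD[OF smooth_x c] u])
  have "(\<Sum>b\<in>Basis. D Z ?q b \<bullet> b) = (\<Sum>b\<in>Basis. cder c Z ?q (coord ?E b) \<bullet> b)"
    by (simp add: D_cder[OF Z c q])
  also have "\<dots> = (\<Sum>i\<in>UNIV. \<Sum>j\<in>UNIV. ?N $ i $ j * (cder c Z ?q (axis i 1) \<bullet> Xd j u))"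
    using trace_inner[OF linear_cder[OF Z c q]] by (simp add: Ei[OF u])
  also have "\<dots> = (\<Sum>i\<in>UNIV. \<Sum>j\<in>UNIV. \<Sum>l\<in>UNIV. \<zeta> u $ l * (?N $ i $ j * (X2 i l \<bullet> Xd j u))
      + d\<zeta> l i * (?N $ i $ j * (Xd l u \<bullet> Xd j u)))"
    by (simp add: dZ inner_sum_left inner_add_left sum_distrib_left distrib_left mult_ac sym)
  also have "\<dots> = (\<Sum>i\<in>UNIV. \<Sum>l\<in>UNIV. \<Sum>j\<in>UNIV. \<zeta> u $ l * (?N $ i $ j * (X2 i l \<bullet> Xd j u))
      + d\<zeta> l i * (?N $ i $ j * (Xd l u \<bullet> Xd j u)))"
    by (intro sum.cong refl sum.swap)
  also have "\<dots> = (\<Sum>i\<in>UNIV. \<Sum>l\<in>UNIV. \<zeta> u $ l * (\<Sum>j\<in>UNIV. ?N $ i $ j * (X2 i l \<bullet> Xd j u)))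
      + (\<Sum>i\<in>UNIV. \<Sum>l\<in>UNIV. d\<zeta> l i * (\<Sum>j\<in>UNIV. ?N $ i $ j * (Xd l u \<bullet> Xd j u)))"
    by (simp add: sum.distrib sum_distrib_left)
  also have "(\<Sum>i\<in>UNIV. \<Sum>l\<in>UNIV. d\<zeta> l i * (\<Sum>j\<in>UNIV. ?N $ i $ j * (Xd l u \<bullet> Xd j u))) = (\<Sum>l\<in>UNIV. d\<zeta> l l)"
    by (simp add: N1 if_distrib cong: if_cong)
  also have "(\<Sum>i\<in>UNIV. \<Sum>l\<in>UNIV. \<zeta> u $ l * (\<Sum>j\<in>UNIV. ?N $ i $ j * (X2 i l \<bullet> Xd j u))) = (\<Sum>l\<in>UNIV. \<zeta> u $ l * ?T l)"
    by (subst sum.swap) (simp add: sum_distrib_left)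
  finally have div: "(\<Sum>b\<in>Basis. D Z ?q b \<bullet> b) = (\<Sum>l\<in>UNIV. \<zeta> u $ l * ?T l + d\<zeta> l l)"
    by (simp add: sum.distrib)
  have "frechet_derivative (\<lambda>u. ?vol u * \<zeta> u $ l) (at u) (axis l 1) = ?vol u * (\<zeta> u $ l * ?T l + d\<zeta> l l)" for l
  proof -
    have "((\<lambda>u. ?vol u * \<zeta> u $ l) has_derivative
       (\<lambda>h. ?vol u * frechet_derivative (\<lambda>u. \<zeta> u $ l) (at u) h + frechet_derivative ?vol (at u) h * \<zeta> u $ l)) (at u)"
      by (intro has_derivative_mult smooth_on_has_derivative[OF sm\<zeta>l u]
          smooth_on_has_derivative[OF smooth_on_vol_density[OF c] u])
    from fun_cong[OF frechet_derivative_at[OF this], of "axis l 1"]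
    have "frechet_derivative (\<lambda>u. ?vol u * \<zeta> u $ l) (at u) (axis l 1) =
        ?vol u * d\<zeta> l l + frechet_derivative ?vol (at u) (axis l 1) * \<zeta> u $ l"
      by (simp add: d\<zeta>_def)
    also have "frechet_derivative ?vol (at u) (axis l 1) = ?vol u * ?T l"
      using vol_density_derivative[OF c u, of l] by (simp add: X2_def Xd_def Ei[OF u])
    finally show ?thesis by (simp add: algebra_simps)
  qed
  then have "(\<Sum>l\<in>UNIV. frechet_derivative (\<lambda>u. ?vol u * \<zeta> u $ l) (at u) (axis l 1))
      = ?vol u * (\<Sum>b\<in>Basis. D Z ?q b \<bullet> b)"
    by (simp only: div sum_distrib_left)
  then show ?thesis by (simp only: \<zeta>_def)
qed

lemma compact_param_image:
  assumes "c \<in> \<A>" "compact K" "K \<subseteq> chart_image c"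
  shows "compact (param c ` K)" "closed (param c ` K)"
proof -
  show "compact (param c ` K)"
    by (rule compact_continuous_image[OF continuous_on_subset[OF chart_cont(2)[OF assms(1)] assms(3)] assms(2)])
  then show "closed (param c ` K)" by (rule compact_imp_closed)
qed

lemma D_zero_outside:
  assumes y: "smooth_map \<A> y" and W: "closed K" "\<And>q. q \<notin> K \<Longrightarrow> y q = 0" and q: "q \<notin> K"
  shows "D y q w = 0"
  using D_cong_open[OF y smooth_map_const[of 0], of "- K" q w] W q by (simp add: D_const open_Compl)

lemma smooth_map_divergence: "smooth_map \<A> Z \<Longrightarrow> smooth_map \<A> (\<lambda>q. \<Sum>b\<in>Basis. D Z q b \<bullet> b)"
  by (intro smooth_map_sum smooth_map_inner smooth_map_D smooth_map_const)

lemma smooth_map_measurable: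
  fixes y :: "'a \<Rightarrow> real"
  shows "smooth_map \<A> y \<Longrightarrow> y \<in> borel_measurable borel"
  by (rule borel_measurable_continuous_onI[OF smooth_map_continuous])

text \<open>Continued by 0, the coordinate field times the density is smooth on the whole coordinate
  space with support in \<open>K\<close>, so each directional derivative in the coordinate
  divergence integrates to 0.\<close>

lemma integral_divergence_chart:
  assumes c: "c \<in> \<A>" and K: "compact K" "K \<subseteq> chart_image c"
    and Z: "smooth_map \<A> Z" and tan: "\<And>q. P q (Z q) = Z q"
    and 0: "\<And>q. q \<notin> param c ` K \<Longrightarrow> Z q = 0"
  shows "integrable \<mu> (\<lambda>q. \<Sum>b\<in>Basis. D Z q b \<bullet> b)" "(LINT q|\<mu>. (\<Sum>b\<in>Basis. D Z q b \<bullet> b)) = 0"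
proof -
  let ?U = "chart_image c"
  let ?div = "\<lambda>q. \<Sum>b\<in>Basis. D Z q b \<bullet> b"
  have U: "open ?U" by (rule chart[OF c])
  have K_img: "param c u \<notin> param c ` K" if "u \<in> ?U" "u \<notin> K" for u
  proof
    assume "param c u \<in> param c ` K"
    then obtain k where "k \<in> K" "param c u = param c k" by auto
    then have "u = k" using that(1) K(2) chart_param[OF c] by (metis subsetD)
    then show False using that(2) \<open>k \<in> K\<close> by simp
  qed
  define h0 where "h0 l = (\<lambda>u. vol_density c x u * coord (cder c x (param c u)) (Z (param c u)) $ l)" for l
  define h where "h l u = (if u \<in> ?U then h0 l u else 0)" for l u
  have h_zero: "h l u = 0" if "u \<notin> K" for l u
  proof (cases "u \<in> ?U")
    case True
    have "linear (coord (cder c x (param c u)))"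
      using frame.linear_coord[OF frame_cder[OF c param_in[OF c True]]] .
    then show ?thesis using 0[OF K_img[OF True that]] by (simp add: h_def h0_def linear_0)
  qed (simp add: h_def)
  have sm_coord: "smooth_on ?U (\<lambda>u. coord (cder c x (param c u)) (Z (param c u)))"
  proof (rule smooth_on_cong[OF _ U])
    show "smooth_on ?U (\<lambda>u. \<Sum>d\<in>Basis. (Z (param c u) \<bullet> d) *\<^sub>R coord (cder c x (param c u)) d)"
      by (intro smooth_on_sum smooth_on_scaleR smooth_on_inner smooth_on_const smooth_on_coord U c smooth_mapD[OF Z])
    fix u assume "u \<in> ?U"
    then have lin: "linear (coord (cder c x (param c u)))"
      using frame.linear_coord[OF frame_cder[OF c]] c by simp
    show "(\<Sum>d\<in>Basis. (Z (param c u) \<bullet> d) *\<^sub>R coord (cder c x (param c u)) d)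
       = coord (cder c x (param c u)) (Z (param c u))"
      by (simp only: linear_sum[OF lin, symmetric] linear_scale[OF lin, symmetric] euclidean_representation)
  qed
  have sm_h0: "smooth_on ?U (h0 l)" for l
    unfolding h0_def by (intro smooth_on_mult smooth_on_nth U smooth_on_vol_density c sm_coord)
  have sm_h: "smooth_on UNIV (h l)" for l
  proof -
    have "smooth_on ?U (h l)" by (rule smooth_on_cong[OF sm_h0 U]) (simp add: h_def)
    moreover have "open (- K)" using compact_imp_closed[OF K(1)] by auto
    moreover from this have "smooth_on (- K) (h l)"
      by (intro smooth_on_cong[OF smooth_on_const[of _ 0]]) (auto simp: h_zero)
    ultimately have "smooth_on (?U \<union> - K) (h l)" using smooth_on_Un[OF U] by blast
    moreover have "?U \<union> - K = UNIV" using K(2) by auto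
    ultimately show ?thesis by simp
  qed
  have fr: "frechet_derivative (h l) (at u) = frechet_derivative (h0 l) (at u)" if "u \<in> ?U" for l u
  proof -
    have "(h0 l has_derivative frechet_derivative (h l) (at u)) (at u)"
      by (rule has_derivative_transform_within_open[OF smooth_on_has_derivative[OF sm_h UNIV_I] U that])
        (simp add: h_def)
    then show ?thesis by (rule frechet_derivative_at)
  qed
  have eq: "indicator ?U u * vol_density c x u * ?div (param c u) =
      (\<Sum>l\<in>UNIV. frechet_derivative (h l) (at u) (axis l 1))" for u
  proof (cases "u \<in> ?U")
    case True
    have "(\<Sum>l\<in>UNIV. frechet_derivative (h l) (at u) (axis l 1)) = vol_density c x u * ?div (param c u)"
      unfolding fr[OF True] h0_def by (rule divergence_in_chart[OF c True Z tan])
    then show ?thesis using True by simp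
  next
    case False
    have "frechet_derivative (h l) (at u) = (\<lambda>v. 0)" for l
    proof -
      have "(h l has_derivative (\<lambda>v. 0)) (at u)"
        by (rule has_derivative_transform_within_open[of "\<lambda>u. 0" _ _ _ "- K"])
          (use False K compact_imp_closed[OF K(1)] in \<open>auto simp: h_zero\<close>)
      from frechet_derivative_at[OF this] show ?thesis by simp
    qed
    then show ?thesis using False by simp
  qed
  have closed: "closed (param c ` K)" by (rule compact_param_image[OF c K])
  have div0: "?div q = 0" if "q \<notin> fst c" for q
  proof -
    have "q \<notin> param c ` K" using that K(2) c by auto
    then show ?thesis using D_zero_outside[OF Z closed 0] by simp
  qed
  note meas = smooth_map_measurable[OF smooth_map_divergence[OF Z]]
  have int1: "(LINT q|\<mu>. ?div q) = (LINT u|lborel. indicator ?U u * vol_density c x u * ?div (param c u))"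
    by (rule integral_in_chart(1)[OF c meas]) (rule div0)
  have int2: "integrable \<mu> ?div \<longleftrightarrow> integrable lborel (\<lambda>u. indicator ?U u * vol_density c x u * ?div (param c u))"
    by (rule integral_in_chart(2)[OF c meas]) (rule div0)
  note part = integral_directional_derivative_0[OF sm_h K(1) h_zero]
  have "integrable lborel (\<lambda>u. indicator ?U u * vol_density c x u * ?div (param c u))"
    unfolding eq by (intro Bochner_Integration.integrable_sum part(1))
  then show "integrable \<mu> ?div" by (simp only: int2)
  show "(LINT q|\<mu>. ?div q) = 0"
    unfolding int1 eq by (simp add: part Bochner_Integration.integral_sum)
qed

text \<open>The parametrized closed coordinate ball is compact, hence closed because the manifold is
  Hausdorff; this is what makes the continuation by 0 smooth at points outside the chart.\<close>

lemma chart_bump: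
  "\<exists>c K \<beta> W. c \<in> \<A> \<and> compact K \<and> K \<subseteq> chart_image c \<and> smooth_map \<A> \<beta> \<and> open W \<and> q0 \<in> W \<and>
    (\<forall>q. 0 \<le> (\<beta> q :: real)) \<and> (\<forall>q\<in>W. 0 < \<beta> q) \<and> (\<forall>q. q \<notin> param c ` K \<longrightarrow> \<beta> q = 0)"
proof -
  define c where "c = chart_at \<A> q0"
  have c: "c \<in> \<A>" and q0: "q0 \<in> fst c" using chart_at by (auto simp: c_def)
  let ?u0 = "snd c q0"
  have U: "open (chart_image c)" "?u0 \<in> chart_image c" using chart(2)[OF c] q0 by auto
  then obtain r where r: "r > 0" "cball ?u0 r \<subseteq> chart_image c" by (meson open_contains_cball)
  let ?K = "cball ?u0 r"
  define b where "b u = bump (r\<^sup>2 - (u - ?u0) \<bullet> (u - ?u0))" for u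
  have smb: "smooth_on S b" if "open S" for S
  proof -
    have "smooth_on S (\<lambda>u. r\<^sup>2 - (u - ?u0) \<bullet> (u - ?u0))"
      by (intro smooth_on_diff smooth_on_inner smooth_on_const smooth_on_linear bounded_linear_ident that)
    from smooth_on_compose[OF that open_UNIV _ this smooth_on_bump] show ?thesis
      unfolding b_def by simp
  qed
  have b_zero: "b u = 0" if "u \<notin> ?K" for u
  proof -
    have "r \<le> norm (u - ?u0)" using that by (simp add: dist_norm norm_minus_commute)
    then have "r\<^sup>2 \<le> (norm (u - ?u0))\<^sup>2" using r(1) by (intro power_mono) auto
    then show ?thesis by (simp add: b_def bump_eq_0 power2_norm_eq_inner)
  qed
  have b_pos: "b u > 0" if "u \<in> ball ?u0 r" for u
  proof -
    have "norm (u - ?u0) < r" using that by (simp add: dist_norm norm_minus_commute)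
    then have "(norm (u - ?u0))\<^sup>2 < r\<^sup>2" by (intro power_strict_mono) auto
    then show ?thesis by (simp add: b_def bump_pos_iff power2_norm_eq_inner)
  qed
  define \<beta> where "\<beta> q = (if q \<in> fst c then b (snd c q) else 0)" for q
  have \<beta>_zero: "\<beta> q = 0" if "q \<notin> param c ` ?K" for q
  proof (cases "q \<in> fst c")
    case True
    then have "snd c q \<notin> ?K" using that c by (metis image_eqI param_chart)
    then show ?thesis using True by (simp add: \<beta>_def b_zero)
  qed (simp add: \<beta>_def)
  have closed: "closed (param c ` ?K)" by (rule compact_param_image[OF c compact_cball r(2)])
  have "smooth_map \<A> \<beta>"
  proof (rule smooth_map_local)
    fix q
    show "\<exists>W. open W \<and> q \<in> W \<and> (\<forall>d\<in>\<A>. smooth_on (chart_image d \<inter> param d -` W) (\<lambda>u. \<beta> (param d u)))"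
    proof (cases "q \<in> fst c")
      case True
      have "smooth_on (chart_image d \<inter> param d -` fst c) (\<lambda>u. \<beta> (param d u))" if d: "d \<in> \<A>" for d
      proof (rule smooth_on_cong)
        show o: "open (chart_image d \<inter> param d -` fst c)" by (rule open_chart_preimage[OF d chart(1)[OF c]])
        have t: "smooth_on (chart_image d \<inter> param d -` fst c) (\<lambda>u. snd c (param d u))"
          using smooth_transition[OF d c] by (simp add: overlap[OF d] o_def)
        show "smooth_on (chart_image d \<inter> param d -` fst c) (\<lambda>u. b (snd c (param d u)))"
          by (rule smooth_on_compose[OF o open_UNIV _ t smb]) auto
      qed (auto simp: \<beta>_def)
      then show ?thesis using chart(1)[OF c] True by blast
    next
      case False
      have "smooth_on (chart_image d \<inter> param d -` (- param c ` ?K)) (\<lambda>u. \<beta> (param d u))" if d: "d \<in> \<A>" for d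
      proof (rule smooth_on_cong)
        show o: "open (chart_image d \<inter> param d -` (- param c ` ?K))"
          by (rule open_chart_preimage[OF d open_Compl[OF closed]])
        show "smooth_on (chart_image d \<inter> param d -` (- param c ` ?K)) (\<lambda>u. 0 :: real)"
          by (rule smooth_on_const[OF o])
      qed (auto simp: \<beta>_zero)
      moreover have "q \<in> - param c ` ?K" using False r(2) c by auto
      ultimately show ?thesis using open_Compl[OF closed] by blast
    qed
  qed
  moreover have "open (param c ` ball ?u0 r)" "q0 \<in> param c ` ball ?u0 r"
  proof -
    have "ball ?u0 r \<subseteq> chart_image c" using r(2) by (meson ball_subset_cball order_trans)
    then show "open (param c ` ball ?u0 r)" by (intro open_param_image[OF c]) auto
    have "q0 = param c ?u0" using c q0 by simp
    then show "q0 \<in> param c ` ball ?u0 r" using r(1) by (metis centre_in_ball imageI)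
  qed
  moreover have "0 \<le> \<beta> q" for q by (simp add: \<beta>_def b_def bump_nonneg)
  moreover have "0 < \<beta> q" if qin: "q \<in> param c ` ball ?u0 r" for q
  proof -
    obtain u where "u \<in> ball ?u0 r" "q = param c u" using qin by (auto simp del: mem_ball)
    moreover then have "u \<in> chart_image c" using r(2) by (auto simp: subset_iff)
    ultimately show ?thesis using c b_pos by (simp add: \<beta>_def)
  qed
  ultimately show ?thesis
    using c r(2) \<beta>_zero
    by (intro exI[of _ c] exI[of _ "?K"] exI[of _ \<beta>] exI[of _ "param c ` ball ?u0 r"]) auto
qed

text \<open>Near a point of \<open>K\<close> the denominator is positive. Near any other point
  \<open>Z\<close> vanishes, and so does the product, whatever value the quotient has.\<close>

lemma smooth_map_quotient:
  fixes \<beta> \<sigma> :: "'a \<Rightarrow> real"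
  assumes Z: "smooth_map \<A> Z" "\<And>q. q \<notin> K \<Longrightarrow> Z q = 0" and K: "closed K"
    and \<beta>: "smooth_map \<A> \<beta>" and \<sigma>: "smooth_map \<A> \<sigma>" "\<And>q. q \<in> K \<Longrightarrow> 0 < \<sigma> q"
  shows "smooth_map \<A> (\<lambda>q. (\<beta> q / \<sigma> q) *\<^sub>R Z q)"
proof (rule smooth_map_local)
  fix q
  show "\<exists>W. open W \<and> q \<in> W \<and> (\<forall>d\<in>\<A>. smooth_on (chart_image d \<inter> param d -` W) (\<lambda>u. (\<beta> (param d u) / \<sigma> (param d u)) *\<^sub>R Z (param d u)))"
  proof (cases "q \<in> K")
    case True
    let ?W = "{q. 0 < \<sigma> q}"
    have W: "open ?W"
      using open_Collect_less[of "\<lambda>q. 0" \<sigma>] smooth_map_continuous[OF \<sigma>(1)] by simp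
    have "smooth_on (chart_image d \<inter> param d -` ?W) (\<lambda>u. (\<beta> (param d u) / \<sigma> (param d u)) *\<^sub>R Z (param d u))"
      if d: "d \<in> \<A>" for d
      by (intro smooth_on_scaleR smooth_on_divide open_chart_preimage[OF d W]
          smooth_on_subset[OF smooth_mapD[OF \<beta> d]] smooth_on_subset[OF smooth_mapD[OF \<sigma>(1) d]]
          smooth_on_subset[OF smooth_mapD[OF Z(1) d]]) auto
    then show ?thesis using W \<sigma>(2)[OF True] by blast
  next
    case False
    have "smooth_on (chart_image d \<inter> param d -` (- K)) (\<lambda>u. (\<beta> (param d u) / \<sigma> (param d u)) *\<^sub>R Z (param d u))"
      if d: "d \<in> \<A>" for d
    proof (rule smooth_on_cong)
      show o: "open (chart_image d \<inter> param d -` (- K))" by (rule open_chart_preimage[OF d open_Compl[OF K]])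
      show "smooth_on (chart_image d \<inter> param d -` (- K)) (\<lambda>u. 0)" by (rule smooth_on_const[OF o])
    qed (auto simp: Z(2))
    then show ?thesis using open_Compl[OF K] False by blast
  qed
qed

lemma integral_divergence:
  assumes Z: "smooth_map \<A> Z" and tan: "\<And>q. P q (Z q) = Z q"
    and K: "compact K" and 0: "\<And>q. q \<notin> K \<Longrightarrow> Z q = 0"
  shows "integrable \<mu> (\<lambda>q. \<Sum>b\<in>Basis. D Z q b \<bullet> b)" "(LINT q|\<mu>. (\<Sum>b\<in>Basis. D Z q b \<bullet> b)) = 0"
proof -
  obtain c k \<beta> W where b: "\<And>p. c p \<in> \<A>" "\<And>p. compact (k p)" "\<And>p. k p \<subseteq> chart_image (c p)"
    "\<And>p. smooth_map \<A> (\<beta> p)" "\<And>p. open (W p)" "\<And>p. p \<in> W p" "\<And>p q. 0 \<le> (\<beta> p q :: real)"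
    "\<And>p q. q \<in> W p \<Longrightarrow> 0 < \<beta> p q" "\<And>p q. q \<notin> param (c p) ` k p \<Longrightarrow> \<beta> p q = 0"
    using chart_bump by metis
  obtain I where I: "finite I" "K \<subseteq> (\<Union>p\<in>I. W p)"
  proof -
    have "K \<subseteq> (\<Union>p\<in>K. W p)" using b(6) by blast
    then show thesis using compactE_image[OF K, of K W] b(5) that by metis
  qed
  \<comment> \<open>Dividing the finitely many bumps by their sum gives a partition of unity on
    \<open>K\<close>, which suffices because \<open>Z\<close> is 0 elsewhere.\<close>
  define \<sigma> where "\<sigma> q = (\<Sum>p\<in>I. \<beta> p q)" for q
  have sm\<sigma>: "smooth_map \<A> \<sigma>" unfolding \<sigma>_def by (intro smooth_map_sum b(4))
  have \<sigma>_pos: "0 < \<sigma> q" if qin: "q \<in> K" for q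
  proof -
    obtain p where p: "p \<in> I" "q \<in> W p" using subsetD[OF I(2) qin] by auto
    then show ?thesis unfolding \<sigma>_def using b(7,8) I(1) by (intro sum_pos2[of _ p]) auto
  qed
  have closed: "closed K" by (rule compact_imp_closed[OF K])
  define Zp where "Zp p q = (\<beta> p q / \<sigma> q) *\<^sub>R Z q" for p q
  have smZp: "smooth_map \<A> (Zp p)" for p
    unfolding Zp_def by (rule smooth_map_quotient[OF Z 0 closed b(4) sm\<sigma> \<sigma>_pos])
  have tanZp: "P q (Zp p q) = Zp p q" for p q by (simp add: Zp_def P_simps tan)
  have Zp0: "Zp p q = 0" if "q \<notin> param (c p) ` k p" for p q using b(9)[OF that] by (simp add: Zp_def)
  note part = integral_divergence_chart[OF b(1,2,3) smZp tanZp Zp0]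
  have Zsum: "Z = (\<lambda>q. \<Sum>p\<in>I. Zp p q)"
  proof
    fix q
    have "(\<Sum>p\<in>I. Zp p q) = (\<sigma> q / \<sigma> q) *\<^sub>R Z q"
      by (simp add: Zp_def scaleR_left.sum[symmetric] sum_divide_distrib[symmetric] \<sigma>_def)
    then show "Z q = (\<Sum>p\<in>I. Zp p q)" using \<sigma>_pos[of q] 0[of q] by (cases "q \<in> K") auto
  qed
  have "D Z q b = (\<Sum>p\<in>I. D (Zp p) q b)" for q b
    by (subst Zsum) (simp add: D_sum smZp)
  then have div: "(\<Sum>b\<in>Basis. D Z q b \<bullet> b) = (\<Sum>p\<in>I. \<Sum>b\<in>Basis. D (Zp p) q b \<bullet> b)" for q
    by (simp only: inner_sum_left) (rule sum.swap)
  show "integrable \<mu> (\<lambda>q. \<Sum>b\<in>Basis. D Z q b \<bullet> b)"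
    unfolding div by (intro Bochner_Integration.integrable_sum part(1))
  show "(LINT q|\<mu>. (\<Sum>b\<in>Basis. D Z q b \<bullet> b)) = 0"
    unfolding div by (simp add: Bochner_Integration.integral_sum part)
qed

end

subsection \<open>The second variation\<close>

text \<open>The bound \<open>h\<close> on the derivative bounds the difference quotients by the mean
  value inequality, and dominated convergence applies along every sequence of parameters tending to
  \<open>t\<close>.\<close>

lemma has_real_derivative_integral:
  fixes g g' :: "real \<Rightarrow> 'a \<Rightarrow> real"
  assumes int: "\<And>t. \<bar>t\<bar> < \<delta> \<Longrightarrow> integrable M (g t)"
    and der: "\<And>t q. \<bar>t\<bar> < \<delta> \<Longrightarrow> q \<in> space M \<Longrightarrow> ((\<lambda>t. g t q) has_real_derivative g' t q) (at t)"
    and bound: "\<And>t q. \<bar>t\<bar> < \<delta> \<Longrightarrow> q \<in> space M \<Longrightarrow> \<bar>g' t q\<bar> \<le> h q"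
    and h: "integrable M h" and t: "\<bar>t\<bar> < \<delta>"
  shows "integrable M (g' t)"
    and "((\<lambda>t. LINT q|M. g t q) has_real_derivative (LINT q|M. g' t q)) (at t)"
proof -
  have seq: "integrable M (g' t) \<and> (\<lambda>n. ((LINT q|M. g (s n) q) - (LINT q|M. g t q)) / (s n - t)) \<longlonglongrightarrow> (LINT q|M. g' t q)"
    if s: "\<And>n. s n \<noteq> t" "\<And>n. \<bar>s n\<bar> < \<delta>" "s \<longlonglongrightarrow> t" for s
  proof -
    define G where "G n q = (g (s n) q - g t q) / (s n - t)" for n q
    have lim: "(\<lambda>n. G n q) \<longlonglongrightarrow> g' t q" if "q \<in> space M" for q
    proof -
      have "((\<lambda>r. (g r q - g t q) / (r - t)) \<longlongrightarrow> g' t q) (at t)"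
        using der[OF t that] by (simp add: has_field_derivative_iff)
      moreover have "filterlim s (at t) sequentially"
        using s(1,3) by (intro filterlim_atI) auto
      ultimately show ?thesis unfolding G_def by (rule filterlim_compose)
    qed
    have G_bound: "norm (G n q) \<le> h q" if q: "q \<in> space M" for n q
    proof -
      let ?S = "{- \<delta><..<\<delta>}"
      have "norm (g (s n) q - g t q) \<le> h q * norm (s n - t)"
      proof (rule field_differentiable_bound[of ?S])
        show "((\<lambda>t. g t q) has_real_derivative g' r q) (at r within ?S)" if "r \<in> ?S" for r
          using der[of r q] that q by (auto intro: has_field_derivative_at_within)
        show "norm (g' r q) \<le> h q" if "r \<in> ?S" for r using bound[of r q] that q by auto
      qed (use t s(2)[of n] in auto)
      then show ?thesis using s(1)[of n] by (simp add: G_def norm_divide divide_le_eq)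
    qed
    have Gm: "G n \<in> borel_measurable M" for n
      unfolding G_def using int[OF s(2)[of n]] int[OF t] by measurable
    have g'm: "g' t \<in> borel_measurable M"
      by (rule borel_measurable_LIMSEQ_real[OF lim Gm])
    have al: "AE q in M. (\<lambda>n. G n q) \<longlonglongrightarrow> g' t q" using lim by (rule AE_I2)
    have ab: "AE q in M. norm (G n q) \<le> h q" for n using G_bound by (rule AE_I2)
    have "integrable M (g' t)" "(\<lambda>n. LINT q|M. G n q) \<longlonglongrightarrow> (LINT q|M. g' t q)"
      by (rule integrable_dominated_convergence[OF g'm Gm h al ab], rule integral_dominated_convergence[OF g'm Gm h al ab])
    moreover have "(LINT q|M. G n q) = ((LINT q|M. g (s n) q) - (LINT q|M. g t q)) / (s n - t)" for n
      unfolding G_def using int[OF s(2)[of n]] int[OF t] by (simp add: Bochner_Integration.integral_diff)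
    ultimately show ?thesis by simp
  qed
  have "((\<lambda>r. ((LINT q|M. g r q) - (LINT q|M. g t q)) / (r - t)) \<longlongrightarrow> (LINT q|M. g' t q)) (at t within {- \<delta><..<\<delta>})"
    unfolding tendsto_at_iff_sequentially o_def
  proof (intro allI impI)
    fix X assume X: "\<forall>i. X i \<in> {- \<delta><..<\<delta>} - {t}" "X \<longlonglongrightarrow> t"
    have "X n \<noteq> t" "\<bar>X n\<bar> < \<delta>" for n using spec[OF X(1), of n] by auto
    from seq[OF this X(2)]
    show "(\<lambda>n. ((LINT q|M. g (X n) q) - (LINT q|M. g t q)) / (X n - t)) \<longlonglongrightarrow> (LINT q|M. g' t q)" ..
  qed
  moreover have "at t within {- \<delta><..<\<delta>} = at t"
    using t by (intro at_within_open) auto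
  ultimately show "((\<lambda>t. LINT q|M. g t q) has_real_derivative (LINT q|M. g' t q)) (at t)"
    by (simp add: has_field_derivative_iff)
  \<comment> \<open>The statement \<open>seq\<close> also delivers the integrability of
    \<open>g' t\<close>, provided that some admissible sequence is at hand. The radius
    \<open>r\<close> keeps the one below inside the interval.\<close>
  define r where "r = (\<delta> - \<bar>t\<bar>) / 2"
  have r: "r > 0" "\<bar>t\<bar> + r < \<delta>" using t by (auto simp: r_def field_simps)
  define s where "s n = t + r / (1 + real n)" for n
  have "(\<lambda>n. r * (1 / (1 + real n))) \<longlonglongrightarrow> r * 0"
    using LIMSEQ_inverse_real_of_nat by (intro tendsto_mult tendsto_const) (simp add: inverse_eq_divide add.commute)
  then have "s \<longlonglongrightarrow> t + 0" unfolding s_def by (intro tendsto_add tendsto_const) simp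
  moreover have "s n \<noteq> t" "\<bar>s n\<bar> < \<delta>" for n
  proof -
    have "0 < r / (1 + real n)" using r by simp
    moreover have "r / (1 + real n) \<le> r" using r by (simp add: divide_le_eq_1 mult_le_cancel_left1 field_simps)
    ultimately show "s n \<noteq> t" "\<bar>s n\<bar> < \<delta>" using r(2) by (auto simp: s_def)
  qed
  ultimately show "integrable M (g' t)" using seq[of s] by simp
qed

context immersed
begin

text \<open>A change of charts multiplies numerator and denominator by the same squared Jacobian
  determinant.\<close>

lemma det_gram_ratio:
  assumes y: "smooth_map \<A> (y :: 'a \<Rightarrow> 'e)" and c: "c \<in> \<A>" "q \<in> fst c" and d: "d \<in> \<A>" "q \<in> fst d"
  shows "det (gram (cder c y q)) / det (gram (cder c x q)) = det (gram (cder d y q)) / det (gram (cder d x q))"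
proof -
  let ?T = "trans c d q"
  have lin: "linear ?T" by (rule linear_trans[OF c(1) d(1) c(2) d(2)])
  have g: "det (gram (cder c z q)) = (det (matrix ?T))\<^sup>2 * det (gram (cder d z q))" if z: "smooth_map \<A> z" for z :: "'a \<Rightarrow> 'e"
    unfolding cder_trans[OF z c(1) d(1) c(2) d(2)] gram_compose[OF linear_cder[OF z d] lin]
    by (simp add: det_mul det_transpose power2_eq_square)
  have "det (gram (cder c x q)) \<noteq> 0" by (rule frame.det_gram[OF frame_cder[OF c]])
  then have "det (matrix ?T) \<noteq> 0" using g[OF smooth_x] by auto
  then show ?thesis by (simp add: g[OF y] g[OF smooth_x])
qed

end

section \<open>The linear variation along a normal field of compact support\<close>

locale compact_normal_variation = xi_immersed \<A> x \<xi>
  for \<A> :: "('a::{t2_space, second_countable_topology}, 'm::finite) chart set"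
    and x \<xi> :: "'a \<Rightarrow> 'e::euclidean_space" +
  fixes \<eta> :: "'a \<Rightarrow> 'e" and K :: "'a set"
  assumes smooth_\<eta>: "smooth_map \<A> \<eta>" and P_\<eta>: "tan_part \<A> x q (\<eta> q) = 0"
    and compact_K: "compact K" and \<eta>_zero: "q \<notin> K \<Longrightarrow> \<eta> q = 0"
    and finite_V: "V_xi \<A> \<xi> x < \<infinity>"
begin

definition y where "y t = (\<lambda>q. x q + t *\<^sub>R \<eta> q)"

lemma smooth_y: "smooth_map \<A> (y t)"
  unfolding y_def by (intro smooth_map_add smooth_map_scaleR smooth_x smooth_\<eta> smooth_map_const)

lemma cder_y:
  assumes c: "c \<in> \<A>" "q \<in> fst c"
  shows "cder c (y t) q = (\<lambda>a. cder c x q a + t *\<^sub>R cder c \<eta> q a)"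
proof (rule cder_eqI)
  show "((\<lambda>u. y t (param c u)) has_derivative (\<lambda>a. cder c x q a + t *\<^sub>R cder c \<eta> q a)) (at (snd c q))"
    unfolding y_def
    by (intro has_derivative_add has_derivative_scaleR_right has_derivative_cder smooth_x smooth_\<eta> c)
qed

text \<open>The square of the ratio of the volume elements of \<open>y t\<close> and
  \<open>x\<close>. Being a ratio, it is a function on the manifold and not just in a chart.\<close>

definition jac where
  "jac q t = det (gram (cder (chart_at \<A> q) (y t) q)) / det (gram (cder (chart_at \<A> q) x q))"

lemma jac_chart:
  "c \<in> \<A> \<Longrightarrow> q \<in> fst c \<Longrightarrow> jac q t = det (gram (cder c (y t) q)) / det (gram (cder c x q))"
  unfolding jac_def by (rule det_gram_ratio[OF smooth_y chart_at])

definition \<Theta> where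
  "\<Theta> q t = exp (- (1/2) * (norm ((x q - \<xi> q) + t *\<^sub>R \<eta> q))\<^sup>2) * sqrt (jac q t)"

definition \<Theta>1 where "\<Theta>1 q t = deriv (\<Theta> q) t"
definition \<Theta>2 where "\<Theta>2 q t = deriv (\<Theta>1 q) t"

lemma det_gram_x_pos: "c \<in> \<A> \<Longrightarrow> q \<in> fst c \<Longrightarrow> det (gram (cder c x q)) > 0"
  by (rule frame.det_gram[OF frame_cder])

lemma closed_K: "closed K" by (rule compact_imp_closed[OF compact_K])

lemma outside_K:
  assumes q: "q \<notin> K"
  shows "jac q t = 1" "\<Theta> q t = \<omega> q" "\<Theta>1 q t = 0" "\<Theta>2 q t = 0"
proof -
  let ?c = "chart_at \<A> q"
  have "((\<lambda>u. \<eta> (param ?c u)) has_derivative (\<lambda>a. 0)) (at (snd ?c q))"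
    by (rule has_derivative_transform_within_open[of "\<lambda>u. 0" _ _ _ "chart_image ?c \<inter> param ?c -` (- K)"])
      (use q chart_at[of q] closed_K in \<open>auto simp: \<eta>_zero intro: open_chart_preimage\<close>)
  then have "cder ?c \<eta> q = (\<lambda>a. 0)" by (rule cder_eqI)
  then have "cder ?c (y t) q = cder ?c x q" for t
    using cder_y[OF chart_at, of q t] by simp
  then show j: "jac q t = 1" for t
    using det_gram_x_pos[OF chart_at, of q] by (simp add: jac_def)
  show t: "\<Theta> q t = \<omega> q" for t by (simp add: \<Theta>_def j \<eta>_zero[OF q] \<omega>_def)
  then have "\<Theta> q = (\<lambda>t. \<omega> q)" by auto
  then show t1: "\<Theta>1 q t = 0" for t by (simp add: \<Theta>1_def)
  then have "\<Theta>1 q = (\<lambda>t. 0)" by auto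
  then show "\<Theta>2 q t = 0" by (simp add: \<Theta>2_def)
qed

text \<open>What differentiation under the integral requires at the point \<open>q\<close>, together
  with the immersion condition \<open>jac q t > 0\<close>. Joint smoothness gives it locally with
  some constants, stationarity gives it off \<open>K\<close>, and compactness of \<open>K\<close>
  makes the constants uniform.\<close>

definition good where
  "good \<delta> C q \<longleftrightarrow> (\<forall>t. \<bar>t\<bar> < \<delta> \<longrightarrow> jac q t > 0 \<and> (\<Theta> q has_real_derivative \<Theta>1 q t) (at t) \<and>
    (\<Theta>1 q has_real_derivative \<Theta>2 q t) (at t) \<and> \<bar>\<Theta>1 q t\<bar> \<le> C \<and> \<bar>\<Theta>2 q t\<bar> \<le> C)"

lemma good_mono: "good \<delta> C q \<Longrightarrow> \<delta>' \<le> \<delta> \<Longrightarrow> C \<le> C' \<Longrightarrow> good \<delta>' C' q"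
  unfolding good_def by (meson dual_order.trans less_le_trans)

lemma good_outside: "q \<notin> K \<Longrightarrow> 0 \<le> C \<Longrightarrow> good \<delta> C q"
  unfolding good_def by (simp add: outside_K ext[of "\<Theta> q" "\<lambda>t. \<omega> q"] ext[of "\<Theta>1 q" "\<lambda>t. 0"])

text \<open>In a chart, \<open>\<Theta>\<close> is a smooth function of position and time jointly
  wherever the Gram determinant is positive, so its time derivatives are bounded near
  \<open>(q0, 0)\<close>.\<close>

lemma good_local: "\<exists>W \<delta> C. open W \<and> q0 \<in> W \<and> \<delta> > 0 \<and> (\<forall>q\<in>W. good \<delta> C q)"
proof -
  define c where "c = chart_at \<A> q0"
  have c: "c \<in> \<A>" and q0: "q0 \<in> fst c" using chart_at by (auto simp: c_def)
  let ?U = "chart_image c"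
  let ?u0 = "snd c q0"
  have U: "open ?U" and u0: "?u0 \<in> ?U" using chart(2)[OF c] q0 by auto
  let ?O = "?U \<times> (UNIV :: real set)"
  have O: "open ?O" using U by (intro open_Times) auto
  define Xd where "Xd i = (\<lambda>u. frechet_derivative (\<lambda>u. x (param c u)) (at u) (axis i 1))" for i
  define Yd where "Yd i = (\<lambda>u. frechet_derivative (\<lambda>u. \<eta> (param c u)) (at u) (axis i 1))" for i
  have smX: "smooth_on ?U (Xd i)" "smooth_on ?U (Yd i)" for i
    unfolding Xd_def Yd_def by (intro smooth_on_frechet smooth_mapD c smooth_x smooth_\<eta>)+
  have fst_O: "smooth_on ?O (\<lambda>p. f (fst p))" if "smooth_on ?U f" for f :: "real ^ 'm \<Rightarrow> 'z::real_normed_vector"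
    by (rule smooth_on_compose[OF O U _ smooth_on_linear[OF O bounded_linear_fst] that]) auto
  have snd_O: "smooth_on ?O (snd :: _ \<Rightarrow> real)" by (rule smooth_on_linear[OF O bounded_linear_snd])
  define M where "M p = (\<chi> i j. (Xd i (fst p) + snd p *\<^sub>R Yd i (fst p)) \<bullet> (Xd j (fst p) + snd p *\<^sub>R Yd j (fst p)))" for p
  have smd: "smooth_on ?O (\<lambda>p. det (M p))"
  proof (rule smooth_on_det[OF O])
    show "smooth_on ?O (\<lambda>p. M p $ i $ j)" for i j
      unfolding M_def by (simp, intro smooth_on_inner smooth_on_add smooth_on_scaleR O fst_O smX snd_O)
  qed
  have M_gram: "M (u, t) = gram (cder c (y t) (param c u))" if "u \<in> ?U" for u t
    using that c by (simp add: M_def gram_def cder_y, simp add: cder_def o_def Xd_def Yd_def)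
  have M_x: "M (u, 0) = gram (cder c x (param c u))" if "u \<in> ?U" for u
    using M_gram[OF that, of 0] by (simp add: y_def)
  let ?W = "?O \<inter> (\<lambda>p. det (M p)) -` {0<..}"
  have W: "open ?W"
    by (rule continuous_open_preimage[OF smooth_on_continuous[OF smd] O]) simp
  have u0W: "(?u0, 0) \<in> ?W" using u0 det_gram_x_pos[OF c q0] q0 c by (simp add: M_x)
  define \<Theta>c where "\<Theta>c p = exp (- (1/2) * ((x (param c (fst p)) - \<xi> (param c (fst p)) + snd p *\<^sub>R \<eta> (param c (fst p)))
      \<bullet> (x (param c (fst p)) - \<xi> (param c (fst p)) + snd p *\<^sub>R \<eta> (param c (fst p)))))
      * sqrt (det (M p) / det (gram (cder c x (param c (fst p)))))" for p
  have WO: "?W \<subseteq> ?O" by auto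
  have smW: "smooth_on ?W f" if "smooth_on ?O f" for f :: "(real ^ 'm) \<times> real \<Rightarrow> 'z::real_normed_vector"
    by (rule smooth_on_subset[OF that WO])
  have sm\<Theta>: "smooth_on ?W \<Theta>c"
    unfolding \<Theta>c_def
  proof (intro smooth_on_mult smooth_on_exp smooth_on_const smooth_on_inner smooth_on_add smooth_on_diff
      smooth_on_scaleR W smooth_on_sqrt smooth_on_divide)
    show "smooth_on ?W (\<lambda>p. x (param c (fst p)))" by (rule smW, rule fst_O, rule smooth_mapD[OF smooth_x c])
    then show "smooth_on ?W (\<lambda>p. x (param c (fst p)))" .
    show "smooth_on ?W (\<lambda>p. \<xi> (param c (fst p)))" by (rule smW, rule fst_O, rule smooth_mapD[OF smooth_xi c])
    then show "smooth_on ?W (\<lambda>p. \<xi> (param c (fst p)))" .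
    show "smooth_on ?W (\<lambda>p. \<eta> (param c (fst p)))" by (rule smW, rule fst_O, rule smooth_mapD[OF smooth_\<eta> c])
    then show "smooth_on ?W (\<lambda>p. \<eta> (param c (fst p)))" .
    show "smooth_on ?W (\<lambda>p. snd p)" using smW[OF snd_O] .
    then show "smooth_on ?W (\<lambda>p. snd p)" .
    show "smooth_on ?W (\<lambda>p. det (M p))" by (rule smW[OF smd])
    show "smooth_on ?W (\<lambda>p. det (gram (cder c x (param c (fst p)))))"
      by (rule smW, rule fst_O, rule smooth_on_det_gram[OF c])
  qed (use c in \<open>auto simp: det_gram_x_pos less_imp_neq[symmetric]\<close>)
  define \<Psi>1 where "\<Psi>1 p = frechet_derivative \<Theta>c (at p) (0, 1)" for p
  define \<Psi>2 where "\<Psi>2 p = frechet_derivative \<Psi>1 (at p) (0, 1)" for p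
  have sm1: "smooth_on ?W \<Psi>1" unfolding \<Psi>1_def by (rule smooth_on_frechet[OF sm\<Theta>])
  have sm2: "smooth_on ?W \<Psi>2" unfolding \<Psi>2_def by (rule smooth_on_frechet[OF sm1])
  have cont: "isCont \<Psi>1 (?u0, 0)" "isCont \<Psi>2 (?u0, 0)"
    using smooth_on_continuous[OF sm1] smooth_on_continuous[OF sm2] W u0W
    by (simp_all add: continuous_on_eq_continuous_at)
  obtain r1 where r1: "r1 > 0" "\<And>p. dist p (?u0, 0) < r1 \<Longrightarrow> dist (\<Psi>1 p) (\<Psi>1 (?u0, 0)) < 1"
    using cont(1) unfolding continuous_at_eps_delta by (metis zero_less_one)
  obtain r2 where r2: "r2 > 0" "\<And>p. dist p (?u0, 0) < r2 \<Longrightarrow> dist (\<Psi>2 p) (\<Psi>2 (?u0, 0)) < 1"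
    using cont(2) unfolding continuous_at_eps_delta by (metis zero_less_one)
  obtain r3 where r3: "r3 > 0" "ball (?u0, 0) r3 \<subseteq> ?W"
    using W u0W openE by metis
  define r where "r = min r1 (min r2 r3)"
  have r: "r > 0" "r \<le> r1" "r \<le> r2" "r \<le> r3" using r1 r2 r3 by (auto simp: r_def)
  \<comment> \<open>The summand 1 is the tolerance used for \<open>r1\<close> and
    \<open>r2\<close>.\<close>
  define C where "C = max (\<bar>\<Psi>1 (?u0, 0)\<bar>) (\<bar>\<Psi>2 (?u0, 0)\<bar>) + 1"
  have near: "(u, t) \<in> ?W \<and> \<bar>\<Psi>1 (u, t)\<bar> \<le> C \<and> \<bar>\<Psi>2 (u, t)\<bar> \<le> C" if "dist u ?u0 < r / 2" "\<bar>t\<bar> < r / 2" for u t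
  proof -
    have "dist (u, t) (?u0, 0) \<le> dist u ?u0 + dist t 0"
      unfolding dist_Pair_Pair by (rule sqrt_sum_squares_le_sum) auto
    then have d: "dist (u, t) (?u0, 0) < r" using that by simp
    then have "(u, t) \<in> ball (?u0, 0) r3" using r by (simp add: dist_commute)
    moreover have "dist (\<Psi>1 (u, t)) (\<Psi>1 (?u0, 0)) < 1" using r1(2) d r by simp
    moreover have "dist (\<Psi>2 (u, t)) (\<Psi>2 (?u0, 0)) < 1" using r2(2) d r by simp
    ultimately show ?thesis using r3(2) by (auto simp: C_def dist_real_def)
  qed
  let ?V = "param c ` (?U \<inter> ball ?u0 (r/2))"
  have "open ?V" by (rule open_param_image[OF c]) (use U in auto)
  moreover have "q0 \<in> ?V"
  proof -
    have "q0 = param c ?u0" using c q0 by simp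
    moreover have "?u0 \<in> ?U \<inter> ball ?u0 (r/2)" using u0 r by simp
    ultimately show ?thesis by blast
  qed
  moreover have "good (r/2) C q" if qV: "q \<in> ?V" for q
  proof -
    obtain u where u: "u \<in> ?U" "u \<in> ball ?u0 (r/2)" and qu: "q = param c u" using qV by blast
    have du: "dist u ?u0 < r / 2" using u(2) by (simp add: dist_commute)
    have q: "q \<in> fst c" using u c by (simp add: qu)
    have \<Theta>_eq: "\<Theta> q = (\<lambda>t. \<Theta>c (u, t))"
      unfolding \<Theta>_def \<Theta>c_def jac_chart[OF c q] power2_norm_eq_inner
      by (simp add: M_gram[OF u(1)] qu)
    have d0: "(\<Theta> q has_real_derivative \<Psi>1 (u, t)) (at t)" if t: "\<bar>t\<bar> < r/2" for t
      using smooth_on_line_derivative[OF W sm\<Theta>, of "(u, 0)" t "(0, 1)"] near[OF du t]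
      by (simp add: \<Theta>_eq \<Psi>1_def has_real_derivative_iff_has_vector_derivative)
    then have t1: "\<Theta>1 q t = \<Psi>1 (u, t)" if t: "\<bar>t\<bar> < r/2" for t
      using DERIV_imp_deriv[OF d0[OF t]] by (simp add: \<Theta>1_def)
    have d1: "(\<Theta>1 q has_real_derivative \<Psi>2 (u, t)) (at t)" if t: "\<bar>t\<bar> < r/2" for t
    proof -
      have "((\<lambda>t. \<Psi>1 (u, t)) has_real_derivative \<Psi>2 (u, t)) (at t)"
        using smooth_on_line_derivative[OF W sm1, of "(u, 0)" t "(0, 1)"] near[OF du t]
        by (simp add: \<Psi>2_def has_real_derivative_iff_has_vector_derivative)
      then show ?thesis
        by (rule has_field_derivative_transform_within_open[of _ _ _ "{- (r/2)<..<r/2}"])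
          (use t t1 in auto)
    qed
    then have t2: "\<Theta>2 q t = \<Psi>2 (u, t)" if t: "\<bar>t\<bar> < r/2" for t
      using DERIV_imp_deriv[OF d1[OF t]] by (simp add: \<Theta>2_def)
    have "jac q t > 0" if t: "\<bar>t\<bar> < r/2" for t
      unfolding jac_chart[OF c q] using near[OF du t] det_gram_x_pos[OF c q] by (simp add: M_gram[OF u(1)] qu)
    then show ?thesis
      unfolding good_def using d0 d1 t1 t2 near[OF du] by auto
  qed
  ultimately show ?thesis
    using r(1) by (intro exI[of _ ?V] exI[of _ "r/2"] exI[of _ C]) auto
qed

lemma good_uniform: "\<exists>\<delta>>0. \<exists>C\<ge>0. \<forall>q. good \<delta> C q"
proof -
  obtain W \<delta> C where g: "\<And>p. open (W p)" "\<And>p. p \<in> W p" "\<And>p. \<delta> p > 0" "\<And>p q. q \<in> W p \<Longrightarrow> good (\<delta> p) (C p) q"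
    using good_local by metis
  obtain I where I: "finite I" "K \<subseteq> (\<Union>p\<in>I. W p)"
  proof -
    have "K \<subseteq> (\<Union>p\<in>K. W p)" using g(2) by blast
    then show thesis using compactE_image[OF compact_K, of K W] g(1) that by metis
  qed
  let ?d = "Min (insert 1 (\<delta> ` I))" and ?C = "Max (insert 0 (C ` I))"
  have "good ?d ?C q" for q
  proof (cases "q \<in> K")
    case True
    then obtain p where p: "p \<in> I" "q \<in> W p" using subsetD[OF I(2)] by auto
    show ?thesis
      by (rule good_mono[OF g(4)[OF p(2)]]) (use p(1) I(1) in auto)
  next
    case False
    then show ?thesis by (rule good_outside) (use I(1) in simp)
  qed
  moreover have "?d > 0" using g(3) I(1) by auto
  moreover have "?C \<ge> 0" using I(1) by simp
  ultimately show ?thesis by blast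
qed

lemma immersed_y: "\<forall>q. jac q t > 0 \<Longrightarrow> immersed \<A> (y t)"
proof (unfold_locales)
  assume j: "\<forall>q. jac q t > 0"
  have "inj (differential \<A> (y t) q)" for q
  proof -
    have "det (gram (cder (chart_at \<A> q) (y t) q)) \<noteq> 0"
      using spec[OF j, of q] by (auto simp: jac_def)
    then show ?thesis
      using det_gram_pos_iff(2)[OF linear_cder[OF smooth_y chart_at]] by (simp add: differential_eq_cder)
  qed
  then show "immersion \<A> (y t)" by (simp add: immersion_def smooth_y)
qed

lemma smooth_map_sqrt_jac:
  assumes j: "\<forall>q. jac q t > 0"
  shows "smooth_map \<A> (\<lambda>q. sqrt (jac q t))"
proof (rule smooth_mapI, rule smooth_on_cong)
  interpret y: immersed \<A> "y t" by (rule immersed_y[OF j])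
  fix c assume c: "c \<in> \<A>"
  show "open (chart_image c)" by (rule chart[OF c])
  show "smooth_on (chart_image c) (\<lambda>u. sqrt (det (gram (cder c (y t) (param c u))) / det (gram (cder c x (param c u)))))"
    by (intro smooth_on_sqrt smooth_on_divide smooth_on_det_gram y.smooth_on_det_gram c chart)
      (use c in \<open>auto simp: det_gram_cder_pos y.det_gram_cder_pos less_imp_neq[symmetric]\<close>)
  show "sqrt (det (gram (cder c (y t) (param c u))) / det (gram (cder c x (param c u)))) = sqrt (jac (param c u) t)"
    if "u \<in> chart_image c" for u
    using that c by (simp add: jac_chart)
qed

text \<open>Expressing the volume of \<open>y t\<close> as a density for the volume of
  \<open>x\<close> refers all times to one fixed measure, as differentiation under the integral
  demands.\<close>

lemma volume_y:
  assumes j: "\<forall>q. jac q t > 0"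
  shows "volume_measure \<A> (y t) = density \<mu> (\<lambda>q. ennreal (sqrt (jac q t)))"
proof -
  interpret y: immersed \<A> "y t" by (rule immersed_y[OF j])
  have jm: "(\<lambda>q. sqrt (jac q t)) \<in> borel_measurable borel"
    by (rule smooth_map_measurable[OF smooth_map_sqrt_jac[OF j]])
  show ?thesis
  proof (rule y.\<mu>_unique, unfold y.is_volume_def, intro conjI ballI impI)
    fix c B assume c: "c \<in> \<A>" and B: "B \<in> sets borel" "B \<subseteq> fst c"
    have fc: "fst c \<in> sets borel" using chart(1)[OF c] by simp
    let ?g = "\<lambda>q. ennreal (sqrt (jac q t)) * indicator B q"
    have gm: "?g \<in> borel_measurable borel" using jm B(1) by measurable
    have "emeasure (density \<mu> (\<lambda>q. ennreal (sqrt (jac q t)))) B = (\<integral>\<^sup>+q. ?g q \<partial>\<mu>)"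
      using jm B(1) by (simp add: emeasure_density)
    also have "\<dots> = (\<integral>\<^sup>+q. indicator (fst c) q * ?g q \<partial>\<mu>)"
      using B(2) by (intro nn_integral_cong) (auto simp: indicator_def)
    also have "\<dots> = (\<integral>\<^sup>+q. ?g q \<partial>density \<mu> (indicator (fst c)))"
      using fc gm by (subst nn_integral_density) auto
    also have "\<dots> = (\<integral>\<^sup>+u. ennreal (indicator (chart_image c) u * vol_density c x u) * ?g (pm c u) \<partial>lborel)"
      unfolding density_chart[OF c] by (rule nn_integral_chart_measure[OF c gm])
    also have "\<dots> = (\<integral>\<^sup>+u. ennreal (indicator (chart_image c) u * vol_density c (y t) u) * indicator B (pm c u) \<partial>lborel)"
    proof (rule nn_integral_cong)
      fix u
      show "ennreal (indicator (chart_image c) u * vol_density c x u) * ?g (pm c u)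
        = ennreal (indicator (chart_image c) u * vol_density c (y t) u) * indicator B (pm c u)"
      proof (cases "u \<in> chart_image c")
        case True
        have "vol_density c x u * sqrt (jac (param c u) t) = vol_density c (y t) u"
          using True c det_gram_cder_pos[OF c True]
          by (simp add: vol_density_eq y.vol_density_eq jac_chart real_sqrt_divide)
        then have "ennreal (vol_density c x u) * ennreal (sqrt (jac (param c u) t)) = ennreal (vol_density c (y t) u)"
          using vol_density_pos[OF c True] by (simp add: ennreal_mult'[symmetric])
        then show ?thesis using True by (simp add: pm_def mult.assoc[symmetric])
      qed simp
    qed
    also have "\<dots> = emeasure (y.chart_measure c) B"
      using y.emeasure_chart_measure[OF c B(1)] by (simp add: y.pm_def pm_def)
    finally show "emeasure (density \<mu> (\<lambda>q. ennreal (sqrt (jac q t)))) B = emeasure (y.chart_measure c) B" .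
  qed simp
qed

lemma V_xi_y:
  assumes j: "\<forall>q. jac q t > 0"
  shows "V_xi \<A> \<xi> (y t) = (\<integral>\<^sup>+q. ennreal (\<Theta> q t) \<partial>\<mu>)" "(\<lambda>q. \<Theta> q t) \<in> borel_measurable borel"
proof -
  have jm: "(\<lambda>q. sqrt (jac q t)) \<in> borel_measurable borel"
    by (rule smooth_map_measurable[OF smooth_map_sqrt_jac[OF j]])
  have "smooth_map \<A> (\<lambda>q. (x q - \<xi> q) + t *\<^sub>R \<eta> q)"
    by (intro smooth_map_add smooth_map_diff smooth_map_scaleR smooth_map_const smooth_x smooth_xi smooth_\<eta>)
  then have "continuous_on UNIV (\<lambda>q. exp (- (1/2) * (norm ((x q - \<xi> q) + t *\<^sub>R \<eta> q))\<^sup>2))"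
    by (intro continuous_intros smooth_map_continuous)
  then have em: "(\<lambda>q. exp (- (1/2) * (norm ((x q - \<xi> q) + t *\<^sub>R \<eta> q))\<^sup>2)) \<in> borel_measurable borel"
    by (rule borel_measurable_continuous_onI)
  then show "(\<lambda>q. \<Theta> q t) \<in> borel_measurable borel"
    unfolding \<Theta>_def using jm by measurable
  have "V_xi \<A> \<xi> (y t) = (\<integral>\<^sup>+q. ennreal (exp (- (1/2) * (norm ((x q - \<xi> q) + t *\<^sub>R \<eta> q))\<^sup>2))
      \<partial>density \<mu> (\<lambda>q. ennreal (sqrt (jac q t))))"
    by (simp only: V_xi_def volume_y[OF j]) (simp add: y_def algebra_simps)
  also have "\<dots> = (\<integral>\<^sup>+q. ennreal (sqrt (jac q t)) * ennreal (exp (- (1/2) * (norm ((x q - \<xi> q) + t *\<^sub>R \<eta> q))\<^sup>2)) \<partial>\<mu>)"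
    using em jm by (subst nn_integral_density) auto
  also have "\<dots> = (\<integral>\<^sup>+q. ennreal (\<Theta> q t) \<partial>\<mu>)"
  proof (rule nn_integral_cong)
    fix q
    have "0 \<le> sqrt (jac q t)" using spec[OF j, of q] by simp
    then have "ennreal (\<Theta> q t) = ennreal (exp (- (1/2) * (norm ((x q - \<xi> q) + t *\<^sub>R \<eta> q))\<^sup>2)) * ennreal (sqrt (jac q t))"
      unfolding \<Theta>_def by (rule ennreal_mult'')
    then show "ennreal (sqrt (jac q t)) * ennreal (exp (- (1/2) * (norm ((x q - \<xi> q) + t *\<^sub>R \<eta> q))\<^sup>2)) = ennreal (\<Theta> q t)"
      by (simp only: mult.commute)
  qed
  finally show "V_xi \<A> \<xi> (y t) = (\<integral>\<^sup>+q. ennreal (\<Theta> q t) \<partial>\<mu>)" .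
qed

lemma integrable_\<omega>: "integrable \<mu> \<omega>"
proof (rule integrableI_nonneg)
  show "\<omega> \<in> borel_measurable \<mu>" using smooth_map_measurable[OF smooth_\<omega>] by simp
  show "(\<integral>\<^sup>+q. ennreal (\<omega> q) \<partial>\<mu>) < \<infinity>" using finite_V by (simp add: V_xi_def \<omega>_def)
qed (use \<omega>_pos in \<open>auto simp: less_imp_le\<close>)

text \<open>The weight \<open>\<omega>\<close> has a positive minimum on the compact set
  \<open>K\<close>, so finite weighted volume implies finite volume of \<open>K\<close>.\<close>

lemma integrable_indicator_K: "integrable \<mu> (\<lambda>q. C * indicator K q :: real)"
proof (cases "K = {}")
  case False
  have "continuous_on K \<omega>" using smooth_map_continuous[OF smooth_\<omega>] continuous_on_subset by blast
  then obtain k where k: "k \<in> K" "\<forall>q\<in>K. \<omega> k \<le> \<omega> q"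
    using continuous_attains_inf[OF compact_K False] by blast
  have "integrable \<mu> (\<lambda>q. indicator K q :: real)"
  proof (rule Bochner_Integration.integrable_bound)
    show "integrable \<mu> (\<lambda>q. \<omega> q / \<omega> k)" using integrable_\<omega> by simp
    show "(\<lambda>q. indicator K q :: real) \<in> borel_measurable \<mu>"
      by (rule borel_measurable_indicator) (simp add: borel_closed closed_K)
    show "AE q in \<mu>. norm (indicator K q :: real) \<le> norm (\<omega> q / \<omega> k)"
      using k \<omega>_pos by (auto simp: indicator_def field_simps abs_of_pos less_imp_le)
  qed
  then show ?thesis by simp
qed simp

text \<open>Two differentiations under the integral sign. Off \<open>K\<close> the density does not
  depend on \<open>t\<close>, so \<open>C * indicator K\<close> dominates both derivatives, and also
  controls the deviation of the density from \<open>\<omega>\<close>.\<close>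

lemma second_variation:
  "\<exists>\<epsilon>>0. (\<forall>t. \<bar>t\<bar> < \<epsilon> \<longrightarrow> (\<forall>q. jac q t > 0)) \<and>
    integrable \<mu> (\<lambda>q. \<Theta>2 q 0) \<and>
    deriv (deriv (\<lambda>t. enn2real (V_xi \<A> \<xi> (y t)))) 0 = (LINT q|\<mu>. \<Theta>2 q 0)"
proof -
  obtain \<delta> C where \<delta>: "\<delta> > 0" and C: "C \<ge> 0" and g: "\<And>q. good \<delta> C q"
    using good_uniform by blast
  have jac: "\<forall>q. jac q t > 0" if "\<bar>t\<bar> < \<delta>" for t using g that by (auto simp: good_def)
  let ?h = "\<lambda>q. C * indicator K q :: real"
  have h1: "\<bar>\<Theta>1 q t\<bar> \<le> ?h q" "\<bar>\<Theta>2 q t\<bar> \<le> ?h q" if "\<bar>t\<bar> < \<delta>" for q t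
    using g[of q] that outside_K(3,4)[of q t] by (cases "q \<in> K", auto simp: good_def)+
  have d0: "((\<lambda>t. \<Theta> q t) has_real_derivative \<Theta>1 q t) (at t)" and d1: "((\<lambda>t. \<Theta>1 q t) has_real_derivative \<Theta>2 q t) (at t)"
    if "\<bar>t\<bar> < \<delta>" for q t
    using g[of q] that by (auto simp: good_def)
  have int0: "integrable \<mu> (\<lambda>q. \<Theta> q t)" if t: "\<bar>t\<bar> < \<delta>" for t
  proof (rule Bochner_Integration.integrable_bound)
    show "integrable \<mu> (\<lambda>q. \<omega> q + C * \<delta> * indicator K q)"
      using integrable_\<omega> integrable_indicator_K by (rule Bochner_Integration.integrable_add)
    show "(\<lambda>q. \<Theta> q t) \<in> borel_measurable \<mu>" using V_xi_y(2)[OF jac[OF t]] by simp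
    show "AE q in \<mu>. norm (\<Theta> q t) \<le> norm (\<omega> q + C * \<delta> * indicator K q)"
    proof (rule AE_I2)
      fix q
      have j0: "jac q 0 = 1" using det_gram_x_pos[OF chart_at, of q] by (simp add: jac_def y_def)
      have "norm (\<Theta> q t - \<Theta> q 0) \<le> ?h q * norm (t - 0)"
      proof (rule field_differentiable_bound[of "{- \<delta><..<\<delta>}"])
        show "(\<Theta> q has_real_derivative \<Theta>1 q r) (at r within {- \<delta><..<\<delta>})" if "r \<in> {- \<delta><..<\<delta>}" for r
          using d0[of r q] that by (auto intro: has_field_derivative_at_within)
        show "norm (\<Theta>1 q r) \<le> ?h q" if "r \<in> {- \<delta><..<\<delta>}" for r using h1(1)[of r q] that by auto
      qed (use t \<delta> in auto)
      also have "\<dots> \<le> ?h q * \<delta>" using t C by (intro mult_left_mono) auto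
      finally have "\<bar>\<Theta> q t - \<omega> q\<bar> \<le> C * \<delta> * indicator K q"
        by (simp add: \<Theta>_def[of q 0] j0 \<omega>_def mult_ac)
      moreover have "0 \<le> C * \<delta> * indicator K q" using C \<delta> by simp
      ultimately show "norm (\<Theta> q t) \<le> norm (\<omega> q + C * \<delta> * indicator K q)"
        using \<omega>_pos[of q] by (simp add: abs_if split: if_splits)
    qed
  qed
  have V: "enn2real (V_xi \<A> \<xi> (y t)) = (LINT q|\<mu>. \<Theta> q t)" if t: "\<bar>t\<bar> < \<delta>" for t
  proof -
    have "0 \<le> \<Theta> q t" for q using jac[OF t] by (simp add: \<Theta>_def less_imp_le)
    then show ?thesis
      using V_xi_y(1)[OF jac[OF t]] nn_integral_eq_integral[OF int0[OF t]] by (simp add: enn2real_ennreal)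
  qed
  have i1: "integrable \<mu> (\<lambda>q. \<Theta>1 q t)" and D1: "((\<lambda>t. LINT q|\<mu>. \<Theta> q t) has_real_derivative (LINT q|\<mu>. \<Theta>1 q t)) (at t)"
    if t: "\<bar>t\<bar> < \<delta>" for t
    using has_real_derivative_integral[of \<delta> \<mu> "\<lambda>t q. \<Theta> q t" "\<lambda>t q. \<Theta>1 q t" ?h, OF int0 d0 h1(1) integrable_indicator_K t]
    by auto
  have i2: "integrable \<mu> (\<lambda>q. \<Theta>2 q 0)" and D2: "((\<lambda>t. LINT q|\<mu>. \<Theta>1 q t) has_real_derivative (LINT q|\<mu>. \<Theta>2 q 0)) (at 0)"
    using has_real_derivative_integral[of \<delta> \<mu> "\<lambda>t q. \<Theta>1 q t" "\<lambda>t q. \<Theta>2 q t" ?h, OF i1 d1 h1(2) integrable_indicator_K, of 0] \<delta>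
    by auto
  have "deriv (\<lambda>t. enn2real (V_xi \<A> \<xi> (y t))) t = (LINT q|\<mu>. \<Theta>1 q t)" if t: "\<bar>t\<bar> < \<delta>" for t
  proof (rule DERIV_imp_deriv)
    show "((\<lambda>t. enn2real (V_xi \<A> \<xi> (y t))) has_real_derivative (LINT q|\<mu>. \<Theta>1 q t)) (at t)"
      by (rule has_field_derivative_transform_within_open[OF D1[OF t], of "{- \<delta><..<\<delta>}"]) (use t V in auto)
  qed
  then have "(deriv (\<lambda>t. enn2real (V_xi \<A> \<xi> (y t))) has_real_derivative (LINT q|\<mu>. \<Theta>2 q 0)) (at 0)"
    by (intro has_field_derivative_transform_within_open[OF D2, of "{- \<delta><..<\<delta>}"]) (use \<delta> in auto)
  then show ?thesis
    using \<delta> jac i2 DERIV_imp_deriv by blast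
qed

lemma D_\<eta>: "P q (D \<eta> q a) = - S q a (\<eta> q)"
  by (rule D_normal[OF smooth_\<eta> P_\<eta>])

text \<open>An instance of \<open>volume_second_variation\<close>. As \<open>\<eta>\<close> is
  normal, its derivative paired with tangent vectors is minus the second fundamental form paired
  with \<open>\<eta>\<close>, which is symmetric; the trace of this form is given by the equation
  \<open>H_xi\<close>.\<close>

lemma \<Theta>2_formula:
  "\<Theta>2 q 0 = \<omega> q * ((\<Sum>c\<in>Basis. (norm (D \<eta> q c))\<^sup>2) - 2 * (\<Sum>c\<in>Basis. (norm (P q (D \<eta> q c)))\<^sup>2) - (norm (\<eta> q))\<^sup>2)"
proof -
  let ?c = "chart_at \<A> q"
  let ?E = "cder ?c x q" and ?F = "cder ?c \<eta> q"
  interpret frame ?E by (rule frame_cder[OF chart_at])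
  have DF: "D \<eta> q a = ?F (coord ?E a)" for a by (rule D_cder[OF smooth_\<eta> chart_at])
  have F: "linear ?F" by (rule linear_cder[OF smooth_\<eta> chart_at])
  have PE: "P q a = ?E (coord ?E a)" for a by (rule P_cder[OF chart_at])
  have PEa: "P q (?E a) = ?E a" for a by (simp add: PE coord_E)
  have FE: "?F a \<bullet> ?E b = - (\<eta> q \<bullet> S q (?E a) (?E b))" for a b
  proof -
    have "?F a \<bullet> ?E b = D \<eta> q (?E a) \<bullet> P q (?E b)" by (simp add: DF coord_E PEa)
    also have "\<dots> = P q (D \<eta> q (?E a)) \<bullet> ?E b" by (simp only: P_inner)
    finally show ?thesis by (simp add: D_\<eta> S_symmetric)
  qed
  have sym: "?F a \<bullet> ?E b = ?F b \<bullet> ?E a" for a b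
    unfolding FE using S_commute[of q "?E a" "?E b"] by (simp add: PEa)
  have crit: "(\<Sum>c\<in>Basis. ?F (coord ?E c) \<bullet> c) = (x q - \<xi> q) \<bullet> \<eta> q"
  proof -
    have "bilinear (\<lambda>a b. D \<eta> q a \<bullet> b)"
      unfolding bilinear_def using linear_D[OF smooth_\<eta>]
      by (auto intro!: linearI simp: inner_add_left inner_add_right linear_add linear_scale)
    from trace_cross[OF this, of q]
    have "(\<Sum>c\<in>Basis. D \<eta> q c \<bullet> (c - P q c)) = 0" by (simp add: D_P[OF smooth_\<eta>])
    then have "(\<Sum>c\<in>Basis. D \<eta> q c \<bullet> c) = (\<Sum>c\<in>Basis. P q (D \<eta> q c) \<bullet> c)"
      by (simp add: inner_diff_right sum_subtractf P_inner)
    also have "\<dots> = - (\<eta> q \<bullet> H q)"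
      by (simp add: D_\<eta> S_symmetric H_eq_trace[symmetric] inner_sum_right sum_negf)
    also have "\<dots> = (x q - \<xi> q) \<bullet> \<eta> q"
      using P_inner[of q "\<eta> q" "x q"]
      by (simp add: H_xi P_\<eta> inner_diff_right inner_diff_left inner_add_right inner_commute)
    finally show ?thesis by (simp add: DF)
  qed
  let ?X = "exp (- (1/2) * (norm (x q - \<xi> q))\<^sup>2) *
      ((\<Sum>c\<in>Basis. (norm (?F (coord ?E c)))\<^sup>2) - 2 * (\<Sum>c\<in>Basis. (norm (?E (coord ?E (?F (coord ?E c)))))\<^sup>2)
        - (norm (\<eta> q))\<^sup>2)"
  have "\<Theta> q = (\<lambda>t. exp (- (1/2) * (norm (x q - \<xi> q + t *\<^sub>R \<eta> q))\<^sup>2) *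
      sqrt (det (gram (\<lambda>a. ?E a + t *\<^sub>R ?F a)) / det (gram (\<lambda>a. ?E a + 0 *\<^sub>R ?F a))))"
    by (rule ext) (simp add: \<Theta>_def jac_def cder_y[OF chart_at])
  with volume_second_variation[OF F sym crit] obtain \<Theta>' where
    1: "\<forall>\<^sub>F t in nhds 0. (\<Theta> q has_real_derivative \<Theta>' t) (at t)" and
    2: "(\<Theta>' has_real_derivative ?X) (at 0)" by auto
  from 1 have "\<forall>\<^sub>F t in nhds 0. \<Theta>1 q t = \<Theta>' t"
    unfolding \<Theta>1_def by eventually_elim (rule DERIV_imp_deriv)
  then have "(\<Theta>1 q has_real_derivative ?X) (at 0)"
    using 2 by (subst DERIV_cong_ev[OF refl _ refl])
  then have "\<Theta>2 q 0 = ?X" unfolding \<Theta>2_def by (rule DERIV_imp_deriv)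
  then show ?thesis by (simp only: DF PE \<omega>_def)
qed

end

subsection \<open>Stability forces the normal parts of constant vectors to be parallel\<close>

context immersed
begin

lemma D_zero_imp_constant:
  fixes y :: "'a \<Rightarrow> 'f::real_normed_vector"
  assumes y: "smooth_map \<A> y" and D0: "\<And>q w. D y q w = 0" and con: "connected (UNIV :: 'a set)"
  shows "y p = y q"
proof (rule connected_local_const[OF con UNIV_I UNIV_I])
  show "\<forall>a\<in>UNIV. \<forall>\<^sub>F b in at a within UNIV. y a = y b"
  proof
    fix a :: 'a
    define c where "c = chart_at \<A> a"
    have c: "c \<in> \<A>" and a: "a \<in> fst c" using chart_at by (auto simp: c_def)
    have "open (chart_image c)" "snd c a \<in> chart_image c" using chart(2)[OF c] a by auto
    then obtain r where r: "r > 0" "ball (snd c a) r \<subseteq> chart_image c" using openE by metis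
    have const: "y (param c u) = y (param c (snd c a))" if u: "u \<in> ball (snd c a) r" for u
    proof (rule has_derivative_zero_unique[OF convex_ball _ u])
      fix u assume u: "u \<in> ball (snd c a) r"
      then have q: "param c u \<in> fst c" "snd c (param c u) = u" using r(2) c by auto
      have "cder c y (param c u) = (\<lambda>v. 0)"
      proof
        fix v
        show "cder c y (param c u) v = 0"
          using D_cder[OF y c q(1), of "cder c x (param c u) v"] frame.coord_E[OF frame_cder[OF c q(1)], of v]
          by (simp add: D0)
      qed
      then show "((\<lambda>u. y (param c u)) has_derivative (\<lambda>v. 0)) (at u within ball (snd c a) r)"
        using has_derivative_cder[OF y c q(1)] q(2) by (simp add: has_derivative_at_withinI)
    qed (use r(1) in simp)
    have "y b = y a" if b: "b \<in> param c ` ball (snd c a) r" for b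
    proof -
      obtain u where "u \<in> ball (snd c a) r" "b = param c u" using b by blast
      then show ?thesis using const[of u] param_chart[OF c a] by simp
    qed
    moreover have "open (param c ` ball (snd c a) r)" by (rule open_param_image[OF c open_ball r(2)])
    moreover have "a \<in> param c ` ball (snd c a) r"
      by (rule image_eqI[of _ _ "snd c a"]) (use r(1) param_chart[OF c a] in auto)
    ultimately show "\<forall>\<^sub>F b in at a within UNIV. y a = y b"
      unfolding eventually_at_topological by metis
  qed
qed

section \<open>The space of parallel normal fields, and positivity of the volume measure\<close>

lemma parallel_inner_constant:
  assumes N: "parallel_normal_field \<A> x N" "parallel_normal_field \<A> x N'"
    and con: "connected (UNIV :: 'a set)"
  shows "N p \<bullet> N' p = N q \<bullet> N' q"
proof (rule D_zero_imp_constant[OF _ _ con, where y = "\<lambda>q. N q \<bullet> N' q"])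
  note N1 = N[unfolded parallel_normal_field_iff]
  show "smooth_map \<A> (\<lambda>q. N q \<bullet> N' q)" using N1 by (intro smooth_map_inner) auto
  fix q w
  have z: "n \<bullet> S q w k = 0" if "P q n = 0" "P q k = 0" for n k
    using tangent_normal_orthogonal[OF S_normal[OF that(2)] that(1)] by (simp add: inner_commute)
  have "D (\<lambda>q. N q \<bullet> N' q) q w = - (N q \<bullet> S q w (N' q)) - N' q \<bullet> S q w (N q)"
    using N1 by (simp add: D_inner inner_commute)
  then show "D (\<lambda>q. N q \<bullet> N' q) q w = 0" using N1 by (simp add: z)
qed

lemma parallel_sum:
  assumes "\<And>i. i \<in> I \<Longrightarrow> parallel_normal_field \<A> x (N i)"
  shows "parallel_normal_field \<A> x (\<lambda>q. \<Sum>i\<in>I. (a i :: real) *\<^sub>R N i q)"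
proof -
  have N: "smooth_map \<A> (N i)" "P q (N i q) = 0" "D (N i) q w = - S q w (N i q)" if "i \<in> I" for i q w
    using assms[OF that] by (auto simp: parallel_normal_field_iff)
  have sm: "smooth_map \<A> (\<lambda>q. a i *\<^sub>R N i q)" if "i \<in> I" for i
    by (intro smooth_map_scaleR smooth_map_const N that)
  show ?thesis
    unfolding parallel_normal_field_iff
    by (simp add: smooth_map_sum sm linear_sum[OF P_linear] linear_sum[OF linear_S] P_simps S_linear_simps N
        D_sum D_scaleR smooth_map_const D_const sum_negf)
qed

text \<open>Inner products of parallel fields are constant, so a parallel field is determined by its
  value at one point. Evaluation there embeds the parallel fields in the ambient space, and fields
  through an orthonormal basis of the image stay orthonormal. The \<open>VP\<close> condition
  thereby reduces to finitely many equations.\<close>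

lemma parallel_orthonormal_frame:
  assumes con: "connected (UNIV :: 'a set)"
  shows "\<exists>B (N :: 'e \<Rightarrow> 'a \<Rightarrow> 'e). finite B \<and> (\<forall>b\<in>B. parallel_normal_field \<A> x (N b)) \<and>
    (\<forall>a\<in>B. \<forall>b\<in>B. \<forall>q. N a q \<bullet> N b q = (if a = b then 1 else 0)) \<and>
    (\<forall>M. parallel_normal_field \<A> x M \<longrightarrow> (\<exists>\<beta>. \<forall>q. M q = (\<Sum>b\<in>B. \<beta> b *\<^sub>R N b q)))"
proof -
  define q0 :: 'a where "q0 = undefined"
  define W where "W = {N q0 | N. parallel_normal_field \<A> x N}"
  have zero: "parallel_normal_field \<A> x (\<lambda>q. 0)"
    using parallel_sum[of "{}" "\<lambda>_ _. 0" "\<lambda>_. 0"] by simp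
  have "subspace W"
    unfolding subspace_def
  proof (intro conjI ballI allI)
    show "0 \<in> W" using zero by (auto simp: W_def)
  next
    fix m n assume "m \<in> W" "n \<in> W"
    then obtain M N where "parallel_normal_field \<A> x M" "parallel_normal_field \<A> x N" "m = M q0" "n = N q0"
      by (auto simp: W_def)
    then show "m + n \<in> W"
      using parallel_sum[of UNIV "\<lambda>b. if b then M else N" "\<lambda>_. 1"]
      by (auto simp: W_def UNIV_bool add.commute)
  next
    fix r :: real and n assume "n \<in> W"
    then obtain N where "parallel_normal_field \<A> x N" "n = N q0"
      by (auto simp: W_def)
    then show "r *\<^sub>R n \<in> W"
      using parallel_sum[of "{()}" "\<lambda>_. N" "\<lambda>_. r"] by (auto simp: W_def)
  qed
  then obtain B where B: "B \<subseteq> W" "pairwise orthogonal B" "\<And>b. b \<in> B \<Longrightarrow> norm b = 1"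
    "independent B" "span B = W"
    using orthonormal_basis_subspace by metis
  have fin: "finite B" by (rule independent_imp_finite[OF B(4)])
  have "\<exists>N. parallel_normal_field \<A> x N \<and> N q0 = b" if "b \<in> B" for b
    using that B(1) by (auto simp: W_def)
  then obtain N where N: "\<And>b. b \<in> B \<Longrightarrow> parallel_normal_field \<A> x (N b)" "\<And>b. b \<in> B \<Longrightarrow> N b q0 = b"
    by metis
  have orth: "N a q \<bullet> N b q = (if a = b then 1 else 0)" if "a \<in> B" "b \<in> B" for a b q
  proof -
    have "N a q \<bullet> N b q = a \<bullet> b"
      using parallel_inner_constant[OF N(1)[OF that(1)] N(1)[OF that(2)] con, of q q0] N(2) that by simp
    also have "\<dots> = (if a = b then 1 else 0)"
      using B(2,3) that by (auto simp: pairwise_def orthogonal_def norm_eq_1)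
    finally show ?thesis .
  qed
  have expand: "\<exists>\<beta>. \<forall>q. M q = (\<Sum>b\<in>B. \<beta> b *\<^sub>R N b q)" if M: "parallel_normal_field \<A> x M" for M
  proof -
    have "M q0 \<in> span B" using M B(5) by (auto simp: W_def)
    then obtain \<beta> where \<beta>: "M q0 = (\<Sum>b\<in>B. \<beta> b *\<^sub>R b)"
      using span_finite[OF fin] by auto
    have "parallel_normal_field \<A> x (\<lambda>q. \<Sum>b\<in>B. \<beta> b *\<^sub>R N b q)"
      by (rule parallel_sum[OF N(1)])
    from parallel_sum[of UNIV "\<lambda>i. if i then M else (\<lambda>q. \<Sum>b\<in>B. \<beta> b *\<^sub>R N b q)" "\<lambda>i. if i then 1 else - 1"] M this
    have diff: "parallel_normal_field \<A> x (\<lambda>q. M q - (\<Sum>b\<in>B. \<beta> b *\<^sub>R N b q))"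
      by (simp add: UNIV_bool)
    have "(M q - (\<Sum>b\<in>B. \<beta> b *\<^sub>R N b q)) \<bullet> (M q - (\<Sum>b\<in>B. \<beta> b *\<^sub>R N b q)) = 0" for q
      using parallel_inner_constant[OF diff diff con, of q q0] \<beta> N(2) by simp
    then show ?thesis by (intro exI[of _ \<beta>]) simp
  qed
  show ?thesis
    by (intro exI[of _ B] exI[of _ N] conjI ballI allI impI) (rule fin N(1) orth expand; assumption)+
qed

lemma \<mu>_open_pos:
  assumes W: "open W" "W \<noteq> {}"
  shows "emeasure \<mu> W \<noteq> 0"
proof
  assume 0: "emeasure \<mu> W = 0"
  obtain q where q: "q \<in> W" using W by blast
  define c where "c = chart_at \<A> q"
  have c: "c \<in> \<A>" and qc: "q \<in> fst c" using chart_at by (auto simp: c_def)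
  let ?V = "W \<inter> fst c"
  let ?S = "snd c ` ?V"
  have Vs: "?V \<in> sets borel" using W(1) chart(1)[OF c] by auto
  have "?S = chart_image c \<inter> param c -` W"
    using c by (force simp: chart_image_def)
  then have S: "open ?S" using open_chart_preimage[OF c W(1)] by simp
  have "emeasure \<mu> ?V \<le> emeasure \<mu> W" using W(1) by (intro emeasure_mono) auto
  then have "emeasure \<mu> ?V = 0" using 0 by simp
  then have "emeasure (chart_measure c) ?V = 0"
    using is_volume_\<mu> c Vs by (auto simp: is_volume_def)
  then have "(\<integral>\<^sup>+u. ennreal (indicator (chart_image c) u * vol_density c x u) * indicator ?V (pm c u) \<partial>lborel) = 0"
    by (simp add: emeasure_chart_measure[OF c Vs])
  moreover have "(\<lambda>u. ennreal (indicator (chart_image c) u * vol_density c x u) * indicator ?V (pm c u)) \<in> borel_measurable lborel"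
    using measurable_vol[OF c] measurable_compose[OF measurable_pm[OF c] borel_measurable_indicator[OF Vs]]
    by (intro borel_measurable_times_ennreal) auto
  ultimately have "AE u in lborel. ennreal (indicator (chart_image c) u * vol_density c x u) * indicator ?V (pm c u) = 0"
    by (subst (asm) nn_integral_0_iff_AE) auto
  then have "AE u in lborel. u \<notin> ?S"
  proof (rule AE_mp, intro AE_I2 impI notI)
    fix u assume "ennreal (indicator (chart_image c) u * vol_density c x u) * indicator ?V (pm c u) = 0" and "u \<in> ?S"
    then show False
      using vol_density_pos[OF c, of u] c by (auto simp: pm_def)
  qed
  then have "?S \<in> null_sets lborel"
    using S by (subst (asm) AE_iff_null_sets[symmetric]) auto
  then have "negligible ?S" by (simp add: negligible_iff_null_sets null_sets_completionI)
  moreover have "?S \<noteq> {}" using q qc by auto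
  ultimately show False using open_not_negligible[OF S] by simp
qed

text \<open>A continuous function that is positive somewhere is positive on a nonempty open set, and
  such a set has positive volume by \<open>\<mu>_open_pos\<close>.\<close>

lemma integral_zero_imp_zero:
  fixes f :: "'a \<Rightarrow> real"
  assumes cont: "continuous_on UNIV f" and nn: "\<And>q. 0 \<le> f q" and int: "integrable \<mu> f" and 0: "(LINT q|\<mu>. f q) = 0"
  shows "f q = 0"
proof (rule ccontr)
  assume "f q \<noteq> 0"
  let ?W = "{q. 0 < f q}"
  have W: "open ?W" using open_Collect_less[of "\<lambda>q. 0" f] cont by simp
  have "AE q in \<mu>. f q = 0"
    using integral_nonneg_eq_0_iff_AE[OF int] nn 0 by simp
  then have "AE q in \<mu>. q \<notin> ?W" by (rule AE_mp) (auto intro!: AE_I2)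
  then have "?W \<in> null_sets \<mu>" using W by (subst AE_iff_null_sets) auto
  then have "emeasure \<mu> ?W = 0" by auto
  moreover have "?W \<noteq> {}" using \<open>f q \<noteq> 0\<close> nn[of q] by (metis empty_iff less_eq_real_def mem_Collect_eq)
  ultimately show False using \<mu>_open_pos[OF W] by simp
qed

end

text \<open>The cutoffs evaluate \<open>bump\<close> only at arguments up to 1, so the derivative
  has to be bounded only there.\<close>

lemma bump_deriv:
  "\<exists>b. (\<forall>s. (bump has_real_derivative b s) (at s)) \<and> (\<exists>C. \<forall>s\<le>1. \<bar>b s\<bar> \<le> C) \<and> (\<forall>s\<le>0. b s = 0)"
proof -
  define b where "b = flat_fun ([:0, 0, 1:] * (1 - pderiv 1))"
  have "continuous_on {0..1} b"
    unfolding b_def using smooth_on_continuous[OF smooth_on_flat_fun] continuous_on_subset by blast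
  then have "bounded (b ` {0..1})"
    by (intro compact_imp_bounded compact_continuous_image) auto
  then obtain C where C: "\<forall>y\<in>b ` {0..1}. norm y \<le> C" unfolding bounded_iff by blast
  have b0: "b s = 0" if "s \<le> 0" for s using that by (simp add: b_def flat_fun_def)
  have "\<bar>b s\<bar> \<le> max C 0" if "s \<le> 1" for s
  proof (cases "s \<le> 0")
    case False
    then have "\<bar>b s\<bar> \<le> C" using C that by simp
    then show ?thesis by linarith
  qed (simp add: b0)
  then show ?thesis
    using b0 flat_fun_has_derivative[of 1] unfolding bump_def b_def by blast
qed

locale stable_xi = xi_immersed \<A> x \<xi>
  for \<A> :: "('a::{t2_space, second_countable_topology}, 'm::finite) chart set"
    and x \<xi> :: "'a \<Rightarrow> 'e::euclidean_space" +
  assumes connected: "connected (UNIV :: 'a set)"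
    and proper: "proper_immersion x"
    and stable: "W_stable \<A> x \<xi>"
begin

lemma finite_V: "V_xi \<A> \<xi> x < \<infinity>"
  using stable by (simp add: W_stable_def)

lemma integrable_\<omega>: "integrable \<mu> \<omega>"
proof (rule integrableI_nonneg)
  show "\<omega> \<in> borel_measurable \<mu>" using smooth_map_measurable[OF smooth_\<omega>] by simp
  show "(\<integral>\<^sup>+q. ennreal (\<omega> q) \<partial>\<mu>) < \<infinity>" using finite_V by (simp add: V_xi_def \<omega>_def)
qed (use \<omega>_pos in \<open>auto simp: less_imp_le\<close>)

lemma integrable_mult_\<omega>:
  assumes f: "continuous_on UNIV f" and C: "\<And>q. \<bar>f q\<bar> \<le> C"
  shows "integrable \<mu> (\<lambda>q. f q * \<omega> q :: real)"
proof (rule Bochner_Integration.integrable_bound)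
  show "integrable \<mu> (\<lambda>q. C * \<omega> q)" using integrable_\<omega> by simp
  show "(\<lambda>q. f q * \<omega> q) \<in> borel_measurable \<mu>"
    using borel_measurable_continuous_onI[OF f] smooth_map_measurable[OF smooth_\<omega>] by simp
  show "AE q in \<mu>. norm (f q * \<omega> q) \<le> norm (C * \<omega> q)"
  proof (rule AE_I2)
    fix q
    have "0 \<le> C" using C[of q] by linarith
    then show "norm (f q * \<omega> q) \<le> norm (C * \<omega> q)"
      using C[of q] \<omega>_pos[of q] by (simp add: abs_mult mult_right_mono)
  qed
qed

lemma compact_x_cball: "compact (x -` cball 0 R)"
  using proper by (simp add: proper_immersion_def)

text \<open>The linear variation \<open>x + t \<eta>\<close> is an \<open>SN\<close>-variation, as its second derivative in \<open>t\<close> vanishes.\<close>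

lemma stability_inequality:
  assumes \<eta>: "smooth_map \<A> \<eta>" "\<And>q. P q (\<eta> q) = 0" "\<And>q. q \<notin> x -` cball 0 R \<Longrightarrow> \<eta> q = 0"
    and VP: "\<And>N. parallel_normal_field \<A> x N \<Longrightarrow> (LINT q|\<mu>. (\<eta> q \<bullet> N q) * \<omega> q) = 0"
  defines "I \<equiv> \<lambda>q. \<omega> q * ((\<Sum>c\<in>Basis. (norm (D \<eta> q c))\<^sup>2) - 2 * (\<Sum>c\<in>Basis. (norm (P q (D \<eta> q c)))\<^sup>2) - (norm (\<eta> q))\<^sup>2)"
  shows "integrable \<mu> I" "0 \<le> (LINT q|\<mu>. I q)"
proof -
  let ?K = "x -` cball 0 R"
  interpret nv: compact_normal_variation \<A> x \<xi> \<eta> ?K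
    by unfold_locales (use \<eta> compact_x_cball finite_V in auto)
  obtain \<epsilon> where \<epsilon>: "\<epsilon> > 0" and j: "\<And>t. \<bar>t\<bar> < \<epsilon> \<Longrightarrow> \<forall>q. nv.jac q t > 0"
    and int: "integrable \<mu> (\<lambda>q. nv.\<Theta>2 q 0)"
    and V2: "deriv (deriv (\<lambda>t. enn2real (V_xi \<A> \<xi> (nv.y t)))) 0 = (LINT q|\<mu>. nv.\<Theta>2 q 0)"
    using nv.second_variation by blast
  have I: "nv.\<Theta>2 q 0 = I q" for q by (simp only: nv.\<Theta>2_formula I_def)
  show "integrable \<mu> I" using int by (simp add: I)
  let ?F = "\<lambda>q t. nv.y t q"
  have vel: "velocity ?F t q = \<eta> q" for t q
  proof -
    have "((\<lambda>t. x q + t *\<^sub>R \<eta> q) has_vector_derivative \<eta> q) (at t)"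
      by (auto intro!: derivative_eq_intros)
    then show ?thesis by (simp add: velocity_def nv.y_def vector_derivative_at)
  qed
  have "variation \<A> x \<epsilon> ?F"
    unfolding variation_def
  proof (intro conjI ballI allI)
    fix c assume c: "c \<in> \<A>"
    let ?O = "chart_image c \<times> {-\<epsilon><..<\<epsilon>}"
    have O: "open ?O" using chart(2)[OF c] by (intro open_Times) auto
    have f: "smooth_on ?O (\<lambda>p. z (param c (fst p)))" if "smooth_map \<A> z" for z :: "'a \<Rightarrow> 'e"
      by (rule smooth_on_compose[OF O chart(2)[OF c] _ smooth_on_linear[OF O bounded_linear_fst] smooth_mapD[OF that c]]) auto
    have "smooth_on ?O (\<lambda>p. x (param c (fst p)) + snd p *\<^sub>R \<eta> (param c (fst p)))"
      by (intro smooth_on_add smooth_on_scaleR O f smooth_x \<eta> smooth_on_linear[OF O bounded_linear_snd])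
    then show "smooth_on ?O (\<lambda>(u, t). nv.y t (param c u))"
      by (simp add: nv.y_def case_prod_unfold)
  next
    fix t assume "t \<in> {-\<epsilon><..<\<epsilon>}"
    then have "\<bar>t\<bar> < \<epsilon>" by auto
    then show "immersion \<A> (\<lambda>q. nv.y t q)"
      using immersed.immersion[OF nv.immersed_y[OF j]] by blast
  qed (use \<epsilon> in \<open>auto simp: nv.y_def\<close>)
  moreover have "compact_variation \<epsilon> ?F"
    unfolding compact_variation_def
  proof (intro exI conjI ballI)
    \<comment> \<open>Properness makes preimages of balls relatively compact; the larger radius
      gives an open set around the closed support.\<close>
    let ?B = "x -` ball 0 (R + 1)"
    show "open ?B" by (rule open_vimage[OF open_ball smooth_map_continuous[OF smooth_x]])
    have "closed (x -` cball 0 (R + 1))" by (rule compact_imp_closed[OF compact_x_cball])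
    then have "closure ?B \<subseteq> x -` cball 0 (R + 1)" by (intro closure_minimal) auto
    then show "compact (closure ?B)"
      using compact_x_cball[of "R + 1"] closed_closure[of ?B] by (metis compact_Int_closed inf.absorb_iff2)
    fix t
    have "{q. velocity ?F t q \<noteq> 0} \<subseteq> ?K" using \<eta>(3) unfolding vel by blast
    then have "closure {q. velocity ?F t q \<noteq> 0} \<subseteq> ?K"
      by (intro closure_minimal compact_imp_closed compact_x_cball)
    then show "closure {q. velocity ?F t q \<noteq> 0} \<subseteq> ?B" by auto
  qed
  moreover have "VP_variation \<A> x \<xi> ?F"
    unfolding VP_variation_def SN_variation_def normal_variation_def
  proof (intro conjI allI impI)
    have "velocity ?F 0 = \<eta>" using vel by auto
    then show "normal_field \<A> x (velocity ?F 0)" using \<eta> by (simp add: normal_field_def normal_iff)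
    show "vector_derivative (\<lambda>t. velocity ?F t q) (at 0) = 0" for q by (simp add: vel)
  next
    fix N assume "parallel_normal_field \<A> x N"
    from VP[OF this]
    show "(LINT q|\<mu>. (velocity ?F 0 q \<bullet> N q) * exp (- (1/2) * (norm (x q - \<xi> q))\<^sup>2)) = 0"
      by (simp only: vel \<omega>_def)
  qed
  ultimately have "0 \<le> deriv (deriv (\<lambda>t. enn2real (V_xi \<A> \<xi> (\<lambda>q. ?F q t)))) 0"
    using stable unfolding W_stable_def by blast
  then show "0 \<le> (LINT q|\<mu>. I q)" by (simp add: V2 I)
qed

text \<open>It vanishes off the preimage of a ball, which is compact by properness. The summand 1
  keeps the radius positive for \<open>k = 0\<close>.\<close>

definition cutoff :: "nat \<Rightarrow> 'a \<Rightarrow> real" where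
  "cutoff k q = bump (1 - (x q \<bullet> x q) / (real k + 1)\<^sup>2)"

lemma smooth_cutoff: "smooth_map \<A> (cutoff k)"
proof -
  have "smooth_map \<A> (\<lambda>q. 1 - (1 / (real k + 1)\<^sup>2) * (x q \<bullet> x q))"
    by (intro smooth_map_diff smooth_map_mult smooth_map_const smooth_map_inner smooth_x)
  from smooth_map_compose[OF this smooth_on_bump] show ?thesis
    by (simp add: cutoff_def[abs_def])
qed

lemma cutoff_bounds: "0 \<le> cutoff k q" "cutoff k q \<le> 1" "\<bar>cutoff k q\<bar> \<le> 1"
  using bump_nonneg bump_le_1 by (auto simp: cutoff_def abs_le_iff intro: order_trans[OF _ bump_nonneg])

lemma cutoff_outside: "q \<notin> x -` cball 0 (real k + 1) \<Longrightarrow> cutoff k q = 0"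
proof -
  assume "q \<notin> x -` cball 0 (real k + 1)"
  then have "real k + 1 \<le> norm (x q)" by simp
  then have "(real k + 1)\<^sup>2 \<le> x q \<bullet> x q"
    unfolding power2_norm_eq_inner[symmetric] by (intro power_mono) auto
  then show "cutoff k q = 0" by (simp add: cutoff_def bump_eq_0)
qed

lemma cutoff_tendsto: "(\<lambda>k. cutoff k q) \<longlonglongrightarrow> bump 1"
proof -
  have "(\<lambda>k. 1 / (1 + real k)) \<longlonglongrightarrow> 0"
    using LIMSEQ_inverse_real_of_nat by (simp add: inverse_eq_divide add.commute)
  then have "(\<lambda>k. 1 - (x q \<bullet> x q) * (1 / (1 + real k))\<^sup>2) \<longlonglongrightarrow> 1 - (x q \<bullet> x q) * 0\<^sup>2"
    by (intro tendsto_intros)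
  then have "(\<lambda>k. 1 - (x q \<bullet> x q) / (real k + 1)\<^sup>2) \<longlonglongrightarrow> 1"
    by (simp add: power_divide add.commute)
  moreover have "isCont bump 1"
    using smooth_on_continuous[OF smooth_on_bump] by (simp add: continuous_on_eq_continuous_at)
  ultimately show ?thesis
    unfolding cutoff_def by (rule isCont_tendsto_compose[rotated])
qed

text \<open>The gradient of \<open>x q \<bullet> x q\<close> is twice the tangential part of
  \<open>x q\<close>, of norm at most \<open>2 * (real k + 1)\<close> where the argument of
  \<open>bump\<close> is positive; the scaling divides it by the square of
  \<open>real k + 1\<close>. So the gradient of the cutoff decays like
  \<open>1 / (real k + 1)\<close>.\<close>

lemma cutoff_gradient: "\<exists>C\<ge>0. \<forall>k q. (\<Sum>c\<in>Basis. (D (cutoff k) q c)\<^sup>2) \<le> C / (real k + 1)\<^sup>2"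
proof -
  obtain b C where b: "\<And>s. (bump has_real_derivative b s) (at s)" "\<And>s. s \<le> 1 \<Longrightarrow> \<bar>b s\<bar> \<le> C" "\<And>s. s \<le> 0 \<Longrightarrow> b s = 0"
    using bump_deriv by blast
  have "(\<Sum>c\<in>Basis. (D (cutoff k) q c)\<^sup>2) \<le> 4 * C\<^sup>2 / (real k + 1)\<^sup>2" for k q
  proof -
    let ?R = "real k + 1"
    let ?s = "1 - (1 / ?R\<^sup>2) * (x q \<bullet> x q)"
    have sm: "smooth_map \<A> (\<lambda>q. 1 - (1 / ?R\<^sup>2) * (x q \<bullet> x q))"
      by (intro smooth_map_diff smooth_map_mult smooth_map_const smooth_map_inner smooth_x)
    have cut: "cutoff k = (\<lambda>q. bump (1 - (1 / ?R\<^sup>2) * (x q \<bullet> x q)))" by (simp add: cutoff_def[abs_def])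
    have Ds: "D (\<lambda>q. 1 - (1 / ?R\<^sup>2) * (x q \<bullet> x q)) q c = - (2 / ?R\<^sup>2) * (P q (x q) \<bullet> c)" for c
    proof -
      have "D (\<lambda>q. 1 - (1 / ?R\<^sup>2) * (x q \<bullet> x q)) q c =
          0 - ((1 / ?R\<^sup>2) * (x q \<bullet> P q c + P q c \<bullet> x q) + 0 * (x q \<bullet> x q))"
        by (simp only: D_diff D_mult D_inner smooth_map_mult smooth_map_inner smooth_map_const smooth_x D_const D_x)
      then show ?thesis using P_inner[of q "x q" c] inner_commute[of "P q c" "x q"] by simp
    qed
    have "D (cutoff k) q c = b ?s * (- (2 / ?R\<^sup>2) * (P q (x q) \<bullet> c))" for c
      unfolding cut Ds[symmetric] by (rule D_compose_real[OF sm smooth_on_bump b(1)])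
    then have "(\<Sum>c\<in>Basis. (D (cutoff k) q c)\<^sup>2) = (b ?s)\<^sup>2 * (4 / ?R ^ 4) * (\<Sum>c\<in>Basis. (P q (x q) \<bullet> c)\<^sup>2)"
      by (simp add: power_mult_distrib power_divide sum_distrib_left mult.assoc)
    also have "(\<Sum>c\<in>Basis. (P q (x q) \<bullet> c)\<^sup>2) = P q (x q) \<bullet> P q (x q)"
      by (simp add: euclidean_inner[of "P q (x q)" "P q (x q)"] power2_eq_square)
    finally have eq: "(\<Sum>c\<in>Basis. (D (cutoff k) q c)\<^sup>2) = (b ?s)\<^sup>2 * (4 / ?R ^ 4) * (P q (x q) \<bullet> P q (x q))" .
    show ?thesis
    proof (cases "?s \<le> 0")
      case True
      then show ?thesis by (simp only: eq b(3)) simp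
    next
      case False
      then have xR: "x q \<bullet> x q \<le> ?R\<^sup>2" by (simp add: field_simps)
      have "P q (x q) \<bullet> P q (x q) \<le> x q \<bullet> x q"
      proof -
        have "0 \<le> (x q - P q (x q)) \<bullet> (x q - P q (x q))" by simp
        also have "\<dots> = x q \<bullet> x q - P q (x q) \<bullet> P q (x q)"
          using P_inner[of q "x q" "P q (x q)"] P_inner[of q "x q" "x q"]
          by (simp add: inner_diff_left inner_diff_right inner_commute)
        finally show ?thesis by simp
      qed
      then have 1: "P q (x q) \<bullet> P q (x q) \<le> ?R\<^sup>2" using xR by simp
      have "\<bar>b ?s\<bar> \<le> C" by (rule b(2)) simp
      then have 2: "(b ?s)\<^sup>2 \<le> C\<^sup>2" by (metis abs_ge_zero power2_abs power_mono)
      have "(b ?s)\<^sup>2 * (4 / ?R ^ 4) * (P q (x q) \<bullet> P q (x q)) \<le> C\<^sup>2 * (4 / ?R ^ 4) * ?R\<^sup>2"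
        by (intro mult_mono 1 2) auto
      also have "\<dots> = 4 * C\<^sup>2 / ?R\<^sup>2"
      proof -
        have "C\<^sup>2 * (4 / r ^ 4) * r\<^sup>2 = 4 * C\<^sup>2 / r\<^sup>2" if "r \<noteq> 0" for r :: real
          using that by (simp add: divide_simps power2_eq_square power4_eq_xxxx)
        then show ?thesis by simp
      qed
      finally show ?thesis unfolding eq .
    qed
  qed
  then show ?thesis by (intro exI[of _ "4 * C\<^sup>2"]) simp
qed

lemma integral_\<omega>_pos: "0 < (LINT q|\<mu>. \<omega> q)"
proof -
  have "0 \<le> (LINT q|\<mu>. \<omega> q)"
    by (rule Bochner_Integration.integral_nonneg) (simp add: less_imp_le \<omega>_pos)
  moreover have "(LINT q|\<mu>. \<omega> q) \<noteq> 0"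
  proof
    assume "(LINT q|\<mu>. \<omega> q) = 0"
    then have "\<omega> undefined = 0"
      by (intro integral_zero_imp_zero[OF smooth_map_continuous[OF smooth_\<omega>] _ integrable_\<omega>])
        (simp_all add: less_imp_le \<omega>_pos)
    then show False using \<omega>_pos[of undefined] by simp
  qed
  ultimately show ?thesis by simp
qed

lemma normal_part_parallel: "\<exists>N. parallel_normal_field \<A> x N \<and> (\<forall>q. v - P q v = N q)"
proof -
  obtain B and N :: "'e \<Rightarrow> 'a \<Rightarrow> 'e" where fin: "finite B"
    and N': "\<forall>b\<in>B. parallel_normal_field \<A> x (N b)"
    and orth': "\<forall>a\<in>B. \<forall>b\<in>B. \<forall>q. N a q \<bullet> N b q = (if a = b then 1 else 0)"
    and expand': "\<forall>M. parallel_normal_field \<A> x M \<longrightarrow> (\<exists>\<beta>. \<forall>q. M q = (\<Sum>b\<in>B. \<beta> b *\<^sub>R N b q))"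
    using parallel_orthonormal_frame[OF connected] by (elim exE conjE) (rule that)
  note N = bspec[OF N'] and expand = mp[OF spec[OF expand']]
  have orth: "N a q \<bullet> N b q = (if a = b then 1 else 0)" if "a \<in> B" "b \<in> B" for a b q
    using orth' that by simp
  have Nsm: "smooth_map \<A> (N b)" and PN: "P q (N b q) = 0" if "b \<in> B" for b q
    using N[OF that] by (auto simp: parallel_normal_field_iff)
  have norm_N: "norm (N b q) = 1" if "b \<in> B" for b q
    using orth[OF that that, of q] by (simp add: norm_eq_1)
  define f where "f b q = v \<bullet> N b q" for b q
  have f_cont: "continuous_on UNIV (f b)" if "b \<in> B" for b
    unfolding f_def using smooth_map_continuous[OF Nsm[OF that]] by (intro continuous_intros)
  have f_le: "\<bar>f b q\<bar> \<le> norm v" if "b \<in> B" for b q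
    using Cauchy_Schwarz_ineq2[of v "N b q"] norm_N[OF that] by (simp add: f_def)
  have cut_cont: "continuous_on UNIV (cutoff k)" for k by (rule smooth_map_continuous[OF smooth_cutoff])
  define cc where "cc k = (LINT q|\<mu>. cutoff k q * \<omega> q)" for k
  define L where "L k b = (LINT q|\<mu>. (cutoff k q * f b q) * \<omega> q)" for k b
  \<comment> \<open>Weighted averages of \<open>f b\<close>, since orthogonality of
    \<open>cutoff k q *\<^sub>R uk k q\<close> to \<open>N b\<close> reads
    \<open>\<alpha> k b * cc k = L k b\<close>. If \<open>cc k = 0\<close>, then the quotient is 0
    and the equation still holds, because \<open>L k b\<close> is bounded by a multiple of
    \<open>cc k\<close>.\<close>
  define \<alpha> where "\<alpha> k b = L k b / cc k" for k b
  have icc: "integrable \<mu> (\<lambda>q. cutoff k q * \<omega> q)" for k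
    by (rule integrable_mult_\<omega>[OF cut_cont cutoff_bounds(3)])
  have cf_le: "\<bar>cutoff k q * f b q\<bar> \<le> norm v" if "b \<in> B" for k b q
  proof -
    have "\<bar>cutoff k q * f b q\<bar> \<le> 1 * norm v"
      unfolding abs_mult by (intro mult_mono cutoff_bounds f_le that) auto
    then show ?thesis by simp
  qed
  have iL: "integrable \<mu> (\<lambda>q. (cutoff k q * f b q) * \<omega> q)" if "b \<in> B" for k b
    by (rule integrable_mult_\<omega>[OF continuous_on_mult[OF cut_cont f_cont[OF that]] cf_le[OF that]])
  have cc_nonneg: "0 \<le> cc k" for k
    unfolding cc_def by (rule Bochner_Integration.integral_nonneg) (simp add: cutoff_bounds less_imp_le \<omega>_pos)
  have L_le: "\<bar>L k b\<bar> \<le> norm v * cc k" if b: "b \<in> B" for k b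
  proof -
    have "\<bar>L k b\<bar> \<le> (LINT q|\<mu>. \<bar>(cutoff k q * f b q) * \<omega> q\<bar>)"
      unfolding L_def using integral_norm_bound[of \<mu> "\<lambda>q. (cutoff k q * f b q) * \<omega> q"] by simp
    also have "\<dots> \<le> (LINT q|\<mu>. norm v * (cutoff k q * \<omega> q))"
    proof (rule Bochner_Integration.integral_mono)
      show "integrable \<mu> (\<lambda>q. \<bar>(cutoff k q * f b q) * \<omega> q\<bar>)" using iL[OF b] by (rule integrable_abs)
      show "integrable \<mu> (\<lambda>q. norm v * (cutoff k q * \<omega> q))" using icc by simp
      fix q
      have "\<bar>f b q\<bar> * (cutoff k q * \<omega> q) \<le> norm v * (cutoff k q * \<omega> q)"
        using f_le[OF b, of q] cutoff_bounds(1)[of k q] \<omega>_pos[of q] by (intro mult_right_mono) auto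
      then show "\<bar>(cutoff k q * f b q) * \<omega> q\<bar> \<le> norm v * (cutoff k q * \<omega> q)"
        using cutoff_bounds(1)[of k q] \<omega>_pos[of q] by (simp add: abs_mult mult_ac)
    qed
    finally show ?thesis by (simp add: cc_def)
  qed
  have \<alpha>_cc: "\<alpha> k b * cc k = L k b" if "b \<in> B" for k b
    using L_le[OF that, of k] by (cases "cc k = 0") (auto simp: \<alpha>_def)
  have \<alpha>_le: "\<bar>\<alpha> k b\<bar> \<le> norm v" if "b \<in> B" for k b
    using L_le[OF that, of k] cc_nonneg[of k] by (cases "cc k = 0") (auto simp: \<alpha>_def abs_divide divide_le_eq)
  define Nk where "Nk k q = (\<Sum>b\<in>B. \<alpha> k b *\<^sub>R N b q)" for k q
  have Nk_par: "parallel_normal_field \<A> x (Nk k)" for k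
    unfolding Nk_def by (rule parallel_sum[OF N])
  \<comment> \<open>A bound for \<open>uk k\<close> that is uniform in \<open>k\<close>; it controls
    the gradient term in \<open>E_le\<close> and dominates the integrands of
    \<open>E\<close>.\<close>
  define U where "U = norm v + real (card B) * norm v"
  define uk where "uk k q = v - P q v - Nk k q" for k q
  have uk_sm: "smooth_map \<A> (uk k)" for k
    unfolding uk_def using Nk_par[of k]
    by (intro smooth_map_diff smooth_map_const smooth_map_P) (simp add: parallel_normal_field_iff)
  have vn_le: "norm (v - P q v) \<le> norm v" for q
  proof -
    have "(norm (v - P q v))\<^sup>2 + (norm (P q v))\<^sup>2 = (norm v)\<^sup>2"
      unfolding power2_norm_eq_inner using P_inner[of q v "P q v"]
      by (simp add: inner_diff_left inner_diff_right inner_commute)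
    then have "(norm (v - P q v))\<^sup>2 \<le> (norm v)\<^sup>2" by (metis le_add_same_cancel1 zero_le_power2)
    then show ?thesis by (rule power2_le_imp_le) simp
  qed
  have uk_le: "norm (uk k q) \<le> U" for k q
  proof -
    have "norm (Nk k q) \<le> (\<Sum>b\<in>B. norm (\<alpha> k b *\<^sub>R N b q))" unfolding Nk_def by (rule norm_sum)
    also have "\<dots> \<le> (\<Sum>b\<in>B. norm v)" by (intro sum_mono) (simp add: norm_N \<alpha>_le)
    finally have "norm (Nk k q) \<le> real (card B) * norm v" by simp
    then show ?thesis
      using norm_triangle_ineq4[of "v - P q v" "Nk k q"] vn_le[of q] by (simp add: uk_def U_def)
  qed
  obtain C where C: "C \<ge> 0" "\<And>k q. (\<Sum>c\<in>Basis. (D (cutoff k) q c)\<^sup>2) \<le> C / (real k + 1)\<^sup>2"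
    using cutoff_gradient by blast
  define E where "E k = (LINT q|\<mu>. ((cutoff k q)\<^sup>2 * (norm (uk k q))\<^sup>2) * \<omega> q)" for k
  define V where "V = (LINT q|\<mu>. \<omega> q)"
  let ?e = "\<lambda>k q. (cutoff k q)\<^sup>2 * (norm (uk k q))\<^sup>2"
  have e_cont: "continuous_on UNIV (?e k)" for k
    by (intro continuous_intros cut_cont smooth_map_continuous[OF uk_sm])
  have e_le: "?e k q \<le> U\<^sup>2" for k q
  proof -
    have "?e k q \<le> 1 * U\<^sup>2"
      using cutoff_bounds[of k q] uk_le[of k q] by (intro mult_mono power_mono) (auto simp: power_le_one)
    then show ?thesis by simp
  qed
  have ie: "integrable \<mu> (\<lambda>q. ?e k q * \<omega> q)" for k
    by (rule integrable_mult_\<omega>[OF e_cont, of _ "U\<^sup>2"]) (simp add: e_le)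
  have E_le: "E k \<le> C / (real k + 1)\<^sup>2 * (U\<^sup>2 + (norm v)\<^sup>2) * V" for k
  proof -
    interpret st: stable_test \<A> x \<xi> v "Nk k" by unfold_locales (rule Nk_par)
    let ?\<eta> = "\<lambda>q. cutoff k q *\<^sub>R st.u q"
    let ?R = "real k + 1"
    let ?I = "\<lambda>q. \<omega> q * ((\<Sum>c\<in>Basis. (norm (D ?\<eta> q c))\<^sup>2) - 2 * (\<Sum>c\<in>Basis. (norm (P q (D ?\<eta> q c)))\<^sup>2) - (norm (?\<eta> q))\<^sup>2)"
    have u: "st.u q = uk k q" for q by (simp add: st.u_def st.vn_def uk_def)
    have VP: "(LINT q|\<mu>. (?\<eta> q \<bullet> M q) * \<omega> q) = 0" if M: "parallel_normal_field \<A> x M" for M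
    proof -
      obtain \<beta> where \<beta>: "\<And>q. M q = (\<Sum>b\<in>B. \<beta> b *\<^sub>R N b q)" using expand[OF M] by blast
      have uN: "st.u q \<bullet> N b q = f b q - \<alpha> k b" if b: "b \<in> B" for q b
      proof -
        have "Nk k q \<bullet> N b q = (\<Sum>a\<in>B. \<alpha> k a * (if a = b then 1 else 0))"
          unfolding Nk_def inner_sum_left by (intro sum.cong refl) (simp add: orth b)
        also have "\<dots> = \<alpha> k b" using fin b by (simp add: if_distrib cong: if_cong)
        finally have "Nk k q \<bullet> N b q = \<alpha> k b" .
        moreover have "P q v \<bullet> N b q = 0" using P_inner[of q v "N b q"] PN[OF b] by simp
        ultimately show ?thesis by (simp add: u uk_def f_def inner_diff_left)
      qed
      have "(?\<eta> q \<bullet> M q) * \<omega> q = (\<Sum>b\<in>B. \<beta> b * ((cutoff k q * f b q) * \<omega> q - \<alpha> k b * (cutoff k q * \<omega> q)))" for q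
      proof -
        have "(?\<eta> q \<bullet> M q) * \<omega> q = (\<Sum>b\<in>B. cutoff k q * \<beta> b * (st.u q \<bullet> N b q) * \<omega> q)"
          by (simp add: \<beta> inner_sum_right sum_distrib_left sum_distrib_right mult_ac)
        also have "\<dots> = (\<Sum>b\<in>B. \<beta> b * ((cutoff k q * f b q) * \<omega> q - \<alpha> k b * (cutoff k q * \<omega> q)))"
          by (intro sum.cong refl) (simp add: uN algebra_simps)
        finally show ?thesis .
      qed
      then have "(LINT q|\<mu>. (?\<eta> q \<bullet> M q) * \<omega> q) =
        (LINT q|\<mu>. (\<Sum>b\<in>B. \<beta> b * ((cutoff k q * f b q) * \<omega> q - \<alpha> k b * (cutoff k q * \<omega> q))))"
        by simp
      also have "\<dots> = (\<Sum>b\<in>B. \<beta> b * (L k b - \<alpha> k b * cc k))"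
        using iL icc by (simp add: Bochner_Integration.integral_sum Bochner_Integration.integral_diff L_def cc_def)
      also have "\<dots> = 0" using \<alpha>_cc by simp
      finally show ?thesis .
    qed
    have stab: "integrable \<mu> ?I" "0 \<le> (LINT q|\<mu>. ?I q)"
    proof -
      have sm: "smooth_map \<A> ?\<eta>" by (intro smooth_map_scaleR smooth_cutoff st.smooth_u)
      have nor: "P q (?\<eta> q) = 0" for q by (simp add: P_simps st.P_u)
      have out: "?\<eta> q = 0" if "q \<notin> x -` cball 0 ?R" for q using cutoff_outside[OF that] by simp
      show "integrable \<mu> ?I" "0 \<le> (LINT q|\<mu>. ?I q)"
        using stability_inequality[OF sm nor out VP] by auto
    qed
    let ?div = "\<lambda>q. \<Sum>c\<in>Basis. D (st.Z (cutoff k)) q c \<bullet> c"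
    have Z0: "st.Z (cutoff k) q = 0" if "q \<notin> x -` cball 0 ?R" for q
      using cutoff_outside[OF that] by (simp add: st.Z_def)
    note div = integral_divergence[OF st.smooth_Z[OF smooth_cutoff] st.tangent_Z compact_x_cball Z0]
    let ?G = "\<lambda>q. (\<Sum>c\<in>Basis. (D (cutoff k) q c)\<^sup>2) * ((norm (uk k q))\<^sup>2 + (norm v)\<^sup>2)"
    let ?CC = "C / ?R\<^sup>2 * (U\<^sup>2 + (norm v)\<^sup>2)"
    have G_le: "?G q \<le> ?CC" for q
      by (intro mult_mono C add_mono power_mono uk_le) (auto simp: C(1) sum_nonneg)
    have le: "?I q + ?e k q * \<omega> q \<le> ?div q + ?CC * \<omega> q" for q
    proof -
      have "\<omega> q * ?G q \<le> \<omega> q * ?CC" using G_le[of q] \<omega>_pos[of q] by (intro mult_left_mono) auto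
      then show ?thesis
        using st.integrand_le[OF smooth_cutoff[of k], of q] by (simp add: u algebra_simps)
    qed
    \<comment> \<open>The divergence integrates to 0 and the integral of \<open>?I\<close> is
      nonnegative by stability, so \<open>E k\<close> is at most the gradient term, which has order
      \<open>1 / (real k + 1)\<^sup>2\<close>.\<close>
    have "(LINT q|\<mu>. ?I q + ?e k q * \<omega> q) \<le> (LINT q|\<mu>. ?div q + ?CC * \<omega> q)"
      by (rule Bochner_Integration.integral_mono[OF _ _ le])
        (intro Bochner_Integration.integrable_add stab ie div(1) integrable_mult_right integrable_\<omega>)+
    also have "(LINT q|\<mu>. ?div q + ?CC * \<omega> q) = ?CC * V"
      using div integrable_\<omega> by (simp add: Bochner_Integration.integral_add V_def)
    also have "(LINT q|\<mu>. ?I q + ?e k q * \<omega> q) = (LINT q|\<mu>. ?I q) + E k"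
      using stab(1) ie by (simp add: Bochner_Integration.integral_add E_def)
    finally show ?thesis using stab(2) by simp
  qed
  \<comment> \<open>The limits of \<open>\<alpha> k b\<close>. The factor \<open>bump 1\<close>, the
    limit of the cutoffs, stays in numerator and denominator so that each matches the limit of its
    own sequence.\<close>
  define \<alpha>0 where "\<alpha>0 b = (bump 1 * (LINT q|\<mu>. f b q * \<omega> q)) / (bump 1 * V)" for b
  have conv: "(\<lambda>k. LINT q|\<mu>. (cutoff k q * h q) * \<omega> q) \<longlonglongrightarrow> bump 1 * (LINT q|\<mu>. h q * \<omega> q)"
    if h: "continuous_on UNIV h" and hb: "\<And>q. \<bar>h q\<bar> \<le> K" for h K
  proof -
    have K: "0 \<le> K" using hb[of undefined] by linarith
    have hm: "h \<in> borel_measurable borel" and wm: "\<omega> \<in> borel_measurable borel" and cm: "cutoff k \<in> borel_measurable borel" for k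
      using borel_measurable_continuous_onI[OF h] smooth_map_measurable[OF smooth_\<omega>] smooth_map_measurable[OF smooth_cutoff] by auto
    have "(\<lambda>k. LINT q|\<mu>. (cutoff k q * h q) * \<omega> q) \<longlonglongrightarrow> (LINT q|\<mu>. (bump 1 * h q) * \<omega> q)"
    proof (rule integral_dominated_convergence)
      show "integrable \<mu> (\<lambda>q. K * \<omega> q)" using integrable_\<omega> by simp
      show "AE q in \<mu>. (\<lambda>k. (cutoff k q * h q) * \<omega> q) \<longlonglongrightarrow> (bump 1 * h q) * \<omega> q"
        by (intro AE_I2 tendsto_intros cutoff_tendsto)
      show "AE q in \<mu>. norm ((cutoff k q * h q) * \<omega> q) \<le> K * \<omega> q" for k
      proof (rule AE_I2)
        fix q
        have "\<bar>cutoff k q\<bar> * \<bar>h q\<bar> \<le> 1 * K" by (intro mult_mono cutoff_bounds hb) auto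
        then show "norm ((cutoff k q * h q) * \<omega> q) \<le> K * \<omega> q"
          using \<omega>_pos[of q] by (simp add: abs_mult mult_right_mono)
      qed
    qed (use hm wm cm in auto)
    then show ?thesis by (simp add: mult.assoc)
  qed
  have "V \<noteq> 0" using integral_\<omega>_pos by (simp add: V_def)
  then have bV: "bump 1 * V \<noteq> 0" using bump_pos_iff[of 1] by simp
  have cc_lim: "cc \<longlonglongrightarrow> bump 1 * V"
    using conv[of "\<lambda>q. 1" 1] by (simp add: cc_def[abs_def] V_def)
  have \<alpha>_lim: "(\<lambda>k. \<alpha> k b) \<longlonglongrightarrow> \<alpha>0 b" if "b \<in> B" for b
    unfolding \<alpha>_def \<alpha>0_def L_def
    by (intro tendsto_divide cc_lim bV conv[OF f_cont[OF that] f_le[OF that]])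
  define N0 where "N0 q = (\<Sum>b\<in>B. \<alpha>0 b *\<^sub>R N b q)" for q
  have N0_par: "parallel_normal_field \<A> x N0" unfolding N0_def by (rule parallel_sum[OF N])
  define u0 where "u0 q = v - P q v - N0 q" for q
  have uk_lim: "(\<lambda>k. uk k q) \<longlonglongrightarrow> u0 q" for q
    unfolding uk_def u0_def Nk_def N0_def by (intro tendsto_intros \<alpha>_lim)
  have u0_sm: "smooth_map \<A> u0"
    unfolding u0_def[abs_def] using N0_par
    by (intro smooth_map_diff smooth_map_const smooth_map_P) (simp add: parallel_normal_field_iff)
  let ?lm = "\<lambda>q. ((bump 1)\<^sup>2 * (norm (u0 q))\<^sup>2) * \<omega> q"
  have e0_cont: "continuous_on UNIV ?lm"
    by (intro continuous_intros smooth_map_continuous[OF u0_sm] smooth_map_continuous[OF smooth_\<omega>])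
  have lim_ptw: "(\<lambda>k. ?e k q * \<omega> q) \<longlonglongrightarrow> ?lm q" for q
    by (intro tendsto_intros cutoff_tendsto uk_lim)
  have dom: "AE q in \<mu>. norm (?e k q * \<omega> q) \<le> U\<^sup>2 * \<omega> q" for k
  proof (rule AE_I2)
    fix q
    show "norm (?e k q * \<omega> q) \<le> U\<^sup>2 * \<omega> q"
      using e_le[of k q] \<omega>_pos[of q] by (simp add: abs_mult)
  qed
  have em: "?lm \<in> borel_measurable \<mu>" "(\<lambda>q. ?e k q * \<omega> q) \<in> borel_measurable \<mu>" for k
    using borel_measurable_continuous_onI[OF e0_cont] ie[of k] by auto
  have dw: "integrable \<mu> (\<lambda>q. U\<^sup>2 * \<omega> q)" using integrable_\<omega> by simp
  have al: "AE q in \<mu>. (\<lambda>k. ?e k q * \<omega> q) \<longlonglongrightarrow> ?lm q" using lim_ptw by (rule AE_I2)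
  have ie0: "integrable \<mu> ?lm" by (rule integrable_dominated_convergence[OF em dw al dom])
  have Elim: "E \<longlonglongrightarrow> (LINT q|\<mu>. ?lm q)"
    unfolding E_def by (rule integral_dominated_convergence[OF em dw al dom])
  have "(LINT q|\<mu>. ?lm q) \<le> 0"
  proof (rule LIMSEQ_le[OF Elim])
    have "(\<lambda>k. 1 / (1 + real k)) \<longlonglongrightarrow> 0"
      using LIMSEQ_inverse_real_of_nat by (simp add: inverse_eq_divide add.commute)
    then have "(\<lambda>k. C * (1 / (1 + real k))\<^sup>2 * (U\<^sup>2 + (norm v)\<^sup>2) * V) \<longlonglongrightarrow> C * 0\<^sup>2 * (U\<^sup>2 + (norm v)\<^sup>2) * V"
      by (intro tendsto_intros)
    then show "(\<lambda>k. C / (real k + 1)\<^sup>2 * (U\<^sup>2 + (norm v)\<^sup>2) * V) \<longlonglongrightarrow> 0"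
      by (simp add: power_divide add.commute)
    show "\<exists>n. \<forall>k\<ge>n. E k \<le> C / (real k + 1)\<^sup>2 * (U\<^sup>2 + (norm v)\<^sup>2) * V" using E_le by blast
  qed
  moreover have nn: "0 \<le> ?lm q" for q using \<omega>_pos[of q] by simp
  moreover have "0 \<le> (LINT q|\<mu>. ?lm q)" by (rule Bochner_Integration.integral_nonneg[OF nn])
  ultimately have zero: "(LINT q|\<mu>. ?lm q) = 0" by simp
  have "u0 q = 0" for q
  proof -
    have "?lm q = 0" by (rule integral_zero_imp_zero[OF e0_cont nn ie0 zero])
    then show ?thesis using \<omega>_pos[of q] bump_pos_iff[of 1] by simp
  qed
  then show ?thesis using N0_par by (intro exI[of _ N0]) (simp add: u0_def)
qed

subsection \<open>The image is a plane\<close>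

text \<open>The derivative of \<open>v - P q v\<close>, computed directly and as that of a parallel
  field, comes out as \<open>- S q c v\<close> and as \<open>- S q c (v - P q v)\<close>. Hence
  \<open>S q c\<close> vanishes on tangent vectors, and by self-adjointness on normal ones.\<close>

lemma S_zero: "S q a w = 0"
proof -
  have tan: "S q c (P q v) = 0" for c v
  proof -
    obtain N where N: "parallel_normal_field \<A> x N" "\<And>q. v - P q v = N q"
      using normal_part_parallel by blast
    have "N = (\<lambda>q. v - P q v)" using N(2) by auto
    then have "D N q c = - S q c v"
      by (simp add: D_diff smooth_map_const smooth_map_P D_const S_def)
    moreover have "D N q c = - S q c (v - P q v)"
      using N by (simp add: parallel_normal_field_iff)
    ultimately show ?thesis by (simp add: S_linear_simps)
  qed
  let ?n = "w - P q w"
  have "S q a ?n = P q (S q a ?n)" by (rule S_normal[symmetric]) (simp add: P_simps)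
  then have "S q a ?n \<bullet> S q a ?n = S q a ?n \<bullet> P q (S q a ?n)" by simp
  also have "\<dots> = 0" by (simp add: S_symmetric tan)
  finally have "S q a ?n = 0" by simp
  then show ?thesis using tan[of a w] by (simp add: S_linear_simps)
qed

lemma range_is_plane: "affine (range x) \<and> aff_dim (range x) = int CARD('m)"
proof -
  define q0 :: 'a where "q0 = undefined"
  define E where "E = cder (chart_at \<A> q0) x q0"
  interpret frame E unfolding E_def by (rule frame_cder[OF chart_at])
  have P_const: "P q w = P q0 w" for q w
    by (rule D_zero_imp_constant[OF smooth_map_P _ connected]) (use S_zero in \<open>simp add: S_def\<close>)
  have PE: "P q0 w = E (coord E w)" for w unfolding E_def by (rule P_cder[OF chart_at])
  have "x q - P q (x q) = x q0 - P q0 (x q0)" for q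
  proof (rule D_zero_imp_constant[OF _ _ connected, where y = "\<lambda>q. x q - P q (x q)"])
    show "smooth_map \<A> (\<lambda>q. x q - P q (x q))"
      by (intro smooth_map_diff smooth_x smooth_map_P_field)
    show "D (\<lambda>q. x q - P q (x q)) q w = 0" for q w
      by (simp add: D_diff smooth_x smooth_map_P_field D_P_field D_x S_zero)
  qed
  then obtain a where a: "\<And>q. x q = a + E (coord E (x q))"
    by (metis P_const PE add.commute diff_add_cancel)
  \<comment> \<open>In the coordinates of the plane, relative openness becomes openness in
    \<open>real ^ 'm\<close>, where a nonempty open and closed set is everything.\<close>
  define g where "g q = coord E (x q)" for q
  have xg: "x q = a + E (g q)" for q using a[of q] by (simp add: g_def)
  have contE: "continuous_on UNIV E" by (rule linear_continuous_on) (simp add: linear_conv_bounded_linear[symmetric] lin)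
  have open_g: "open (range g)"
  proof (subst open_subopen, intro ballI)
    fix z assume "z \<in> range g"
    then obtain q where q: "z = g q" by blast
    define c where "c = chart_at \<A> q"
    have c: "c \<in> \<A>" and qc: "q \<in> fst c" using chart_at by (auto simp: c_def)
    let ?U = "chart_image c"
    let ?f = "\<lambda>u. coord E (x (param c u))"
    have U: "open ?U" "snd c q \<in> ?U" using chart(2)[OF c] qc by auto
    have bl: "bounded_linear (coord E)" using linear_coord linear_conv_bounded_linear by blast
    have sm: "smooth_on ?U ?f" by (rule smooth_on_bounded_linear[OF U(1) bl smooth_mapD[OF smooth_x c]])
    let ?f' = "\<lambda>h. coord E (cder c x q h)"
    have der: "(?f has_derivative ?f') (at (snd c q))"
      by (rule bounded_linear.has_derivative[OF bl has_derivative_cder[OF smooth_x c qc]])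
    interpret cq: frame "cder c x q" by (rule frame_cder[OF c qc])
    have lin': "linear ?f'" using linear_compose[OF cq.lin linear_coord] by (simp add: o_def)
    \<comment> \<open>All tangent spaces coincide with the one at \<open>q0\<close>, so projecting
      to the latter is injective on the image of the differential.\<close>
    have "inj ?f'"
      unfolding linear_injective_0[OF lin']
    proof (intro allI impI)
      fix h assume "?f' h = 0"
      then have "P q0 (cder c x q h) = 0" by (simp add: PE linear_0[OF lin])
      moreover have "P q (cder c x q h) = cder c x q h" by (simp add: P_cder[OF c qc] cq.coord_E)
      ultimately have "cder c x q h = cder c x q 0" using P_const[of q] linear_0[OF cq.lin] by simp
      then show "h = 0" using cq.inj by (rule injD[rotated])
    qed
    from linear_injective_isomorphism[OF lin' this refl]
    obtain g' where g': "linear g'" "\<forall>h. ?f' (g' h) = h" by (elim exE conjE) (rule that)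
    then have "?f' \<circ> g' = id" by (auto simp: o_def)
    then have "?f (snd c q) \<in> interior (?f ` ?U)"
      using sussmann_open_mapping[OF U(1) smooth_on_continuous[OF sm] U(2) der, of g' ?U] g'(1) U
      by (simp add: linear_conv_bounded_linear interior_open)
    moreover have "?f (snd c q) = z" using c qc by (simp add: q g_def)
    moreover have "?f ` ?U \<subseteq> range g" by (auto simp: g_def)
    ultimately show "\<exists>T. open T \<and> z \<in> T \<and> T \<subseteq> range g"
      using open_interior[of "?f ` ?U"] interior_subset[of "?f ` ?U"]
      by (intro exI[of _ "interior (?f ` ?U)"]) auto
  qed
  have closed_g: "closed (range g)"
    unfolding closed_sequential_limits
  proof (intro allI impI, elim conjE)
    fix s z assume s: "\<forall>n. s n \<in> range g" "s \<longlonglongrightarrow> z"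
    have "\<forall>n. \<exists>q. s n = g q" using s(1) by blast
    from choice[OF this] obtain r where r: "\<And>n. s n = g (r n)" by blast
    have "isCont E z" using contE by (simp add: continuous_on_eq_continuous_at)
    then have lim: "(\<lambda>n. x (r n)) \<longlonglongrightarrow> a + E z"
      unfolding xg r[symmetric] by (intro tendsto_add tendsto_const isCont_tendsto_compose[OF _ s(2)])
    \<comment> \<open>The sequence eventually lies in this ball. The part of the image of
      \<open>x\<close> in the ball is compact by properness, hence closed, and so contains the
      limit.\<close>
    let ?C = "cball (a + E z) 1"
    have "compact (x -` ?C)" using proper by (simp add: proper_immersion_def)
    then have "compact (x ` (x -` ?C))"
      by (rule compact_continuous_image[OF continuous_on_subset[OF smooth_map_continuous[OF smooth_x] subset_UNIV]])
    then have cl: "closed (x ` (x -` ?C))" by (rule compact_imp_closed)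
    have "\<forall>\<^sub>F n in sequentially. dist (x (r n)) (a + E z) < 1" using lim by (rule tendstoD) simp
    then have "\<forall>\<^sub>F n in sequentially. x (r n) \<in> x ` (x -` ?C)"
      by eventually_elim (auto simp: dist_commute less_imp_le)
    then have "a + E z \<in> x ` (x -` ?C)"
      using Lim_in_closed_set[OF cl _ _ lim] by simp
    then obtain q where "a + E z = x q" by blast
    then have "E z = E (g q)" using xg[of q] by simp
    then show "z \<in> range g" using inj by (auto dest: injD)
  qed
  have "range g = UNIV"
    using open_g closed_g connected_UNIV unfolding connected_clopen by (auto simp: openin_open_eq closedin_closed_eq)
  then have "range x = (\<lambda>z. a + z) ` range E"
  proof -
    assume surj: "range g = UNIV"
    have "range x = range (\<lambda>q. a + E (g q))" using xg by simp
    also have "\<dots> = (\<lambda>z. a + z) ` E ` range g" by (simp add: image_image)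
    finally show ?thesis by (simp only: surj)
  qed
  moreover have "subspace (range E)" using linear_subspace_image[OF lin subspace_UNIV] .
  moreover have "dim (range E) = CARD('m)"
    using dim_image_eq[OF lin, of UNIV] inj by (simp add: DIM_cart)
  ultimately show ?thesis
    by (simp add: affine_translation[symmetric] subspace_imp_affine aff_dim_translation_eq aff_dim_subspace)
qed

end

theorem theorem7p1:
  fixes \<A> :: "('a::{t2_space, second_countable_topology}, 'm::finite) chart set"
    and x \<xi> :: "'a \<Rightarrow> real ^ ('m + 'p::finite)"
  assumes "smooth_atlas \<A>"
    and "connected (UNIV :: 'a set)"
    and "xi_submanifold \<A> x \<xi>"
    and "proper_immersion x"
    and "complete_immersion \<A> x"
    and "W_stable \<A> x \<xi>"
    and "flat_normal_bundle \<A> x"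
    and "\<And>q v. second_form \<A> x q
                 (weingarten \<A> x q (\<xi> q) (tan_part \<A> x q (x q)))
                 (tan_part \<A> x q v) = 0"
  shows "affine (range x) \<and> aff_dim (range x) = int CARD('m)"
proof -
  interpret stable_xi \<A> x \<xi>
    by unfold_locales (use assms in \<open>auto simp: xi_submanifold_def\<close>)
  show ?thesis by (rule range_is_plane)
qed

end
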